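(* Let $\mathbb{B}$ be the unit ball in $\mathbb{R}^2$ and let $\lambda_1(\mathbb{B})$ be as defined in the context. Then for any $\beta\leq 4\pi$ and any $\alpha$ with $0\leq\alpha<\lambda_1(\mathbb{B})$, the supremum $$\sup_{u\in \mathscr{H},\,\|u\|_{1,\alpha}\leq 1}\int_{\mathbb{B}} e^{\beta u^2}\,dx$$ can be attained by some function $u_0\in \mathscr{H}$ with $\|u_0\|_{1,\alpha}=1$.
   Context: $\mathbb{B}$ is the open unit disc in $\mathbb{R}^2$ and $\|\cdot\|_p$ is the $L^p(\mathbb{B})$-norm. $\mathscr{H}$ is the Hilbert space obtained as the completion of $C_0^\infty(\mathbb{B})$ under the norm $$\|u\|_{\mathscr{H}}=\left(\int_{\mathbb{B}}|\nabla u|^2dx-\int_{\mathbb{B}}\frac{u^2}{(1-|x|^2)^2}dx\right)^{1/2}.$$ It is known that for every $p>1$ there is $C_p>0$ with $\|u\|_p\le C_p\|u\|_{\mathscr{H}}$ for all $u\in\mathscr{H}$, so elements of $\mathscr{H}$ are regarded as functions, and $W_0^{1,2}(\mathbb{B})\subset\mathscr{H}\subset\bigcap_{p\ge1}L^p(\mathbb{B})$. Define $$\lambda_1(\mathbb{B})=\inf_{u\in\mathscr{H},\,u\not\equiv 0}\frac{\|u\|_{\mathscr{H}}^2}{\|u\|_2^2},$$ which is positive, and, for $0\le\alpha<\lambda_1(\mathbb{B})$ and $u\in\mathscr{H}$, $\|u\|_{1,\alpha}=\left(\|u\|_{\mathscr{H}}^2-\alpha\|u\|_2^2\right)^{1/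2}$.
   Formalization: The formal theorem assumes 0 ≤ β ≤ 4π; for β < 0 the claim fails, since the integral is at most the area of the unit ball, with equality only for u = 0, which has norm 0 and not 1. *)

theory Defs
  imports "HOL-Analysis.Analysis"
begin

type_synonym plane = "real ^ 2"

abbreviation disc :: "plane set" where
  "disc \<equiv> ball 0 1"

abbreviation disc_measure :: "plane measure" where
  "disc_measure \<equiv> lebesgue_on disc"

primrec C_k :: "nat \<Rightarrow> (plane \<Rightarrow> real) \<Rightarrow> bool" where
  "C_k 0 f \<longleftrightarrow> continuous_on UNIV f"
| "C_k (Suc k) f \<longleftrightarrow>
     (\<forall>x. f differentiable (at x)) \<and>
     (\<forall>b\<in>Basis. C_k k (\<lambda>x. frechet_derivative f (at x) b))"

definition gradient :: "(plane \<Rightarrow> real) \<Rightarrow> plane \<Rightarrow> plane" where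
  "gradient f x = (\<Sum>b\<in>Basis. frechet_derivative f (at x) b *\<^sub>R b)"

text \<open>Elements of \<open>C\<^sub>0\<^sup>\<infinity>(disc)\<close> are extended by zero to the whole plane.\<close>

definition test_functions :: "(plane \<Rightarrow> real) set" where
  "test_functions =
     {f. (\<forall>k. C_k k f) \<and> compact (closure {x. f x \<noteq> 0}) \<and> closure {x. f x \<noteq> 0} \<subseteq> disc}"

definition test_norm :: "(plane \<Rightarrow> real) \<Rightarrow> real" where
  "test_norm f =
     sqrt ((\<integral>x. (norm (gradient f x))\<^sup>2 \<partial>disc_measure)
         - (\<integral>x. (f x)\<^sup>2 / (1 - (norm x)\<^sup>2)\<^sup>2 \<partial>disc_measure))"

text \<open>Classes of functions modulo equality almost everywhere on the disc are handled through
  representatives; the values outside the disc are irrelevant.\<close>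

definition Lp_space :: "real \<Rightarrow> (plane \<Rightarrow> real) set" where
  "Lp_space p =
     {u \<in> borel_measurable disc_measure. integrable disc_measure (\<lambda>x. \<bar>u x\<bar> powr p)}"

definition Lp_norm :: "real \<Rightarrow> (plane \<Rightarrow> real) \<Rightarrow> real" where
  "Lp_norm p u = (\<integral>x. \<bar>u x\<bar> powr p \<partial>disc_measure) powr (1 / p)"

definition test_Cauchy :: "(nat \<Rightarrow> plane \<Rightarrow> real) \<Rightarrow> bool" where
  "test_Cauchy \<phi> \<longleftrightarrow>
     (\<forall>n. \<phi> n \<in> test_functions) \<and>
     (\<forall>e>0. \<exists>N. \<forall>m\<ge>N. \<forall>n\<ge>N. test_norm (\<lambda>x. \<phi> m x - \<phi> n x) < e)"

text \<open>An element of the completion is a class of Cauchy sequences of test functions. Since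
  \<open>Lp_norm p\<close> is dominated by a multiple of \<open>test_norm\<close> for every \<open>p > 1\<close>, such a sequence
  converges in every \<open>L\<^sup>p\<close>, and the element of the completion is regarded as the limit function.
  Its norm is the limit of the norms of the approximating test functions.\<close>

definition represents :: "(nat \<Rightarrow> plane \<Rightarrow> real) \<Rightarrow> (plane \<Rightarrow> real) \<Rightarrow> bool" where
  "represents \<phi> u \<longleftrightarrow>
     test_Cauchy \<phi> \<and>
     (\<forall>p>1. u \<in> Lp_space p \<and> (\<lambda>n. Lp_norm p (\<lambda>x. \<phi> n x - u x)) \<longlonglongrightarrow> 0)"

definition H_space :: "(plane \<Rightarrow> real) set" where
  "H_space = {u. \<exists>\<phi>. represents \<phi> u}"

definition H_norm :: "(plane \<Rightarrow> real) \<Rightarrow> real" where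
  "H_norm u = (THE L. \<forall>\<phi>. represents \<phi> u \<longrightarrow> (\<lambda>n. test_norm (\<phi> n)) \<longlonglongrightarrow> L)"

definition lambda1 :: real where
  "lambda1 =
     Inf {(H_norm u)\<^sup>2 / (Lp_norm 2 u)\<^sup>2 | u.
            u \<in> H_space \<and> \<not> (AE x in disc_measure. u x = 0)}"

definition norm_1 :: "real \<Rightarrow> (plane \<Rightarrow> real) \<Rightarrow> real" where
  "norm_1 \<alpha> u = sqrt ((H_norm u)\<^sup>2 - \<alpha> * (Lp_norm 2 u)\<^sup>2)"

text \<open>The integrand is nonnegative, so the integral is taken in the extended nonnegative reals,
  where an infinite value is not mistaken for zero.\<close>

definition exp_integral :: "real \<Rightarrow> (plane \<Rightarrow> real) \<Rightarrow> ennreal" where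
  "exp_integral \<beta> u = (\<integral>\<^sup>+x. ennreal (exp (\<beta> * (u x)\<^sup>2)) \<partial>disc_measure)"

end

theory Submission
  imports Defs "HOL-Analysis.Analysis" "HOL-Complex_Analysis.Great_Picard" "HOL-Real_Asymp.Real_Asymp"
begin

text \<open>Polarization with respect to hyperbolic reflections turns a test function into a radial
  nonincreasing one without increasing the Dirichlet integral or changing the Hardy term, while the
  \<open>L\<^sup>2\<close>-norm and the exponential integral do not decrease; so radial functions suffice. Let \<open>\<phi>\<close> be the
  radial solution of \<open>- \<Delta>\<phi> = (V + \<alpha>) \<phi>\<close>, \<open>V = 1/(1 - \<bar>x\<bar>\<^sup>2)\<^sup>2\<close>, which is positive because \<open>\<alpha> < \<lambda>\<^sub>1\<close>. Writing
  \<open>u = \<phi> y(S) / sqrt (2\<pi>)\<close> with \<open>S\<close> the Green function at the origin (\<open>S = - ln \<bar>x\<bar> + A + o(1)\<close>), the quadratic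
  form becomes \<open>\<integral> y'\<^sup>2\<close>, and the problem becomes a one-dimensional Moser functional with the weight
  \<open>2 exp (2A - 2s)\<close>. A maximizing sequence that does not concentrate has a maximizer as its limit; a
  concentrating one yields at most \<open>1 + exp (1 + 2A)\<close>, and corrected Moser functions exceed this level.\<close>

text \<open>The Hardy weight grows towards the boundary, so Schwarz rearrangement would lower the
  Hardy term. That term is integration against hyperbolic area, which hyperbolic reflections
  preserve, whereas Lebesgue measure favours the side of the origin. Polarization and limits leave
  the C^1 class; symmetrized functions therefore live in a uniform closure, their energy being
  controlled by dilation quotients, and on the half-line energy is a supremum of difference
  quotients, which survives pointwise limits. In the level \<open>1 + exp (1 + 2 * A)\<close> the
  first 1 is the mass of the zero function (area divided by pi), the exponential is the largest
  limiting mass of a tail: \<open>2 * A\<close> stems from the weight, the 1 in the exponent from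
  the sharp tail estimate. The bound \<alpha> < lambda1 acts as a spectral gap: at a zero of the
  radial solution S would run to minus infinity, and functions built from S would violate the gap.
  The maximizer must be exhibited as the limit of an energy-Cauchy sequence of test functions;
  minimality of its energy replaces weak convergence there.\<close>

notation scaleR (infixr "*R" 75)
abbreviation (input) seq_limit (infix "---->" 60) where "X ----> L \<equiv> X \<longlonglongrightarrow> L"

subsection \<open>Energies of functions on a half-line\<close>

definition partition_sum :: "(real => real) => (nat => real) => nat => real" where
 "partition_sum y p n = (\<Sum>i<n. (y (p (Suc i)) - y (p i))^2 / (p (Suc i) - p i))"

text \<open>This expresses that the integral of y'^2 over [a, infinity) is at most C. No derivative
  occurs and each partition sum depends on finitely many values, so the bound passes to pointwise
  limits.\<close>

definition energy_le :: "real => (real => real) => real => bool" where "energy_le a y C \<longleftrightarrow>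
  (ALL p n. a <= p 0 --> (ALL i<n. p i < p (Suc i)) --> partition_sum y p n <= C)"

lemma energy_leD: "energy_le a y C ==> a <= p 0 ==> (!!i. i < n ==> p i < p (Suc i)) ==> partition_sum y p n <= C"
 unfolding energy_le_def by blast

lemma energy_le_nonneg: "energy_le a y C ==> 0 <= C" using energy_leD[of a y C "%_. a" 0] by (simp add: partition_sum_def)

lemma energy_le_mono: "energy_le a y C ==> C <= C' ==> energy_le a y C'" unfolding energy_le_def by (meson order_trans)

text \<open>A partition with one interval: the Cauchy-Schwarz bound that makes such functions
  Hoelder continuous with exponent 1/2.\<close>

lemma energy_le_two: assumes "energy_le a y C" "a <= s" "s <= t" shows "(y t - y s)^2 <= C * (t - s)" proof (cases "s = t")
 case False
 with assms have "s < t" by simp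
 have "partition_sum y (%i. if i = 0 then s else t) 1 <= C"
  by (rule energy_leD[OF assms(1)]) (use assms \<open>s < t\<close> in auto)
 thus ?thesis using \<open>s < t\<close> by (simp add: partition_sum_def divide_le_eq)
qed simp

text \<open>A witness \<open>e\<close> plays the role of the cumulative energy \<open>\<integral> y'\<^sup>2\<close>.\<close>

definition energy_witness :: "real set => (real => real) => (real => real) => bool" where
 "energy_witness S y e \<longleftrightarrow> mono_on S e & (ALL s:S. ALL t:S. s <= t --> (y t - y s)^2 <= (t - s) * (e t - e s))"

lemma partition_sum_le_witness: assumes "energy_witness S y e" "!!i. i < n ==> p i < p (Suc i)" "!!i. i <= n ==> p i : S"
 shows "partition_sum y p n <= e (p n) - e (p 0)" proof -
 have "partition_sum y p n <= (\<Sum>i<n. e (p (Suc i)) - e (p i))" unfolding partition_sum_def proof (rule sum_mono)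
  fix i assume i: "i : {..<n}"
  hence "(y (p (Suc i)) - y (p i))^2 <= (p (Suc i) - p i) * (e (p (Suc i)) - e (p i))"
   using assms(2)[of i] assms(1) assms(3)[of i] assms(3)[of "Suc i"] unfolding energy_witness_def by (auto intro!: less_imp_le)
  thus "(y (p (Suc i)) - y (p i))^2 / (p (Suc i) - p i) <= e (p (Suc i)) - e (p i)"
   using assms(2)[of i] i by (simp add: divide_le_eq mult.commute)
 qed
 also have "... = e (p n) - e (p 0)" by (rule sum_lessThan_telescope)
 finally show ?thesis .
qed

lemma increasing_prefix:
 fixes p :: "nat => real" assumes "!!i. i < n ==> p i < p (Suc i)" "i <= j" "j <= n" shows "p i <= p j" using assms(2,3)
proof (induction rule: dec_induct)
 case (step k) thus ?case using assms(1)[of k] by auto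
qed simp

lemma witness_imp_energy_le: assumes "energy_witness {a..} y e" "!!t. t >= a ==> e t - e a <= C" shows "energy_le a y C"
 unfolding energy_le_def proof (intro allI impI)
 fix p n assume p: "a <= p 0" "ALL i<n. p i < p (Suc i)"
 have in_a: "p i : {a..}" if "i <= n" for i using increasing_prefix[of n p 0 i] p that by auto
 have "partition_sum y p n <= e (p n) - e (p 0)" by (rule partition_sum_le_witness[OF assms(1)]) (use p in_a in auto)
 moreover have "e a <= e (p 0)" using assms(1) p(1) unfolding energy_witness_def by (auto intro: mono_onD)
 ultimately show "partition_sum y p n <= C" using assms(2)[of "p n"] in_a[of n] by auto
qed

text \<open>The witness at t is the supremum of the partition sums ending at or before t. Appending
  the interval from s to t to a partition that ends by s shows that it grows by at least the
  quotient belonging to s and t.\<close>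

lemma energy_le_imp_witness: assumes E: "energy_le a y C" shows "EX e. energy_witness {a..} y e & (ALL t>=a. 0 <= e t & e t <= C)"
proof -
 define X where "X t = {partition_sum y p n | p n. a <= p 0 & (ALL i<n. p i < p (Suc i)) & p n <= t}" for t
 define e where "e t = Sup (X t)" for t
 have bdd: "bdd_above (X t)" for t by (rule bdd_aboveI[of _ C]) (use E in "auto simp: X_def energy_le_def")
 have zero: "0 : X t" if "a <= t" for t unfolding X_def by (rule CollectI, rule exI[of _ "%_. a"], rule exI[of _ 0])
   (use that in "auto simp: partition_sum_def")
 have step: "e s + (y t - y s)^2 / (t - s) <= e t" if st: "a <= s" "s < t" for s t proof -
  have "x <= e t - (y t - y s)^2 / (t - s)" if "x : X s" for x proof -
   from that obtain p n where p: "x = partition_sum y p n" "a <= p 0" "ALL i<n. p i < p (Suc i)" "p n <= s"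
    unfolding X_def by auto
   \<comment> \<open>Empty intervals are not allowed: if the partition already ends at s only t is
     appended, otherwise s and then t. \<open>Suc m\<close> counts the intervals in both
     cases.\<close>
   define m where "m = (if p n = s then n else Suc n)"
   define r where "r i = (if i <= n then p i else if i = Suc n & m = Suc n then s else t)" for i
   have "partition_sum y r (Suc m) : X t" unfolding X_def proof (rule CollectI, intro exI conjI allI impI)
    show "r i < r (Suc i)" if "i < Suc m" for i using that p st by (auto simp: r_def m_def less_Suc_eq split: if_splits)
       show "partition_sum y r (Suc m) = partition_sum y r (Suc m)" by simp
   qed (use p st in "auto simp: r_def m_def")
   moreover have "partition_sum y r (Suc m) >= x + (y t - y s)^2 / (t - s)" proof -
    have *: "partition_sum y r n = x" unfolding p partition_sum_def by (rule sum.cong) (auto simp: r_def)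
    show ?thesis proof (cases "p n = s")
     case True
     hence "partition_sum y r (Suc m) = partition_sum y r n + (y t - y s)^2 / (t - s)"
      by (simp add: m_def partition_sum_def r_def)
     with * show ?thesis by simp
    next
     case False
     hence "partition_sum y r (Suc m) = partition_sum y r n + (y s - y (p n))^2 / (s - p n) + (y t - y s)^2 / (t - s)"
      by (simp add: m_def partition_sum_def r_def)
     with * p show ?thesis by simp
    qed
   qed
   ultimately have "x + (y t - y s)^2 / (t - s) <= e t" unfolding e_def using cSup_upper[OF _ bdd] by fastforce
   thus ?thesis by simp
  qed
  hence "e s <= e t - (y t - y s)^2 / (t - s)" unfolding e_def[of s] using zero[OF st(1)] by (intro cSup_least) auto
  thus ?thesis by simp
 qed
 show ?thesis proof (intro exI conjI allI impI)
  show "energy_witness {a..} y e" unfolding energy_witness_def proof (intro conjI ballI impI mono_onI)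
   fix s t assume "s : {a..}" "t : {a..}" "s <= t"
   thus "e s <= e t" using step[of s t] by (cases "s = t") (auto intro: order_trans[rotated])
   show "(y t - y s)^2 <= (t - s) * (e t - e s)"
    using step[of s t] \<open>s : _\<close> \<open>s <= t\<close> by (cases "s = t") (auto simp: field_simps)
  qed
  show "0 <= e t" if "a <= t" for t unfolding e_def using cSup_upper[OF zero[OF that] bdd] .
  show "e t <= C" if "a <= t" for t unfolding e_def by (rule cSup_least) (use zero[OF that] E in "auto simp: X_def energy_le_def")
 qed
qed

text \<open>By Cauchy-Schwarz the stretch from 0 to a has already consumed (y a - y 0)^2 / a, and
  the witness makes energy additive over adjacent stretches.\<close>

lemma energy_le_tail: assumes "energy_le 0 y C" "0 < a" shows "energy_le a y (C - (y a - y 0)^2 / a)" proof -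
 obtain e where e: "energy_witness {0..} y e" "!!t. 0 <= t ==> 0 <= e t" "!!t. 0 <= t ==> e t <= C"
  using energy_le_imp_witness[OF assms(1)] by blast
 have "(y a - y 0)^2 <= a * (e a - e 0)" using e(1) assms(2) energy_witness_def[of "{0..}" y e] by (metis atLeast_iff diff_zero order_refl less_imp_le)
 hence "(y a - y 0)^2 / a <= e a - e 0" using assms(2) by (simp add: pos_divide_le_eq mult.commute)
 hence *: "(y a - y 0)^2 / a <= e a" using e(2)[of 0] by simp
 show ?thesis proof (rule witness_imp_energy_le)
  show "energy_witness {a..} y e" using e(1) assms unfolding energy_witness_def by (auto intro: mono_on_subset)
  show "e t - e a <= C - (y a - y 0)^2 / a" if "t >= a" for t using * e(3)[of t] that assms by simp
 qed
qed

text \<open>Lower semicontinuity of the energy: partition sums are continuous in the finitely many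
  values involved.\<close>

lemma energy_le_limit: assumes "!!k::nat. energy_le a (Y k) (C k)" "!!s. a <= s ==> (%k. Y k s) ----> y s" "C ----> c"
 shows "energy_le a y c" unfolding energy_le_def proof (intro allI impI)
 fix p n assume p: "a <= p 0" "ALL i<n. p i < p (Suc i)"
 have in_a: "a <= p i" if "i <= n" for i using increasing_prefix[of n p 0 i] p that by auto
 have "(%k. partition_sum (Y k) p n) ----> partition_sum y p n" unfolding partition_sum_def
  by (intro tendsto_intros assms in_a) (use p in force)+
 thus "partition_sum y p n <= c" by (rule LIMSEQ_le[OF _ assms(3)]) (use assms(1) p in "auto simp: energy_le_def")
qed

lemma energy_le_scale: assumes "energy_le a y C" shows "energy_le a (%s. k * y s) (k^2 * C)" proof -
 have "partition_sum (%s. k * y s) p n = k^2 * partition_sum y p n" for p n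
  by (simp add: partition_sum_def sum_distrib_left power_mult_distrib flip: right_diff_distrib)
 thus ?thesis using assms by (auto simp: energy_le_def intro: mult_left_mono)
qed

lemma energy_le_shift: assumes "energy_le a y C" shows "energy_le 0 (%s. y (a + s) - k) C" proof -
 have "partition_sum (%s. y (a + s) - k) p n = partition_sum y (%i. a + p i) n" for p n by (simp add: partition_sum_def)
 thus ?thesis using assms by (auto simp: energy_le_def)
qed

lemma energy_le_continuous: assumes "energy_le a y C" shows "continuous_on {a..} y" proof -
 have *: "dist (y t) (y s) <= sqrt (C * dist t s)" if "s >= a" "t >= a" for s t proof -
  have "abs (y t - y s) <= sqrt (C * abs (t - s))" proof (cases "s <= t")
   case True
   show ?thesis using energy_le_two[OF assms that(1) True] True by (intro real_le_rsqrt) simp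
  next
   case False
   thus ?thesis using energy_le_two[OF assms that(2), of s] by (intro real_le_rsqrt) (simp add: power2_commute)
  qed
  thus ?thesis by (simp add: dist_real_def)
 qed
 show ?thesis unfolding continuous_on proof
  fix s assume s: "s : {a..}"
  have "((%t. sqrt (C * dist t s)) \<longlongrightarrow> sqrt (C * dist s s)) (at s within {a..})" by (intro tendsto_intros)
  hence lim: "((%t. sqrt (C * dist t s)) \<longlongrightarrow> 0) (at s within {a..})" by simp
  have "\<forall>\<^sub>F t in at s within {a..}. dist (y t) (y s) <= sqrt (C * dist t s)"
   unfolding eventually_at_filter using *[of s] s by simp
  hence "((%t. dist (y t) (y s)) \<longlongrightarrow> 0) (at s within {a..})"
   by (intro tendsto_sandwich[OF _ _ tendsto_const lim]) simp_all
  thus "(y \<longlongrightarrow> y s) (at s within {a..})" by (rule tendsto_dist_iff[THEN iffD2])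
 qed
qed

lemma energy_le_C1: assumes der: "!!s. a <= s ==> (y has_real_derivative y' s) (at s within {a..})"
  and cont: "continuous_on {a..} y'" and C: "!!t. a <= t ==> integral {a..t} (%s. (y' s)^2) <= C" shows "energy_le a y C"
proof (rule witness_imp_energy_le)
 let ?e = "%t. integral {a..t} (%s. (y' s)^2)"
 have int: "(%s. (y' s)^2) integrable_on {s..t}" if "a <= s" for s t
  by (intro integrable_continuous_real continuous_intros continuous_on_subset[OF cont]) (use that in auto)
 have diff: "?e t - ?e s = integral {s..t} (%s. (y' s)^2)" if "a <= s" "s <= t" for s t
  using Henstock_Kurzweil_Integration.integral_combine[of a s t "%s. (y' s)^2"] int[of a t] that by simp
 show "energy_witness {a..} y ?e" unfolding energy_witness_def proof (intro conjI ballI impI mono_onI)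
  fix s t assume st: "s : {a..}" "t : {a..}" "s <= t"
  show "?e s <= ?e t" using diff[of s t] st integral_nonneg[OF int[of s t]] by auto
  have ci: "continuous_on {s..t} y'" by (rule continuous_on_subset[OF cont]) (use st in auto)
  have ft: "(y' has_integral (y t - y s)) {s..t}" by (rule fundamental_theorem_of_calculus[OF st(3)])
    (unfold has_real_derivative_iff_has_vector_derivative[symmetric], rule DERIV_subset[OF der], use st in auto)
  show "(y t - y s)^2 <= (t - s) * (?e t - ?e s)" proof (cases "s = t")
   case False
   with st have "s < t" by simp
   \<comment> \<open>The mean slope; Cauchy-Schwarz is read off from the nonnegative integral of (y'
     - m)^2.\<close>
   define m where "m = (y t - y s) / (t - s)"
   have "0 <= integral {s..t} (%x. (y' x - m)^2)" by (intro integral_nonneg integrable_continuous_real continuous_intros ci) auto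
   also have "integral {s..t} (%x. (y' x - m)^2) = integral {s..t} (%x. (y' x)^2 + (m^2 - 2 * m * y' x))"
    by (simp add: power2_diff algebra_simps)
   also have "... = integral {s..t} (%x. (y' x)^2) + (m^2 * (t - s) - 2 * m * (y t - y s))"
   proof (rule integral_unique, intro has_integral_add has_integral_diff)
    show "((%x. (y' x)^2) has_integral integral {s..t} (%x. (y' x)^2)) {s..t}"
     using int[of s t] st by (auto intro: integrable_integral)
    show "((%x. m^2) has_integral m^2 * (t - s)) {s..t}"
     using has_integral_const_real[of "m^2" s t] \<open>s < t\<close> by (simp add: mult.commute)
    show "((%x. 2 * m * y' x) has_integral 2 * m * (y t - y s)) {s..t}" by (rule has_integral_mult_right[OF ft])
   qed
   also have "m^2 * (t - s) - 2 * m * (y t - y s) = - ((y t - y s)^2) / (t - s)" proof -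
    have d: "m * (t - s) = y t - y s" using \<open>s < t\<close> by (simp add: m_def)
    have "m^2 * (t - s) = m * (y t - y s)" by (simp add: power2_eq_square d)
    hence "m^2 * (t - s) - 2 * m * (y t - y s) = - (m * (y t - y s))" by simp
    thus ?thesis by (simp add: m_def power2_eq_square)
   qed
   finally show ?thesis using diff[of s t] st \<open>s < t\<close> by (simp add: field_simps)
  qed simp
 qed
 show "?e t - ?e a <= C" if "t >= a" for t using C[OF that] by simp
qed

text \<open>A Steklov average of y, stopped at T and delayed by 2h. If y 0 = 0, the delay makes it
  vanish for s <= h, that is near the boundary of the disc; stopping makes it constant for s >= T +
  2h, that is near the centre.\<close>

definition steklov :: "real => real => (real => real) => real => real" where "steklov h T y s =
  (let g = (%x. y (max 0 (min T (x - 2 * h)))); G = (%s. integral {0..s} g) in (G (s + h) - G s) / h)"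

definition steklov_deriv :: "real => real => (real => real) => real => real" where "steklov_deriv h T y s =
  (y (max 0 (min T (s + h - 2 * h))) - y (max 0 (min T (s - 2 * h)))) / h"

locale steklov_average =
 fixes h T C :: real and y :: "real => real" assumes h: "0 < h" and T: "0 <= T" and y0: "y 0 = 0" and energy: "energy_le 0 y C"
begin

definition clamp where "clamp x = max 0 (min T (x - 2 * h))"
definition g where "g x = y (clamp x)"
definition G where "G s = integral {0..s} g"

lemma steklov_eq: "steklov h T y s = (G (s + h) - G s) / h" unfolding steklov_def Let_def G_def g_def clamp_def ..

lemma clamp: "0 <= clamp x" "clamp x <= T" "x <= 2 * h ==> clamp x = 0" "T + 2 * h <= x ==> clamp x = T"
 using T by (auto simp: clamp_def)

lemma clamp_mono: "x <= x' ==> clamp x <= clamp x'" by (auto simp: clamp_def)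

lemma clamp_contract: "x <= x' ==> clamp x' - clamp x <= x' - x" by (auto simp: clamp_def)

lemma g_continuous: "continuous_on S g" proof -
 have "continuous_on S (y \<circ> clamp)" proof (rule continuous_on_compose)
  show "continuous_on S clamp" unfolding clamp_def by (intro continuous_intros)
  show "continuous_on (clamp ` S) y" by (rule continuous_on_subset[OF energy_le_continuous[OF energy]]) (use clamp in auto)
 qed
 thus ?thesis by (simp add: comp_def g_def[abs_def])
qed

lemma g_integrable: "g integrable_on {a..b}" by (intro integrable_continuous_real g_continuous)

lemma g_zero: "x <= 2 * h ==> g x = 0" by (simp add: g_def clamp y0)

lemma G_zero: "s <= 2 * h ==> G s = 0" unfolding G_def using integral_cong[of "{0..s}" g "%_. 0"] by (simp add: g_zero)

lemma G_deriv: "DERIV G s :> g s" proof (cases "s < 2 * h")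
 case True
 have "DERIV (%_. 0) s :> 0" by simp
 hence "DERIV G s :> 0" by (rule has_field_derivative_transform_within_open[of _ _ _ "{..<2*h}"]) (use True G_zero in auto)
 thus ?thesis using True g_zero[of s] by simp
next
 case False
 with h have "0 < s" by simp
 have "(G has_real_derivative g s) (at s within {0..s+1})"
  unfolding G_def by (rule integral_has_real_derivative[OF g_continuous]) (use \<open>0 < s\<close> in auto)
 moreover have "s : interior {0..s+1}" using \<open>0 < s\<close> by (simp add: interior_atLeastAtMost_real)
 ultimately show ?thesis using at_within_interior[of s "{0..s+1}"] by simp
qed

lemma deriv: "DERIV (steklov h T y) s :> steklov_deriv h T y s" proof -
 have "DERIV (%s. (G (s + h) - G s) / h) s :> (g (s + h) - g s) / h"
  using h by (auto intro!: derivative_eq_intros DERIV_chain2[OF G_deriv] G_deriv)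
 thus ?thesis by (simp add: steklov_eq[abs_def] steklov_deriv_def g_def clamp_def)
qed

lemma steklov_deriv_eq: "steklov_deriv h T y s = (g (s + h) - g s) / h" by (simp add: steklov_deriv_def g_def clamp_def)

lemma deriv_continuous: "continuous_on S (steklov_deriv h T y)" unfolding steklov_deriv_eq[abs_def]
 by (intro continuous_intros continuous_on_compose2[OF g_continuous[of UNIV]]) (use h in auto)

lemma deriv_zero_left: "s <= h ==> steklov_deriv h T y s = 0" using h by (simp add: steklov_deriv_eq g_zero)

lemma deriv_zero_right: "T + 2 * h <= s ==> steklov_deriv h T y s = 0" using h by (simp add: steklov_deriv_eq g_def clamp)

lemma zero_left: "s <= h ==> steklov h T y s = 0" using h by (simp add: steklov_eq G_zero)

lemma deriv_square_integrable: "(%s. (steklov_deriv h T y s)^2) integrable_on {a..b}"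
 by (intro integrable_continuous_real continuous_intros deriv_continuous)

text \<open>Averaging does not raise the energy: with e' the stopped witness, the squared derivative
  is at most (e' (s + h) - e' s) / h, and the integral of this telescopes to a mean of e' over the
  last window minus one over the first.\<close>

lemma energy_bound: assumes "0 <= t" shows "integral {0..t} (%s. (steklov_deriv h T y s)^2) <= C" proof -
 obtain e where e: "energy_witness {0..} y e" "!!t. 0 <= t ==> 0 <= e t" "!!t. 0 <= t ==> e t <= C"
  using energy_le_imp_witness[OF energy] by blast
 define e' where "e' x = e (clamp x)" for x
 have e'_mono: "e' x <= e' x'" if "x <= x'" for x x'
  using e(1) clamp clamp_mono[OF that] unfolding e'_def energy_witness_def by (auto intro: mono_onD)
 have e'_int: "e' integrable_on {a..b}" for a b by (rule integrable_on_mono_on) (auto intro!: mono_onI e'_mono)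
 have e'_int2: "(%s. e' (s + h)) integrable_on {a..b}" for a b by (rule integrable_on_mono_on) (auto intro!: mono_onI e'_mono)
 have pt: "(steklov_deriv h T y s)^2 <= (e' (s + h) - e' s) / h" for s proof -
  have "(g (s + h) - g s)^2 <= (clamp (s + h) - clamp s) * (e' (s + h) - e' s)"
   using e(1) clamp clamp_mono[of s "s + h"] h unfolding e'_def energy_witness_def g_def by auto
  also have "... <= h * (e' (s + h) - e' s)"
   using clamp_contract[of s "s + h"] h e'_mono[of s "s + h"] by (intro mult_right_mono) auto
  finally show ?thesis using h unfolding steklov_deriv_eq by (simp add: power_divide field_simps power2_eq_square[of h])
 qed
 have shift: "integral {0..t} (%s. e' (s + h)) = integral {h..t + h} e'" using integral_shift_real_ivl[of h h "t + h" e'] by simp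
 have c1: "integral {0..t + h} e' = integral {0..h} e' + integral {h..t + h} e'"
  using Henstock_Kurzweil_Integration.integral_combine[of 0 h "t + h" e'] e'_int h assms by simp
 have c2: "integral {0..t + h} e' = integral {0..t} e' + integral {t..t + h} e'"
  using Henstock_Kurzweil_Integration.integral_combine[of 0 t "t + h" e'] e'_int h assms by simp
 have u: "integral {t..t + h} e' <= h * C" proof -
  have "integral {t..t + h} e' <= integral {t..t + h} (%_. C)" by (intro integral_le e'_int) (auto simp: e'_def clamp e)
  thus ?thesis using h by simp
 qed
 have l: "integral {0..h} e' >= 0" by (intro integral_nonneg e'_int) (auto simp: e'_def clamp e)
 have "integral {0..t} (%s. (steklov_deriv h T y s)^2) <= integral {0..t} (%s. (e' (s + h) - e' s) / h)"
  by (intro integral_le deriv_square_integrable integrable_on_divide integrable_diff e'_int e'_int2 pt)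
 also have "... = (integral {0..t} (%s. e' (s + h)) - integral {0..t} e') / h" by (simp add: integral_diff[OF e'_int2 e'_int])
 also have "... <= C" using shift c1 c2 u l h by (simp add: field_simps)
 finally show ?thesis .
qed

lemma steklov_energy: "energy_le 0 (steklov h T y) C"
 by (rule energy_le_C1[OF DERIV_subset[OF deriv] deriv_continuous]) (auto intro: energy_bound)

lemma steklov_close: assumes "2 * h <= s" "s + h <= T + 2 * h" shows "abs (steklov h T y s - y s) <= sqrt (C * (2 * h))" proof -
 have b: "abs (g x - y s) <= sqrt (C * (2 * h))" if "x : {s..s + h}" for x proof -
  have x: "clamp x = x - 2 * h" using assms that h T by (auto simp: clamp_def)
  have "(y s - y (x - 2 * h))^2 <= C * (s - (x - 2 * h))" by (rule energy_le_two[OF energy]) (use that assms h in auto)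
  also have "... <= C * (2 * h)" using energy_le_nonneg[OF energy] that by (intro mult_left_mono) auto
  finally show ?thesis unfolding g_def x by (intro real_le_rsqrt) (simp add: power2_commute)
 qed
 have "G (s + h) - G s = integral {s..s + h} g" unfolding G_def
  using Henstock_Kurzweil_Integration.integral_combine[of 0 s "s + h" g] g_integrable h assms by simp
 hence "h * (steklov h T y s - y s) = integral {s..s + h} (%x. g x - y s)"
  using h integral_diff[OF g_integrable integrable_const_ivl, of s "s + h" "y s"] by (simp add: steklov_eq right_diff_distrib)
 moreover have "norm (integral (cbox s (s + h)) (%x. g x - y s)) <= sqrt (C * (2 * h)) * measure lborel (cbox s (s + h))"
  by (rule integrable_bound) (use b energy_le_nonneg[OF energy] h in "auto intro!: integrable_diff g_integrable")
 ultimately have "abs (h * (steklov h T y s - y s)) <= sqrt (C * (2 * h)) * h" using h by simp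
 hence "h * abs (steklov h T y s - y s) <= h * sqrt (C * (2 * h))" using h by (simp add: abs_mult mult.commute)
 thus ?thesis using h by simp
qed

end

lemma steklov_tendsto: assumes "y 0 = 0" "energy_le 0 y C" "0 <= s"
 shows "(%k. steklov (1 / real (Suc k)) (real (Suc k)) y s) ----> y s" proof (cases "s = 0")
 case True
 have "steklov (1 / real (Suc k)) (real (Suc k)) y s = y s" for k
  using steklov_average.zero_left[of "1 / real (Suc k)" "real (Suc k)" _ y s] assms True by (simp add: steklov_average_def)
 thus ?thesis by simp
next
 case False
 with assms have s: "s > 0" by simp
 have lim: "(%k. 1 / real (Suc k)) ----> 0" using LIMSEQ_inverse_real_of_nat by (simp add: inverse_eq_divide)
 have ev1: "\<forall>\<^sub>F k in sequentially. 1 / real (Suc k) < s / 2" by (rule order_tendstoD(2)[OF lim]) (use s in auto)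
 have ev2: "\<forall>\<^sub>F k in sequentially. s < real k"
  using filterlim_real_sequentially unfolding filterlim_at_top_dense by blast
 have ev: "\<forall>\<^sub>F k in sequentially.
  norm (steklov (1 / real (Suc k)) (real (Suc k)) y s - y s) <= sqrt (C * (2 * (1 / real (Suc k))))" using ev1 ev2
 proof eventually_elim
  case (elim k)
  interpret steklov_average "1 / real (Suc k)" "real (Suc k)" C y using assms by unfold_locales auto
  have "0 <= 1 / real (Suc k)" by simp
  hence "s + 1 / real (Suc k) <= real (Suc k) + 2 * (1 / real (Suc k))" using elim(2) by linarith
  moreover have "2 * (1 / real (Suc k)) <= s" using elim(1) by linarith
  ultimately show ?case unfolding real_norm_def by (intro steklov_close)
 qed
 have "(%k. sqrt (C * (2 * (1 / real (Suc k))))) ----> sqrt (C * (2 * 0))" by (intro tendsto_intros lim)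
 hence "(%k. sqrt (C * (2 * (1 / real (Suc k))))) ----> 0" by simp
 from Lim_null_comparison[OF ev this] show ?thesis by (simp add: LIM_zero_iff)
qed

subsection \<open>A weighted one-dimensional Moser inequality\<close>

lemma DERIV_integral_at:
 fixes f :: "real => real" assumes "continuous_on UNIV f" "a < s" shows "DERIV (%t. integral {a..t} f) s :> f s" proof -
 have "((%t. integral {a..t} f) has_real_derivative f s) (at s within {a..s+1})"
  by (rule integral_has_real_derivative[OF continuous_on_subset[OF assms(1)]]) (use assms in auto)
 moreover have "s : interior {a..s+1}" using assms by (simp add: interior_atLeastAtMost_real)
 ultimately show ?thesis using at_within_interior[of s "{a..s+1}"] by simp
qed

lemma DERIV_zero_const:
 fixes f :: "real => real" assumes "!!x. T <= x ==> DERIV f x :> 0" "T <= s" shows "f s = f T" proof -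
 have "EX c. ALL x:{T..}. f x = c" by (rule has_field_derivative_zero_constant) (auto intro: DERIV_subset[OF assms(1)])
 thus ?thesis using assms(2) by fastforce
qed

lemma borel_measurable_ennreal_indicator_Ici:
 fixes f :: "real => real" assumes "continuous_on {a..} f"
 shows "(%s. ennreal (f s) * indicator {a..} s) : borel_measurable borel" proof -
 have "(%s. indicator {a..} s *R f s) : borel_measurable borel"
  by (rule borel_measurable_continuous_on_indicator[OF _ assms]) simp
 hence "(%s. ennreal (indicator {a..} s *R f s)) : borel_measurable borel" by simp
 also have "(%s. ennreal (indicator {a..} s *R f s)) = (%s. ennreal (f s) * indicator {a..} s)" by (auto simp: indicator_def)
 finally show ?thesis .
qed

text \<open>A Hamilton-Jacobi argument: with \<open>Z t = \<integral>\<^sub>t\<^sup>\<infinity> E\<close> and \<open>q = ln (\<lambda> Z) - (p z - \<lambda> t)\<close>, the quantity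
  \<open>p\<^sup>2/(4\<lambda>) \<integral>\<^sub>t\<^sup>\<infinity> z'\<^sup>2 - (q + exp (- q) - 1)\<close> has derivative
  \<open>- (p z'/2 - \<lambda> (1 - exp (- q)))\<^sup>2 / \<lambda>\<close>, so it is nonincreasing; it vanishes in the limit.\<close>

lemma exp_integral_C1_bound:
 fixes z z' :: "real => real" assumes der: "!!s. DERIV z s :> z' s" and cont: "continuous_on UNIV z'"
  and z'T: "!!s. T <= s ==> z' s = 0" and T: "0 < T" and z0: "z 0 = 0" and lam: "0 < lam"
  and delta: "integral {0..T} (%s. (z' s)^2) <= \<delta>"
 shows "(\<integral>\<^sup>+s. ennreal (exp (p * z s - lam * s)) * indicator {0..} s \<partial>lborel)
   <= ennreal (exp (1 + p^2 * \<delta> / (4 * lam)) / lam)" proof -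
 define E where "E s = exp (p * z s - lam * s)" for s
 \<comment> \<open>The integrals start at -1 so that their derivatives at 0 are two-sided.\<close>
 define F where "F t = integral {-1..t} E" for t
 define Kin where "Kin t = integral {-1..t} (%s. (z' s)^2)" for t
 \<comment> \<open>For t <= T this is the integral of E over [t, infinity): past T the function z is
   constant, so E is a pure exponential with remaining mass E T / lam.\<close>
 define Z where "Z t = F T + E T / lam - F t" for t
 define q where "q t = ln (lam * Z t) - (p * z t - lam * t)" for t
 define \<Phi> where "\<Phi> t = p^2 / (4 * lam) * (Kin T - Kin t) - (q t + exp (- q t) - 1)" for t
 have Epos: "E s > 0" for s by (simp add: E_def)
 have zcont: "continuous_on UNIV z" using der by (auto intro!: DERIV_continuous_on)
 have Econt: "continuous_on UNIV E" unfolding E_def by (intro continuous_intros zcont)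
 have dF: "DERIV F s :> E s" if "-1 < s" for s unfolding F_def by (rule DERIV_integral_at[OF Econt that])
 have dK: "DERIV Kin s :> (z' s)^2" if "-1 < s" for s
  unfolding Kin_def by (rule DERIV_integral_at[OF _ that]) (intro continuous_intros cont)
 have Fmono: "F s <= F t" if "-1 < s" "s <= t" for s t proof (rule DERIV_nonneg_imp_nondecreasing[OF that(2)])
  show "EX d. DERIV F x :> d & 0 <= d" if "s <= x" for x
   using dF[of x] Epos[of x] that \<open>-1 < s\<close> by (intro exI[of _ "E x"]) auto
 qed
 have Zpos: "Z t > 0" if "-1 < t" "t <= T" for t
  using Fmono[OF that] Epos[of T] lam unfolding Z_def by (smt (verit) divide_pos_pos)
 have dE: "DERIV E s :> E s * (p * z' s - lam)" for s unfolding E_def by (auto intro!: derivative_eq_intros der)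
 have zT: "z s = z T" if "T <= s" for s using DERIV_zero_const[OF _ that, of z] der z'T by metis
 have FT: "F s + E s / lam = F T + E T / lam" if "T <= s" for s proof -
  have d0: "DERIV (%s. F s + E s / lam) x :> 0" if "T <= x" for x
   using that T lam z'T[of x] by (auto intro!: derivative_eq_intros dF dE)
  show ?thesis by (rule DERIV_zero_const[OF d0 that])
 qed
 have Elim: "(E \<longlongrightarrow> 0) at_top" proof -
  have "((%s. exp (p * z T) * exp (- (lam * s))) \<longlongrightarrow> exp (p * z T) * 0) at_top"
  proof (intro tendsto_intros filterlim_compose[OF exp_at_bot])
   show "filterlim (%s. - (lam * s)) at_bot at_top"
    using lam by (simp add: filterlim_uminus_at_bot filterlim_tendsto_pos_mult_at_top[OF tendsto_const _ filterlim_ident])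
  qed
  moreover have "\<forall>\<^sub>F s in at_top. exp (p * z T) * exp (- (lam * s)) = E s" using eventually_ge_at_top[of T]
  proof eventually_elim
   case (elim s)
   show ?case unfolding E_def zT[OF elim] by (simp add: mult_exp_exp)
  qed
  ultimately show ?thesis by (simp add: tendsto_cong)
 qed
 have Flim: "(F \<longlongrightarrow> F T + E T / lam) at_top" proof -
  have "((%s. F T + E T / lam - E s / lam) \<longlongrightarrow> F T + E T / lam - 0 / lam) at_top"
   using lam by (intro tendsto_intros Elim) auto
  moreover have "\<forall>\<^sub>F s in at_top. F T + E T / lam - E s / lam = F s" using eventually_ge_at_top[of T]
  proof eventually_elim
   case (elim s)
   show ?case using FT[OF elim] by linarith
  qed
  ultimately show ?thesis by (simp add: tendsto_cong)
 qed
 have "(\<integral>\<^sup>+s. ennreal (E s) * indicator {0..} s \<partial>lborel) = ennreal (F T + E T / lam - F 0)"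
  by (rule nn_integral_FTC_atLeast[OF _ _ _ Flim])
   (use dF Epos Econt in "auto intro: less_imp_le borel_measurable_continuous_onI")
 hence val: "(\<integral>\<^sup>+s. ennreal (E s) * indicator {0..} s \<partial>lborel) = ennreal (Z 0)" by (simp add: Z_def)
 have dq: "DERIV q t :> lam * (1 - exp (- q t)) - p * z' t" if "-1 < t" "t <= T" for t proof -
  have e: "exp (- q t) = E t / (lam * Z t)" using Zpos[OF that] lam by (simp add: q_def E_def exp_diff exp_ln)
  have dZ: "DERIV Z t :> - E t" unfolding Z_def using that by (auto intro!: derivative_eq_intros dF)
  have "DERIV q t :> (- E t) / Z t - (p * z' t - lam)" unfolding q_def using Zpos[OF that] lam that
   by (auto intro!: derivative_eq_intros dZ der)
  thus ?thesis using e lam Zpos[OF that] by (simp add: algebra_simps)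
 qed
 have d\<Phi>: "DERIV \<Phi> t :> - ((p * z' t / 2 - lam * (1 - exp (- q t)))^2) / lam" if "-1 < t" "t <= T" for t proof -
  have "DERIV \<Phi> t :> p^2 / (4 * lam) * (- ((z' t)^2))
    - ((lam * (1 - exp (- q t)) - p * z' t) - exp (- q t) * (lam * (1 - exp (- q t)) - p * z' t))"
   unfolding \<Phi>_def using that lam by (auto intro!: derivative_eq_intros dK dq simp: algebra_simps)
  also have "p^2 / (4 * lam) * (- ((z' t)^2))
    - ((lam * (1 - exp (- q t)) - p * z' t) - exp (- q t) * (lam * (1 - exp (- q t)) - p * z' t))
    = - ((p * z' t / 2 - lam * (1 - exp (- q t)))^2) / lam" using lam by (simp add: field_simps power2_eq_square)
  finally show ?thesis .
 qed
 have "\<Phi> T <= \<Phi> 0" proof (rule DERIV_nonpos_imp_nonincreasing[of 0 T \<Phi>])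
  show "EX d. DERIV \<Phi> x :> d & d <= 0" if "0 <= x" "x <= T" for x using d\<Phi>[of x] that lam by (intro exI conjI) auto
 qed (use T in simp)
 \<comment> \<open>At T the tail equals E T / lam, hence q T = 0.\<close>
 moreover have "\<Phi> T = 0" using lam by (simp add: \<Phi>_def q_def Z_def E_def)
 \<comment> \<open>Dropping \<open>exp (- q 0)\<close> from q + exp (- q) - 1 leaves the 1 in the
   exponent, the source of the factor e in the concentration level.\<close>
 ultimately have "q 0 <= 1 + p^2 / (4 * lam) * (Kin T - Kin 0)" unfolding \<Phi>_def by (smt (verit) exp_gt_zero)
 moreover have "Kin T - Kin 0 <= \<delta>" proof -
  have "Kin T = Kin 0 + integral {0..T} (%s. (z' s)^2)" unfolding Kin_def
   by (rule Henstock_Kurzweil_Integration.integral_combine[symmetric])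
    (use T in "auto intro!: integrable_continuous_real continuous_intros continuous_on_subset[OF cont]")
  with delta show ?thesis by simp
 qed
 ultimately have "q 0 <= 1 + p^2 * \<delta> / (4 * lam)"
  using lam mult_left_mono[of "Kin T - Kin 0" \<delta> "p^2 / (4 * lam)"] by simp
 hence "exp (q 0) <= exp (1 + p^2 * \<delta> / (4 * lam))" by simp
 moreover have "exp (q 0) = lam * Z 0" using Zpos[of 0] T lam z0 by (simp add: q_def)
 ultimately have "Z 0 <= exp (1 + p^2 * \<delta> / (4 * lam)) / lam" using lam by (simp add: field_simps)
 with val show ?thesis unfolding E_def by (simp add: ennreal_leI)
qed

text \<open>Steklov averages of z satisfy the C^1 hypotheses with the same energy bound; Fatou's
  lemma carries the estimate over to z.\<close>

lemma exp_integral_energy_bound: assumes "z 0 = 0" "energy_le 0 z \<delta>" "0 < lam"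
 shows "(\<integral>\<^sup>+s. ennreal (exp (p * z s - lam * s)) * indicator {0..} s \<partial>lborel)
   <= ennreal (exp (1 + p^2 * \<delta> / (4 * lam)) / lam)" proof -
 define Y where "Y k = steklov (1 / real (Suc k)) (real (Suc k)) z" for k
 define f where "f k s = ennreal (exp (p * Y k s - lam * s)) * indicator {0..} s" for k s
 have st: "steklov_average (1 / real (Suc k)) (real (Suc k)) \<delta> z" for k using assms by (simp add: steklov_average_def)
 have bound: "(\<integral>\<^sup>+s. f k s \<partial>lborel) <= ennreal (exp (1 + p^2 * \<delta> / (4 * lam)) / lam)" for k
 proof -
  interpret steklov_average "1 / real (Suc k)" "real (Suc k)" \<delta> z by (rule st)
  have T2: "0 < real (Suc k) + 2 * (1 / real (Suc k))" by (intro add_pos_pos) auto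
  show ?thesis unfolding f_def Y_def
   by (intro exp_integral_C1_bound[OF deriv deriv_continuous deriv_zero_right _ zero_left assms(3) energy_bound])
    (use h T2 in "auto intro: less_imp_le")
 qed
 have meas: "f k : borel_measurable lborel" for k proof -
  interpret steklov_average "1 / real (Suc k)" "real (Suc k)" \<delta> z by (rule st)
  have "continuous_on UNIV (Y k)" unfolding Y_def using deriv by (auto intro!: DERIV_continuous_on)
  hence "Y k : borel_measurable borel" by (rule borel_measurable_continuous_onI)
  thus ?thesis unfolding f_def by measurable
 qed
 have lim: "(%k. f k s) ----> ennreal (exp (p * z s - lam * s)) * indicator {0..} s" for s proof (cases "0 <= s")
  case True
  have "(%k. Y k s) ----> z s" unfolding Y_def by (rule steklov_tendsto[OF assms(1,2) True])
  thus ?thesis using True unfolding f_def by (auto intro!: tendsto_ennrealI tendsto_intros)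
 qed (simp add: f_def)
 have "(\<integral>\<^sup>+s. ennreal (exp (p * z s - lam * s)) * indicator {0..} s \<partial>lborel)
  = (\<integral>\<^sup>+s. liminf (%k. f k s) \<partial>lborel)" by (intro nn_integral_cong) (simp add: lim_imp_Liminf[OF _ lim])
 also have "... <= liminf (%k. \<integral>\<^sup>+s. f k s \<partial>lborel)" by (rule nn_integral_liminf[OF meas])
 also have "... <= ennreal (exp (1 + p^2 * \<delta> / (4 * lam)) / lam)"
  by (rule order_trans[OF Liminf_le_Limsup Limsup_bounded]) (use bound in auto)
 finally show ?thesis .
qed

text \<open>The exponents cancel exactly because \<open>(y a)\<^sup>2 = a (1 - \<delta>)\<close>, where \<open>\<delta>\<close> is the energy that
  is left on \<open>{a..}\<close>.\<close>

lemma exp_square_tail: assumes y0: "y 0 = 0" and E: "energy_le 0 y 1" and a: "0 < a" and ya: "y a ~= 0"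
 shows "(\<integral>\<^sup>+s. ennreal (exp (2 * (y s)^2 - 2 * s)) * indicator {a..} s \<partial>lborel)
   <= ennreal (exp 1 / 2 * (a / (y a)^2))" proof -
 define \<delta> where "\<delta> = 1 - (y a)^2 / a"
 define c where "c = y a"
 define z where "z s = y (a + s) - c" for s
 have Ea: "energy_le a y \<delta>" using energy_le_tail[OF E a] y0 by (simp add: \<delta>_def)
 have Ez: "energy_le 0 z \<delta>" unfolding z_def by (rule energy_le_shift[OF Ea])
 have d1: "\<delta> < 1" using a ya by (simp add: \<delta>_def)
 have z0: "z 0 = 0" by (simp add: z_def c_def)
 \<comment> \<open>With y (a + s) = c + z s, the bound (z s)^2 <= \<delta> s linearizes the square,
   and the exponent takes the form treated above with p = 4 c and lam = 2 (1 - \<delta>).\<close>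
 have pt: "2 * (y (a + s))^2 - 2 * (a + s) <= 2 * c^2 - 2 * a + (4 * c * z s - 2 * (1 - \<delta>) * s)" if "0 <= s" for s proof -
  have "(z s)^2 <= \<delta> * s" using energy_le_two[OF Ez order_refl that] z0 by simp
  moreover have "y (a + s) = c + z s" by (simp add: z_def)
  ultimately show ?thesis by (simp add: power2_sum algebra_simps)
 qed
 have "(\<integral>\<^sup>+s. ennreal (exp (2 * (y s)^2 - 2 * s)) * indicator {a..} s \<partial>lborel)
  = (\<integral>\<^sup>+s. ennreal (exp (2 * (y (a + s))^2 - 2 * (a + s))) * indicator {a..} (a + s) \<partial>lborel)"
  by (subst nn_integral_real_affine[where c = 1 and t = a]) (auto intro!: borel_measurable_ennreal_indicator_Ici continuous_intros
    continuous_on_subset[OF energy_le_continuous[OF E]] intro: less_imp_le simp: a)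
 also have "... <= (\<integral>\<^sup>+s. ennreal (exp (2 * c^2 - 2 * a)) * (ennreal (exp (4 * c * z s - 2 * (1 - \<delta>) * s)) * indicator {0..} s) \<partial>lborel)"
 proof (rule nn_integral_mono)
  fix s
  have "exp (2 * (y (a + s))^2 - 2 * (a + s))
    <= exp (2 * c^2 - 2 * a) * exp (4 * c * z s - 2 * (1 - \<delta>) * s)" if "0 <= s"
   unfolding exp_add[symmetric] exp_le_cancel_iff by (rule pt[OF that])
  thus "ennreal (exp (2 * (y (a + s))^2 - 2 * (a + s))) * indicator {a..} (a + s)
    <= ennreal (exp (2 * c^2 - 2 * a)) * (ennreal (exp (4 * c * z s - 2 * (1 - \<delta>) * s)) * indicator {0..} s)"
   by (auto simp: indicator_def simp flip: ennreal_mult intro!: ennreal_leI)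
 qed
 also have "... = ennreal (exp (2 * c^2 - 2 * a)) * (\<integral>\<^sup>+s. ennreal (exp (4 * c * z s - 2 * (1 - \<delta>) * s)) * indicator {0..} s \<partial>lborel)"
  by (rule nn_integral_cmult) (auto intro!: borel_measurable_ennreal_indicator_Ici continuous_intros energy_le_continuous[OF Ez])
 also have "... <= ennreal (exp (2 * c^2 - 2 * a)) * ennreal (exp (1 + (4 * c)^2 * \<delta> / (4 * (2 * (1 - \<delta>)))) / (2 * (1 - \<delta>)))"
  by (intro mult_left_mono exp_integral_energy_bound z0 Ez) (use d1 in auto)
 also have "... = ennreal (exp 1 / 2 * (a / (y a)^2))" proof -
  have c2: "c^2 = a * (1 - \<delta>)" using a by (simp add: \<delta>_def c_def)
  have "(4 * c)^2 * \<delta> / (4 * (2 * (1 - \<delta>))) = 2 * \<delta> * (c^2 / (1 - \<delta>))"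
   using d1 by (simp add: power_mult_distrib divide_simps)
  hence e1: "(4 * c)^2 * \<delta> / (4 * (2 * (1 - \<delta>))) = 2 * a * \<delta>" using d1 by (simp add: c2)
  have e2: "2 * c^2 - 2 * a = - (2 * a * \<delta>)" by (simp add: c2 algebra_simps)
  have e3: "a / (y a)^2 = 1 / (1 - \<delta>)" using a ya by (simp add: \<delta>_def)
  have "exp (2 * c^2 - 2 * a) * (exp (1 + (4 * c)^2 * \<delta> / (4 * (2 * (1 - \<delta>)))) / (2 * (1 - \<delta>)))
    = exp 1 / 2 * (a / (y a)^2)" unfolding e1 e2 e3 using d1 by (simp add: exp_add exp_minus field_simps)
  thus ?thesis using d1 by (subst ennreal_mult[symmetric]) auto
 qed
 finally show ?thesis .
qed

section \<open>Admissible functions and their compactness\<close>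

definition admissible :: "(real => real) => bool" where "admissible y \<longleftrightarrow> y 0 = 0 & energy_le 0 y 1"

lemma admissible_square_le: "admissible y ==> 0 <= s ==> (y s)^2 <= s"
 unfolding admissible_def using energy_le_two[of 0 y 1 0 s] by auto

lemma admissible_zero: "admissible (%_. 0)" by (simp add: admissible_def energy_le_def partition_sum_def)

lemma admissible_abs_le: assumes "admissible y" "0 <= s" shows "abs (y s) <= sqrt s"
 using admissible_square_le[OF assms] by (simp add: real_le_rsqrt)

lemma admissible_limit: assumes "!!k::nat. admissible (Y k)" "!!s. 0 <= s ==> (%k. Y k s) ----> y s" shows "admissible y" proof -
 have "(%k. Y k 0) ----> y 0" using assms(2) by simp
 hence "y 0 = 0" using assms(1) LIMSEQ_unique[OF _ tendsto_const] unfolding admissible_def by simp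
 moreover have "energy_le 0 y 1" by (rule energy_le_limit[of 0 Y "%_. 1"]) (use assms in "auto simp: admissible_def")
 ultimately show ?thesis by (simp add: admissible_def)
qed

lemma admissible_diff_le: assumes "admissible y" "0 <= s" "0 <= t" shows "abs (y t - y s) <= sqrt (abs (t - s))"
proof (cases "s <= t")
 case True
 thus ?thesis using energy_le_two[of 0 y 1 s t] assms by (auto simp: admissible_def intro!: real_le_rsqrt)
next
 case False
 thus ?thesis using energy_le_two[of 0 y 1 t s] assms by (auto simp: admissible_def power2_commute intro!: real_le_rsqrt)
qed

text \<open>A diagonal subsequence converges at the nonnegative rationals; the common Hoelder bound
  extends convergence to every s >= 0, and admissibility is closed under pointwise limits.\<close>

lemma admissible_compact: assumes Y: "!!k::nat. admissible (Y k)"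
 shows "EX r y. strict_mono (r::nat => nat) & admissible y & (ALL s>=0. (%k. Y (r k) s) ----> y s)" proof -
 define S where "S = {s:\<rat>. (0::real) <= s}"
 have "countable S" unfolding S_def by (rule countable_subset[OF _ countable_rat]) auto
 \<comment> \<open>Division by 1 + s turns the growth bound sqrt s into the uniform bound that the
   diagonal selection requires.\<close>
 moreover have "norm (Y n s / (1 + s)) <= 1" if "s : S" for n s proof -
  have "abs (Y n s) <= sqrt s" using admissible_abs_le[OF Y] that by (simp add: S_def)
  also have "sqrt s <= 1 + s" using that by (intro real_le_lsqrt) (auto simp: S_def power2_eq_square algebra_simps)
  finally show ?thesis using that by (simp add: S_def)
 qed
 ultimately obtain r where r: "strict_mono (r::nat => nat)" "!!s. s : S ==> EX l. (%n. Y (r n) s / (1 + s)) ----> l"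
  using function_convergent_subsequence[of S "%n s. Y n s / (1 + s)" 1] by metis
 have conv: "convergent (%n. Y (r n) s)" if "0 <= s" for s proof -
  have "Cauchy (%n. Y (r n) s)" proof (rule metric_CauchyI)
   fix e :: real assume "0 < e"
   obtain q where q: "q : \<rat>" "s < q" "q < s + (e/4)^2"
    using Rats_dense_in_real[of s "s + (e/4)^2"] \<open>0 < e\<close> by auto
   hence "q : S" using that by (simp add: S_def)
   then obtain l where "(%n. Y (r n) q / (1 + q)) ----> l" using r(2) by blast
   hence "(%n. (Y (r n) q / (1 + q)) * (1 + q)) ----> l * (1 + q)" by (intro tendsto_intros)
   moreover have "(Y (r n) q / (1 + q)) * (1 + q) = Y (r n) q" for n using q that by simp
   ultimately have "Cauchy (%n. Y (r n) q)" by (simp add: LIMSEQ_imp_Cauchy)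
   then obtain N where N: "!!m n. m >= N ==> n >= N ==> dist (Y (r m) q) (Y (r n) q) < e / 4"
    using \<open>0 < e\<close> unfolding Cauchy_def by (metis divide_pos_pos zero_less_numeral)
   have cl: "abs (Y (r n) q - Y (r n) s) < e / 4" for n proof -
    have "abs (Y (r n) q - Y (r n) s) <= sqrt (abs (q - s))" using admissible_diff_le[OF Y[of "r n"] that, of q] that q by simp
    also have "... < sqrt ((e/4)^2)" using q by (intro real_sqrt_less_mono) auto
    finally show ?thesis using \<open>0 < e\<close> by simp
   qed
   show "EX M. ALL m>=M. ALL n>=M. dist (Y (r m) s) (Y (r n) s) < e" proof (intro exI allI impI)
    fix m n assume "N <= m" "N <= n"
    from N[OF this] cl[of m] cl[of n] show "dist (Y (r m) s) (Y (r n) s) < e" unfolding dist_real_def by linarith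
   qed
  qed
  thus ?thesis by (simp add: Cauchy_convergent_iff)
 qed
 define y where "y s = lim (%n. Y (r n) s)" for s
 have y: "(%n. Y (r n) s) ----> y s" if "0 <= s" for s using conv[OF that] unfolding y_def by (simp add: convergent_LIMSEQ_iff)
 have "admissible y" by (rule admissible_limit[of "%k. Y (r k)"]) (use Y y in auto)
 with r(1) y show ?thesis by blast
qed

lemma exp_Ici_finite: "0 < kap ==> (\<integral>\<^sup>+s. ennreal (exp (- kap * s)) * indicator {0..} s \<partial>lborel) < \<infinity>"
 using exp_integral_energy_bound[of "%_. 0" 0 kap 0]
 by (simp add: energy_le_def partition_sum_def) (metis ennreal_less_top le_less_trans)

text \<open>The problem in the variable s = S(|x|^2): \<omega> ds is area divided by pi, h is the
  square of the ground state, and \<gamma> = \<beta> / (2 pi). Against the model weight 2 exp (2A -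
  2s) and the sharp bound y^2 <= s, the exponent \<gamma> = 2 is critical.\<close>

locale weighted_moser =
 fixes \<omega> h :: "real => real" and A \<gamma> :: real assumes \<omega>_meas[measurable]: "\<omega> : borel_measurable borel"
  and h_meas[measurable]: "h : borel_measurable borel" and \<omega>_nonneg: "!!s. 0 <= s ==> 0 <= \<omega> s"
  and \<omega>_le: "!!s. 0 <= s ==> \<omega> s <= 2 * exp (2 * A - 2 * s)" and h_nonneg: "!!s. 0 <= s ==> 0 <= h s"
  and h_le: "!!s. 0 <= s ==> h s <= 1"
  and total: "(\<integral>\<^sup>+s. ennreal (\<omega> s) * indicator {0..} s \<partial>lborel) = 1"
  and \<gamma>: "0 <= \<gamma>" "\<gamma> <= 2"
begin

definition integrand :: "(real => real) => real => ennreal" where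
 "integrand y s = ennreal (\<omega> s * exp (\<gamma> * h s * (y s)^2)) * indicator {0..} s"

definition J :: "(real => real) => ennreal" where "J y = (\<integral>\<^sup>+s. integrand y s \<partial>lborel)"

lemma integrand_measurable[measurable]: assumes "energy_le 0 y C" shows "integrand y : borel_measurable borel" proof -
 have [measurable]: "(%s. indicator {0..} s *R y s) : borel_measurable borel"
  by (rule borel_measurable_continuous_on_indicator[OF _ energy_le_continuous[OF assms]]) simp
 have "(%s. ennreal (\<omega> s * exp (\<gamma> * h s * (indicator {0..} s *R y s)^2)) * indicator {0..} s) : borel_measurable borel"
  by measurable
 also have "(%s. ennreal (\<omega> s * exp (\<gamma> * h s * (indicator {0..} s *R y s)^2)) * indicator {0..} s) = integrand y"
  by (auto simp: integrand_def indicator_def)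
 finally show ?thesis .
qed

lemma exponent_le: "0 <= s ==> \<gamma> * h s * x^2 <= \<gamma> * x^2"
 using h_le[of s] \<gamma> by (simp add: mult_left_le mult_mono mult_right_mono)

lemma integrand_le: assumes "0 <= s"
 shows "\<omega> s * exp (\<gamma> * h s * x^2) <= 2 * exp (2 * A) * exp (\<gamma> * x^2 - 2 * s)" proof -
 have "\<omega> s * exp (\<gamma> * h s * x^2) <= 2 * exp (2 * A - 2 * s) * exp (\<gamma> * x^2)"
  using exponent_le[OF assms] \<omega>_le[OF assms] \<omega>_nonneg[OF assms] by (intro mult_mono) auto
 also have "... = 2 * exp (2 * A) * exp (\<gamma> * x^2 - 2 * s)" by (simp add: exp_diff)
 finally show ?thesis .
qed

lemma integrand_le2: assumes "0 <= s" shows "\<omega> s * exp (\<gamma> * h s * x^2) <= 2 * exp (2 * A) * exp (2 * x^2 - 2 * s)"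
proof -
 have "\<gamma> * x^2 <= 2 * x^2" using \<gamma> by (intro mult_right_mono) auto
 hence "2 * exp (2 * A) * exp (\<gamma> * x^2 - 2 * s) <= 2 * exp (2 * A) * exp (2 * x^2 - 2 * s)" by (intro mult_left_mono) auto
 with integrand_le[OF assms, of x] show ?thesis by linarith
qed

lemma tail_bound: assumes "admissible y" "0 < a" "y a ~= 0"
 shows "(\<integral>\<^sup>+s. integrand y s * indicator {a..} s \<partial>lborel) <= ennreal (exp (1 + 2 * A) * (a / (y a)^2))"
proof -
 have E: "y 0 = 0" "energy_le 0 y 1" using assms by (auto simp: admissible_def)
 have "(\<integral>\<^sup>+s. integrand y s * indicator {a..} s \<partial>lborel)
  <= (\<integral>\<^sup>+s. ennreal (2 * exp (2 * A)) * (ennreal (exp (2 * (y s)^2 - 2 * s)) * indicator {a..} s) \<partial>lborel)"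
  by (intro nn_integral_mono)
   (use assms(2) integrand_le2 in "auto simp: integrand_def indicator_def simp flip: ennreal_mult intro!: ennreal_leI")
 also have "... = ennreal (2 * exp (2 * A)) * (\<integral>\<^sup>+s. ennreal (exp (2 * (y s)^2 - 2 * s)) * indicator {a..} s \<partial>lborel)"
  by (rule nn_integral_cmult) (use assms(2) in "auto intro!: borel_measurable_ennreal_indicator_Ici continuous_intros
    continuous_on_subset[OF energy_le_continuous[OF E(2)]]")
 also have "... <= ennreal (2 * exp (2 * A)) * ennreal (exp 1 / 2 * (a / (y a)^2))"
  by (intro mult_left_mono exp_square_tail E assms) auto
 also have "... = ennreal (exp (1 + 2 * A) * (a / (y a)^2))"
  using assms(2) by (subst ennreal_mult[symmetric]) (auto simp: exp_add)
 finally show ?thesis .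
qed

text \<open>Bounds exp (2 y^2 - 2 s) as long as y^2 stays below s - ln s: the logarithm yields the
  integrable s^(-2). Before 1, where y^2 <= s, any constant of at least 1 serves.\<close>

definition barrier :: "real => real" where "barrier s = (if s < 1 then exp 2 else 1 / s^2)"

definition envelope :: "real => ennreal" where "envelope s = ennreal (2 * exp (2 * A) * barrier s) * indicator {0..} s"

lemma envelope_measurable[measurable]: "envelope : borel_measurable borel" unfolding envelope_def barrier_def by measurable

lemma envelope_finite: "(\<integral>\<^sup>+s. envelope s \<partial>lborel) < \<infinity>" proof -
 have fin: "(\<integral>\<^sup>+s. ennreal (1 / s^2) * indicator {1..} s \<partial>lborel) = ennreal (0 - (- inverse 1))"
 proof (rule nn_integral_FTC_atLeast)
  have "((%s::real. - inverse s) \<longlongrightarrow> - 0) at_top"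
   by (intro tendsto_minus tendsto_inverse_0_at_top filterlim_ident)
  thus "((%s::real. - inverse s) \<longlongrightarrow> 0) at_top" by simp
 qed (auto intro!: derivative_eq_intros simp: power2_eq_square field_simps)
 have "envelope s <= ennreal (2 * exp (2 * A)) * (ennreal (exp 2) * indicator {0..<1} s + ennreal (1 / s^2) * indicator {1..} s)" for s
  by (auto simp: envelope_def barrier_def indicator_def ennreal_mult' simp flip: ennreal_plus intro!: mult_left_mono)
 hence "(\<integral>\<^sup>+s. envelope s \<partial>lborel)
  <= (\<integral>\<^sup>+s. ennreal (2 * exp (2 * A)) * (ennreal (exp 2) * indicator {0..<1} s + ennreal (1 / s^2) * indicator {1..} s) \<partial>lborel)"
  by (intro nn_integral_mono) auto
 also have "... = ennreal (2 * exp (2 * A)) * (ennreal (exp 2) + 1)" using fin by (simp add: nn_integral_cmult nn_integral_add)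
 also have "... < \<infinity>" by (simp add: ennreal_mult_less_top)
 finally show ?thesis .
qed

lemma integrand_le_envelope: assumes "admissible y" "0 <= s" "1 <= s ==> (y s)^2 <= s - ln s" shows "integrand y s <= envelope s"
proof -
 have "exp (2 * (y s)^2 - 2 * s) <= barrier s" proof (cases "s < 1")
  case True
  thus ?thesis using admissible_square_le[OF assms(1,2)] by (simp add: barrier_def)
 next
  case False
  hence "exp (2 * (y s)^2 - 2 * s) <= exp (- (2 * ln s))" using assms by simp
  also have "... = 1 / s^2" using False by (simp add: exp_minus exp_of_nat_mult[of 2, simplified] inverse_eq_divide)
  finally show ?thesis using False by (simp add: barrier_def)
 qed
 hence "2 * exp (2 * A) * exp (2 * (y s)^2 - 2 * s) <= 2 * exp (2 * A) * barrier s" by (intro mult_left_mono) auto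
 with integrand_le2[OF assms(2), of "y s"]
 have "\<omega> s * exp (\<gamma> * h s * (y s)^2) <= 2 * exp (2 * A) * barrier s" by linarith
 thus ?thesis using assms(2) by (simp add: integrand_def envelope_def ennreal_leI)
qed

lemma first_crossing: assumes "admissible y" "1 <= s0" "(y s0)^2 > s0 - ln s0"
 shows "EX a>=1. (y a)^2 >= a - ln a & (ALL s. 1 <= s & s < a --> (y s)^2 < s - ln s)" proof -
 define S where "S = {s : {1..}. s - ln s <= (y s)^2}"
 have "continuous_on {1..} y" using assms(1) energy_le_continuous[of 0 y 1] unfolding admissible_def
  by (auto intro: continuous_on_subset)
 hence "closed S" unfolding S_def by (intro continuous_on_closed_Collect_le continuous_intros) auto
 moreover have ne: "S ~= {}" using assms by (auto simp: S_def)
 moreover have bdd: "bdd_below S" by (rule bdd_belowI[of _ 1]) (auto simp: S_def)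
 ultimately have "Inf S : S" by (intro closed_contains_Inf)
 moreover have "(y s)^2 < s - ln s" if "1 <= s" "s < Inf S" for s using cInf_lower[OF _ bdd, of s] that by (force simp: S_def)
 ultimately show ?thesis by (intro exI[of _ "Inf S"]) (auto simp: S_def)
qed

lemma ln_le_half: "1 <= (a::real) ==> ln a <= a / 2" proof -
 assume "1 <= a"
 have "ln (a / 2) <= a / 2 - 1" using \<open>1 <= a\<close> by (intro ln_le_minus_one) auto
 thus ?thesis using \<open>1 <= a\<close> ln2_le_25_over_36 by (simp add: ln_div)
qed

text \<open>Until y^2 first reaches s - ln s the integrand lies below a fixed integrable envelope;
  beyond the crossing point a, the relation (y a)^2 >= a / 2 makes the tail estimate
  uniform.\<close>

lemma J_bounded: "EX B<\<infinity>. ALL y. admissible y --> J y <= B" proof (intro exI conjI allI impI)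
 let ?B = "(\<integral>\<^sup>+s. envelope s \<partial>lborel) + ennreal (exp (1 + 2 * A) * 2)"
 show "?B < \<infinity>" using envelope_finite by simp
 fix y assume y: "admissible y"
 hence [measurable]: "integrand y : borel_measurable borel" using integrand_measurable unfolding admissible_def by blast
 show "J y <= ?B" proof (cases "EX s0>=1. (y s0)^2 > s0 - ln s0")
  case False
  hence "J y <= (\<integral>\<^sup>+s. envelope s \<partial>lborel)" unfolding J_def
   by (intro nn_integral_mono) (metis integrand_le_envelope[OF y] not_le_imp_less integrand_def indicator_simps(2) atLeast_iff mult_zero_right zero_le linorder_not_less)
  thus ?thesis by (simp add: add_increasing2)
 next
  case True
  then obtain a where a: "1 <= a" "(y a)^2 >= a - ln a" "!!s. 1 <= s ==> s < a ==> (y s)^2 < s - ln s"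
   using first_crossing[OF y] by blast
  have ya: "(y a)^2 >= a / 2" using a ln_le_half[of a] by linarith
  hence "y a ~= 0" using a by auto
  have "integrand y s <= envelope s + integrand y s * indicator {a..} s" for s proof (cases "0 <= s & s < a")
   case True
   thus ?thesis using integrand_le_envelope[OF y, of s] a(3)[of s] by (simp add: less_imp_le)
  qed (use a in "auto simp: integrand_def indicator_def")
  hence "J y <= (\<integral>\<^sup>+s. envelope s + integrand y s * indicator {a..} s \<partial>lborel)"
   unfolding J_def by (intro nn_integral_mono) auto
  also have "... = (\<integral>\<^sup>+s. envelope s \<partial>lborel) + (\<integral>\<^sup>+s. integrand y s * indicator {a..} s \<partial>lborel)"
   by (rule nn_integral_add) auto
  also have "... <= (\<integral>\<^sup>+s. envelope s \<partial>lborel) + ennreal (exp (1 + 2 * A) * (a / (y a)^2))"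
   using tail_bound[OF y _ \<open>y a ~= 0\<close>] a by (intro add_left_mono) auto
  also have "... <= ?B" proof (intro add_left_mono ennreal_leI mult_left_mono)
   show "a / (y a)^2 <= 2" using ya a by (simp add: divide_le_eq)
  qed simp
  finally show ?thesis .
 qed
qed

end

section \<open>Behaviour of J along pointwise convergent sequences\<close>

context weighted_moser begin

lemma integrand_tendsto: assumes "!!s. 0 <= s ==> (%n. Y n s) ----> y s" shows "(%n. integrand (Y n) s) ----> integrand y s"
proof (cases "0 <= s")
 case True
 thus ?thesis unfolding integrand_def by (auto intro!: tendsto_ennrealI tendsto_intros assms)
qed (simp add: integrand_def)

lemma J_tendsto_dominated: assumes Y: "!!n. admissible (Y n)" and y: "admissible y"
  and lim: "!!s. 0 <= s ==> (%n. Y n s) ----> y s" and kap: "0 < kap"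
  and dom: "\<forall>\<^sub>F n in sequentially. ALL s>=0. \<gamma> * (Y n s)^2 - 2 * s <= D - kap * s"
 shows "(%n. J (Y n)) ----> J y" proof -
 obtain N where N: "!!n s. n >= N ==> s >= 0 ==> \<gamma> * (Y n s)^2 - 2 * s <= D - kap * s"
  using dom unfolding eventually_sequentially by blast
 define w where "w s = ennreal (2 * exp (2 * A) * exp D) * (ennreal (exp (- kap * s)) * indicator {0..} s)" for s
 have [measurable]: "integrand (Y n) : borel_measurable borel" "integrand y : borel_measurable borel" for n
  using integrand_measurable Y y unfolding admissible_def by blast+
 have "(%n. J (Y (n + N))) ----> J y" unfolding J_def proof (rule nn_integral_dominated_convergence[where w = w])
  show "AE s in lborel. integrand (Y (n + N)) s <= w s" for n proof (rule AE_I2)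
   fix s :: real
   show "integrand (Y (n + N)) s <= w s" proof (cases "0 <= s")
    case True
    have "\<omega> s * exp (\<gamma> * h s * (Y (n + N) s)^2) <= 2 * exp (2 * A) * exp (\<gamma> * (Y (n + N) s)^2 - 2 * s)"
     by (rule integrand_le[OF True])
    also have "... <= 2 * exp (2 * A) * exp (D - kap * s)" using N[of "n + N" s] True by (intro mult_left_mono) auto
    also have "... = 2 * exp (2 * A) * exp D * exp (- kap * s)" by (simp add: exp_diff exp_minus field_simps)
    finally show ?thesis using True by (simp add: integrand_def w_def ennreal_leI flip: ennreal_mult)
   qed (simp add: integrand_def)
  qed
  show "(\<integral>\<^sup>+s. w s \<partial>lborel) < \<infinity>" unfolding w_def using exp_Ici_finite[OF kap]
   by (subst nn_integral_cmult) (auto simp: ennreal_mult_less_top)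
  show "AE s in lborel. (%n. integrand (Y (n + N)) s) ----> integrand y s"
   by (rule AE_I2) (rule LIMSEQ_ignore_initial_segment, rule integrand_tendsto[OF lim])
 qed (auto simp: w_def[abs_def])
 thus ?thesis by (rule LIMSEQ_offset)
qed

text \<open>Since y^2 <= s, a subcritical \<gamma> leaves the decay (2 - \<gamma>) s in the
  exponent, which dominates all integrands at once.\<close>

lemma J_tendsto_subcritical: assumes "!!n. admissible (Y n)" "admissible y" "!!s. 0 <= s ==> (%n. Y n s) ----> y s" "\<gamma> < 2"
 shows "(%n. J (Y n)) ----> J y" proof (rule J_tendsto_dominated[OF assms(1-3), of "2 - \<gamma>" 0])
 show "\<forall>\<^sub>F n in sequentially. ALL s>=0. \<gamma> * (Y n s)^2 - 2 * s <= 0 - (2 - \<gamma>) * s"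
 proof (intro always_eventually allI impI)
  fix n and s :: real assume "0 <= s"
  hence "\<gamma> * (Y n s)^2 <= \<gamma> * s" using admissible_square_le[OF assms(1)] \<gamma>(1) by (intro mult_left_mono) auto
  thus "\<gamma> * (Y n s)^2 - 2 * s <= 0 - (2 - \<gamma>) * s" by (simp add: algebra_simps)
 qed
qed (use assms in auto)

lemma two_term_square:
 fixes a b \<eta> :: real assumes "0 < \<eta>" shows "(a + b)^2 <= (1 + 1 / \<eta>) * a^2 + (1 + \<eta>) * b^2" proof -
 have "0 <= (a / sqrt \<eta> - sqrt \<eta> * b)^2" by simp
 also have "... = a^2 / \<eta> - 2 * a * b + \<eta> * b^2" using assms by (simp add: power2_diff power_divide power_mult_distrib)
 finally show ?thesis by (simp add: power2_sum algebra_simps)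
qed

text \<open>If the limit is not zero, a fixed fraction of the energy sits on a compact interval, and the
  rest is too small to concentrate.\<close>

lemma J_tendsto_nonzero: assumes Y: "!!n. admissible (Y n)" and y: "admissible y"
  and lim: "!!s. 0 <= s ==> (%n. Y n s) ----> y s" and T: "0 < T" "y T ~= 0" shows "(%n. J (Y n)) ----> J y" proof -
 \<comment> \<open>Half of the share (y T)^2 / T of the energy that the limit needs up to T; for
   large n the functions \<open>Y n\<close> spend at least this much there.\<close>
 define \<eta> where "\<eta> = (y T)^2 / (2 * T)"
 have \<eta>: "0 < \<eta>" "\<eta> <= 1 / 2" using T admissible_square_le[OF y, of T] by (auto simp: \<eta>_def field_simps)
 have "(%n. (Y n T)^2) ----> (y T)^2" using lim[of T] T by (intro tendsto_intros) auto
 moreover have "\<eta> * T < (y T)^2" using T by (simp add: \<eta>_def)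
 ultimately have ev: "\<forall>\<^sub>F n in sequentially. \<eta> * T < (Y n T)^2" by (rule order_tendstoD)
 show ?thesis proof (rule J_tendsto_dominated[OF Y y lim, of "2 * \<eta>^2" "2 * (1 + 1 / \<eta>) * T"])
  show "\<forall>\<^sub>F n in sequentially. ALL s>=0. \<gamma> * (Y n s)^2 - 2 * s <= 2 * (1 + 1 / \<eta>) * T - 2 * \<eta>^2 * s"
   using ev proof eventually_elim
   case (elim n)
   show ?case proof (intro allI impI)
    fix s :: real assume s: "0 <= s"
    have g2: "\<gamma> * (Y n s)^2 <= 2 * (Y n s)^2" using \<gamma> by (intro mult_right_mono) auto
    have "(Y n s)^2 <= (1 + 1 / \<eta>) * T + (1 - \<eta>^2) * s" proof (cases "s <= T")
     case True
     have "(Y n s)^2 <= s" using admissible_square_le[OF Y s] .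
     also have "... <= (1 + 1 / \<eta>) * T + (1 - \<eta>^2) * s" proof -
      have "\<eta>^2 * s <= 1 * T" using \<eta> True s by (intro mult_mono) (auto simp: power_le_one)
      moreover have "0 <= T / \<eta>" using T \<eta> by simp
      ultimately show ?thesis by (simp add: algebra_simps)
     qed
     finally show ?thesis .
    next
     case False
     have "energy_le T (Y n) (1 - (Y n T - Y n 0)^2 / T)" by (rule energy_le_tail) (use Y T in "auto simp: admissible_def")
     hence "energy_le T (Y n) (1 - \<eta>)"
      by (rule energy_le_mono) (use elim T Y[of n] in "auto simp: admissible_def field_simps")
     hence d: "(Y n s - Y n T)^2 <= (1 - \<eta>) * (s - T)" by (rule energy_le_two) (use False in auto)
     \<comment> \<open>The energy left beyond T is at most 1 - \<eta>, and the weight 1 + \<eta> is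
       chosen so that (1 + \<eta>) (1 - \<eta>) = 1 - \<eta>^2 still leaves a definite linear
       decay.\<close>
     have "(Y n s)^2 = (Y n T + (Y n s - Y n T))^2" by simp
     also have "... <= (1 + 1 / \<eta>) * (Y n T)^2 + (1 + \<eta>) * (Y n s - Y n T)^2" by (rule two_term_square[OF \<eta>(1)])
     also have "... <= (1 + 1 / \<eta>) * T + (1 + \<eta>) * ((1 - \<eta>) * s)" proof (intro add_mono mult_left_mono)
      show "(Y n T)^2 <= T" using admissible_square_le[OF Y, of T] T by simp
      show "(Y n s - Y n T)^2 <= (1 - \<eta>) * s" using d mult_left_mono[of "s - T" s "1 - \<eta>"] T \<eta> by linarith
     qed (use \<eta> in auto)
     finally show ?thesis by (simp add: algebra_simps power2_eq_square)
    qed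
    moreover have "(1 - \<eta>^2) * s = s - \<eta>^2 * s" by (simp add: algebra_simps)
    ultimately show "\<gamma> * (Y n s)^2 - 2 * s <= 2 * (1 + 1 / \<eta>) * T - 2 * \<eta>^2 * s"
     using g2 unfolding mult.assoc by linarith
   qed
  qed
 qed (use \<eta> in auto)
qed

lemma tendsto_if_const: assumes "(f \<longlongrightarrow> l) F" shows "((%n. if c n then f n else l) \<longlongrightarrow> l) F"
proof (rule topological_tendstoI)
 fix S assume S: "open S" "l : S"
 have "\<forall>\<^sub>F n in F. f n : S" using topological_tendstoD[OF assms S] .
 thus "\<forall>\<^sub>F n in F. (if c n then f n else l) : S" by eventually_elim (use S in auto)
qed

lemma J_zero: "J (%_. 0) = 1" using total by (simp add: J_def integrand_def)

text \<open>A vanishing sequence first crosses the barrier \<open>s - ln s\<close> further and further out; up to the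
  crossing it is dominated, and beyond it the tail estimate gives the limiting constant.\<close>

lemma J_concentration: assumes Y: "!!n. admissible (Y n)" and lim: "!!s. 0 <= s ==> (%n. Y n s) ----> 0"
  and M: "(%n. J (Y n)) ----> M" shows "M <= ennreal (1 + exp (1 + 2 * A))" proof -
 define P where "P n \<longleftrightarrow> (EX s0>=1. (Y n s0)^2 > s0 - ln s0)" for n
 have "ALL n. EX a. P n --> a >= 1 & (Y n a)^2 >= a - ln a & (ALL s. 1 <= s & s < a --> (Y n s)^2 < s - ln s)"
  using first_crossing[OF Y] unfolding P_def by blast
 then obtain a where a: "!!n. P n ==> a n >= 1" "!!n. P n ==> (Y n (a n))^2 >= a n - ln (a n)"
   "!!n s. P n ==> 1 <= s ==> s < a n ==> (Y n s)^2 < s - ln s" by metis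
 \<comment> \<open>Beyond the crossing point the integrand is replaced by that of the zero function,
   so that the integrals converge to the full mass 1; the tail cut off here is estimated
   separately.\<close>
 define g where "g n s = (if P n --> s < a n then integrand (Y n) s else integrand (%_. 0) s)" for n s
 have m0[measurable]: "integrand (%_. 0) : borel_measurable borel"
  using integrand_measurable[of "%_. 0" 1] admissible_zero by (simp add: admissible_def)
 have mY[measurable]: "integrand (Y n) : borel_measurable borel" for n
  using integrand_measurable Y unfolding admissible_def by blast
 have gm[measurable]: "g n : borel_measurable borel" for n unfolding g_def by (cases "P n") auto
 have below: "(Y n s)^2 <= s - ln s" if "P n --> s < a n" "1 <= s" for n s
  using a(3)[of n s] that unfolding P_def by (meson less_imp_le not_le_imp_less)
 have lnle: "ln s <= s" if "1 <= s" for s :: real using ln_le_half[OF that] that by linarith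
 have gle: "g n s <= envelope s" for n s proof (cases "0 <= s")
  case True
  thus ?thesis unfolding g_def using integrand_le_envelope[OF Y True, of n] below[of n s]
    integrand_le_envelope[OF admissible_zero True] lnle[of s] by auto
 qed (simp add: g_def integrand_def)
 have glim: "(%n. \<integral>\<^sup>+s. g n s \<partial>lborel) ----> (\<integral>\<^sup>+s. integrand (%_. 0) s \<partial>lborel)"
 proof (rule nn_integral_dominated_convergence[where w = envelope])
  show "AE s in lborel. (%n. g n s) ----> integrand (%_. 0) s"
   unfolding g_def by (intro AE_I2 tendsto_if_const integrand_tendsto lim)
 qed (use gle envelope_finite in auto)
 have Jle: "J (Y n) <= (\<integral>\<^sup>+s. g n s \<partial>lborel) + (if P n then ennreal (exp (1 + 2 * A) * (a n / (Y n (a n))^2)) else 0)" for n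
 proof (cases "P n")
  case False
  thus ?thesis by (simp add: J_def g_def)
 next
  case True
  have ya: "(Y n (a n))^2 >= a n / 2" using a(1,2)[OF True] ln_le_half[of "a n"] by linarith
  hence "Y n (a n) ~= 0" using a(1)[OF True] by auto
  have "J (Y n) <= (\<integral>\<^sup>+s. g n s + integrand (Y n) s * indicator {a n..} s \<partial>lborel)"
   unfolding J_def by (intro nn_integral_mono) (auto simp: g_def indicator_def)
  also have "... = (\<integral>\<^sup>+s. g n s \<partial>lborel) + (\<integral>\<^sup>+s. integrand (Y n) s * indicator {a n..} s \<partial>lborel)"
   by (rule nn_integral_add) auto
  also have "... <= (\<integral>\<^sup>+s. g n s \<partial>lborel) + ennreal (exp (1 + 2 * A) * (a n / (Y n (a n))^2))"
   using tail_bound[OF Y _ \<open>Y n (a n) ~= 0\<close>] a(1)[OF True] by (intro add_left_mono) auto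
  finally show ?thesis using True by simp
 qed
 \<comment> \<open>Crossing points escape to infinity: on a grid of mesh 1/4 the values are
   eventually below 1/4, and the Hoelder bound adds at most 1/2 between grid points, whereas a
   crossing requires a square of at least 1.\<close>
 have far: "\<forall>\<^sub>F n in sequentially. P n --> real N < a n" for N :: nat proof -
  have "\<forall>\<^sub>F n in sequentially. abs (Y n (real i / 4)) < 1 / 4" for i :: nat
   using order_tendstoD(2)[OF tendsto_rabs[OF lim[of "real i / 4"]], of "1 / 4"] by simp
  hence "\<forall>\<^sub>F n in sequentially. ALL i:{..4 * N}. abs (Y n (real i / 4)) < 1 / 4"
   by (simp add: eventually_ball_finite)
  thus ?thesis proof eventually_elim
   case (elim n)
   show ?case proof (rule impI, rule ccontr)
    assume n: "P n" and "\<not> real N < a n"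
    hence aN: "a n <= real N" by simp
    define i where "i = nat \<lfloor>4 * a n\<rfloor>"
    have a1: "1 <= a n" by (rule a(1)[OF n])
    have i: "real i <= 4 * a n" "4 * a n < real i + 1" unfolding i_def using a1 by (simp_all add: of_nat_nat)
    have "real i <= real (4 * N)" using i(1) aN by simp
    hence "i <= 4 * N" by (simp only: of_nat_le_iff)
    hence c1: "abs (Y n (real i / 4)) < 1 / 4" using elim by simp
    have "abs (Y n (a n) - Y n (real i / 4)) <= sqrt (abs (a n - real i / 4))"
     using admissible_diff_le[OF Y, of "real i / 4" "a n"] a1 by simp
    also have "... <= sqrt ((1 / 2)^2)" using i by (intro real_sqrt_le_mono) (auto simp: power2_eq_square)
    finally have "abs (Y n (a n) - Y n (real i / 4)) <= 1 / 2" by simp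
    hence "abs (Y n (a n)) < 1" using c1 by linarith
    hence "(Y n (a n))^2 < 1" by (simp add: abs_square_less_1)
    moreover have "1 <= a n - ln (a n)" using ln_le_minus_one[of "a n"] a1 by simp
    ultimately show False using a(2)[OF n] by simp
   qed
  qed
 qed
 \<comment> \<open>The tail bound carries the factor a / (y a)^2 <= a / (a - ln a), which tends to 1
   as the crossing point moves out.\<close>
 have leeps: "M <= ennreal (1 + exp (1 + 2 * A) * (1 + eps))" if "0 < eps" for eps proof -
  have "((%x::real. 1 / (1 - ln x / x)) \<longlongrightarrow> 1 / (1 - 0)) at_top"
   by (intro tendsto_intros ln_x_over_x_tendsto_0) auto
  hence "\<forall>\<^sub>F x::real in at_top. 1 / (1 - ln x / x) < 1 + eps" using that by (intro order_tendstoD) auto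
  then obtain X where X: "!!x. x >= X ==> 1 / (1 - ln x / x) < 1 + eps" unfolding eventually_at_top_linorder by blast
  obtain N where N: "X <= real N" using real_arch_simple by blast
  have "\<forall>\<^sub>F n in sequentially. J (Y n) <= (\<integral>\<^sup>+s. g n s \<partial>lborel) + ennreal (exp (1 + 2 * A) * (1 + eps))"
   using far[of N] proof eventually_elim
   case (elim n)
   have "(if P n then ennreal (exp (1 + 2 * A) * (a n / (Y n (a n))^2)) else 0) <= ennreal (exp (1 + 2 * A) * (1 + eps))"
   proof (cases "P n")
    case True
    have a1: "1 <= a n" by (rule a(1)[OF True])
    have pos: "a n - ln (a n) > 0" using ln_le_half[OF a1] a1 by linarith
    have ypos: "0 < (Y n (a n))^2" using a(2)[OF True] pos by linarith
    have "a n / (Y n (a n))^2 <= a n / (a n - ln (a n))"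
     using a(2)[OF True] a1 by (intro divide_left_mono mult_pos_pos ypos pos) auto
    also have "... = 1 / (1 - ln (a n) / a n)" using a1 by (simp add: field_simps)
    also have "... <= 1 + eps" using X[of "a n"] elim True N by simp
    finally have "exp (1 + 2 * A) * (a n / (Y n (a n))^2) <= exp (1 + 2 * A) * (1 + eps)" by (intro mult_left_mono) auto
    thus ?thesis using True by (simp only: if_True ennreal_leI)
   qed simp
   thus ?case using Jle[of n] by (meson add_left_mono order_trans)
  qed
  moreover have "(%n. (\<integral>\<^sup>+s. g n s \<partial>lborel) + ennreal (exp (1 + 2 * A) * (1 + eps)))
    ----> 1 + ennreal (exp (1 + 2 * A) * (1 + eps))" using glim J_zero unfolding J_def by (intro tendsto_intros) auto
  ultimately have "M <= 1 + ennreal (exp (1 + 2 * A) * (1 + eps))" using M by (intro tendsto_le[OF sequentially_bot]) auto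
  also have "... = ennreal (1 + exp (1 + 2 * A) * (1 + eps))" using that by (simp add: ennreal_plus)
  finally show ?thesis .
 qed
 have "(%n. 1 + exp (1 + 2 * A) * (1 + inverse (real (Suc n)))) ----> 1 + exp (1 + 2 * A) * (1 + 0)"
  by (intro tendsto_intros LIMSEQ_inverse_real_of_nat)
 hence "(%n. ennreal (1 + exp (1 + 2 * A) * (1 + inverse (real (Suc n))))) ----> ennreal (1 + exp (1 + 2 * A) * (1 + 0))"
  by (rule tendsto_ennrealI)
 hence "M <= ennreal (1 + exp (1 + 2 * A) * (1 + 0))" by (rule LIMSEQ_le_const) (use leeps in auto)
 thus ?thesis by simp
qed

text \<open>Direct method: J converges along a maximizing subsequence to its value at the limit.
  Only \<gamma> = 2 with limit zero must be excluded, and there the supremum could not exceed the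
  concentration level.\<close>

lemma maximizer_exists: assumes strict: "\<gamma> = 2 ==> EX y. admissible y & J y > ennreal (1 + exp (1 + 2 * A))"
 shows "EX y. admissible y & J y = (SUP y\<in>{y. admissible y}. J y) & J y < \<infinity>" proof -
 let ?M = "SUP y\<in>{y. admissible y}. J y"
 obtain B where B: "B < \<infinity>" "!!y. admissible y ==> J y <= B" using J_bounded by blast
 have Jle: "J y <= ?M" if "admissible y" for y using that by (intro SUP_upper) auto
 have "J ` {y. admissible y} ~= {}" using admissible_zero by auto
 from ennreal_Sup_countable_SUP[OF this] obtain f where f: "incseq f" "range f \<subseteq> J ` {y. admissible y}"
  "?M = (SUP i. f i)" by blast
 have "ALL i. EX y. admissible y & f i = J y" using f(2) by blast
 then obtain Y0 where Y0: "!!i. admissible (Y0 i)" "!!i. f i = J (Y0 i)" by metis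
 have lim0: "(%i. J (Y0 i)) ----> ?M" using LIMSEQ_SUP[OF f(1)] unfolding f(3)[symmetric] by (simp add: Y0(2)[abs_def, symmetric] flip: Y0(2))
 obtain r y where r: "strict_mono r" and y: "admissible y" and lim: "!!s. 0 <= s ==> (%k. Y0 (r k) s) ----> y s"
  using admissible_compact[of Y0] Y0(1) by blast
 have limr: "(%i. J (Y0 (r i))) ----> ?M" using LIMSEQ_subseq_LIMSEQ[OF lim0 r] by (simp add: comp_def)
 have "(%i. J (Y0 (r i))) ----> J y" proof (cases "\<gamma> < 2")
  case True
  thus ?thesis by (intro J_tendsto_subcritical Y0 y lim)
 next
  case False
  hence g2: "\<gamma> = 2" using \<gamma> by simp
  have "EX T>0. y T ~= 0" proof (rule ccontr)
   assume "\<not> ?thesis"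
   hence "y s = 0" if "0 <= s" for s using y that by (cases "s = 0") (auto simp: admissible_def)
   hence "(%k. Y0 (r k) s) ----> 0" if "0 <= s" for s using lim[OF that] that by simp
   from J_concentration[OF Y0(1) this limr] have "?M <= ennreal (1 + exp (1 + 2 * A))" by simp
   moreover obtain y1 where "admissible y1" "J y1 > ennreal (1 + exp (1 + 2 * A))" using strict[OF g2] by blast
   ultimately show False using Jle[of y1] by simp
  qed
  thus ?thesis using J_tendsto_nonzero[OF Y0(1) y lim] by blast
 qed
 hence "J y = ?M" using limr LIMSEQ_unique by blast
 moreover have "J y < \<infinity>" using B y by (meson le_less_trans)
 ultimately show ?thesis using y by blast
qed

end

subsection \<open>Moser functions above the concentration level\<close>

text \<open>The mixed term of (y t - y s)^2 across the joint is absorbed by the arithmetic-geometric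
  mean inequality; the second witness is shifted so that the two match at a.\<close>

lemma energy_witness_glue: assumes 1: "energy_witness {0..a} y e1" and 2: "energy_witness {a..} y e2" and a: "0 <= a"
 shows "energy_witness {0..} y (%s. if s <= a then e1 s else e1 a + (e2 s - e2 a))" proof -
 let ?e = "%s. if s <= a then e1 s else e1 a + (e2 s - e2 a)"
 have m1: "e1 s <= e1 t" if "0 <= s" "s <= t" "t <= a" for s t using 1 that unfolding energy_witness_def by (auto intro: mono_onD)
 have m2: "e2 s <= e2 t" if "a <= s" "s <= t" for s t using 2 that unfolding energy_witness_def by (auto intro: mono_onD)
 have d1: "(y t - y s)^2 <= (t - s) * (e1 t - e1 s)" if "0 <= s" "s <= t" "t <= a" for s t
  using 1 that unfolding energy_witness_def by auto
 have d2: "(y t - y s)^2 <= (t - s) * (e2 t - e2 s)" if "a <= s" "s <= t" for s t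
  using 2 that unfolding energy_witness_def by auto
 show ?thesis unfolding energy_witness_def proof (intro conjI ballI impI mono_onI)
  fix s t :: real assume st: "s : {0..}" "t : {0..}" "s <= t"
  show "?e s <= ?e t" using st m1[of s t] m1[of s a] m2[of a t] m2[of s t] by auto
  show "(y t - y s)^2 <= (t - s) * (?e t - ?e s)" proof (cases "s <= a & a < t")
   case True
   define u v p q where "u = a - s" "v = t - a" "p = e1 a - e1 s" "q = e2 t - e2 a"
   have nn: "0 <= u" "0 < v" "0 <= p" "0 <= q" using True st m1[of s a] m2[of a t] by (auto simp: u_v_p_q_def)
   have X: "(y a - y s)^2 <= u * p" using d1[of s a] True st by (simp add: u_v_p_q_def)
   have Y: "(y t - y a)^2 <= v * q" using d2[of a t] True by (simp add: u_v_p_q_def)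
   have "abs (y a - y s) * abs (y t - y a) <= sqrt (u * p) * sqrt (v * q)" using X Y nn by (intro mult_mono real_le_rsqrt) auto
   also have "... = sqrt ((u * q) * (v * p))" by (simp add: real_sqrt_mult[symmetric] ac_simps)
   also have "... <= (u * q + v * p) / 2" using nn by (intro arith_geo_mean_sqrt) auto
   finally have "2 * ((y a - y s) * (y t - y a)) <= u * q + v * p"
    using abs_ge_self[of "(y a - y s) * (y t - y a)"] by (simp add: abs_mult)
   moreover have "(y t - y s)^2 = (y a - y s)^2 + (y t - y a)^2 + 2 * ((y a - y s) * (y t - y a))"
    by (simp add: power2_eq_square algebra_simps)
   ultimately have "(y t - y s)^2 <= u * p + v * q + (u * q + v * p)" using X Y by linarith
   also have "... = (u + v) * (p + q)" by (simp add: algebra_simps)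
   also have "... = (t - s) * (?e t - ?e s)" using True by (simp add: u_v_p_q_def)
   finally show ?thesis .
  next
   case False
   thus ?thesis using d1[of s t] d2[of s t] st by (auto simp: not_le)
  qed
 qed
qed

text \<open>The concentrating family of Moser functions, corrected by the bubble
  \<open>- ln (1 + C exp (- 2 (s - a))) / 2\<close> in the place of the constant cap. The parameters are chosen
  so that the energy is exactly 1.\<close>

locale bubble =
 fixes c :: real assumes c: "2 <= c"
begin

text \<open>\<open>C\<close> gives g a = c^4; \<open>a\<close> solves the equation stating that a /
  c^2 and the energy of the cap add up to 1; \<open>b\<close> is forced by continuity at a. The
  power c^4 keeps the loss in the cap at order c^(-4), below the gain of order c^(-2) obtained
  later.\<close>

definition "L = 4 * ln c"
definition "C = c ^ 4 - 1"
definition "a = c^2 - (L - 1 + 1 / c ^ 4) / 2"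
definition "b = (1 - 1 / c ^ 4) / 2"
definition "g s = 1 + C * exp (- 2 * (s - a))"
definition "cap s = c + (b - ln (g s) / 2) / c"
definition "bub s = (if s <= a then s / c else cap s)"

lemma C_pos: "0 < C" using c one_less_power[of c 4] by (simp add: C_def)

lemma g_gt: "1 < g s" using C_pos by (simp add: g_def)

lemma g_nz: "g s ~= 0" using g_gt[of s] by simp

lemma g_a: "g a = c ^ 4" by (simp add: g_def C_def)

lemma ln_g_a: "ln (g a) = L" using c by (simp add: g_a L_def ln_realpow)

lemma a_ge: "c^2 / 2 <= a" proof -
 have "ln (c / 2) <= c / 2 - 1" using c by (intro ln_le_minus_one) auto
 hence "ln c <= c / 2 - 1 + ln 2" using c by (simp add: ln_div)
 hence "L <= 2 * c" using ln2_le_25_over_36 by (simp add: L_def)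
 moreover have "1 / c ^ 4 <= 1" using c one_le_power[of c 4] by simp
 moreover have "2 * c <= c * c" using c by (intro mult_right_mono) auto
 ultimately show ?thesis unfolding a_def power2_eq_square by argo
qed

lemma a_ge1: "1 <= a" proof -
 have "2 * 2 <= c * c" using c by (intro mult_mono) auto
 thus ?thesis using a_ge by (simp add: power2_eq_square)
qed

lemma cap_a: "cap a = a / c" proof -
 have "cap a = c + (b - L / 2) / c" by (simp only: cap_def ln_g_a)
 also have "... = a / c" using c by (simp add: a_def b_def field_simps power2_eq_square)
 finally show ?thesis .
qed

lemma bub_ge: "a <= s ==> bub s = cap s" using cap_a by (auto simp: bub_def)

lemma bub_le: "s <= a ==> bub s = s / c" by (simp add: bub_def)

lemma g_deriv: "DERIV g s :> - 2 * (g s - 1)" unfolding g_def by (auto intro!: derivative_eq_intros)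

lemma cap_deriv: "DERIV cap s :> (g s - 1) / (c * g s)" unfolding cap_def using g_gt[of s] c
 by (auto intro!: derivative_eq_intros g_deriv) (auto simp: field_simps)

lemma cap_energy: "energy_le a cap ((L + 1 / c ^ 4 - 1) / (2 * c^2))"
proof (rule energy_le_C1[where y' = "%s. (g s - 1) / (c * g s)"])
 show "(cap has_real_derivative (g s - 1) / (c * g s)) (at s within {a..})" for s by (rule DERIV_subset[OF cap_deriv]) simp
 have gc: "continuous_on S g" for S unfolding g_def by (intro continuous_intros)
 show "continuous_on {a..} (%s. (g s - 1) / (c * g s))" using c g_nz by (intro continuous_intros gc) auto
 \<comment> \<open>An antiderivative of the squared slope of the cap; since ln g + 1 / g >= 1, it
   never exceeds - 1 / (2 c^2).\<close>
 define H where "H s = - (ln (g s) + 1 / g s) / (2 * c^2)" for s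
 have dH: "DERIV H s :> ((g s - 1) / (c * g s))^2" for s unfolding H_def using g_gt[of s] c
  by (auto intro!: derivative_eq_intros g_deriv) (auto simp: field_simps power2_eq_square power4_eq_xxxx)
 show "integral {a..t} (%s. ((g s - 1) / (c * g s))^2) <= (L + 1 / c ^ 4 - 1) / (2 * c^2)" if "a <= t" for t proof -
  have "((%s. ((g s - 1) / (c * g s))^2) has_integral (H t - H a)) {a..t}" by (rule fundamental_theorem_of_calculus[OF that])
    (unfold has_real_derivative_iff_has_vector_derivative[symmetric], rule DERIV_subset[OF dH], simp)
  hence "integral {a..t} (%s. ((g s - 1) / (c * g s))^2) = H t - H a" by (rule integral_unique)
  also have "... <= (L + 1 / c ^ 4 - 1) / (2 * c^2)" proof -
   have "ln (1 / g t) <= 1 / g t - 1" using g_gt[of t] by (intro ln_le_minus_one) auto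
   hence "1 <= ln (g t) + 1 / g t" using g_gt[of t] by (simp add: ln_div)
   hence "H t <= - 1 / (2 * c^2)" unfolding H_def using c by (intro divide_right_mono) auto
   moreover have "H a = - (L + 1 / c ^ 4) / (2 * c^2)" by (simp only: H_def ln_g_a) (simp only: g_a)
   ultimately show ?thesis by (simp add: diff_divide_distrib add_divide_distrib)
  qed
  finally show ?thesis .
 qed
qed

lemma admissible_bub: "admissible bub" proof -
 obtain e where e: "energy_witness {a..} cap e" "!!t. a <= t ==> 0 <= e t"
   "!!t. a <= t ==> e t <= (L + 1 / c ^ 4 - 1) / (2 * c^2)" using energy_le_imp_witness[OF cap_energy] by blast
 have w1: "energy_witness {0..a} bub (%s. s / c^2)" using c unfolding energy_witness_def
  by (auto simp: bub_le divide_right_mono power2_eq_square field_simps intro!: mono_onI)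
 have w2: "energy_witness {a..} bub e" using e(1) unfolding energy_witness_def by (simp add: bub_ge)
 have "energy_le 0 bub 1" proof (rule witness_imp_energy_le[OF energy_witness_glue[OF w1 w2]])
  fix t :: real assume "0 <= t"
  have ca: "a / c^2 + (L + 1 / c ^ 4 - 1) / (2 * c^2) = 1" using c by (simp add: a_def field_simps)
  have "0 <= (L + 1 / c ^ 4 - 1) / (2 * c^2)" using e(2,3)[of a] by linarith
  moreover have "t / c^2 <= a / c^2" if "t <= a" using that by (simp add: divide_right_mono)
  ultimately show "(if t <= a then t / c^2 else a / c^2 + (e t - e a)) - (if 0 <= a then 0 / c^2 else a / c^2 + (e 0 - e a)) <= 1"
   using ca e(2)[of a] e(3)[of t] a_ge1 by auto
 qed (use a_ge1 in auto)
 thus ?thesis using a_ge1 by (simp add: admissible_def bub_def)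
qed

text \<open>When the square is expanded around c, only the term (w / c)^2 >= 0 with w = b - ln (g s)
  / 2 is dropped; what remains can be integrated explicitly.\<close>

lemma bub_square_ge: assumes "a <= s"
 shows "exp (2 * (bub s)^2 - 2 * s) >= exp (2 * c^2 + 4 * b - 2 * a) * (exp (- 2 * (s - a)) / (g s)^2)" proof -
 define w where "w = b - ln (g s) / 2"
 have "(bub s)^2 = c^2 + 2 * w + (w / c)^2" using c by (simp add: bub_ge[OF assms] cap_def w_def[symmetric] power2_sum)
 hence "c^2 + 2 * (b - ln (g s) / 2) <= (bub s)^2" by (simp add: w_def)
 hence "2 * (bub s)^2 - 2 * s >= (2 * c^2 + 4 * b - 2 * a) + (- 2 * (s - a) - 2 * ln (g s))" by argo
 hence "exp (2 * (bub s)^2 - 2 * s) >= exp ((2 * c^2 + 4 * b - 2 * a) + (- 2 * (s - a) - 2 * ln (g s)))" by simp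
 also have "exp ((2 * c^2 + 4 * b - 2 * a) + (- 2 * (s - a) - 2 * ln (g s)))
   = exp (2 * c^2 + 4 * b - 2 * a) * (exp (- 2 * (s - a)) / exp (2 * ln (g s)))" by (simp only: exp_add exp_diff)
 also have "exp (2 * ln (g s)) = (g s)^2" using g_gt[of s] exp_of_nat_mult[of 2 "ln (g s)"] by simp
 finally show ?thesis .
qed

lemma exponent: "2 * c^2 + 4 * b - 2 * a = 1 - 1 / c ^ 4 + L" by (simp add: a_def b_def field_simps)

text \<open>The integrand is the derivative of 1 / (2 C g). Multiplied by exp (2 c^2 + 4 b - 2 a) =
  c^4 exp (1 - 1 / c^4), this mass tends to e / 2, which the factor 2 exp (2A) of the weight turns
  into exp (1 + 2A).\<close>

lemma bubble_mass:
 "(\<integral>\<^sup>+s. ennreal (exp (- 2 * (s - a)) / (g s)^2) * indicator {a..} s \<partial>lborel) = ennreal (1 / (2 * c ^ 4))"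
proof -
 have "(\<integral>\<^sup>+s. ennreal (exp (- 2 * (s - a)) / (g s)^2) * indicator {a..} s \<partial>lborel)
  = ennreal (1 / (2 * C) - 1 / (2 * C) * (1 / g a))" proof (rule nn_integral_FTC_atLeast)
  show "(%s. exp (- 2 * (s - a)) / (g s)^2) : borel_measurable borel" unfolding g_def by measurable
  show "DERIV (%s. 1 / (2 * C) * (1 / g s)) s :> exp (- 2 * (s - a)) / (g s)^2" for s proof -
   have "DERIV (%s. 1 / (2 * C) * (1 / g s)) s :> 1 / (2 * C) * (2 * (g s - 1) / (g s)^2)"
    using C_pos by (auto intro!: derivative_eq_intros g_deriv simp: g_nz power2_eq_square) (simp add: field_simps g_nz)
   moreover have "1 / (2 * C) * (2 * (g s - 1) / (g s)^2) = exp (- 2 * (s - a)) / (g s)^2" using C_pos by (simp add: g_def)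
   ultimately show ?thesis by simp
  qed
  have "((%s. 1 / (2 * C) * (1 / (1 + C * exp (- 2 * (s - a))))) \<longlongrightarrow> 1 / (2 * C) * (1 / (1 + C * 0))) at_top"
   by (intro tendsto_intros) (real_asymp, simp)
  thus "((%s. 1 / (2 * C) * (1 / g s)) \<longlongrightarrow> 1 / (2 * C)) at_top" by (simp add: g_def)
 qed (use g_gt in auto)
 also have "1 / (2 * C) - 1 / (2 * C) * (1 / g a) = 1 / (2 * c ^ 4)"
  using C_pos c unfolding g_a by (simp add: field_simps) (simp add: C_def algebra_simps flip: power_add)
 finally show ?thesis .
qed

end

text \<open>Lower bounds matching the upper bounds on \<omega> and h near the centre; the relative
  error K exp (- 2 s) is of the order of |x|^2.\<close>

locale weighted_moser_asymptotics = weighted_moser +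
 fixes K s0 :: real assumes K: "0 <= K"
  and lower_\<omega>: "!!s. s0 <= s ==> 2 * exp (2 * A - 2 * s) * (1 - K * exp (- 2 * s)) <= \<omega> s"
  and lower_h: "!!s. s0 <= s ==> 1 - K * exp (- 2 * s) <= h s"
  and \<omega>_pos: "!!s. 0 < s ==> 0 < \<omega> s" and h_pos: "!!s. 0 < s ==> 0 < h s" and \<gamma>_eq: "\<gamma> = 2"
begin

text \<open>The coefficient of the gain: on [0, 1) a Moser function equals s / c, and the linear
  term of the exponential contributes 2 / c^2 times this integral.\<close>

lemma gain_positive:
 obtains g0 where "0 < g0"
  "(\<integral>\<^sup>+s. ennreal (\<omega> s * (h s * s^2)) * indicator {0..<1} s \<partial>lborel) = ennreal g0" proof -
 let ?G = "\<integral>\<^sup>+s. ennreal (\<omega> s * (h s * s^2)) * indicator {0..<1} s \<partial>lborel"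
 have "?G <= (\<integral>\<^sup>+s. ennreal (\<omega> s) * indicator {0..} s \<partial>lborel)" proof (rule nn_integral_mono)
  fix s :: real
  have "\<omega> s * (h s * s^2) <= \<omega> s * (1 * 1)" if "0 <= s" "s < 1"
   using that h_le[of s] h_nonneg[of s] \<omega>_nonneg[of s] by (intro mult_left_mono mult_mono) (auto simp: power_le_one)
  thus "ennreal (\<omega> s * (h s * s^2)) * indicator {0..<1} s <= ennreal (\<omega> s) * indicator {0..} s"
   by (auto simp: indicator_def intro!: ennreal_leI)
 qed
 hence fin: "?G ~= top" using total by (auto simp: top_unique)
 have "?G ~= 0" proof
  assume "?G = 0"
  hence "AE s in lborel. ennreal (\<omega> s * (h s * s^2)) * indicator {0..<1} s = 0" by (subst (asm) nn_integral_0_iff_AE) auto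
  hence "AE s in lborel. s \<notin> {0<..<1::real}"
   by eventually_elim (use \<omega>_pos h_pos in "auto simp: indicator_def ennreal_eq_0_iff not_le split: if_splits dest!: leD")
  hence "emeasure lborel {0<..<1::real} = 0" by (subst (asm) AE_iff_measurable[of "{0<..<1}"]) auto
  thus False by simp
 qed
 thus thesis using that[of "enn2real ?G"] fin by (auto simp: enn2real_positive_iff less_top zero_less_iff_neq_zero)
qed

text \<open>Passing from the true weights to the model costs a factor 1 - k from \<omega> and exp (-
  2 k s) from h, where k = K exp (- 2 s). Since x^2 <= s and k s <= K exp (- s), the total relative
  loss is at most 3 K exp (- s).\<close>

lemma tail_factor: assumes "1 <= s" "s0 <= s" "x^2 <= s"
 shows "2 * exp (2 * A) * ((1 - 3 * K * exp (- s)) * exp (2 * x^2 - 2 * s)) <= \<omega> s * exp (\<gamma> * h s * x^2)" proof -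
 define k where "k = K * exp (- 2 * s)"
 have k: "0 <= k" using K by (simp add: k_def)
 have ses: "s * exp (- 2 * s) <= exp (- s)" proof -
  have "s <= exp s" using exp_ge_add_one_self[of s] by linarith
  hence "s * exp (- 2 * s) <= exp s * exp (- 2 * s)" by (intro mult_right_mono) auto
  thus ?thesis by (simp add: mult_exp_exp)
 qed
 hence ks: "k * s <= K * exp (- s)" using mult_left_mono[OF ses K] by (simp add: k_def algebra_simps)
 have kk: "k <= k * s" using mult_left_mono[OF assms(1) k] by simp
 show ?thesis proof (cases "1 - 3 * K * exp (- s) <= 0")
  case True
  hence "2 * exp (2 * A) * ((1 - 3 * K * exp (- s)) * exp (2 * x^2 - 2 * s)) <= 0"
   by (intro mult_nonneg_nonpos mult_nonpos_nonneg) auto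
  also have "0 <= \<omega> s * exp (\<gamma> * h s * x^2)" using \<omega>_nonneg assms(1) by simp
  finally show ?thesis .
 next
  case False
  hence k1: "2 * (k * s) <= 1" "k <= 1" using ks kk k assms(1) by linarith+
  have "1 - 3 * K * exp (- s) <= (1 - k) * (1 - 2 * (k * s))" proof -
   have "(1 - k) * (1 - 2 * (k * s)) = 1 - k - 2 * (k * s) + 2 * k * (k * s)" by (simp add: algebra_simps)
   moreover have "0 <= 2 * k * (k * s)" using k assms(1) by simp
   ultimately show ?thesis using ks kk by linarith
  qed
  also have "... <= (1 - k) * exp (- 2 * (k * s))" using k1 exp_ge_add_one_self[of "- 2 * (k * s)"] by (intro mult_left_mono) auto
  finally have f: "1 - 3 * K * exp (- s) <= (1 - k) * exp (- 2 * (k * s))" .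
  have hx: "2 * x^2 - 2 * (k * s) <= 2 * h s * x^2" proof -
   have "(1 - h s) * x^2 <= k * s" using lower_h[OF assms(2)] h_le[of s] assms k by (intro mult_mono) (auto simp: k_def)
   thus ?thesis by (simp add: algebra_simps)
  qed
  have "2 * exp (2 * A) * ((1 - 3 * K * exp (- s)) * exp (2 * x^2 - 2 * s))
   <= 2 * exp (2 * A) * (((1 - k) * exp (- 2 * (k * s))) * exp (2 * x^2 - 2 * s))"
   using f by (intro mult_left_mono mult_right_mono) auto
  also have "... = 2 * exp (2 * A - 2 * s) * (1 - k) * exp (2 * x^2 - 2 * (k * s))" by (simp add: exp_diff exp_minus field_simps)
  also have "... <= \<omega> s * exp (2 * h s * x^2)"
   using lower_\<omega>[OF assms(2)] hx \<omega>_nonneg[of s] assms(1) by (intro mult_mono) (auto simp: k_def)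
  finally show ?thesis by (simp add: \<gamma>_eq)
 qed
qed

text \<open>Three contributions: the mass 1, of which at most exp (2A - 2a) lies beyond a and is
  compensated on the right; the gain on [0, 1); and the cap, evaluated by the explicit bubble
  integral.\<close>

lemma J_bubble_lower: assumes c: "2 <= c" and s0: "s0 <= bubble.a c" and g0: "0 < g0"
  "(\<integral>\<^sup>+s. ennreal (\<omega> s * (h s * s^2)) * indicator {0..<1} s \<partial>lborel) = ennreal g0"
  and f: "0 <= 1 - 3 * K * exp (- bubble.a c)"
 shows "ennreal (1 + 2 * g0 / c^2 + (1 - 3 * K * exp (- bubble.a c)) * exp (2 * A + 1 - 1 / c ^ 4))
   <= J (bubble.bub c) + ennreal (exp (2 * A - 2 * bubble.a c))" proof -
 interpret bubble c by unfold_locales (rule c)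
 let ?I = "integrand bub"
 have bE: "energy_le 0 bub 1" using admissible_bub by (simp add: admissible_def)
 note [measurable] = integrand_measurable[OF bE]
 define F where "F = 1 - 3 * K * exp (- a)"
 have "ennreal (F * exp (2 * A + 1 - 1 / c ^ 4))
  = ennreal (2 * exp (2 * A) * F * exp (2 * c^2 + 4 * b - 2 * a)) * ennreal (1 / (2 * c ^ 4))" proof -
  have "exp (1 - 1 / c ^ 4 + L) = exp (1 - 1 / c ^ 4) * c ^ 4"
   using c by (simp add: exp_add L_def exp_of_nat_mult[of 4, simplified])
  hence "2 * exp (2 * A) * F * exp (2 * c^2 + 4 * b - 2 * a) * (1 / (2 * c ^ 4)) = F * (exp (2 * A) * exp (1 - 1 / c ^ 4))"
   unfolding exponent using c by simp
  also have "exp (2 * A) * exp (1 - 1 / c ^ 4) = exp (2 * A + 1 - 1 / c ^ 4)" by (simp flip: exp_add)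
  finally show ?thesis using f c by (subst ennreal_mult[symmetric]) (auto simp: F_def)
 qed
 also have "... = (\<integral>\<^sup>+s. ennreal (2 * exp (2 * A) * F * exp (2 * c^2 + 4 * b - 2 * a)) *
   (ennreal (exp (- 2 * (s - a)) / (g s)^2) * indicator {a..} s) \<partial>lborel)" unfolding bubble_mass[symmetric]
  by (rule nn_integral_cmult[symmetric]) (unfold g_def, measurable)
 also have "... <= (\<integral>\<^sup>+s. ?I s * indicator {a..} s \<partial>lborel)" proof (rule nn_integral_mono)
  fix s
  have "2 * exp (2 * A) * F * exp (2 * c^2 + 4 * b - 2 * a) * (exp (- 2 * (s - a)) / (g s)^2)
   <= \<omega> s * exp (\<gamma> * h s * (bub s)^2)" if s: "a <= s" proof -
   have "2 * exp (2 * A) * F * exp (2 * c^2 + 4 * b - 2 * a) * (exp (- 2 * (s - a)) / (g s)^2)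
    = 2 * exp (2 * A) * (F * (exp (2 * c^2 + 4 * b - 2 * a) * (exp (- 2 * (s - a)) / (g s)^2)))" by simp
   also have "... <= 2 * exp (2 * A) * (F * exp (2 * (bub s)^2 - 2 * s))"
    using bub_square_ge[OF s] f by (intro mult_left_mono) (auto simp: F_def)
   also have "... <= 2 * exp (2 * A) * ((1 - 3 * K * exp (- s)) * exp (2 * (bub s)^2 - 2 * s))"
    using K s by (intro mult_left_mono mult_right_mono) (auto simp: F_def intro: mult_left_mono)
   also have "... <= \<omega> s * exp (\<gamma> * h s * (bub s)^2)"
    using a_ge1 s s0 admissible_square_le[OF admissible_bub, of s] by (intro tail_factor) auto
   finally show ?thesis .
  qed
  thus "ennreal (2 * exp (2 * A) * F * exp (2 * c^2 + 4 * b - 2 * a)) *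
   (ennreal (exp (- 2 * (s - a)) / (g s)^2) * indicator {a..} s) <= ?I s * indicator {a..} s"
   using f a_ge1 by (auto simp: integrand_def indicator_def F_def simp flip: ennreal_mult intro!: ennreal_leI)
 qed
 finally have tail: "ennreal (F * exp (2 * A + 1 - 1 / c ^ 4)) <= (\<integral>\<^sup>+s. ?I s * indicator {a..} s \<partial>lborel)" .
 have far: "(\<integral>\<^sup>+s. ennreal (\<omega> s) * indicator {a..} s \<partial>lborel) <= ennreal (exp (2 * A - 2 * a))"
 proof -
  have "(\<integral>\<^sup>+s. ennreal (\<omega> s) * indicator {a..} s \<partial>lborel)
    <= (\<integral>\<^sup>+s. ennreal (2 * exp (2 * A - 2 * s)) * indicator {a..} s \<partial>lborel)"
   using a_ge1 \<omega>_le by (intro nn_integral_mono) (auto simp: indicator_def intro!: ennreal_leI)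
  also have "... = ennreal (0 - (- exp (2 * A - 2 * a)))" proof (rule nn_integral_FTC_atLeast)
   show "((%s. - exp (2 * A - 2 * s)) \<longlongrightarrow> 0) at_top" by real_asymp
  qed (auto intro!: derivative_eq_intros)
  finally show ?thesis by simp
 qed
 have gain: "(\<integral>\<^sup>+s. ennreal (\<omega> s) * indicator {0..<a} s \<partial>lborel) + ennreal (2 * g0 / c^2)
  <= (\<integral>\<^sup>+s. ?I s * indicator {0..<a} s \<partial>lborel)" proof -
  have "ennreal (2 * g0 / c^2) = ennreal (2 / c^2) * ennreal g0" using g0 c by (subst ennreal_mult[symmetric]) auto
  also have "... = (\<integral>\<^sup>+s. ennreal (2 / c^2) * (ennreal (\<omega> s * (h s * s^2)) * indicator {0..<1} s) \<partial>lborel)"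
   unfolding g0(2)[symmetric] by (rule nn_integral_cmult[symmetric]) measurable
  finally have "(\<integral>\<^sup>+s. ennreal (\<omega> s) * indicator {0..<a} s \<partial>lborel) + ennreal (2 * g0 / c^2)
   = (\<integral>\<^sup>+s. ennreal (\<omega> s) * indicator {0..<a} s + ennreal (2 / c^2) * (ennreal (\<omega> s * (h s * s^2)) * indicator {0..<1} s) \<partial>lborel)"
   by (simp only:) (rule nn_integral_add[symmetric]; measurable)
  also have "... <= (\<integral>\<^sup>+s. ?I s * indicator {0..<a} s \<partial>lborel)" proof (rule nn_integral_mono)
   fix s
   have "\<omega> s + 2 / c^2 * (\<omega> s * (h s * s^2)) <= \<omega> s * exp (\<gamma> * h s * (bub s)^2)" if s: "0 <= s" "s < a"
   proof -
    have "\<omega> s + 2 / c^2 * (\<omega> s * (h s * s^2)) = \<omega> s * (1 + 2 * h s * (bub s)^2)"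
     using s by (simp add: bub_le power_divide algebra_simps)
    also have "... <= \<omega> s * exp (\<gamma> * h s * (bub s)^2)"
     using \<omega>_nonneg[OF s(1)] exp_ge_add_one_self[of "\<gamma> * h s * (bub s)^2"]
     by (intro mult_left_mono) (auto simp: \<gamma>_eq)
    finally show ?thesis .
   qed
   moreover have "\<omega> s <= \<omega> s * exp (\<gamma> * h s * (bub s)^2)" if "0 <= s"
    using \<omega>_nonneg[OF that] h_nonneg[OF that] \<gamma>_eq by (simp add: mult_le_cancel_left1)
   ultimately show "ennreal (\<omega> s) * indicator {0..<a} s + ennreal (2 / c^2) * (ennreal (\<omega> s * (h s * s^2)) * indicator {0..<1} s)
    <= ?I s * indicator {0..<a} s" using a_ge1 \<omega>_nonneg[of s] h_nonneg[of s]
    by (auto simp: integrand_def indicator_def simp flip: ennreal_mult ennreal_plus intro!: ennreal_leI)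
  qed
  finally show ?thesis .
 qed
 have split: "(\<integral>\<^sup>+s. u s * indicator {0..<a} s \<partial>lborel) + (\<integral>\<^sup>+s. u s * indicator {a..} s \<partial>lborel)
   = (\<integral>\<^sup>+s. u s * indicator {0..} s \<partial>lborel)" if [measurable]: "u : borel_measurable borel" for u :: "real => ennreal"
  using a_ge1 by (subst nn_integral_add[symmetric]) (auto intro!: nn_integral_cong simp: indicator_def)
 have I0: "?I s * indicator {0..} s = ?I s" for s by (simp add: integrand_def indicator_def)
 have "ennreal (1 + 2 * g0 / c^2 + F * exp (2 * A + 1 - 1 / c ^ 4))
   = 1 + ennreal (2 * g0 / c^2) + ennreal (F * exp (2 * A + 1 - 1 / c ^ 4))" using g0 f by (simp add: F_def ennreal_plus)
 also have "1 = (\<integral>\<^sup>+s. ennreal (\<omega> s) * indicator {0..<a} s \<partial>lborel) + (\<integral>\<^sup>+s. ennreal (\<omega> s) * indicator {a..} s \<partial>lborel)"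
  using split[of "%s. ennreal (\<omega> s)"] total by simp
 also have "(\<integral>\<^sup>+s. ennreal (\<omega> s) * indicator {0..<a} s \<partial>lborel) + (\<integral>\<^sup>+s. ennreal (\<omega> s) * indicator {a..} s \<partial>lborel)
   + ennreal (2 * g0 / c^2) + ennreal (F * exp (2 * A + 1 - 1 / c ^ 4))
  = ((\<integral>\<^sup>+s. ennreal (\<omega> s) * indicator {0..<a} s \<partial>lborel) + ennreal (2 * g0 / c^2))
   + ennreal (F * exp (2 * A + 1 - 1 / c ^ 4)) + (\<integral>\<^sup>+s. ennreal (\<omega> s) * indicator {a..} s \<partial>lborel)"
  by (simp add: ac_simps)
 also have "... <= (\<integral>\<^sup>+s. ?I s * indicator {0..<a} s \<partial>lborel) + (\<integral>\<^sup>+s. ?I s * indicator {a..} s \<partial>lborel) + ennreal (exp (2 * A - 2 * a))"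
  by (intro add_mono gain tail far)
 also have "(\<integral>\<^sup>+s. ?I s * indicator {0..<a} s \<partial>lborel) + (\<integral>\<^sup>+s. ?I s * indicator {a..} s \<partial>lborel) = J bub"
  using split[of ?I] by (simp add: J_def I0)
 finally show ?thesis by (simp add: F_def)
qed

text \<open>As c grows the gain 2 g0 / c^2 prevails: the factor exp (- 1 / c^4) of the cap costs
  order c^(-4), and the other errors decay faster than any power of c.\<close>

lemma J_exceeds_concentration_level: "EX y. admissible y & J y > ennreal (1 + exp (1 + 2 * A))" proof -
 obtain g0 where g0: "0 < g0"
  "(\<integral>\<^sup>+s. ennreal (\<omega> s * (h s * s^2)) * indicator {0..<1} s \<partial>lborel) = ennreal g0"
  by (rule gain_positive)
 \<comment> \<open>\<open>bubble.a\<close> as an explicit function of c, so that its asymptotics can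
   be computed.\<close>
 define aa where "aa c = c^2 - (4 * ln c - 1 + 1 / c ^ 4) / 2" for c :: real
 have "((%c. c^2 * (exp (2 * A - 2 * aa c) + exp (1 + 2 * A) * (1 - (1 - 3 * K * exp (- aa c)) * exp (- 1 / c ^ 4)))) \<longlongrightarrow> 0) at_top"
  unfolding aa_def by real_asymp
 hence e1: "\<forall>\<^sub>F c in at_top. c^2 * (exp (2 * A - 2 * aa c) + exp (1 + 2 * A) * (1 - (1 - 3 * K * exp (- aa c)) * exp (- 1 / c ^ 4))) < 2 * g0"
  using g0 by (intro order_tendstoD) auto
 have "filterlim aa at_top at_top" unfolding aa_def by real_asymp
 hence e2: "\<forall>\<^sub>F c in at_top. s0 <= aa c" by (simp add: filterlim_at_top)
 have "((%c. 1 - 3 * K * exp (- aa c)) \<longlongrightarrow> 1) at_top" unfolding aa_def by real_asymp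
 hence e3: "\<forall>\<^sub>F c in at_top. 0 < 1 - 3 * K * exp (- aa c)" by (intro order_tendstoD) auto
 have "\<forall>\<^sub>F c::real in at_top. 2 <= c" by (rule eventually_ge_at_top)
 with e1 e2 e3 have "\<forall>\<^sub>F c in at_top. c^2 * (exp (2 * A - 2 * aa c) + exp (1 + 2 * A) * (1 - (1 - 3 * K * exp (- aa c)) * exp (- 1 / c ^ 4))) < 2 * g0
  & s0 <= aa c & 0 < 1 - 3 * K * exp (- aa c) & 2 <= c" by eventually_elim auto
 then obtain c where c: "c^2 * (exp (2 * A - 2 * aa c) + exp (1 + 2 * A) * (1 - (1 - 3 * K * exp (- aa c)) * exp (- 1 / c ^ 4))) < 2 * g0"
  "s0 <= aa c" "0 < 1 - 3 * K * exp (- aa c)" "2 <= c" by (metis (no_types, lifting) eventually_at_top_linorder order_refl)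
 have bc: "bubble c" by unfold_locales (rule c(4))
 have ac: "bubble.a c = aa c" by (simp add: aa_def bubble.a_def[OF bc] bubble.L_def[OF bc])
 have low: "ennreal (1 + 2 * g0 / c^2 + (1 - 3 * K * exp (- aa c)) * exp (2 * A + 1 - 1 / c ^ 4))
   <= J (bubble.bub c) + ennreal (exp (2 * A - 2 * aa c))" using J_bubble_lower[OF c(4) _ g0, unfolded ac] c by simp
 have "J (bubble.bub c) > ennreal (1 + exp (1 + 2 * A))" proof (rule ccontr)
  assume "\<not> ?thesis"
  hence "J (bubble.bub c) <= ennreal (1 + exp (1 + 2 * A))" by simp
  hence "J (bubble.bub c) + ennreal (exp (2 * A - 2 * aa c)) <= ennreal (1 + exp (1 + 2 * A)) + ennreal (exp (2 * A - 2 * aa c))"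
   by (rule add_right_mono)
  also have "... = ennreal (1 + exp (1 + 2 * A) + exp (2 * A - 2 * aa c))" by (simp add: ennreal_plus add_nonneg_nonneg)
  finally have "1 + 2 * g0 / c^2 + (1 - 3 * K * exp (- aa c)) * exp (2 * A + 1 - 1 / c ^ 4) <= 1 + exp (1 + 2 * A) + exp (2 * A - 2 * aa c)"
   using low by (meson ennreal_le_iff order_trans add_nonneg_nonneg exp_ge_zero zero_le_one)
  moreover have "exp (2 * A + 1 - 1 / c ^ 4) = exp (1 + 2 * A) * exp (- 1 / c ^ 4)" by (simp flip: exp_add)
  ultimately have "2 * g0 / c^2 <= exp (2 * A - 2 * aa c) + exp (1 + 2 * A) * (1 - (1 - 3 * K * exp (- aa c)) * exp (- 1 / c ^ 4))"
   by (simp add: algebra_simps)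
  thus False using c(1,4) by (simp add: divide_le_eq mult.commute)
 qed
 thus ?thesis using bubble.admissible_bub[OF bc] by blast
qed

end

subsection \<open>The radial ground state and its Green function\<close>

lemma real_power_series_deriv:
 fixes c :: "nat => real" assumes "!!z. abs z < 1 ==> summable (%n. c n * z ^ n)" "abs q < 1"
 shows "DERIV (%z. \<Sum>n. c n * z ^ n) q :> (\<Sum>n. diffs c n * q ^ n)" and "summable (%n. diffs c n * q ^ n)" proof -
 show "DERIV (%z. \<Sum>n. c n * z ^ n) q :> (\<Sum>n. diffs c n * q ^ n)"
  by (rule termdiffs_strong'[of 1]) (use assms in "simp_all only: real_norm_def")
 show "summable (%n. diffs c n * q ^ n)" by (rule termdiff_converges[of q 1]) (use assms in "simp_all only: real_norm_def")
qed

text \<open>In the variable \<open>q = \<bar>x\<bar>\<^sup>2\<close> the radial equation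
  \<open>- \<Delta>\<phi> - \<phi>/(1 - \<bar>x\<bar>\<^sup>2)\<^sup>2 - \<alpha> \<phi> = 0\<close> reads \<open>4 (q \<phi>')' + (1/(1 - q)\<^sup>2 + \<alpha>) \<phi> = 0\<close>; these are the
  coefficients of its solution with \<open>\<phi> 0 = 1\<close>.\<close>

fun gs_coeff :: "real => nat => real" where "gs_coeff \<alpha> 0 = 1"
| "gs_coeff \<alpha> (Suc n) =
  - (\<Sum>k\<le>n. (real (Suc k) + (if k = 0 then \<alpha> else 0)) * gs_coeff \<alpha> (n - k)) / (4 * (real (Suc n))^2)"

declare gs_coeff.simps(2)[simp del]

locale ground_state =
 fixes \<alpha> :: real assumes \<alpha>: "0 <= \<alpha>"
begin

abbreviation v :: "nat => real" where "v k \<equiv> real (Suc k) + (if k = 0 then \<alpha> else 0)"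
abbreviation cf :: "nat => real" where "cf \<equiv> gs_coeff \<alpha>"

definition \<phi> :: "real => real" where "\<phi> q = (\<Sum>n. cf n * q ^ n)"
definition \<phi>' :: "real => real" where "\<phi>' q = (\<Sum>n. diffs cf n * q ^ n)"
definition pot :: "real => real" where "pot q = 1 / (1 - q)^2 + \<alpha>"

lemma v_sum: "(\<Sum>k\<le>n. v k) = real (Suc n) * real (n + 2) / 2 + \<alpha>" proof -
 have "(\<Sum>k\<le>n. real (Suc k)) = real (Suc n) * real (n + 2) / 2" by (induction n) (auto simp: field_simps)
 moreover have "(\<Sum>k\<le>n. if k = 0 then \<alpha> else 0) = \<alpha>" by (induction n) auto
 ultimately show ?thesis by (simp add: sum.distrib)
qed

text \<open>In the recursion the weights v sum to (n + 1) (n + 2) / 2 + \<alpha>, which stays below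
  the denominator 4 (n + 1)^2 once n >= \<alpha>. From there on the maximum of the earlier
  coefficients bounds all of them, so the series converges for |q| < 1.\<close>

lemma cf_bounded: "EX M>0. ALL n. abs (cf n) <= M" proof -
 obtain N :: nat where N: "\<alpha> <= real N" using real_arch_simple by blast
 define M where "M = Max ((%n. abs (cf n)) ` {..N})"
 have M: "abs (cf n) <= M" if "n <= N" for n unfolding M_def using that by (intro Max_ge) auto
 have M1: "1 <= M" using M[of 0] by simp
 have "abs (cf n) <= M" for n proof (induction n rule: less_induct)
  case (less n)
  show ?case proof (cases "n <= N")
   case False
   then obtain m where m: "n = Suc m" "N <= m" by (cases n) auto
   have "abs (\<Sum>k\<le>m. v k * cf (m - k)) <= (\<Sum>k\<le>m. v k * M)"
    by (rule order_trans[OF sum_abs sum_mono]) (use \<alpha> less m in "auto simp: abs_mult intro!: mult_mono")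
   also have "... = (real (Suc m) * real (m + 2) / 2 + \<alpha>) * M" by (simp only: sum_distrib_right[symmetric] v_sum)
   also have "... <= (4 * (real (Suc m))^2) * M" proof (intro mult_right_mono)
    have "real (Suc m) * real (m + 2) / 2 + \<alpha> <= real (Suc m) * real (m + 2) / 2 + real m" using N m by simp
    also have "... <= 4 * (real (Suc m))^2" by (simp add: power2_eq_square algebra_simps)
    finally show "real (Suc m) * real (m + 2) / 2 + \<alpha> <= 4 * (real (Suc m))^2" .
   qed (use M1 in auto)
   finally show ?thesis unfolding m(1) gs_coeff.simps by (simp add: divide_le_eq mult.commute)
  qed (use M in auto)
 qed
 with M1 show ?thesis by (intro exI[of _ M]) auto
qed

lemma cf_summable: assumes "abs q < 1" shows "summable (%n. abs (cf n * q ^ n))" proof -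
 obtain M where M: "M > 0" "!!n. abs (cf n) <= M" using cf_bounded by blast
 show ?thesis proof (rule summable_comparison_test')
  show "summable (%n. M * abs q ^ n)" using assms by (intro summable_mult summable_geometric) auto
  show "norm (abs (cf n * q ^ n)) <= M * abs q ^ n" if "0 <= n" for n
   using M(2)[of n] by (auto simp: abs_mult power_abs intro: mult_right_mono)
 qed
qed

lemma cf_summable': "abs q < 1 ==> summable (%n. cf n * q ^ n)" by (rule summable_rabs_cancel, rule cf_summable)

lemma \<phi>_deriv: "abs q < 1 ==> DERIV \<phi> q :> \<phi>' q"
 unfolding \<phi>_def[abs_def] \<phi>'_def by (rule real_power_series_deriv(1)[OF cf_summable'])

lemma \<phi>'_summable: "abs q < 1 ==> summable (%n. diffs cf n * q ^ n)" by (rule real_power_series_deriv(2)[OF cf_summable'])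

lemma \<phi>'_isCont: "abs q < 1 ==> isCont \<phi>' q" unfolding \<phi>'_def[abs_def]
 by (rule DERIV_isCont, rule real_power_series_deriv(1)[OF \<phi>'_summable])

lemma \<phi>_0: "\<phi> 0 = 1" by (simp add: \<phi>_def powser_zero)

text \<open>The quotient (1 - \<phi> q) / q, written as a power series so that it is continuous at
  0; it carries the regular part of the Green function.\<close>

definition chi :: "real => real" where "chi q = - (\<Sum>n. cf (Suc n) * q ^ n)"

lemma cf_Suc_summable: assumes "abs q < 1" shows "summable (%n. cf (Suc n) * q ^ n)" proof -
 obtain M where M: "M > 0" "!!n. abs (cf n) <= M" using cf_bounded by blast
 show ?thesis proof (rule summable_comparison_test')
  show "summable (%n. M * abs q ^ n)" using assms by (intro summable_mult summable_geometric) auto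
  show "norm (cf (Suc n) * q ^ n) <= M * abs q ^ n" if "0 <= n" for n
   unfolding real_norm_def abs_mult power_abs using M(2) by (intro mult_right_mono) auto
 qed
qed

lemma \<phi>_chi: assumes "abs q < 1" shows "\<phi> q = 1 - q * chi q" proof -
 have "(\<Sum>n. cf (Suc n) * q ^ Suc n) = \<phi> q - cf 0 * q ^ 0"
  unfolding \<phi>_def using suminf_minus_initial_segment[OF cf_summable'[OF assms], of 1] by simp
 moreover have "(\<Sum>n. cf (Suc n) * q ^ Suc n) = q * (\<Sum>n. cf (Suc n) * q ^ n)"
  using suminf_mult[OF cf_Suc_summable[OF assms], of q] by (simp add: ac_simps)
 ultimately show ?thesis by (simp add: chi_def)
qed

lemma chi_isCont: "abs q < 1 ==> isCont chi q" unfolding chi_def[abs_def]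
 by (rule DERIV_isCont, rule DERIV_minus, rule real_power_series_deriv(1)[OF cf_Suc_summable])

text \<open>The Cauchy product of the series of the potential and of \<phi>, compared
  coefficientwise with the recursion.\<close>

lemma \<phi>_ode: assumes q: "abs q < 1" shows "DERIV (%q. q * \<phi>' q) q :> - (pot q * \<phi> q) / 4" proof -
 define d where "d n = real n * cf n" for n
 have d_sums: "(%n. d n * z ^ n) sums (z * \<phi>' z)" if "abs z < 1" for z proof -
  have "(%n. z * (diffs cf n * z ^ n)) sums (z * \<phi>' z)"
   unfolding \<phi>'_def by (intro sums_mult summable_sums \<phi>'_summable that)
  moreover have "z * (diffs cf n * z ^ n) = d (Suc n) * z ^ Suc n" for n by (simp add: d_def diffs_def)
  ultimately have "(%n. d (Suc n) * z ^ Suc n) sums (z * \<phi>' z)" by simp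
  hence "(%n. d n * z ^ n) sums (z * \<phi>' z + d 0 * z ^ 0)" using sums_Suc_iff[of "%n. d n * z ^ n"] by simp
  thus ?thesis by (simp add: d_def)
 qed
 have d_sm: "summable (%n. d n * z ^ n)" and d_eq: "(\<Sum>n. d n * z ^ n) = z * \<phi>' z" if "abs z < 1" for z
  using d_sums[OF that] by (auto simp: sums_iff)
 have "DERIV (%z. \<Sum>n. d n * z ^ n) q :> (\<Sum>n. diffs d n * q ^ n)" by (rule real_power_series_deriv(1)[OF d_sm q])
 hence D: "DERIV (%z. z * \<phi>' z) q :> (\<Sum>n. diffs d n * q ^ n)"
  by (rule has_field_derivative_transform_within_open[of _ _ _ "{-1<..<1}"]) (use q d_eq in auto)
 have vs: "(%k. v k * q ^ k) sums pot q" proof -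
  have "(%k. real (Suc k) * q ^ k) sums (1 / (1 - q)^2)" using geometric_deriv_sums[of q] q by simp
  moreover have "(%k. if k = 0 then \<alpha> * q ^ k else 0) sums (\<alpha> * q ^ 0)" by (rule sums_single)
  ultimately have "(%k. real (Suc k) * q ^ k + (if k = 0 then \<alpha> * q ^ k else 0)) sums (1 / (1 - q)^2 + \<alpha> * q ^ 0)"
   by (intro sums_add)
  moreover have "(%k. real (Suc k) * q ^ k + (if k = 0 then \<alpha> * q ^ k else 0)) = (%k. v k * q ^ k)"
   by (auto simp: algebra_simps)
  ultimately show ?thesis by (simp add: pot_def)
 qed
 have vabs: "summable (%k. norm (v k * q ^ k))" proof -
  have "summable (%k. real (Suc k) * abs q ^ k)" using geometric_deriv_sums[of "abs q"] q by (simp add: sums_iff)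
  moreover have "summable (%k. if k = 0 then \<alpha> * abs q ^ k else 0)"
   using sums_single[of 0 "%k. \<alpha> * abs q ^ k"] by (rule sums_summable)
  ultimately have "summable (%k. real (Suc k) * abs q ^ k + (if k = 0 then \<alpha> * abs q ^ k else 0))" by (rule summable_add)
  moreover have "norm (v k * q ^ k) = real (Suc k) * abs q ^ k + (if k = 0 then \<alpha> * abs q ^ k else 0)" for k proof -
   have "abs (v k) = v k" using \<alpha> by simp
   hence "norm (v k * q ^ k) = v k * abs q ^ k" by (simp only: real_norm_def abs_mult power_abs)
   thus ?thesis by (auto simp: algebra_simps)
  qed
  ultimately show ?thesis by simp
 qed
 have "(%n. \<Sum>k\<le>n. (v k * q ^ k) * (cf (n - k) * q ^ (n - k))) sums ((\<Sum>k. v k * q ^ k) * (\<Sum>k. cf k * q ^ k))"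
  by (rule Cauchy_product_sums[OF vabs]) (use cf_summable[OF q] in simp)
 also have "(\<Sum>k. v k * q ^ k) * (\<Sum>k. cf k * q ^ k) = pot q * \<phi> q"
  unfolding \<phi>_def by (simp only: sums_unique[OF vs, symmetric])
 finally have S: "(%n. - (\<Sum>k\<le>n. (v k * q ^ k) * (cf (n - k) * q ^ (n - k))) / 4) sums (- (pot q * \<phi> q) / 4)"
  by (intro sums_divide sums_minus)
 have "- (\<Sum>k\<le>n. (v k * q ^ k) * (cf (n - k) * q ^ (n - k))) / 4 = diffs d n * q ^ n" for n proof -
  have "(\<Sum>k\<le>n. (v k * q ^ k) * (cf (n - k) * q ^ (n - k))) = (\<Sum>k\<le>n. v k * cf (n - k)) * q ^ n"
   unfolding sum_distrib_right proof (rule sum.cong[OF refl])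
   fix k assume "k : {..n}"
   hence "q ^ n = q ^ k * q ^ (n - k)" by (simp flip: power_add)
   thus "(v k * q ^ k) * (cf (n - k) * q ^ (n - k)) = v k * cf (n - k) * q ^ n" by simp
  qed
  moreover have "diffs d n = - (\<Sum>k\<le>n. v k * cf (n - k)) / 4"
   unfolding diffs_def d_def gs_coeff.simps by (simp add: power2_eq_square del: of_nat_Suc)
  ultimately show ?thesis by simp
 qed
 with S have X: "(%n. diffs d n * q ^ n) sums (- (pot q * \<phi> q) / 4)" by (simp only:)
 show ?thesis using D by (simp only: sums_unique[OF X, symmetric])
qed

lemma pot_nonneg: "0 <= pot q" using \<alpha> by (simp add: pot_def)

lemma \<phi>_isCont: "abs q < 1 ==> isCont \<phi> q" by (rule DERIV_isCont, rule \<phi>_deriv)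

lemma \<phi>_continuous: "S \<subseteq> {-1<..<1} ==> continuous_on S \<phi>"
 by (rule continuous_at_imp_continuous_on) (use \<phi>_isCont in "auto simp: abs_less_iff subset_iff")

lemma \<phi>'_continuous: "S \<subseteq> {-1<..<1} ==> continuous_on S \<phi>'"
 by (rule continuous_at_imp_continuous_on) (use \<phi>'_isCont in "auto simp: abs_less_iff subset_iff")

lemma chi_continuous: "S \<subseteq> {-1<..<1} ==> continuous_on S chi"
 by (rule continuous_at_imp_continuous_on) (use chi_isCont in "auto simp: abs_less_iff subset_iff")

text \<open>By the equation q \<phi>' is nonincreasing as long as \<phi> is nonnegative, and it
  starts at 0.\<close>

lemma \<phi>'_nonpos: assumes "0 < q" "q < 1" "!!x. 0 <= x ==> x < q ==> 0 <= \<phi> x" shows "\<phi>' q <= 0" proof -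
 have "q * \<phi>' q <= 0 * \<phi>' 0" proof (rule DERIV_nonpos_imp_decreasing_open[of 0 q "%q. q * \<phi>' q"])
  show "EX y. DERIV (%q. q * \<phi>' q) x :> y & y <= 0" if "0 < x" "x < q" for x
   using \<phi>_ode[of x] pot_nonneg[of x] assms that by (intro exI conjI) auto
  show "continuous_on {0..q} (%q. q * \<phi>' q)" using assms by (intro continuous_intros \<phi>'_continuous) auto
 qed (use assms in auto)
 thus ?thesis using assms by (simp add: mult_le_0_iff)
qed

lemma \<phi>_decreasing: assumes "0 <= p" "p <= q" "q < 1" "!!x. 0 <= x ==> x < q ==> 0 <= \<phi> x" shows "\<phi> q <= \<phi> p"
proof (rule DERIV_nonpos_imp_decreasing_open[of p q \<phi>])
 show "EX y. DERIV \<phi> x :> y & y <= 0" if "p < x" "x < q" for x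
  using \<phi>_deriv[of x] \<phi>'_nonpos[of x] assms that by (intro exI conjI) auto
 show "continuous_on {p..q} \<phi>" using assms by (intro \<phi>_continuous) auto
qed (use assms in auto)

lemma \<phi>_le_1: assumes "0 <= q" "q < 1" "!!x. 0 <= x ==> x < q ==> 0 <= \<phi> x" shows "\<phi> q <= 1"
 using \<phi>_decreasing[OF order_refl assms] \<phi>_0 by simp

end

section \<open>Radial profiles and Jacobi's factorization\<close>

lemma DERIV_integral_zero_left:
 fixes f :: "real => real" assumes cont: "continuous_on UNIV f" and zero: "!!s. s <= 0 ==> f s = 0"
 shows "DERIV (%t. integral {0..t} f) s :> f s" proof (cases "s < 0")
 case True
 have "DERIV (%_. 0) s :> 0" by simp
 hence "DERIV (%t. integral {0..t} f) s :> 0"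
  by (rule has_field_derivative_transform_within_open[of _ _ _ "{..<0}"]) (use True in auto)
 thus ?thesis using zero[of s] True by simp
next
 case False
 have int: "f integrable_on {a..b}" for a b by (intro integrable_continuous_real continuous_on_subset[OF cont]) auto
 have neg: "integral {-1..t} f = 0" if "t <= 0" for t using integral_cong[of "{-1..t}" f "%_. 0"] that zero by simp
 have eq: "integral {-1..t} f = integral {0..t} f" if "-1 < t" for t proof (cases "0 <= t")
  case True
  thus ?thesis using Henstock_Kurzweil_Integration.integral_combine[of "-1" 0 t f] int neg[of 0] by simp
 qed (use neg[of t] in simp)
 have "DERIV (%t. integral {-1..t} f) s :> f s" by (rule DERIV_integral_at[OF cont]) (use False in auto)
 thus ?thesis by (rule has_field_derivative_transform_within_open[of _ _ _ "{-1<..}"]) (use False eq in auto)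
qed

text \<open>Profiles are functions of q = |x|^2, so no condition at q = 0 is needed for a C^1
  function of x. They vanish from \<rho> < 1 on, and the derivative is carried along
  explicitly.\<close>

definition rad_C1 :: "real => (real => real) => (real => real) => bool" where
 "rad_C1 \<rho> U U' \<longleftrightarrow> 0 < \<rho> & \<rho> < 1 &
  (ALL q:{0..1}. (U has_real_derivative U' q) (at q within {0..1})) &
  continuous_on {0..1} U' & (ALL q:{\<rho>..1}. U q = 0 & U' q = 0)"

text \<open>S may be singular at 0 and is controlled only up to q1; F is constant where S is large
  and zero where S is small, so the composition is locally constant near both ends and extends
  across them.\<close>

lemma extended_composition_deriv:
 fixes S F :: "real => real" assumes q1: "0 < q1" and S: "!!q. 0 < q ==> q < q1 ==> DERIV S q :> Sd q"
  and qT: "0 < qT" "qT < q1" "!!q. 0 < q ==> q < qT ==> T <= S q"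
  and \<rho>: "0 < \<rho>" "\<rho> < q1" "!!q. \<rho> < q ==> q < q1 ==> S q <= sg" and F: "!!s. DERIV F s :> F' s"
  and FT: "!!s. T <= s ==> F s = F T" "!!s. T <= s ==> F' s = 0" and F0: "!!s. s <= sg ==> F s = 0" "!!s. s <= sg ==> F' s = 0"
 shows "((%q. if q <= 0 then F T else if q < q1 then F (S q) else 0) has_real_derivative
   (if 0 < q & q < q1 then F' (S q) * Sd q else 0)) (at q)" (is "DERIV ?G q :> ?D") proof -
 consider "q < qT" | "0 < q" "q < q1" | "\<rho> < q" using qT(2) \<rho>(2) qT(1) by linarith
 thus ?thesis proof cases
  case 1
  have "DERIV (%_. F T) q :> 0" by simp
  hence "DERIV ?G q :> 0" proof (rule has_field_derivative_transform_within_open[of _ _ _ "{..<qT}"])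
   show "F T = ?G x" if "x : {..<qT}" for x using FT(1)[of "S x"] qT(3)[of x] qT(2) that by simp
  qed (use 1 in auto)
  moreover have "?D = 0" using 1 qT FT(2) by auto
  ultimately show ?thesis by simp
 next
  case 2
  have "DERIV (%q. F (S q)) q :> F' (S q) * Sd q" by (rule DERIV_chain2[OF F S[OF 2]])
  hence "DERIV ?G q :> F' (S q) * Sd q" by (rule has_field_derivative_transform_within_open[of _ _ _ "{0<..<q1}"]) (use 2 in auto)
  thus ?thesis using 2 by simp
 next
  case 3
  have "DERIV (%_. 0) q :> 0" by simp
  hence "DERIV ?G q :> 0"
   by (rule has_field_derivative_transform_within_open[of _ _ _ "{\<rho><..}"]) (use 3 \<rho> F0(1) in auto)
  moreover have "?D = 0" using 3 \<rho> F0(2) by auto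
  ultimately show ?thesis by simp
 qed
qed

lemma extended_composition_isCont:
 fixes S F' :: "real => real" assumes q1: "0 < q1" and S: "!!q. 0 < q ==> q < q1 ==> DERIV S q :> Sd q"
  and Sd: "!!q. 0 < q ==> q < q1 ==> isCont Sd q" and qT: "0 < qT" "qT < q1" "!!q. 0 < q ==> q < qT ==> T <= S q"
  and \<rho>: "0 < \<rho>" "\<rho> < q1" "!!q. \<rho> < q ==> q < q1 ==> S q <= sg"
  and F': "continuous_on UNIV F'" "!!s. T <= s ==> F' s = 0" "!!s. s <= sg ==> F' s = 0"
 shows "isCont (%q. if 0 < q & q < q1 then F' (S q) * Sd q else 0) q" (is "isCont ?D q") proof -
 have tr: "isCont g q" if "open X" "q : X" "!!x. x : X ==> f x = g x" "isCont f q" for f g :: "real => real" and X proof -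
  have "\<forall>\<^sub>F x in nhds q. g x = f x" unfolding eventually_nhds by (rule exI[of _ X]) (use that in auto)
  hence "isCont g q \<longleftrightarrow> isCont f q" by (rule isCont_cong)
  thus ?thesis using that by simp
 qed
 consider "q < qT" | "0 < q" "q < q1" | "\<rho> < q" using qT(2) \<rho>(2) qT(1) by linarith
 thus ?thesis proof cases
  case 1
  show ?thesis by (rule tr[of "{..<qT}" "%_. 0"]) (use 1 qT F' in auto)
 next
  case 2
  have "isCont (%q. F' (S q) * Sd q) q" using F'(1) S[OF 2] Sd[OF 2] DERIV_isCont
   by (intro continuous_mult isCont_o2[of q S F']) (auto simp: continuous_on_eq_continuous_at)
  thus ?thesis by (rule tr[of "{0<..<q1}", rotated 3]) (use 2 in auto)
 next
  case 3
  show ?thesis by (rule tr[of "{\<rho><..}" "%_. 0"]) (use 3 \<rho> F' in auto)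
 qed
qed

context ground_state
begin

text \<open>Up to the factor pi, the squared norm of the radial function with profile U minus
  \<alpha> times its squared L^2-norm: dx becomes pi dq, and |grad u|^2 becomes 4 q U'^2.\<close>

definition form :: "(real => real) => (real => real) => real" where
 "form U U' = integral {0..1} (%q. 4 * q * (U' q)^2 - pot q * (U q)^2)"

text \<open>Jacobi's factorization: with \<open>U = \<phi> W\<close>,
  \<open>4 q U'\<^sup>2 - (V + \<alpha>) U\<^sup>2 = 4 q \<phi>\<^sup>2 W'\<^sup>2 + (4 q \<phi> \<phi>' W\<^sup>2)'\<close>, and \<open>S' = - 1/(2 q \<phi>\<^sup>2)\<close> turns the right-hand
  side into the free energy of \<open>y\<close> for \<open>W = y \<circ> S\<close>.\<close>

lemma form_factorization:
 fixes S y y' :: "real => real" assumes q1: "0 < q1" "q1 <= 1" and pos: "!!q. 0 <= q ==> q < q1 ==> 0 < \<phi> q"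
  and S: "!!q. 0 < q ==> q < q1 ==> DERIV S q :> - 1 / (2 * q * (\<phi> q)^2)"
  and qT: "0 < qT" "qT < q1" "!!q. 0 < q ==> q < qT ==> T <= S q"
  and \<rho>: "0 < \<rho>" "\<rho> < q1" "!!q. \<rho> < q ==> q < q1 ==> S q <= sg" and sg: "0 <= sg"
  and y: "!!s. DERIV y s :> y' s" "continuous_on UNIV y'" and yT: "!!s. T <= s ==> y' s = 0"
  and y0: "!!s. s <= sg ==> y s = 0" "!!s. s <= sg ==> y' s = 0" and T: "0 <= T"
 defines "W \<equiv> %q. if q <= 0 then y T else if q < q1 then y (S q) else 0"
 defines "W' \<equiv> %q. if 0 < q & q < q1 then y' (S q) * (- 1 / (2 * q * (\<phi> q)^2)) else 0"
 shows "rad_C1 ((\<rho> + q1) / 2) (%q. \<phi> q * W q) (%q. \<phi>' q * W q + \<phi> q * W' q)"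
  and "form (%q. \<phi> q * W q) (%q. \<phi>' q * W q + \<phi> q * W' q) = 2 * integral {0..T} (%s. (y' s)^2)" proof -
 define e where "e t = integral {0..t} (%s. (y' s)^2)" for t
 have yT': "y s = y T" if "T <= s" for s by (rule DERIV_zero_const[OF _ that]) (use y(1) yT in metis)
 have e_deriv: "DERIV e s :> (y' s)^2" for s
  unfolding e_def by (rule DERIV_integral_zero_left) (use y(2) y0 sg in "auto intro!: continuous_intros")
 have eT: "e s = e T" if "T <= s" for s by (rule DERIV_zero_const[OF _ that]) (use e_deriv yT in "metis zero_power2")
 have e0: "e s = 0" if "s <= sg" for s unfolding e_def using integral_cong[of "{0..s}" "%s. (y' s)^2" "%_. 0"] that y0 by simp
 define E where "E = (%q. if q <= 0 then e T else if q < q1 then e (S q) else 0)"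
 have dW: "DERIV W q :> W' q" for q unfolding W_def W'_def
  by (rule extended_composition_deriv[where T = T and sg = sg and \<rho> = \<rho> and qT = qT,
     OF q1(1) S qT \<rho> y(1) yT' yT y0]) assumption+
 have dE: "DERIV E q :> (if 0 < q & q < q1 then (y' (S q))^2 * (- 1 / (2 * q * (\<phi> q)^2)) else 0)" for q unfolding E_def
  by (rule extended_composition_deriv[where T = T and sg = sg and \<rho> = \<rho> and qT = qT,
     OF q1(1) S qT \<rho> e_deriv eT _ e0]) (assumption | simp add: yT y0)+
 have cW': "isCont W' q" for q unfolding W'_def
 proof (rule extended_composition_isCont[where T = T and sg = sg and \<rho> = \<rho> and qT = qT
    and F' = y' and S = S and Sd = "%q. - 1 / (2 * q * (\<phi> q)^2)"])
  show "isCont (%q. - 1 / (2 * q * (\<phi> q)^2)) q" if "0 < q" "q < q1" for q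
   using that q1 pos[of q] by (intro continuous_intros \<phi>_isCont) auto
 qed (use q1 S qT \<rho> y yT y0 in auto)
 define U where "U = (%q. \<phi> q * W q)"
 define U' where "U' = (%q. \<phi>' q * W q + \<phi> q * W' q)"
 have Wz: "W q = 0" "W' q = 0" if "\<rho> < q" for q using that \<rho> y0 by (auto simp: W_def W'_def)
 have Uz: "U q = 0" "U' q = 0" if "\<rho> < q" for q using Wz[OF that] by (auto simp: U_def U'_def)
 have dU: "DERIV U q :> U' q" if "0 <= q" "q <= 1" for q proof (cases "q < 1")
  case True
  thus ?thesis unfolding U_def U'_def using that by (auto intro!: derivative_eq_intros \<phi>_deriv dW)
 next
  case False
  have "DERIV (%_. 0) q :> 0" by simp
  hence "DERIV U q :> 0"
   by (rule has_field_derivative_transform_within_open[of _ _ _ "{\<rho><..}"]) (use False \<rho> q1 Uz in auto)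
  thus ?thesis using Uz[of q] False \<rho> q1 by simp
 qed
 have cU': "isCont U' q" if "0 <= q" "q <= 1" for q proof (cases "q < 1")
  case True
  thus ?thesis unfolding U'_def using that by (intro continuous_intros \<phi>_isCont \<phi>'_isCont cW' DERIV_isCont[OF dW]) auto
 next
  case False
  have "\<forall>\<^sub>F x in nhds q. U' x = 0"
   unfolding eventually_nhds by (rule exI[of _ "{\<rho><..}"]) (use False \<rho> q1 Uz in auto)
  hence "isCont U' q \<longleftrightarrow> isCont (%_. 0::real) q" by (rule isCont_cong)
  thus ?thesis by simp
 qed
 show "rad_C1 ((\<rho> + q1) / 2) (%q. \<phi> q * W q) (%q. \<phi>' q * W q + \<phi> q * W' q)"
  unfolding rad_C1_def U_def[symmetric] U'_def[symmetric] using \<rho> q1 Uz dU cU'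
  by (auto intro!: continuous_at_imp_continuous_on intro: DERIV_subset[of _ _ _ UNIV])
 have Ez: "E q = 0" if "\<rho> < q" for q using e0[OF \<rho>(3)[OF that]] that \<rho>(1) by (simp add: E_def)
 \<comment> \<open>An antiderivative of the integrand of the form. Its first term vanishes at 0
   because of the factor q and at 1 because W does, so only the energy of y remains.\<close>
 define \<Psi> where "\<Psi> = (%q. 4 * (q * \<phi>' q) * \<phi> q * (W q)^2 - 2 * E q)"
 have d\<Psi>: "DERIV \<Psi> q :> 4 * q * (U' q)^2 - pot q * (U q)^2" if "0 <= q" "q <= 1" for q proof (cases "q < 1")
  case True
  with that have q: "abs q < 1" by simp
  define Ed where "Ed = (if 0 < q & q < q1 then (y' (S q))^2 * (- 1 / (2 * q * (\<phi> q)^2)) else 0)"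
  have dE': "DERIV E q :> Ed" unfolding Ed_def by (rule dE)
  have "DERIV \<Psi> q :> 4 * ((- (pot q * \<phi> q) / 4) * \<phi> q * (W q)^2 + (q * \<phi>' q) * \<phi>' q * (W q)^2
    + (q * \<phi>' q) * \<phi> q * (2 * W q * W' q)) - 2 * Ed" unfolding \<Psi>_def
   by (rule derivative_eq_intros refl \<phi>_ode[OF q] \<phi>_deriv[OF q] dW dE')+ (simp add: algebra_simps power2_eq_square)
  also have "4 * ((- (pot q * \<phi> q) / 4) * \<phi> q * (W q)^2 + (q * \<phi>' q) * \<phi>' q * (W q)^2
    + (q * \<phi>' q) * \<phi> q * (2 * W q * W' q)) - 2 * Ed = 4 * q * (U' q)^2 - pot q * (U q)^2" proof -
   have A: "- 2 * Ed = 4 * q * (\<phi> q)^2 * (W' q)^2" proof (cases "0 < q & q < q1")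
    case True
    hence "\<phi> q ~= 0" "q ~= 0" using pos[of q] by auto
    hence "- 2 * (z^2 * (- 1 / (2 * q * (\<phi> q)^2))) = 4 * q * (\<phi> q)^2 * (z * (- 1 / (2 * q * (\<phi> q)^2)))^2" for z
     by (simp add: field_simps power2_eq_square)
    thus ?thesis using True by (simp only: Ed_def W'_def if_True simp_thms)
   next
    case False
    hence "(0 < q & q < q1) = False" by blast
    thus ?thesis unfolding Ed_def W'_def by (simp only: if_False) simp
   qed
   have "4 * q * (U' q)^2 - pot q * (U q)^2
    = 4 * ((- (pot q * \<phi> q) / 4) * \<phi> q * (W q)^2 + (q * \<phi>' q) * \<phi>' q * (W q)^2
    + (q * \<phi>' q) * \<phi> q * (2 * W q * W' q)) + 4 * q * (\<phi> q)^2 * (W' q)^2"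
    unfolding U_def U'_def by (simp add: power2_eq_square algebra_simps)
   thus ?thesis using A by linarith
  qed
  finally show ?thesis .
 next
  case False
  have "DERIV (%_. 0) q :> 0" by simp
  hence "DERIV \<Psi> q :> 0" proof (rule has_field_derivative_transform_within_open[of _ _ _ "{\<rho><..}"])
   show "0 = \<Psi> x" if "x : {\<rho><..}" for x using that Wz[of x] Ez[of x] by (simp add: \<Psi>_def)
  qed (use False \<rho> q1 in auto)
  thus ?thesis using Uz[of q] False \<rho> q1 by simp
 qed
 have "((%q. 4 * q * (U' q)^2 - pot q * (U q)^2) has_integral (\<Psi> 1 - \<Psi> 0)) {0..1}"
  by (rule fundamental_theorem_of_calculus)
   (auto simp: has_real_derivative_iff_has_vector_derivative[symmetric] intro: DERIV_subset[OF d\<Psi>])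
 hence "form U U' = \<Psi> 1 - \<Psi> 0" unfolding form_def by (rule integral_unique)
 also have "... = 2 * e T" using Wz[of 1] Ez[of 1] \<rho>(2) q1 by (simp add: \<Psi>_def E_def)
 finally show "form (%q. \<phi> q * W q) (%q. \<phi>' q * W q + \<phi> q * W' q) = 2 * integral {0..T} (%s. (y' s)^2)"
  unfolding U_def U'_def e_def .
qed

end

lemma DERIV_max_square: "DERIV (%x::real. (max 0 x)^2) x :> 2 * max 0 x" proof (cases "x = 0")
 case True
 have "((%h. (max 0 (0 + h))^2 / h) \<longlongrightarrow> 0) (at (0::real))" proof (rule Lim_null_comparison)
  show "\<forall>\<^sub>F h in at (0::real). norm ((max 0 (0 + h))^2 / h) <= abs h"
   by (intro always_eventually allI) (auto simp: max_def power2_eq_square)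
  show "((%h::real. abs h) \<longlongrightarrow> 0) (at 0)" by (rule tendsto_rabs_zero) simp
 qed
 thus ?thesis using True by (simp add: DERIV_def)
next
 case False
 then consider "x < 0" | "0 < x" by linarith
 thus ?thesis proof cases
  case 1
  have "DERIV (%_. 0::real) x :> 0" by simp
  hence "DERIV (%x::real. (max 0 x)^2) x :> 0"
   by (rule has_field_derivative_transform_within_open[of _ _ _ "{..<0}"]) (use 1 in auto)
  thus ?thesis using 1 by simp
 next
  case 2
  have "DERIV (%x. x^2) x :> 2 * x" by (auto intro!: derivative_eq_intros)
  hence "DERIV (%x::real. (max 0 x)^2) x :> 2 * x"
   by (rule has_field_derivative_transform_within_open[of _ _ _ "{0<..}"]) (use 2 in auto)
  thus ?thesis using 2 by simp
 qed
qed

text \<open>A C^1 substitute for the linear ramp from 0 at 0 to 1 at N: its slope is a tent of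
  height 2 / N, so its energy is still of order 1 / N.\<close>

definition spline :: "real => real => real" where
 "spline N s = 2 / N^2 * ((max 0 s)^2 - 2 * (max 0 (s - N / 2))^2 + (max 0 (s - N))^2)"

definition spline' :: "real => real => real" where
 "spline' N s = 2 / N^2 * (2 * max 0 s - 2 * (2 * max 0 (s - N / 2)) + 2 * max 0 (s - N))"

lemma spline_deriv: "DERIV (spline N) s :> spline' N s" proof -
 have sh: "DERIV (%s. (max 0 (s - a))^2) s :> 2 * max 0 (s - a)" for a :: real proof -
  have "DERIV (%s. (max 0 (s - a))^2) s :> 2 * max 0 (s - a) * 1"
   by (rule DERIV_chain2[where f = "%x. (max 0 x)^2" and g = "%s. s - a", OF DERIV_max_square])
    (auto intro!: derivative_eq_intros)
  thus ?thesis by simp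
 qed
 show ?thesis unfolding spline_def spline'_def by (intro DERIV_cmult DERIV_add DERIV_diff sh DERIV_max_square)
qed

lemma spline_facts: assumes "0 < N" shows "continuous_on S (spline' N)" "s <= 0 ==> spline N s = 0" "s <= 0 ==> spline' N s = 0"
  "N <= s ==> spline' N s = 0" "spline N N = 1" "abs (spline' N s) <= 2 / N" proof -
 show "continuous_on S (spline' N)" unfolding spline'_def by (intro continuous_intros)
 show "spline N N = 1" using assms by (simp add: spline_def power2_eq_square field_simps)
 have "abs (2 * max 0 s - 2 * (2 * max 0 (s - N / 2)) + 2 * max 0 (s - N)) <= N" using assms by (auto simp: max_def abs_le_iff)
 hence "2 / N^2 * abs (2 * max 0 s - 2 * (2 * max 0 (s - N / 2)) + 2 * max 0 (s - N)) <= 2 / N^2 * N"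
  by (intro mult_left_mono) auto
 moreover have "2 / N^2 * N = 2 / N" using assms by (simp add: power2_eq_square)
 ultimately show "abs (spline' N s) <= 2 / N"
  unfolding spline'_def abs_mult by (simp only: abs_of_nonneg[of "2 / N^2"] zero_le_divide_iff zero_le_power2 zero_le_numeral simp_thms)
qed (use assms in "auto simp: spline_def spline'_def max_def")

text \<open>The spectral gap, required for radial C^1 profiles; it is instantiated below with kap =
  lambda1 - \<alpha>.\<close>

locale coercive_ground_state = ground_state +
 fixes kap :: real assumes kap: "0 < kap"
  and coercive: "!!\<rho> U U'. rad_C1 \<rho> U U' ==> kap * integral {0..1} (%q. (U q)^2) <= form U U'"
begin

text \<open>Since 1 - \<phi>^2 = q chi (1 + \<phi>), the function 1 / (2 q \<phi>^2) splits into 1 /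
  (2 q) and the regular part \<psi>; \<open>S0\<close> is the corresponding solution of S' = - 1 /
  (2 q \<phi>^2).\<close>

definition \<psi> :: "real => real" where "\<psi> q = chi q * (1 + \<phi> q) / (2 * (\<phi> q)^2)"
definition \<Psi>0 :: "real => real" where "\<Psi>0 q = integral {0..q} \<psi>"
definition S0 :: "real => real" where "S0 q = - ln q / 2 - \<Psi>0 q"

text \<open>These facts hold on any interval [0, q1) on which \<phi> is positive. They serve twice:
  with q1 a hypothetical first zero, in order to refute it, and afterwards with q1 = 1.\<close>

context
 fixes q1 assumes q1: "0 < q1" "q1 <= 1" and pos: "!!q. 0 <= q ==> q < q1 ==> 0 < \<phi> q"
begin

lemma \<psi>_cont: assumes "q < q1" shows "continuous_on {0..q} \<psi>" proof -
 have sub: "{0..q} \<subseteq> {-1<..<1}" using assms q1 by auto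
 have nz: "\<phi> x ~= 0" if "x : {0..q}" for x using pos[of x] that assms by auto
 show ?thesis unfolding \<psi>_def by (intro continuous_intros chi_continuous \<phi>_continuous sub) (auto simp: nz)
qed

lemma \<psi>_int: assumes "0 <= p" "q < q1" shows "\<psi> integrable_on {p..q}"
 by (rule integrable_continuous_real) (rule continuous_on_subset[OF \<psi>_cont[OF assms(2)]], use assms in auto)

lemma \<psi>_nonneg: assumes "0 < q" "q < q1" shows "0 <= \<psi> q" proof -
 have "\<phi> q <= 1" by (rule \<phi>_le_1) (use assms q1 pos in "auto intro: less_imp_le")
 hence "0 <= q * chi q" using \<phi>_chi[of q] assms q1 by simp
 hence "0 <= chi q" using assms by (simp add: zero_le_mult_iff)
 thus ?thesis using pos[of q] assms by (simp add: \<psi>_def)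
qed

lemma \<Psi>0_mono: assumes "0 <= p" "p <= q" "q < q1" shows "\<Psi>0 p <= \<Psi>0 q" proof -
 have "\<Psi>0 q = \<Psi>0 p + integral {p..q} \<psi>" unfolding \<Psi>0_def
  using Henstock_Kurzweil_Integration.integral_combine[of 0 p q \<psi>] assms \<psi>_int[of 0 q] by simp
 moreover have "0 <= integral {p..q} \<psi>" proof (cases "p = 0")
  case False
  thus ?thesis using assms by (intro integral_nonneg \<psi>_int \<psi>_nonneg) auto
 next
  case True
  have "integral {0..q} (%x. if x = 0 then 0 else \<psi> x) = integral {0..q} \<psi>" by (rule integral_spike[of "{0}"]) auto
  moreover have "0 <= integral {0..q} (%x. if x = 0 then 0 else \<psi> x)" proof (rule integral_nonneg)
   show "(%x. if x = 0 then 0 else \<psi> x) integrable_on {0..q}"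
    by (rule integrable_spike[OF \<psi>_int[of 0 q], of "{0}"]) (use assms in auto)
  qed (use \<psi>_nonneg assms in auto)
  ultimately show ?thesis using True by simp
 qed
 ultimately show ?thesis by simp
qed

lemma S0_deriv: assumes "0 < q" "q < q1" shows "DERIV S0 q :> - 1 / (2 * q * (\<phi> q)^2)" proof -
 obtain r where r: "q < r" "r < q1" using assms dense by blast
 have "(\<Psi>0 has_real_derivative \<psi> q) (at q within {0..r})"
  unfolding \<Psi>0_def by (rule integral_has_real_derivative[OF \<psi>_cont[OF r(2)]]) (use assms r in auto)
 moreover have "q : interior {0..r}" using assms r by (simp add: interior_atLeastAtMost_real)
 ultimately have d: "DERIV (\<Psi>0) q :> \<psi> q" using at_within_interior[of q "{0..r}"] by simp
 have "DERIV S0 q :> - (1 / q) / 2 - \<psi> q" unfolding S0_def using assms by (auto intro!: derivative_eq_intros d)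
 also have "- (1 / q) / 2 - \<psi> q = - 1 / (2 * q * (\<phi> q)^2)" proof -
  have p: "\<phi> q ~= 0" using pos[of q] assms by auto
  have c: "q * chi q = 1 - \<phi> q" using \<phi>_chi[of q] assms q1 by simp
  have "- (1 / q) / 2 - \<psi> q = - ((\<phi> q)^2 + (q * chi q) * (1 + \<phi> q)) / (2 * q * (\<phi> q)^2)"
   using p assms by (simp add: \<psi>_def field_simps)
  also have "(\<phi> q)^2 + (q * chi q) * (1 + \<phi> q) = 1" unfolding c by (simp add: power2_eq_square algebra_simps)
  finally show ?thesis .
 qed
 finally show ?thesis .
qed

lemma S0_strict_decreasing: assumes "0 < p" "p < q" "q < q1" shows "S0 q < S0 p"
proof (rule DERIV_neg_imp_decreasing[OF assms(2)])
 fix x assume x: "p <= x" "x <= q"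
 hence "- 1 / (2 * x * (\<phi> x)^2) < 0" using pos[of x] assms by simp
 thus "EX y. DERIV S0 x :> y & y < 0" using S0_deriv[of x] x assms by force
qed

lemma S0_at_zero: "EX qT>0. qT < q1 & (ALL q. 0 < q --> q < qT --> T <= S0 q)" proof -
 define r where "r = q1 / 2"
 have r: "0 < r" "r < q1" using q1 by (auto simp: r_def)
 define qT where "qT = min r (exp (- 2 * (T + \<Psi>0 r)))"
 have "T <= S0 q" if "0 < q" "q < qT" for q proof -
  have "ln q <= ln (exp (- 2 * (T + \<Psi>0 r)))" using that by (subst ln_le_cancel_iff) (auto simp: qT_def)
  hence "ln q <= - 2 * (T + \<Psi>0 r)" by (simp only: ln_exp)
  moreover have "\<Psi>0 q <= \<Psi>0 r" using that r by (intro \<Psi>0_mono) (auto simp: qT_def)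
  ultimately show ?thesis by (simp add: S0_def)
 qed
 thus ?thesis using r by (intro exI[of _ qT]) (auto simp: qT_def)
qed

text \<open>Testing coercivity with the capacitary potential of \<open>{q \<le> q0}\<close> in \<open>{q < q2}\<close>, which equals the
  ground state on \<open>{q \<le> q0}\<close> and has energy of order \<open>1/(S0 q0 - S0 q2)\<close>.\<close>

lemma S0_gap: assumes "0 < q0" "q0 < q2" "q2 < q1" shows "(S0 q0 - S0 q2) * (kap * integral {0..q0} (%q. (\<phi> q)^2)) <= 8"
proof -
 define N where "N = S0 q0 - S0 q2"
 have N: "0 < N" using S0_strict_decreasing[of q0 q2] assms by (simp add: N_def)
 define S where "S q = S0 q - S0 q2" for q
 obtain qT where qT: "0 < qT" "qT < q1" "!!q. 0 < q ==> q < qT ==> S0 q2 + N <= S0 q" using S0_at_zero[of "S0 q2 + N"] by blast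
 let ?W = "%q. if q <= 0 then spline N N else if q < q1 then spline N (S q) else 0"
 let ?W' = "%q. if 0 < q & q < q1 then spline' N (S q) * (- 1 / (2 * q * (\<phi> q)^2)) else 0"
 let ?U = "%q. \<phi> q * ?W q" and ?U' = "%q. \<phi>' q * ?W q + \<phi> q * ?W' q"
 have dS: "DERIV S q :> - 1 / (2 * q * (\<phi> q)^2)" if "0 < q" "q < q1" for q
  unfolding S_def using S0_deriv[OF that] by (auto intro!: derivative_eq_intros)
 have ST: "N <= S q" if "0 < q" "q < qT" for q using qT(3)[OF that] by (simp add: S_def)
 have S\<rho>: "S q <= 0" if "q2 < q" "q < q1" for q using S0_strict_decreasing[of q2 q] assms that by (simp add: S_def)
 have q2: "0 < q2" using assms by simp
 have ff: "rad_C1 ((q2 + q1) / 2) ?U ?U'" "form ?U ?U' = 2 * integral {0..N} (%s. (spline' N s)^2)"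
  by (rule form_factorization[where S = S and T = N and \<rho> = q2 and sg = 0 and qT = qT,
     OF q1 pos dS qT(1,2) ST q2 assms(3) S\<rho> _ spline_deriv spline_facts(1)[OF N]
     spline_facts(4)[OF N] spline_facts(2,3)[OF N]]; (assumption | use N in simp))+
 have "integral {0..N} (%s. (spline' N s)^2) <= integral {0..N} (%s. (2 / N)^2)" proof (rule integral_le)
  show "(%s. (spline' N s)^2) integrable_on {0..N}" by (intro integrable_continuous_real continuous_intros spline_facts N)
  show "(spline' N s)^2 <= (2 / N)^2" for s using spline_facts(6)[OF N, of s] N by (intro abs_le_square_iff[THEN iffD1]) auto
 qed auto
 also have "... = 4 / N" using N by (simp add: power2_eq_square field_simps)
 finally have "form ?U ?U' <= 8 / N" unfolding ff(2) by simp
 moreover have "kap * integral {0..q0} (%q. (\<phi> q)^2) <= form ?U ?U'" proof -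
  have cU: "continuous_on {0..1} ?U" using ff(1) unfolding rad_C1_def by (intro DERIV_continuous_on) blast
  have W1: "?W q = 1" if "0 <= q" "q <= q0" for q proof (cases "q = 0")
   case True thus ?thesis by (simp add: spline_facts(5)[OF N])
  next
   case False
   hence "S0 q >= S0 q0" using S0_strict_decreasing[of q q0] that assms by (cases "q = q0") auto
   hence "N <= S q" by (simp add: S_def N_def)
   hence "spline N (S q) = spline N N" by (rule DERIV_zero_const[rotated]) (metis spline_deriv spline_facts(4)[OF N])
   thus ?thesis using that False assms spline_facts(5)[OF N] by simp
  qed
  have "integral {0..q0} (%q. (\<phi> q)^2) = integral {0..q0} (%q. (?U q)^2)" proof (rule integral_cong)
   show "(\<phi> q)^2 = (?U q)^2" if "q : {0..q0}" for q using that by (simp only: W1 atLeastAtMost_iff mult_1_right)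
  qed
  also have "... <= integral {0..1} (%q. (?U q)^2)" proof (rule integral_subset_le)
   show "(%q. (?U q)^2) integrable_on {0..1}" by (intro integrable_continuous_real continuous_on_power cU)
   show "(%q. (?U q)^2) integrable_on {0..q0}"
    by (intro integrable_continuous_real continuous_on_power continuous_on_subset[OF cU]) (use assms q1 in auto)
  qed (use assms q1 in auto)
  finally have "kap * integral {0..q0} (%q. (\<phi> q)^2) <= kap * integral {0..1} (%q. (?U q)^2)"
   using kap by (intro mult_left_mono) auto
  also have "... <= form ?U ?U'" by (rule coercive[OF ff(1)])
  finally show ?thesis .
 qed
 ultimately have "kap * integral {0..q0} (%q. (\<phi> q)^2) <= 8 / N" by linarith
 thus ?thesis using N by (simp add: N_def[symmetric] field_simps)
qed

lemma \<phi>_mass_pos: assumes "0 < q0" "q0 < q1" shows "0 < integral {0..q0} (%q. (\<phi> q)^2)" proof -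
 have dec: "\<phi> q0 <= \<phi> q" if "0 <= q" "q <= q0" for q
  by (rule \<phi>_decreasing) (use that assms q1 pos in "auto intro: less_imp_le")
 have "0 < q0 * (\<phi> q0)^2" using assms pos[of q0] by simp
 also have "... = integral {0..q0} (%q. (\<phi> q0)^2)" using assms by simp
 also have "... <= integral {0..q0} (%q. (\<phi> q)^2)"
  by (intro integral_le integrable_continuous_real continuous_intros \<phi>_continuous)
   (use assms q1 dec pos[of q0] in "auto intro: power_mono")
 finally show ?thesis .
qed

text \<open>For fixed q0 the gap inequality bounds S0 q0 - S0 q by 8 / m, where m > 0 does not
  depend on q > q0; before q0 monotonicity suffices.\<close>

lemma S0_bounded_below: "EX B. ALL q. 0 < q --> q < q1 --> B <= S0 q" proof -
 define q0 where "q0 = q1 / 2"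
 have q0: "0 < q0" "q0 < q1" using q1 by (auto simp: q0_def)
 define m where "m = kap * integral {0..q0} (%q. (\<phi> q)^2)"
 have m: "0 < m" using \<phi>_mass_pos[OF q0] kap by (simp add: m_def)
 have "S0 q0 - 8 / m <= S0 q" if "0 < q" "q < q1" for q proof (cases "q0 < q")
  case True
  hence "(S0 q0 - S0 q) * m <= 8" unfolding m_def using S0_gap[OF q0(1) True that(2)] by simp
  thus ?thesis using m by (simp add: field_simps)
 next
  case False
  hence "S0 q0 <= S0 q" using S0_strict_decreasing[of q q0] that q0 by (cases "q = q0") auto
  thus ?thesis using m by (smt (verit) divide_pos_pos)
 qed
 thus ?thesis by blast
qed

end

text \<open>At a first zero q1 the function \<phi> would vanish at least linearly, so 1 / (q
  \<phi>^2) would not be integrable up to q1 and S0 would tend to minus infinity there, against its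
  lower bound.\<close>

lemma \<phi>_pos: assumes "0 <= q" "q < 1" shows "0 < \<phi> q" proof (rule ccontr)
 assume "\<not> 0 < \<phi> q"
 define Z where "Z = {x : {0..q}. \<phi> x <= 0}"
 have "closed Z" unfolding Z_def
  by (intro continuous_on_closed_Collect_le continuous_intros \<phi>_continuous) (use assms in auto)
 moreover have "Z ~= {}" "bdd_below Z" using \<open>\<not> 0 < \<phi> q\<close> assms by (auto simp: Z_def intro!: bdd_belowI[of _ 0])
 ultimately have "Inf Z : Z" by (intro closed_contains_Inf)
 define q1 where "q1 = Inf Z"
 have z: "0 <= q1" "q1 <= q" "\<phi> q1 <= 0" using \<open>Inf Z : Z\<close> by (auto simp: Z_def q1_def)
 have q1: "0 < q1" "q1 < 1" using z \<phi>_0 assms by (cases "q1 = 0"; auto)+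
 have pos: "0 < \<phi> x" if "0 <= x" "x < q1" for x proof (rule ccontr)
  assume "\<not> 0 < \<phi> x"
  hence "x : Z" using that z by (auto simp: Z_def)
  thus False using cInf_lower[OF _ \<open>bdd_below Z\<close>] that by (force simp: q1_def)
 qed
 have q1': "q1 <= 1" using q1 by simp
 obtain B where B: "!!x. 0 < x ==> x < q1 ==> B <= S0 x" using S0_bounded_below[OF q1(1) q1' pos] by blast
 have "continuous_on {0..q1} \<phi>'" using q1 by (intro \<phi>'_continuous) auto
 hence "bounded (\<phi>' ` {0..q1})" by (intro compact_imp_bounded compact_continuous_image) auto
 then obtain K where K0: "ALL z:\<phi>' ` {0..q1}. norm z <= K" unfolding bounded_iff by blast
 have K: "abs (\<phi>' x) <= K" if "0 <= x" "x <= q1" for x using K0 that by auto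
 define K1 where "K1 = K + 1"
 have K1: "0 < K1" "!!x. 0 <= x ==> x <= q1 ==> abs (\<phi>' x) <= K1" using K[of 0] K q1 by (force simp: K1_def)+
 have lin: "\<phi> x <= K1 * (q1 - x)" if "0 <= x" "x < q1" for x proof -
  have "EX z. x < z & z < q1 & \<phi> q1 - \<phi> x = (q1 - x) * \<phi>' z"
   by (rule MVT2[OF that(2)]) (use that q1 in "auto intro!: \<phi>_deriv")
  then obtain w where w: "x < w" "w < q1" "\<phi> q1 - \<phi> x = (q1 - x) * \<phi>' w" by blast
  have "\<phi> x <= - ((q1 - x) * \<phi>' w)" using w z by linarith
  also have "... = (q1 - x) * (- \<phi>' w)" by simp
  also have "... <= (q1 - x) * K1" using K1(2)[of w] w that by (intro mult_left_mono) auto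
  finally show ?thesis by (simp add: mult.commute)
 qed
 \<comment> \<open>The added comparison term blows up at q1, yet the sum is still nonincreasing;
   hence S0 falls at least that fast.\<close>
 define F where "F x = S0 x + 1 / (2 * K1^2) * (1 / (q1 - x))" for x
 define p where "p = q1 / 2"
 have dF: "F x <= F p" if "p <= x" "x < q1" for x proof (rule DERIV_nonpos_imp_nonincreasing[OF that(1), of F])
  fix t assume t: "p <= t" "t <= x"
  have t': "0 < t" "t < q1" "t < 1" using t that q1 by (auto simp: p_def)
  have dS: "DERIV S0 t :> - 1 / (2 * t * (\<phi> t)^2)" by (rule S0_deriv[OF q1(1) q1' pos]) (use t' in auto)
  have d1: "DERIV (%x. 1 / (q1 - x)) t :> 1 / (q1 - t)^2" using t' by (auto intro!: derivative_eq_intros simp: power2_eq_square)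
  have "DERIV F t :> - 1 / (2 * t * (\<phi> t)^2) + 1 / (2 * K1^2) * (1 / (q1 - t)^2)"
   unfolding F_def by (intro DERIV_add DERIV_cmult d1 dS)
  hence "DERIV F t :> - 1 / (2 * t * (\<phi> t)^2) + 1 / (2 * K1^2 * (q1 - t)^2)" by simp
  moreover have "1 / (2 * K1^2 * (q1 - t)^2) <= 1 / (2 * t * (\<phi> t)^2)" proof (rule divide_left_mono)
   have "t * (\<phi> t)^2 <= 1 * (K1 * (q1 - t))^2" using lin[of t] pos[of t] t' by (intro mult_mono power_mono) auto
   thus "2 * t * (\<phi> t)^2 <= 2 * K1^2 * (q1 - t)^2" by (simp add: power_mult_distrib)
  qed (use t' pos[of t] K1 in auto)
  ultimately show "EX y. DERIV F t :> y & y <= 0" by (intro exI conjI) auto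
 qed
 \<comment> \<open>M and x are chosen so that the comparison term at x exceeds F p - B.\<close>
 define M where "M = max 1 (F p - B + 1)"
 define x where "x = q1 - min p (1 / (2 * K1^2 * M))"
 have M: "1 <= M" by (simp add: M_def)
 have p: "0 < p" "p < q1" using q1 by (auto simp: p_def)
 have x: "p <= x" "x < q1" "q1 - x <= 1 / (2 * K1^2 * M)" using p M K1(1) by (auto simp: x_def p_def)
 have "M <= 1 / (2 * K1^2 * (q1 - x))" using x M K1(1) by (simp add: field_simps)
 moreover have "B <= S0 x" using B x p by auto
 ultimately have "F x >= B + M" by (simp add: F_def)
 thus False using dF[OF x(1,2)] by (simp add: M_def max_def split: if_splits)
qed

end

section \<open>The Green function as a coordinate\<close>

context coercive_ground_state
begin

lemmas S0_deriv1 = S0_deriv[of 1, OF zero_less_one order_refl \<phi>_pos]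
lemmas S0_strict_decreasing1 = S0_strict_decreasing[of 1, OF zero_less_one order_refl \<phi>_pos]

lemma S0_bdd_below: "bdd_below (S0 ` {0<..<1})" proof -
 obtain B where "!!q. 0 < q ==> q < 1 ==> B <= S0 q" using S0_bounded_below[of 1, OF zero_less_one order_refl \<phi>_pos] by blast
 thus ?thesis by (intro bdd_belowI[of _ B]) auto
qed

text \<open>\<open>A\<close> is the value at the pole of the regular part \<open>S + ln q / 2\<close> of the Green function.\<close>

definition A :: real where "A = - Inf (S0 ` {0<..<1})"
definition S :: "real => real" where "S q = S0 q + A"

lemma S_deriv: "0 < q ==> q < 1 ==> DERIV S q :> - 1 / (2 * q * (\<phi> q)^2)"
 unfolding S_def using S0_deriv1[of q] by (auto intro!: derivative_eq_intros)

lemma S_strict_decreasing: "0 < p ==> p < q ==> q < 1 ==> S q < S p" unfolding S_def using S0_strict_decreasing1[of p q] by simp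

lemma S_decreasing: "0 < p ==> p <= q ==> q < 1 ==> S q <= S p" using S_strict_decreasing[of p q] by (cases "p = q") auto

lemma S_pos: assumes "0 < q" "q < 1" shows "0 < S q" proof -
 obtain r where r: "q < r" "r < 1" using assms dense by blast
 have "Inf (S0 ` {0<..<1}) <= S0 r" using assms r by (intro cInf_lower S0_bdd_below) auto
 thus ?thesis using S_strict_decreasing[of q r] assms r by (simp add: S_def A_def)
qed

lemma S_small: assumes "0 < e" shows "EX \<rho>>0. \<rho> < 1 & (ALL q. \<rho> <= q --> q < 1 --> S q < e)" proof -
 have "EX x:S0 ` {0<..<1}. x < Inf (S0 ` {0<..<1}) + e"
  by (rule cInf_lessD) (use assms in \<open>auto intro!: image_eqI[of _ _ "1/2"]\<close>)
 then obtain \<rho> where \<rho>: "0 < \<rho>" "\<rho> < 1" "S \<rho> < e" by (auto simp: S_def A_def)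
 have "S q < e" if "\<rho> <= q" "q < 1" for q using S_decreasing[of \<rho> q] \<rho> that by simp
 thus ?thesis using \<rho> by blast
qed

lemma S_at_zero: "EX qT>0. qT < 1 & (ALL q. 0 < q --> q < qT --> T <= S q)" proof -
 have "EX qT>0. qT < 1 & (ALL q. 0 < q --> q < qT --> T - A <= S0 q)" by (rule S0_at_zero) (use \<phi>_pos in auto)
 thus ?thesis by (simp add: S_def diff_le_eq)
qed

lemma \<Psi>0_nonneg: "0 <= q ==> q < 1 ==> 0 <= \<Psi>0 q"
 using \<Psi>0_mono[of 1, OF zero_less_one order_refl \<phi>_pos, of 0 q] by (simp add: \<Psi>0_def)

lemma S_le: "0 < q ==> q < 1 ==> S q <= A - ln q / 2" using \<Psi>0_nonneg[of q] by (simp add: S_def S0_def)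

lemma q_le: assumes "0 < q" "q < 1" shows "q <= exp (2 * A - 2 * S q)" proof -
 have "ln q <= 2 * A - 2 * S q" using S_le[OF assms] by simp
 hence "exp (ln q) <= exp (2 * A - 2 * S q)" by (simp only: exp_le_cancel_iff)
 thus ?thesis using assms by simp
qed

lemma S_ge: "EX C>=0. ALL q. 0 < q --> q <= 1 / 2 --> A - ln q / 2 - C * q <= S q" proof -
 have c: "continuous_on {0..1/2} \<psi>" by (rule \<psi>_cont[of 1, OF zero_less_one order_refl \<phi>_pos]) auto
 hence "bounded (\<psi> ` {0..1/2})" by (intro compact_imp_bounded compact_continuous_image) auto
 then obtain C where C: "ALL z:\<psi> ` {0..1/2}. norm z <= C" unfolding bounded_iff by blast
 have C0: "0 <= C" using C by (auto dest!: bspec[of _ _ 0])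
 have "\<Psi>0 q <= C * q" if "0 < q" "q <= 1 / 2" for q proof -
  have "\<Psi>0 q <= integral {0..q} (%_. C)" unfolding \<Psi>0_def
   using C that by (intro integral_le integrable_continuous_real continuous_on_subset[OF c] continuous_intros) (auto simp: abs_le_iff)
  thus ?thesis using that by (simp add: mult.commute)
 qed
 thus ?thesis using C0 by (intro exI[of _ C]) (auto simp: S_def S0_def)
qed

definition Qi :: "real => real" where "Qi s = (THE q. 0 < q & q < 1 & S q = s)"

lemma Qi_S: assumes "0 < q" "q < 1" shows "Qi (S q) = q" unfolding Qi_def proof (rule the_equality)
 fix p assume "0 < p & p < 1 & S p = S q"
 thus "p = q" using S_strict_decreasing[of p q] S_strict_decreasing[of q p] assms by (cases p q rule: linorder_cases) auto
qed (use assms in auto)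

lemma Qi: assumes "0 < s" shows "0 < Qi s" "Qi s < 1" "S (Qi s) = s" proof -
 obtain \<rho> where \<rho>: "0 < \<rho>" "\<rho> < 1" "S \<rho> < s" using S_small[OF assms] by blast
 obtain qT where qT: "0 < qT" "qT < 1" "!!q. 0 < q ==> q < qT ==> s <= S q" using S_at_zero[of s] by blast
 define p where "p = min qT \<rho> / 2"
 have p: "0 < p" "p < qT" "p < \<rho>" using qT \<rho> by (auto simp: p_def)
 have "EX x. p <= x & x <= \<rho> & S x = s" proof (rule IVT2)
  show "ALL x. p <= x & x <= \<rho> --> isCont S x" using p \<rho> by (auto intro!: DERIV_isCont[OF S_deriv])
 qed (use p \<rho> qT(3)[of p] in auto)
 then obtain x where "p <= x" "x <= \<rho>" "S x = s" by blast
 hence "0 < x" "x < 1" "S x = s" using p \<rho> by auto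
 thus "0 < Qi s" "Qi s < 1" "S (Qi s) = s" using Qi_S[of x] by auto
qed

lemma Qi_less_iff: assumes "0 < s" "0 < q" "q < 1" shows "q < Qi s \<longleftrightarrow> s < S q" proof
 assume "q < Qi s"
 thus "s < S q" using S_strict_decreasing[of q "Qi s"] Qi[OF assms(1)] assms by simp
next
 assume "s < S q"
 show "q < Qi s" proof (rule ccontr)
  assume "\<not> q < Qi s"
  hence "S q <= S (Qi s)" using Qi[OF assms(1)] assms by (intro S_decreasing) auto
  thus False using Qi(3)[OF assms(1)] \<open>s < S q\<close> by simp
 qed
qed

lemma Qi_isCont: assumes "0 < s" shows "isCont Qi s" proof -
 have Q: "0 < Qi s" "Qi s < 1" using Qi[OF assms] by auto
 have "isCont Qi (S (Qi s))"
 proof (rule isCont_inverse_function2[where f = S and g = Qi and a = "Qi s / 2" and b = "(Qi s + 1) / 2"])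
  show "Qi (S z) = z" if "Qi s / 2 <= z" "z <= (Qi s + 1) / 2" for z using Q that by (intro Qi_S) auto
  show "isCont S z" if "Qi s / 2 <= z" "z <= (Qi s + 1) / 2" for z by (rule DERIV_isCont, rule S_deriv) (use Q that in auto)
 qed (use Q in auto)
 thus ?thesis using Qi(3)[OF assms] by simp
qed

lemma Qi_deriv: assumes "0 < s" shows "DERIV Qi s :> - (2 * Qi s * (\<phi> (Qi s))^2)" proof -
 have Q: "0 < Qi s" "Qi s < 1" using Qi[OF assms] by auto
 have p: "\<phi> (Qi s) ~= 0" using \<phi>_pos[of "Qi s"] Q by simp
 have "DERIV Qi s :> inverse (- 1 / (2 * Qi s * (\<phi> (Qi s))^2))"
  by (rule DERIV_inverse_function[of S, where a = 0 and b = "s + 1"]) (use S_deriv[OF Q] Q p assms Qi(3) Qi_isCont in auto)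
 thus ?thesis by simp
qed

text \<open>On positive s, \<open>omega\<close> is minus the derivative of \<open>Qi\<close>, hence
  the density of dq in the variable s, and \<open>hh\<close> is \<phi>^2 in that variable.\<close>

definition omega :: "real => real" where "omega s = (if 0 < s then 2 * Qi s * (\<phi> (Qi s))^2 else 0)"
definition hh :: "real => real" where "hh s = (if 0 < s then (\<phi> (Qi s))^2 else 0)"

lemma \<phi>_Qi_isCont: "0 < s ==> isCont (%s. \<phi> (Qi s)) s"
 by (rule isCont_o2[OF Qi_isCont]) (use Qi[of s] in "auto intro!: \<phi>_isCont")

lemma omega_measurable[measurable]: "omega : borel_measurable borel" and hh_measurable[measurable]: "hh : borel_measurable borel"
proof -
 have "(%s. indicator {0<..} s *R (2 * Qi s * (\<phi> (Qi s))^2)) : borel_measurable borel"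
  by (intro borel_measurable_continuous_on_indicator continuous_at_imp_continuous_on ballI
    continuous_intros Qi_isCont \<phi>_Qi_isCont) auto
 also have "(%s. indicator {0<..} s *R (2 * Qi s * (\<phi> (Qi s))^2)) = omega" by (auto simp: omega_def indicator_def)
 finally show "omega : borel_measurable borel" .
 have "(%s. indicator {0<..} s *R ((\<phi> (Qi s))^2)) : borel_measurable borel"
  by (intro borel_measurable_continuous_on_indicator continuous_at_imp_continuous_on ballI
    continuous_intros Qi_isCont \<phi>_Qi_isCont) auto
 also have "(%s. indicator {0<..} s *R ((\<phi> (Qi s))^2)) = hh" by (auto simp: hh_def indicator_def)
 finally show "hh : borel_measurable borel" .
qed

lemma \<phi>_sq_le_1: "0 <= q ==> q < 1 ==> (\<phi> q)^2 <= 1"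
 using \<phi>_le_1[of q] less_imp_le[OF \<phi>_pos] by (intro power_le_one) simp_all

lemma Qi_le_exp: "0 < s ==> Qi s <= exp (2 * A - 2 * s)" using q_le[of "Qi s"] Qi[of s] by simp

lemma omega_le: "omega s <= 2 * exp (2 * A - 2 * s)" proof (cases "0 < s")
 case True
 have "Qi s * (\<phi> (Qi s))^2 <= exp (2 * A - 2 * s) * 1"
  using Qi[OF True] Qi_le_exp[OF True] \<phi>_sq_le_1[of "Qi s"] by (intro mult_mono) auto
 thus ?thesis using True by (simp add: omega_def)
qed (simp add: omega_def)

lemma Qi_tendsto_0: "(Qi \<longlongrightarrow> 0) at_top" proof (rule tendsto_sandwich[OF _ _ tendsto_const])
 show "((%s. exp (2 * A - 2 * s)) \<longlongrightarrow> 0) at_top" by real_asymp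
 show "\<forall>\<^sub>F s in at_top. 0 <= Qi s" using eventually_gt_at_top[of 0] by eventually_elim (use Qi in "auto intro: less_imp_le")
 show "\<forall>\<^sub>F s in at_top. Qi s <= exp (2 * A - 2 * s)" using eventually_gt_at_top[of 0] by eventually_elim (rule Qi_le_exp)
qed

lemma omega_tail: assumes "0 < t"
 shows "(\<integral>\<^sup>+s. ennreal (omega s) * indicator {t..} s \<partial>lborel) = ennreal (Qi t)" proof -
 have "(\<integral>\<^sup>+s. ennreal (omega s) * indicator {t..} s \<partial>lborel) = ennreal (0 - (- Qi t))"
 proof (rule nn_integral_FTC_atLeast)
  show "DERIV (%s. - Qi s) s :> omega s" if "t <= s" for s
   using Qi_deriv[of s] assms that by (auto intro!: derivative_eq_intros simp: omega_def)
  show "0 <= omega s" if "t <= s" for s using Qi[of s] assms that by (simp add: omega_def)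
  show "((%s. - Qi s) \<longlongrightarrow> 0) at_top" using tendsto_minus[OF Qi_tendsto_0] by simp
 qed simp
 thus ?thesis by simp
qed

lemma Qi_tendsto_1: "(%n. Qi (1 / real (Suc n))) ----> 1" proof (rule order_tendstoI)
 fix a :: real assume "a < 1"
 define q where "q = max a (1 / 2)"
 have q: "0 < q" "q < 1" "a <= q" using \<open>a < 1\<close> by (auto simp: q_def)
 have "(%n. 1 / real (Suc n)) ----> 0" using LIMSEQ_inverse_real_of_nat by (simp add: inverse_eq_divide)
 hence "\<forall>\<^sub>F n in sequentially. 1 / real (Suc n) < S q" using S_pos[OF q(1,2)] by (rule order_tendstoD)
 thus "\<forall>\<^sub>F n in sequentially. a < Qi (1 / real (Suc n))" proof eventually_elim
  case (elim n)
  have "0 < 1 / real (Suc n)" by simp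
  hence "q < Qi (1 / real (Suc n))" using Qi_less_iff[of _ q] q elim by blast
  thus ?case using q(3) by (rule le_less_trans[rotated])
 qed
next
 fix a :: real assume "1 < a"
 thus "\<forall>\<^sub>F n in sequentially. Qi (1 / real (Suc n)) < a"
  using Qi(2) by (intro always_eventually allI) (meson less_trans of_nat_0_less_iff zero_less_Suc zero_less_divide_1_iff)
qed

lemma omega_total: "(\<integral>\<^sup>+s. ennreal (omega s) * indicator {0..} s \<partial>lborel) = 1" proof -
 have "(%n. \<integral>\<^sup>+s. ennreal (omega s) * indicator {1 / real (Suc n)..} s \<partial>lborel)
   ----> (\<integral>\<^sup>+s. ennreal (omega s) * indicator {0..} s \<partial>lborel)" proof (rule nn_integral_LIMSEQ)
  show "incseq (%n s. ennreal (omega s) * indicator {1 / real (Suc n)..} s)" proof (rule incseq_SucI, rule le_funI)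
   fix n s
   have "1 / real (Suc (Suc n)) <= 1 / real (Suc n)" by (rule divide_left_mono) auto
   thus "ennreal (omega s) * indicator {1 / real (Suc n)..} s <= ennreal (omega s) * indicator {1 / real (Suc (Suc n))..} s"
    by (auto simp: indicator_def)
  qed
  show "(%n. ennreal (omega s) * indicator {1 / real (Suc n)..} s) ----> ennreal (omega s) * indicator {0..} s" for s
  proof (cases "0 < s")
   case True
   have "(%n. 1 / real (Suc n)) ----> 0" using LIMSEQ_inverse_real_of_nat by (simp add: inverse_eq_divide)
   hence "\<forall>\<^sub>F n in sequentially. 1 / real (Suc n) < s" using True by (rule order_tendstoD)
   hence "\<forall>\<^sub>F n in sequentially. ennreal (omega s) * indicator {1 / real (Suc n)..} s = ennreal (omega s) * indicator {0..} s"
    by eventually_elim (use True in "auto simp: indicator_def")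
   thus ?thesis by (rule tendsto_eventually)
  qed (simp add: omega_def)
 qed measurable
 moreover have "(%n. \<integral>\<^sup>+s. ennreal (omega s) * indicator {1 / real (Suc n)..} s \<partial>lborel) = (%n. ennreal (Qi (1 / real (Suc n))))"
  by (intro ext omega_tail) simp
 ultimately have "(%n. ennreal (Qi (1 / real (Suc n)))) ----> (\<integral>\<^sup>+s. ennreal (omega s) * indicator {0..} s \<partial>lborel)"
  by simp
 moreover have "(%n. ennreal (Qi (1 / real (Suc n)))) ----> ennreal 1" by (intro tendsto_ennrealI Qi_tendsto_1)
 ultimately show ?thesis using LIMSEQ_unique by fastforce
qed

lemma weighted_moser: assumes "0 <= \<gamma>" "\<gamma> <= 2" shows "weighted_moser omega hh A \<gamma>" proof
 show "0 <= omega s" if "0 <= s" for s using Qi(1)[of s] that by (simp add: omega_def less_imp_le)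
 show "hh s <= 1" for s using Qi[of s] \<phi>_sq_le_1[of "Qi s"] by (cases "0 < s") (simp_all add: hh_def less_imp_le)
qed (use assms omega_le omega_total in "auto simp: hh_def")

lemma weighted_moser_asymptotics: "EX K s0. weighted_moser_asymptotics omega hh A 2 K s0" proof -
 obtain C where C: "0 <= C" "!!q. 0 < q ==> q <= 1 / 2 ==> A - ln q / 2 - C * q <= S q" using S_ge by blast
 have "continuous_on {0..1/2} chi" by (rule chi_continuous) auto
 hence "bounded (chi ` {0..1/2})" by (intro compact_imp_bounded compact_continuous_image) auto
 then obtain M where M: "ALL z:chi ` {0..1/2}. norm z <= M" unfolding bounded_iff by blast
 have M0: "0 <= M" using M by (auto dest!: bspec[of _ _ 0])
 have ph: "1 - 2 * M * q <= (\<phi> q)^2" if "0 < q" "q <= 1 / 2" for q proof -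
  have "q * chi q <= q * M" using M that by (intro mult_left_mono) (auto simp: abs_le_iff)
  hence "1 - M * q <= \<phi> q" using \<phi>_chi[of q] that by (simp add: mult.commute)
  moreover have "2 * \<phi> q - 1 <= (\<phi> q)^2" using zero_le_power2[of "\<phi> q - 1"] by (simp add: power2_diff)
  ultimately show ?thesis by linarith
 qed
 \<comment> \<open>C and M measure the errors of S and of \<phi>^2 in units of q; the factor exp
   (2A) converts q into exp (- 2 s).\<close>
 define K where "K = (2 * C + 2 * M) * exp (2 * A)"
 define s0 where "s0 = S (1 / 2)"
 have K0: "0 <= K" using C M0 by (simp add: K_def)
 have s0: "0 < s0" unfolding s0_def by (rule S_pos) auto
 have main: "2 * exp (2 * A - 2 * s) * (1 - K * exp (- 2 * s)) <= omega s & 1 - K * exp (- 2 * s) <= hh s" if s: "s0 <= s" for s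
 proof -
  have sp: "0 < s" using s s0 by simp
  define q where "q = Qi s"
  have q: "0 < q" "q < 1" "S q = s" using Qi[OF sp] by (auto simp: q_def)
  have q2: "q <= 1 / 2" using S_strict_decreasing[of "1/2" q] q s by (force simp: s0_def)
  have Kq: "(2 * C + 2 * M) * q <= K * exp (- 2 * s)" proof -
   have "(2 * C + 2 * M) * q <= (2 * C + 2 * M) * exp (2 * A - 2 * s)"
    using Qi_le_exp[OF sp] C M0 by (intro mult_left_mono) (auto simp: q_def)
   thus ?thesis by (simp add: K_def exp_diff exp_minus field_simps)
  qed
  have "2 * A - 2 * s - 2 * C * q <= ln q" using C(2)[OF q(1) q2] q(3) by simp
  hence "exp (2 * A - 2 * s - 2 * C * q) <= exp (ln q)" by (simp only: exp_le_cancel_iff)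
  hence qge: "exp (2 * A - 2 * s) * exp (- (2 * C * q)) <= q" using q by (simp flip: exp_add)
  have f: "1 - (2 * C + 2 * M) * q <= exp (- (2 * C * q)) * (\<phi> q)^2" proof (cases "1 - 2 * M * q <= 0")
   case True
   have "0 <= C * q" using C q by simp
   hence "1 - (2 * C + 2 * M) * q <= 0" using True by (simp add: algebra_simps)
   also have "0 <= exp (- (2 * C * q)) * (\<phi> q)^2" by simp
   finally show ?thesis .
  next
   case False
   have "0 <= (2 * C * q) * (2 * M * q)" using C M0 q by simp
   hence "1 - (2 * C + 2 * M) * q <= (1 - 2 * C * q) * (1 - 2 * M * q)" by (simp add: algebra_simps)
   also have "... <= exp (- (2 * C * q)) * (1 - 2 * M * q)"
    using False exp_ge_add_one_self[of "- (2 * C * q)"] by (intro mult_right_mono) auto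
   also have "... <= exp (- (2 * C * q)) * (\<phi> q)^2" using ph[OF q(1) q2] by (intro mult_left_mono) auto
   finally show ?thesis .
  qed
  have "2 * exp (2 * A - 2 * s) * (1 - K * exp (- 2 * s)) <= 2 * exp (2 * A - 2 * s) * (exp (- (2 * C * q)) * (\<phi> q)^2)"
   using f Kq by (intro mult_left_mono) auto
  also have "... = 2 * (exp (2 * A - 2 * s) * exp (- (2 * C * q))) * (\<phi> q)^2" by simp
  also have "... <= 2 * q * (\<phi> q)^2" using qge by (intro mult_right_mono mult_left_mono) auto
  finally have 1: "2 * exp (2 * A - 2 * s) * (1 - K * exp (- 2 * s)) <= omega s" using sp by (simp add: omega_def q_def)
  have "2 * M * q <= (2 * C + 2 * M) * q" using C q by (intro mult_right_mono) auto
  hence "1 - K * exp (- 2 * s) <= hh s" using ph[OF q(1) q2] Kq sp by (simp add: hh_def q_def)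
  with 1 show ?thesis by blast
 qed
 have "weighted_moser_asymptotics omega hh A 2 K s0"
  unfolding weighted_moser_asymptotics_def weighted_moser_asymptotics_axioms_def proof (intro conjI allI impI)
  show "weighted_moser omega hh A 2" by (rule weighted_moser) auto
  show "0 < omega s" "0 < hh s" if "0 < s" for s using Qi[OF that] \<phi>_pos[of "Qi s"] that by (auto simp: omega_def hh_def)
 qed (use K0 main in auto)
 thus ?thesis by blast
qed

lemma maximizer: assumes "0 <= \<gamma>" "\<gamma> <= 2" shows "EX y. admissible y &
  weighted_moser.J omega hh \<gamma> y = (SUP y\<in>{y. admissible y}. weighted_moser.J omega hh \<gamma> y) &
  weighted_moser.J omega hh \<gamma> y < \<infinity>" proof -
 interpret weighted_moser omega hh A \<gamma> by (rule weighted_moser[OF assms])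
 show ?thesis proof (rule maximizer_exists)
  assume g: "\<gamma> = 2"
  obtain K s0 where "weighted_moser_asymptotics omega hh A 2 K s0" using weighted_moser_asymptotics by blast
  from weighted_moser_asymptotics.J_exceeds_concentration_level[OF this]
  show "EX y. admissible y & ennreal (1 + exp (1 + 2 * A)) < J y" unfolding g by blast
 qed
qed

end

subsection \<open>Test functions on the disc and their completion\<close>

lemma disc_sets[simp]: "disc : sets lebesgue" "disc : sets borel" by auto

lemma disc_nn_integral:
 fixes h :: "plane => ennreal"
 shows "(\<integral>\<^sup>+x. h x \<partial>disc_measure) = (\<integral>\<^sup>+x. h x * indicator disc x \<partial>lborel)"
 by (simp add: nn_integral_restrict_space nn_integral_completion)

lemma borel_to_disc:
 fixes h :: "plane => 'a::topological_space" assumes "h : borel_measurable borel" shows "h : borel_measurable disc_measure"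
proof -
 have "h : borel_measurable lborel" using assms by simp
 hence "h : borel_measurable lebesgue" by (rule measurable_completion)
 thus ?thesis by (rule measurable_restrict_space1)
qed

lemma disc_integral:
 fixes h :: "plane => real" assumes "h : borel_measurable borel"
 shows "(\<integral>x. h x \<partial>disc_measure) = (LBINT x. indicator disc x * h x)" proof -
 have m: "(%x. indicator disc x * h x) : borel_measurable lborel"
  using assms by (intro borel_measurable_times borel_measurable_indicator) auto
 show ?thesis by (simp add: integral_restrict_space integral_completion[OF m])
qed

lemma disc_integrable:
 fixes h :: "plane => real" assumes "h : borel_measurable borel"
 shows "integrable disc_measure h \<longleftrightarrow> integrable lborel (%x. indicator disc x * h x)" proof -
 have m: "(%x. indicator disc x * h x) : borel_measurable lborel"
  using assms by (intro borel_measurable_times borel_measurable_indicator) auto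
 show ?thesis by (simp add: integrable_restrict_space integrable_completion[OF m])
qed

section \<open>Compactly supported C^1 functions and integration by parts\<close>

lemma compact_support_integrable:
 fixes h :: "'a::euclidean_space => real" assumes "continuous_on UNIV h" "!!x. R <= norm x ==> h x = 0"
 shows "integrable lborel h" proof -
 have "integrable lborel (%x. indicator (cball 0 R) x *R h x)" using borel_integrable_compact[of "cball 0 R" h] assms(1)
  by (simp add: set_integrable_def continuous_on_subset)
 also have "(%x. indicator (cball 0 R) x *R h x) = h" using assms(2) by (auto simp: indicator_def fun_eq_iff)
 finally show ?thesis .
qed

lemma continuous_times_weight:
 fixes f w :: "plane => 'a::real_normed_algebra"
 assumes "continuous_on UNIV f" "!!x. R <= norm x ==> f x = 0" "R < 1" "continuous_on disc w"
 shows "continuous_on UNIV (%x. f x * w x)" proof -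
 have o: "open (- cball (0::plane) R)" by auto
 have "continuous_on (disc \<union> - cball 0 R) (%x. f x * w x)" proof (rule continuous_on_open_Un[OF open_ball o])
  show "continuous_on disc (%x. f x * w x)" by (intro continuous_intros assms(4) continuous_on_subset[OF assms(1)]) auto
  have "continuous_on (- cball 0 R) (%_::plane. 0::'a)" by simp
  thus "continuous_on (- cball 0 R) (%x. f x * w x)" by (rule continuous_on_eq) (use assms(2) in auto)
 qed
 moreover have "disc \<union> - cball 0 R = UNIV" using assms(3) by auto
 ultimately show ?thesis by simp
qed

text \<open>C^1 functions with compact support in the disc, paired with their gradient. The smoothed
  polarizations constructed later belong to this class but need not be smooth.\<close>

definition C1c :: "(plane => real) => (plane => plane) => bool" where
 "C1c f G \<longleftrightarrow> (ALL x. (f has_derivative (%h. G x \<bullet> h)) (at x)) & continuous_on UNIV G &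
  (EX R<1. ALL x. R <= norm x --> f x = 0 & G x = 0)"

lemma C1c_continuous: assumes C: "C1c f G" shows "continuous_on S f" "continuous_on S G" proof -
 show "continuous_on S f"
  by (rule continuous_at_imp_continuous_on) (use C in "auto simp: C1c_def dest: has_derivative_continuous")
 show "continuous_on S G" using C continuous_on_subset[of UNIV G S] by (auto simp: C1c_def)
qed

lemma C1c_support: assumes "C1c f G"
 obtains R where "0 < R" "R < 1" "!!x. R <= norm x ==> f x = 0" "!!x. R <= norm x ==> G x = 0" proof -
 obtain R where "R < 1" "!!x. R <= norm x ==> f x = 0 & G x = 0" using assms unfolding C1c_def by blast
 thus thesis by (intro that[of "max R (1/2)"]) auto
qed

lemma C1c_bounded_gradient: assumes "C1c f G" obtains L where "0 < L" "!!x. norm (G x) <= L" proof -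
 obtain R where R: "0 < R" "R < 1" "!!x. R <= norm x ==> G x = 0" using C1c_support[OF assms] by metis
 have "bounded (G ` cball 0 1)" by (intro compact_imp_bounded compact_continuous_image C1c_continuous[OF assms] compact_cball)
 then obtain B where B: "ALL z:G ` cball 0 1. norm z <= B" unfolding bounded_iff by blast
 have "norm (G x) <= max B 1" for x proof (cases "norm x <= 1")
  case True
  thus ?thesis using B by (auto simp: le_max_iff_disj)
 qed (use R in auto)
 thus thesis by (intro that[of "max B 1"]) auto
qed

lemma C1c_lipschitz: assumes "C1c f G" "!!x. norm (G x) <= L" shows "abs (f x - f y) <= L * norm (x - y)" proof -
 have "norm (f x - f y) <= L * norm (x - y)" proof (rule differentiable_bound[of UNIV f "%x h. G x \<bullet> h"])
  show "(f has_derivative (\<bullet>) (G x)) (at x)" for x using assms(1) by (auto simp: C1c_def)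
  show "onorm ((\<bullet>) (G x)) <= L" for x proof (rule onorm_le)
   fix h
   have "norm (G x \<bullet> h) <= norm (G x) * norm h" using Cauchy_Schwarz_ineq2[of "G x" h] by simp
   also have "... <= L * norm h" by (intro mult_right_mono assms(2)) auto
   finally show "norm (G x \<bullet> h) <= L * norm h" .
  qed
 qed auto
 thus ?thesis by simp
qed

lemma lborel_integral_translate:
 fixes f :: "'a::euclidean_space => real" assumes "f : borel_measurable borel" shows "(LBINT x. f (c + x)) = (LBINT x. f x)"
proof -
 have "(LBINT x. f x) = (\<integral>x. f x \<partial>distr lborel borel ((+) c))" by (simp add: lborel_distr_plus)
 also have "... = (LBINT x. f (c + x))" by (rule integral_distr) (use assms in auto)
 finally show ?thesis by simp
qed

text \<open>Difference quotients have integral 0 by translation invariance and converge, under a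
  common bound, to the directional derivative. Applied componentwise this yields the divergence
  theorem.\<close>

lemma integral_partial_zero: assumes C: "C1c F G" and b: "norm b = 1" shows "(LBINT x. G x \<bullet> b) = 0" proof -
 obtain R where R: "0 < R" "R < 1" "!!x. R <= norm x ==> F x = 0" using C1c_support[OF C] by metis
 obtain L where L: "0 < L" "!!x. norm (G x) <= L" using C1c_bounded_gradient[OF C] by blast
 define t where "t n = 1 / real (Suc n)" for n
 define D where "D n x = (F (t n *R b + x) - F x) / t n" for n x
 have t: "0 < t n" "t n <= 1" for n by (auto simp: t_def)
 have Fc: "continuous_on UNIV F" by (rule C1c_continuous[OF C])
 have Fm[measurable]: "F : borel_measurable borel" by (rule borel_measurable_continuous_onI[OF Fc])
 have Fi: "integrable lborel F" by (rule compact_support_integrable[OF Fc R(3)])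
 have "(LBINT x. D n x) = 0" for n proof -
  have "integrable lborel (%x. F (t n *R b + x))" proof (rule compact_support_integrable[of _ 3])
   show "continuous_on UNIV (%x. F (t n *R b + x))" by (rule continuous_on_compose2[OF Fc]) (auto intro!: continuous_intros)
   fix x :: plane assume "3 <= norm x"
   moreover have "norm x - norm (t n *R b) <= norm (t n *R b + x)" by (metis add.commute norm_diff_ineq)
   ultimately show "F (t n *R b + x) = 0" using b t[of n] R by (intro R(3)) simp
  qed
  thus ?thesis unfolding D_def using lborel_integral_translate[OF Fm, of "t n *R b"] Fi by simp
 qed
 moreover have "(%n. (LBINT x. D n x)) ----> (LBINT x. G x \<bullet> b)"
 proof (rule integral_dominated_convergence[where w = "%x. L * indicator (cball 0 3) x"])
  show "integrable lborel (%x::plane. L * indicator (cball 0 3) x)"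
   by (intro Bochner_Integration.integrable_mult_right integrable_real_indicator)
    (use emeasure_bounded_finite[OF bounded_cball[of "0::plane" 3]] in auto)
  show "AE x in lborel. norm (D n x) <= L * indicator (cball 0 3) x" for n proof (rule AE_I2)
   fix x :: plane
   show "norm (D n x) <= L * indicator (cball 0 3) x" proof (cases "norm x <= 3")
    case True
    have "abs (F (t n *R b + x) - F x) <= L * norm (t n *R b + x - x)" by (rule C1c_lipschitz[OF C L(2)])
    hence "abs (F (t n *R b + x) - F x) <= L * t n" using b t[of n] by simp
    thus ?thesis using True t[of n] by (simp add: D_def divide_le_eq)
   next
    case False
    moreover have "norm x - norm (t n *R b) <= norm (t n *R b + x)" by (metis add.commute norm_diff_ineq)
    ultimately have "F (t n *R b + x) = 0" "F x = 0" using b t[of n] R by (auto intro!: R(3))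
    thus ?thesis using L(1) by (simp add: D_def)
   qed
  qed
  show "AE x in lborel. (%n. D n x) ----> G x \<bullet> b" proof (rule AE_I2)
   fix x :: plane
   have "((%s. F (s *R b + x)) has_derivative (%s. G (0 *R b + x) \<bullet> (s *R b))) (at 0)"
    by (rule has_derivative_compose[of "%s. s *R b + x" "%s. s *R b" 0 UNIV F])
     (use C in "auto simp: C1c_def intro!: derivative_eq_intros")
   hence "DERIV (%s. F (s *R b + x)) 0 :> G x \<bullet> b" by (simp add: has_field_derivative_def mult_commute_abs)
   hence "((%s. (F (s *R b + x) - F x) / s) \<longlongrightarrow> G x \<bullet> b) (at 0)" by (simp add: DERIV_def)
   moreover have "filterlim t (at 0) sequentially"
    unfolding filterlim_at using LIMSEQ_inverse_real_of_nat by (auto simp: t_def[abs_def] inverse_eq_divide)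
   ultimately show "(%n. D n x) ----> G x \<bullet> b" unfolding D_def by (rule filterlim_compose)
  qed
  have "continuous_on UNIV G" by (rule C1c_continuous[OF C])
  thus "(%x. G x \<bullet> b) : borel_measurable lborel" by (auto intro!: borel_measurable_continuous_onI continuous_intros)
  show "D n : borel_measurable lborel" for n unfolding D_def by measurable
 qed
 ultimately show ?thesis by (simp add: LIMSEQ_const_iff)
qed

definition hardy :: "(plane => real) => plane => real" where "hardy f x = (f x)^2 / (1 - (norm x)^2)^2"

lemma norm_lt_1_sq: "norm (x::plane) < 1 ==> (norm x)^2 < 1" by (simp add: abs_square_less_1)

lemma inverse_weight_continuous: "continuous_on disc (%x::plane. 1 / (1 - (norm x)^2) ^ k)"
 by (intro continuous_intros) (use norm_lt_1_sq in fastforce)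

lemma C1c_weighted_continuous: assumes "C1c f G" shows "continuous_on UNIV (%x. (f x)^2 * (1 / (1 - (norm x)^2) ^ k))" proof -
 obtain R where "0 < R" "R < 1" "!!x. R <= norm x ==> f x = 0" using C1c_support[OF assms] by metis
 thus ?thesis by (intro continuous_times_weight[of _ R] inverse_weight_continuous continuous_intros C1c_continuous[OF assms]) auto
qed

lemma hardy_continuous: "C1c f G ==> continuous_on UNIV (hardy f)"
 using C1c_weighted_continuous[of f G 2] by (simp add: hardy_def[abs_def])

lemma C1c_product_integrable:
 fixes h :: "plane => real" assumes "C1c f G" "continuous_on UNIV h" "!!x. f x = 0 ==> h x = 0" shows "integrable lborel h"
proof -
 obtain R where "0 < R" "R < 1" "!!x. R <= norm x ==> f x = 0" using C1c_support[OF assms(1)] by metis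
 thus ?thesis by (intro compact_support_integrable[OF assms(2), of R] assms(3))
qed

lemma C1c_integrable: assumes "C1c f G"
 shows "integrable lborel (%x. (norm (G x))^2)" "integrable lborel (hardy f)" "integrable lborel (%x. (f x)^2)" proof -
 obtain R where R: "0 < R" "R < 1" "!!x. R <= norm x ==> f x = 0" "!!x. R <= norm x ==> G x = 0" using C1c_support[OF assms] by metis
 show "integrable lborel (%x. (norm (G x))^2)"
  by (rule compact_support_integrable[of _ R]) (use R in "auto intro!: continuous_intros C1c_continuous[OF assms]")
 show "integrable lborel (hardy f)" by (rule C1c_product_integrable[OF assms hardy_continuous[OF assms]]) (simp add: hardy_def)
 show "integrable lborel (%x. (f x)^2)"
  by (rule C1c_product_integrable[OF assms]) (auto intro!: continuous_intros C1c_continuous[OF assms])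
qed

definition Q0 :: "(plane => real) => (plane => plane) => real" where "Q0 f G = (LBINT x. (norm (G x))^2 - hardy f x)"

lemma disc_integral_support:
 fixes h :: "plane => real" assumes "h : borel_measurable borel" "!!x. 1 <= norm x ==> h x = 0"
 shows "(\<integral>x. h x \<partial>disc_measure) = (LBINT x. h x)" unfolding disc_integral[OF assms(1)]
proof (rule Bochner_Integration.integral_cong[OF refl])
 show "indicator disc x * h x = h x" for x using assms(2)[of x] by (cases "norm x < 1") (simp_all add: not_less)
qed

text \<open>The divergence theorem applied to \<open>f\<^sup>2 x / (1 - \<bar>x\<bar>\<^sup>2)\<close> turns the integral of
  \<open>\<bar>\<nabla>f + f x / (1 - \<bar>x\<bar>\<^sup>2)\<bar>\<^sup>2\<close> into \<open>Q0 f - \<integral> f\<^sup>2/(1 - \<bar>x\<bar>\<^sup>2)\<close>.\<close>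

lemma hardy_inequality: assumes C: "C1c f G" shows "(LBINT x. (f x)^2) <= Q0 f G" proof -
 define w where "w x = 1 - (norm x)^2" for x :: plane
 obtain R where R: "0 < R" "R < 1" "!!x. R <= norm x ==> f x = 0" "!!x. R <= norm x ==> G x = 0" using C1c_support[OF C] by metis
 \<comment> \<open>\<open>F b\<close> is the component along b of the field f^2 x / (1 - |x|^2) and
   \<open>GF b\<close> its gradient, so that summing \<open>GF b x \<bullet> b\<close> over the
   basis gives the divergence.\<close>
 define F where "F b x = (f x)^2 * ((x \<bullet> b) / w x)" for b x
 define GF where "GF b x = (2 * f x * ((x \<bullet> b) / w x)) *R G x + ((f x)^2 / w x) *R b + ((f x)^2 * (2 * (x \<bullet> b) / (w x)^2)) *R x" for b x
 have wpos: "0 < w x" if "norm x < 1" for x using norm_lt_1_sq[OF that] by (simp add: w_def)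
 have CF: "C1c (F b) (GF b)" for b unfolding C1c_def proof (intro conjI allI)
  fix x
  show "(F b has_derivative (%h. GF b x \<bullet> h)) (at x)" proof (cases "norm x < 1")
   case True
   have df: "(f has_derivative (%h. G x \<bullet> h)) (at x)" using C by (simp add: C1c_def)
   have dw: "(w has_derivative (%h. - (2 * (x \<bullet> h)))) (at x)"
    unfolding w_def power2_norm_eq_inner by (auto intro!: derivative_eq_intros simp: inner_commute)
   have d1: "((%x. (f x)^2) has_derivative (%h. 2 * f x * (G x \<bullet> h))) (at x)"
    using has_derivative_power[OF df, of 2] by (simp add: ac_simps)
   have d2: "((%x. x \<bullet> b) has_derivative (%h. h \<bullet> b)) (at x)" by (auto intro!: derivative_eq_intros)
   have d3: "((%x. (x \<bullet> b) / w x) has_derivative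
     (%h. ((h \<bullet> b) * w x - (x \<bullet> b) * (- (2 * (x \<bullet> h)))) / (w x * w x))) (at x)"
    by (rule has_derivative_divide'[OF d2 dw]) (use wpos[OF True] in simp)
   have "(F b has_derivative (%h. (f x)^2 * (((h \<bullet> b) * w x - (x \<bullet> b) * (- (2 * (x \<bullet> h)))) / (w x * w x))
     + 2 * f x * (G x \<bullet> h) * ((x \<bullet> b) / w x))) (at x)" unfolding F_def by (rule has_derivative_mult[OF d1 d3])
   thus ?thesis proof (rule has_derivative_eq_rhs, intro ext)
    fix h
    have e: "((h \<bullet> b) * w x - (x \<bullet> b) * (- (2 * (x \<bullet> h)))) / (w x * w x)
      = (h \<bullet> b) / w x + 2 * (x \<bullet> b) / (w x)^2 * (x \<bullet> h)"
     using wpos[OF True] by (simp add: add_divide_distrib power2_eq_square)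
    show "(f x)^2 * (((h \<bullet> b) * w x - (x \<bullet> b) * (- (2 * (x \<bullet> h)))) / (w x * w x))
     + 2 * f x * (G x \<bullet> h) * ((x \<bullet> b) / w x) = GF b x \<bullet> h"
     unfolding e GF_def by (simp add: inner_add_left inner_commute[of h b] distrib_left ac_simps)
   qed
  next
   case False
   have z: "F b y = 0" if "y : - cball 0 R" for y using that R(3)[of y] by (simp add: F_def)
   have "((%_. 0) has_derivative (%_. 0)) (at x)" by simp
   hence "(F b has_derivative (%_. 0)) (at x)"
    by (rule has_derivative_transform_within_open[of _ _ _ _ "- cball 0 R"]) (use z False R(2) in auto)
   moreover have "GF b x = 0" using R(3,4)[of x] R(2) False by (simp add: GF_def)
   ultimately show ?thesis by simp
  qed
 next
  have "continuous_on (disc \<union> - cball 0 R) (GF b)" proof (rule continuous_on_open_Un)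
   show "continuous_on disc (GF b)" unfolding GF_def w_def
    using wpos by (intro continuous_intros C1c_continuous[OF C]) (auto simp: w_def less_imp_neq[THEN not_sym] dest: norm_lt_1_sq)
   have "continuous_on (- cball 0 R) (%_::plane. 0::plane)" by simp
   thus "continuous_on (- cball 0 R) (GF b)" by (rule continuous_on_eq) (use R(3,4) in "auto simp: GF_def")
  qed auto
  moreover have "disc \<union> - cball 0 R = UNIV" using R(2) by auto
  ultimately show "continuous_on UNIV (GF b)" by simp
 next
  show "EX R<1. ALL x. R <= norm x --> F b x = 0 & GF b x = 0" by (rule exI[of _ R]) (use R in "auto simp: F_def GF_def")
 qed
 have int0: "(LBINT x. (\<Sum>b\<in>Basis. GF b x \<bullet> b)) = 0"
  and intS: "integrable lborel (%x. \<Sum>b\<in>Basis. GF b x \<bullet> b)" proof -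
  have i: "integrable lborel (%x. GF b x \<bullet> b)" for b proof (rule compact_support_integrable[of _ R])
   show "continuous_on UNIV (%x. GF b x \<bullet> b)" by (intro continuous_on_inner C1c_continuous(2)[OF CF] continuous_on_const)
  qed (simp add: GF_def R(3,4))
  show "integrable lborel (%x. \<Sum>b\<in>Basis. GF b x \<bullet> b)" by (intro Bochner_Integration.integrable_sum i)
  show "(LBINT x. (\<Sum>b\<in>Basis. GF b x \<bullet> b)) = 0"
   by (subst Bochner_Integration.integral_sum) (use i integral_partial_zero[OF CF] in auto)
 qed
 have S: "(\<Sum>b\<in>Basis. GF b x \<bullet> b) = 2 * f x * (G x \<bullet> x) / w x + 2 * (f x)^2 / (w x)^2" if "norm x < 1" for x
 proof -
  have 1: "(\<Sum>b\<in>Basis. (x \<bullet> b) * (G x \<bullet> b)) = G x \<bullet> x" by (simp add: euclidean_inner[of "G x" x] mult.commute)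
  have 2: "(\<Sum>b\<in>Basis. (x \<bullet> b) * (x \<bullet> b)) = (norm x)^2" by (simp add: euclidean_inner[of x x] power2_norm_eq_inner)
  have "(\<Sum>b\<in>Basis. GF b x \<bullet> b) = (\<Sum>b\<in>Basis. (2 * f x / w x) * ((x \<bullet> b) * (G x \<bullet> b)) + (f x)^2 / w x
    + (2 * (f x)^2 / (w x)^2) * ((x \<bullet> b) * (x \<bullet> b)))"
   by (rule sum.cong) (auto simp: GF_def inner_add_left ac_simps)
  also have "... = (2 * f x / w x) * (G x \<bullet> x) + 2 * ((f x)^2 / w x) + (2 * (f x)^2 / (w x)^2) * (norm x)^2"
   by (simp only: sum.distrib sum_distrib_left[symmetric] 1 2) simp
  also have "... = 2 * f x * (G x \<bullet> x) / w x + 2 * (f x)^2 / (w x)^2" proof -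
   have "2 * ((f x)^2 / w x) + (2 * (f x)^2 / (w x)^2) * (norm x)^2 = (2 * (f x)^2 / (w x)^2) * (w x + (norm x)^2)"
    using wpos[OF that] by (simp add: field_simps power2_eq_square)
   also have "w x + (norm x)^2 = 1" by (simp add: w_def)
   finally show ?thesis by simp
  qed
  finally show ?thesis .
 qed
 have pt: "(f x)^2 - (\<Sum>b\<in>Basis. GF b x \<bullet> b) <= (norm (G x))^2 - hardy f x" for x proof (cases "norm x < 1")
  case True
  let ?w = "w x"
  have w: "0 < ?w" "?w <= 1" using wpos[OF True] by (auto simp: w_def)
  have "0 <= (norm (G x + (f x / ?w) *R x))^2" by simp
  also have "... = (norm (G x))^2 + 2 * f x * (G x \<bullet> x) / ?w + (f x / ?w)^2 * (norm x)^2"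
   unfolding power2_norm_eq_inner by (simp add: inner_add_left inner_add_right inner_commute power2_eq_square)
  also have "(f x / ?w)^2 * (norm x)^2 = (f x)^2 / ?w^2 - (f x)^2 / ?w" proof -
   have n: "(norm x)^2 = 1 - ?w" by (simp add: w_def)
   show ?thesis unfolding n using w by (simp add: power_divide field_simps power2_eq_square)
  qed
  finally have "(f x)^2 / ?w - (\<Sum>b\<in>Basis. GF b x \<bullet> b) <= (norm (G x))^2 - hardy f x"
   unfolding S[OF True] hardy_def w_def[symmetric] by simp
  moreover have "(f x)^2 <= (f x)^2 / ?w" using w by (simp add: pos_le_divide_eq mult_left_le)
  ultimately show ?thesis by linarith
 next
  case False
  thus ?thesis using R by (simp add: GF_def hardy_def)
 qed
 have "(LBINT x. (f x)^2) = (LBINT x. (f x)^2 - (\<Sum>b\<in>Basis. GF b x \<bullet> b))"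
  by (subst Bochner_Integration.integral_diff[OF C1c_integrable(3)[OF C] intS]) (simp add: int0)
 also have "... <= Q0 f G" unfolding Q0_def
  by (intro integral_mono Bochner_Integration.integrable_diff C1c_integrable[OF C] intS pt)
 finally show ?thesis .
qed

section \<open>Smooth functions and test functions\<close>

definition smooth :: "(plane => real) => bool" where "smooth f \<longleftrightarrow> (ALL k. C_k k f)"

abbreviation partial :: "(plane => real) => plane => plane => real" where "partial f b \<equiv> %x. frechet_derivative f (at x) b"

lemma smooth_differentiable: "smooth f ==> f differentiable (at x)" unfolding smooth_def by (drule spec[of _ "Suc 0"]) simp

lemma smooth_partial: "smooth f ==> b : Basis ==> smooth (partial f b)"
 unfolding smooth_def by (rule allI, drule_tac x = "Suc k" in spec) simp

text \<open>Iterated derivatives never leave a set closed under partial derivatives, so smoothness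
  is proved by naming such a set instead of computing derivatives of order k.\<close>

lemma smooth_coinduct: assumes "f : X" "!!g x. g : X ==> g differentiable (at x)" "!!g b. g : X ==> b : Basis ==> partial g b : X"
 shows "smooth f" proof -
 have "C_k k g" if "g : X" for k g using that proof (induction k arbitrary: g)
  case 0
  thus ?case using assms(2) by (auto intro!: continuous_at_imp_continuous_on differentiable_imp_continuous_within)
 next
  case (Suc k)
  thus ?case using assms(2,3) by simp
 qed
 with assms(1) show ?thesis by (simp add: smooth_def)
qed

lemma smooth_continuous: "smooth f ==> continuous_on S f"
 using smooth_differentiable by (auto intro!: continuous_at_imp_continuous_on differentiable_imp_continuous_within)

lemma smooth_has_derivative: "smooth f ==> (f has_derivative frechet_derivative f (at x)) (at x)"
 using smooth_differentiable frechet_derivative_works by blast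

lemma frechet_lincomb:
 fixes f g :: "plane => real" and a b :: real assumes "f differentiable (at x)" "g differentiable (at x)"
 shows "((%x. a * f x + b * g x) has_derivative
   (%h. a * frechet_derivative f (at x) h + b * frechet_derivative g (at x) h)) (at x)"
 using assms unfolding frechet_derivative_works 
 by (intro has_derivative_add bounded_linear.has_derivative[OF bounded_linear_mult_right])

lemma frechet_lincomb_eq:
 fixes f g :: "plane => real" and a b :: real assumes "f differentiable (at x)" "g differentiable (at x)"
 shows "frechet_derivative (%x. a * f x + b * g x) (at x)
   = (%h. a * frechet_derivative f (at x) h + b * frechet_derivative g (at x) h)"
 by (rule frechet_derivative_at[OF frechet_lincomb[OF assms], symmetric])

lemma smooth_lincomb:
 fixes a b :: real assumes "smooth f" "smooth g" shows "smooth (%x. a * f x + b * g x)"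
proof (rule smooth_coinduct[where X = "{(%x. a * f x + b * g x) | f g. smooth f & smooth g}"])
 fix h :: "plane => real" and x and c :: plane
 assume "h : {(%x. a * f x + b * g x) | f g. smooth f & smooth g}"
 then obtain f g where h: "h = (%x. a * f x + b * g x)" "smooth f" "smooth g" by blast
 show "h differentiable (at x)"
  unfolding h(1) using frechet_lincomb[of f x g a b] smooth_differentiable h(2,3) by (auto simp: differentiable_def)
 show "partial h c : {(%x. a * f x + b * g x) | f g. smooth f & smooth g}" if "c : Basis" proof -
  have "partial h c = (%x. a * partial f c x + b * partial g c x)"
   unfolding h(1) using smooth_differentiable h(2,3) by (auto simp: frechet_lincomb_eq)
  thus ?thesis using smooth_partial[OF h(2) that] smooth_partial[OF h(3) that]
   by (intro CollectI exI[of _ "partial f c"] exI[of _ "partial g c"]) simp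
 qed
qed (use assms in blast)

lemma test_smooth: "f : test_functions ==> smooth f" by (simp add: test_functions_def smooth_def)

lemma test_supportI: assumes "smooth f" "R < 1" "!!x. R <= norm x ==> f x = 0" shows "f : test_functions" proof -
 have sub: "closure {x. f x ~= 0} \<subseteq> cball 0 R"
  by (rule closure_minimal) (use assms(3) in "force simp: not_le[symmetric]")+
 hence "compact (closure {x. f x ~= 0})" by (meson bounded_cball bounded_subset closed_closure compact_eq_bounded_closed)
 moreover have "cball (0::plane) R \<subseteq> disc" using assms(2) by auto
 ultimately show ?thesis using assms(1) sub by (auto simp: test_functions_def smooth_def)
qed

lemma test_support: assumes "f : test_functions"
 obtains R where "0 < R" "R < 1" "!!x. R <= norm x ==> f x = 0" proof -
 let ?K = "closure {x. f x ~= 0}"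
 have K: "compact ?K" "?K \<subseteq> disc" using assms by (auto simp: test_functions_def)
 have "EX R. 0 < R & R < 1 & (ALL x:?K. norm x < R)" proof (cases "?K = {}")
  case False
  have "continuous_on ?K norm" by (intro continuous_intros)
  then obtain m where m: "m : ?K" "!!y. y : ?K ==> norm y <= norm m" using continuous_attains_sup[OF K(1) False] by blast
  have "norm m < 1" using m K by auto
  thus ?thesis using m by (intro exI[of _ "(norm m + 1) / 2"]) (force intro: add_nonneg_pos)
 qed (auto intro!: exI[of _ "1/2"])
 then obtain R where R: "0 < R" "R < 1" "ALL x:?K. norm x < R" by blast
 have "f x = 0" if "R <= norm x" for x using R(3) that closure_subset[of "{x. f x ~= 0}"] by force
 with R show thesis by (intro that[of R]) auto
qed

lemma test_lincomb:
 fixes a b :: real assumes f: "f : test_functions" and g: "g : test_functions" shows "(%x. a * f x + b * g x) : test_functions"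
proof -
 obtain R where R: "R < 1" "!!x. R <= norm x ==> f x = 0" using test_support[OF f] by metis
 obtain T where T: "T < 1" "!!x. T <= norm x ==> g x = 0" using test_support[OF g] by metis
 show ?thesis by (rule test_supportI[of _ "max R T"]) (use R T smooth_lincomb[OF f[THEN test_smooth] g[THEN test_smooth]] in auto)
qed

lemma test_scale: "f : test_functions ==> (%x. a * f x) : test_functions" using test_lincomb[of f f a 0] by simp

lemma test_diff: "f : test_functions ==> g : test_functions ==> (%x. f x - g x) : test_functions"
 using test_lincomb[of f g 1 "-1"] by simp

lemma gradient_inner: assumes "(f has_derivative D) (at x)" shows "gradient f x \<bullet> h = D h" proof -
 have D: "frechet_derivative f (at x) = D" by (rule frechet_derivative_at[OF assms, symmetric])
 interpret linear D using assms by (rule has_derivative_linear)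
 have "gradient f x \<bullet> h = (\<Sum>b\<in>Basis. (h \<bullet> b) *R D b)"
  by (simp add: gradient_def D inner_sum_left inner_commute[of h] mult.commute)
 also have "... = D (\<Sum>b\<in>Basis. (h \<bullet> b) *R b)" by (simp add: sum scale)
 finally show ?thesis by (simp add: euclidean_representation)
qed

lemma gradient_Basis: "b : Basis ==> gradient f x \<bullet> b = partial f b x"
 by (simp add: gradient_def inner_sum_left inner_Basis if_distrib[of "%t. _ * t"] cong: if_cong)

lemma gradient_unique: "(f has_derivative (%h. G \<bullet> h)) (at x) ==> gradient f x = G"
 using gradient_inner[of f "%h. G \<bullet> h" x] by (intro vector_eq_rdot[THEN iffD1]) auto

lemma C1c_gradient: "C1c f G ==> gradient f = G" by (rule ext, rule gradient_unique) (simp add: C1c_def)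

lemma smooth_gradient_continuous: "smooth f ==> continuous_on S (gradient f)"
 unfolding gradient_def[abs_def] by (intro continuous_intros smooth_continuous smooth_partial)

lemma smooth_has_gradient: "smooth f ==> (f has_derivative (%h. gradient f x \<bullet> h)) (at x)"
 using smooth_has_derivative[of f x] gradient_inner[OF smooth_has_derivative[of f x]] by simp

lemma derivative_zero_off_support:
 fixes f :: "plane => real" assumes "!!x. R <= norm x ==> f x = 0" "R < norm x" shows "(f has_derivative (%_. 0)) (at x)" proof -
 have "((%_. 0) has_derivative (%_. 0)) (at x)" by simp
 thus ?thesis by (rule has_derivative_transform_within_open[of _ _ _ _ "- cball 0 R"]) (use assms in auto)
qed

lemma smooth_C1c: assumes "smooth f" "R < 1" "!!x. R <= norm x ==> f x = 0" shows "C1c f (gradient f)" unfolding C1c_def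
proof (intro conjI allI smooth_has_gradient smooth_gradient_continuous assms(1))
 have "gradient f x = 0" if "(R + 1) / 2 <= norm x" for x
  by (rule gradient_unique) (use derivative_zero_off_support[where x = x, OF assms(3)] that assms(2) in simp)
 thus "EX R<1. ALL x. R <= norm x --> f x = 0 & gradient f x = 0" using assms(2,3) by (intro exI[of _ "(R + 1) / 2"]) auto
qed

lemma test_C1c: assumes "f : test_functions" shows "C1c f (gradient f)" proof -
 obtain R where "R < 1" "!!x. R <= norm x ==> f x = 0" using test_support[OF assms] by metis
 thus ?thesis by (intro smooth_C1c[of f R] test_smooth assms)
qed

lemma test_partial: assumes f: "f : test_functions" and b: "b : Basis" shows "partial f b : test_functions" proof -
 obtain R where R: "R < 1" "!!x. R <= norm x ==> f x = 0" using test_support[OF f] by metis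
 have "partial f b x = 0" if "(R + 1) / 2 <= norm x" for x proof -
  have "(f has_derivative (%_. 0)) (at x)" by (rule derivative_zero_off_support[OF R(2)]) (use that R(1) in auto)
  thus ?thesis using frechet_derivative_at by metis
 qed
 thus ?thesis by (rule test_supportI[OF smooth_partial[OF test_smooth[OF f] b], of "(R + 1) / 2", rotated]) (use R(1) in auto)
qed

section \<open>The quadratic form and its closability\<close>

definition Q :: "(plane => real) => real" where "Q f = Q0 f (gradient f)"

definition B :: "(plane => real) => (plane => real) => real" where
 "B f g = (LBINT x. gradient f x \<bullet> gradient g x - f x * g x / (1 - (norm x)^2)^2)"

lemma Q_ge: "f : test_functions ==> (LBINT x. (f x)^2) <= Q f" unfolding Q_def by (rule hardy_inequality[OF test_C1c])

lemma Q_nonneg: "f : test_functions ==> 0 <= Q f" by (rule order_trans[OF Bochner_Integration.integral_nonneg Q_ge]) auto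

lemma test_norm_eq: assumes "f : test_functions" shows "test_norm f = sqrt (Q f)" proof -
 note C = test_C1c[OF assms]
 obtain R where R: "R < 1" "!!x. R <= norm x ==> f x = 0" "!!x. R <= norm x ==> gradient f x = 0" using C1c_support[OF C] by metis
 have 1: "(\<integral>x. (norm (gradient f x))^2 \<partial>disc_measure) = (LBINT x. (norm (gradient f x))^2)"
  by (rule disc_integral_support)
   (use R C1c_continuous(2)[OF C] in "auto intro!: borel_measurable_continuous_onI continuous_intros")
 have 2: "(\<integral>x. hardy f x \<partial>disc_measure) = (LBINT x. hardy f x)" by (rule disc_integral_support)
   (use R hardy_continuous[OF C] in "auto intro!: borel_measurable_continuous_onI simp: hardy_def")
 show ?thesis unfolding test_norm_def Q_def Q0_def
  using 1 2 Bochner_Integration.integral_diff[OF C1c_integrable(1,2)[OF C]] by (simp add: hardy_def[abs_def])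
qed

lemma test_norm_sq: "f : test_functions ==> (test_norm f)^2 = Q f" by (simp add: test_norm_eq Q_nonneg)

lemma B_integrable: assumes f: "f : test_functions" and g: "g : test_functions"
 shows "integrable lborel (%x. gradient f x \<bullet> gradient g x)" "integrable lborel (%x. f x * g x / (1 - (norm x)^2)^2)"
proof -
 note Cf = test_C1c[OF f] and Cg = test_C1c[OF g]
 obtain R where R: "R < 1" "!!x. R <= norm x ==> f x = 0" "!!x. R <= norm x ==> gradient f x = 0"
  using C1c_support[OF Cf] by metis
 show "integrable lborel (%x. gradient f x \<bullet> gradient g x)" by (rule compact_support_integrable[of _ R])
   (use R in "auto intro!: continuous_intros C1c_continuous[OF Cf] C1c_continuous[OF Cg]")
 have "continuous_on UNIV (%x. (f x * g x) * (1 / (1 - (norm x)^2)^2))" by (rule continuous_times_weight[of _ R])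
   (use R in "auto intro!: inverse_weight_continuous continuous_intros C1c_continuous(1)[OF Cf] C1c_continuous(1)[OF Cg]")
 thus "integrable lborel (%x. f x * g x / (1 - (norm x)^2)^2)" by (intro compact_support_integrable[of _ R]) (use R in auto)
qed

lemma gradient_lincomb:
 fixes a b :: real assumes "f : test_functions" "g : test_functions"
 shows "gradient (%x. a * f x + b * g x) x = a *R gradient f x + b *R gradient g x" proof (rule gradient_unique)
 show "((%x. a * f x + b * g x) has_derivative (%h. (a *R gradient f x + b *R gradient g x) \<bullet> h)) (at x)"
  using smooth_has_gradient[OF test_smooth[OF assms(1)], of x] smooth_has_gradient[OF test_smooth[OF assms(2)], of x]
  by (auto intro!: derivative_eq_intros simp: inner_add_left)
qed

lemma Q_lincomb:
 fixes a b :: real assumes f: "f : test_functions" and g: "g : test_functions"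
 shows "Q (%x. a * f x + b * g x) = a^2 * Q f + 2 * a * b * B f g + b^2 * Q g" proof -
 let ?W = "%x::plane. (1 - (norm x)^2)^2"
 have Qi: "integrable lborel (%x. (norm (gradient f x))^2 - hardy f x)" if "f : test_functions" for f
  by (intro Bochner_Integration.integrable_diff C1c_integrable[OF test_C1c[OF that]])
 have Bi: "integrable lborel (%x. gradient f x \<bullet> gradient g x - f x * g x / ?W x)"
  by (intro Bochner_Integration.integrable_diff B_integrable f g)
 have "Q (%x. a * f x + b * g x) = (LBINT x. a^2 * ((norm (gradient f x))^2 - hardy f x)
   + (2 * a * b) * (gradient f x \<bullet> gradient g x - f x * g x / ?W x) + b^2 * ((norm (gradient g x))^2 - hardy g x))"
  unfolding Q_def Q0_def gradient_lincomb[OF f g] proof (rule Bochner_Integration.integral_cong[OF refl])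
  fix x :: plane
  have "(norm (a *R gradient f x + b *R gradient g x))^2
    = a^2 * (norm (gradient f x))^2 + 2 * a * b * (gradient f x \<bullet> gradient g x) + b^2 * (norm (gradient g x))^2"
   unfolding power2_norm_eq_inner by (simp add: inner_add_left inner_add_right inner_commute power2_eq_square algebra_simps)
  moreover have "hardy (%x. a * f x + b * g x) x = a^2 * hardy f x + 2 * a * b * (f x * g x / ?W x) + b^2 * hardy g x"
   unfolding hardy_def by (simp add: power2_sum power_mult_distrib add_divide_distrib ac_simps)
  ultimately show "(norm (a *R gradient f x + b *R gradient g x))^2 - hardy (%x. a * f x + b * g x) x
   = a^2 * ((norm (gradient f x))^2 - hardy f x) + (2 * a * b) * (gradient f x \<bullet> gradient g x - f x * g x / ?W x)
   + b^2 * ((norm (gradient g x))^2 - hardy g x)" by (simp add: right_diff_distrib)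
 qed
 also have "... = a^2 * Q f + 2 * a * b * B f g + b^2 * Q g" unfolding Q_def Q0_def B_def using Qi[OF f] Qi[OF g] Bi by simp
 finally show ?thesis .
qed

lemma Q_scale: "f : test_functions ==> Q (%x. a * f x) = a^2 * Q f" using Q_lincomb[of f f a 0] by simp

lemma B_sq_le: assumes f: "f : test_functions" and g: "g : test_functions" shows "(B f g)^2 <= Q f * Q g" proof (cases "Q g = 0")
 case False
 hence pos: "0 < Q g" using Q_nonneg[OF g] by simp
 have "0 <= Q (%x. Q g * f x + (- B f g) * g x)" by (intro Q_nonneg test_lincomb f g)
 also have "... = Q g * (Q f * Q g - (B f g)^2)" unfolding Q_lincomb[OF f g] by (simp add: power2_eq_square algebra_simps)
 finally show ?thesis using pos by (simp add: zero_le_mult_iff)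
next
 case True
 show ?thesis proof (rule ccontr)
  assume "\<not> ?thesis"
  hence nz: "B f g ~= 0" using True by auto
  \<comment> \<open>When Q g = 0 the form is affine along g; this coefficient makes its value
    -1.\<close>
  have "0 <= Q (%x. 1 * f x + (- (Q f + 1) / (2 * B f g)) * g x)" by (intro Q_nonneg test_lincomb f g)
  also have "... = - 1" unfolding Q_lincomb[OF f g] using nz True by (simp add: field_simps)
  finally show False by simp
 qed
qed

lemma test_norm_triangle: assumes f: "f : test_functions" and g: "g : test_functions"
 shows "abs (test_norm f - test_norm g) <= test_norm (%x. f x - g x)" proof -
 have "Q (%x. f x - g x) = Q f - 2 * B f g + Q g" using Q_lincomb[OF f g, of 1 "-1"] by simp
 moreover have "B f g <= sqrt (Q f) * sqrt (Q g)" using B_sq_le[OF f g] by (metis real_le_rsqrt real_sqrt_mult)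
 ultimately have "(sqrt (Q f) - sqrt (Q g))^2 <= Q (%x. f x - g x)" using Q_nonneg[OF f] Q_nonneg[OF g] by (simp add: power2_diff)
 hence "abs (sqrt (Q f) - sqrt (Q g)) <= sqrt (Q (%x. f x - g x))" by (intro real_le_rsqrt) simp
 thus ?thesis using test_norm_eq f g test_diff by simp
qed

text \<open>Closability: testing against a fixed smooth \<open>g\<close>, both derivatives can be moved to \<open>g\<close>, so \<open>B f g\<close>
  is controlled by the \<open>L\<^sup>2\<close>-norm of \<open>f\<close>.\<close>

lemma B_eq_integral: assumes g: "g : test_functions" shows "EX k. continuous_on UNIV k & integrable lborel (%x. (k x)^2) &
  (ALL f:test_functions. integrable lborel (%x. f x * k x) & B f g = (LBINT x. f x * k x))" proof -
 define lap where "lap x = (\<Sum>b\<in>Basis. partial (partial g b) b x)" for x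
 define k where "k x = - lap x - g x * (1 / (1 - (norm x)^2)^2)" for x
 obtain R where R: "R < 1" "!!x. R <= norm x ==> g x = 0" using C1c_support[OF test_C1c[OF g]] by metis
 have lapc: "continuous_on UNIV lap" unfolding lap_def by (intro continuous_intros smooth_continuous test_smooth test_partial g)
 have kc: "continuous_on UNIV k" unfolding k_def
  by (intro continuous_intros lapc continuous_times_weight[of g R] inverse_weight_continuous
    smooth_continuous test_smooth g R)
 have "ALL b:Basis. EX R<1. ALL x. R <= norm x --> partial (partial g b) b x = 0"
  using test_support[OF test_partial[OF test_partial[OF g]]] by metis
 then obtain Rb where Rb: "!!b. b : Basis ==> Rb b < 1 & (ALL x. Rb b <= norm x --> partial (partial g b) b x = 0)" by metis
 have k0: "k x = 0" if "1 <= norm x" for x using that R Rb by (force simp: k_def lap_def intro!: sum.neutral)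
 have k2: "integrable lborel (%x. (k x)^2)"
  by (rule compact_support_integrable[of _ 1]) (auto simp: k0 intro!: continuous_intros kc)
 have main: "integrable lborel (%x. f x * k x) & B f g = (LBINT x. f x * k x)" if f: "f : test_functions" for f proof
  note Cf = test_C1c[OF f]
  obtain T where T: "T < 1" "!!x. T <= norm x ==> f x = 0" "!!x. T <= norm x ==> gradient f x = 0"
   using C1c_support[OF Cf] by metis
  show ifk: "integrable lborel (%x. f x * k x)"
   by (rule C1c_product_integrable[OF Cf]) (auto intro!: continuous_intros kc C1c_continuous[OF Cf])
  define GF where "GF b x = f x *R gradient (partial g b) x + partial g b x *R gradient f x" for b x
  have zero: "(LBINT x. GF b x \<bullet> b) = 0" and ii: "integrable lborel (%x. GF b x \<bullet> b)" if b: "b : Basis" for b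
  proof -
   note p = test_partial[OF g b]
   have CC: "C1c (%x. f x * partial g b x) (GF b)" unfolding C1c_def proof (intro conjI allI)
    show "((%x. f x * partial g b x) has_derivative (%h. GF b x \<bullet> h)) (at x)" for x
     by (rule has_derivative_eq_rhs[OF has_derivative_mult[OF smooth_has_gradient[OF test_smooth[OF f]] smooth_has_gradient[OF test_smooth[OF p]]]])
      (simp add: GF_def inner_add_left mult.commute)
    show "continuous_on UNIV (GF b)" unfolding GF_def
     by (intro continuous_intros smooth_continuous smooth_gradient_continuous test_smooth f p)
    show "EX R<1. ALL x. R <= norm x --> f x * partial g b x = 0 & GF b x = 0" using T by (intro exI[of _ T]) (auto simp: GF_def)
   qed
   show "(LBINT x. GF b x \<bullet> b) = 0" by (rule integral_partial_zero[OF CC]) (use b in simp)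
   show "integrable lborel (%x. GF b x \<bullet> b)"
    by (rule compact_support_integrable[of _ T, OF continuous_on_inner[OF C1c_continuous(2)[OF CC] continuous_on_const]])
     (simp add: GF_def T)
  qed
  have S: "(\<Sum>b\<in>Basis. GF b x \<bullet> b) = f x * lap x + gradient f x \<bullet> gradient g x" for x proof -
   have "(\<Sum>b\<in>Basis. GF b x \<bullet> b) = (\<Sum>b\<in>Basis. f x * partial (partial g b) b x + (gradient f x \<bullet> b) * (gradient g x \<bullet> b))"
    by (rule sum.cong) (auto simp: GF_def inner_add_left gradient_Basis)
   also have "... = f x * lap x + gradient f x \<bullet> gradient g x"
    by (simp only: sum.distrib sum_distrib_left lap_def euclidean_inner[of "gradient f x" "gradient g x"])
   finally show ?thesis .
  qed
  have "B f g = (LBINT x. f x * k x + (\<Sum>b\<in>Basis. GF b x \<bullet> b))"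
   unfolding B_def S by (rule Bochner_Integration.integral_cong) (auto simp: k_def algebra_simps)
  also have "... = (LBINT x. f x * k x)" using ifk ii zero by (simp add: Bochner_Integration.integral_sum)
  finally show "B f g = (LBINT x. f x * k x)" .
 qed
 show ?thesis using kc k2 main by blast
qed

lemma integral_mult_le:
 fixes f k :: "'a => real"
 assumes "integrable M (%x. (f x)^2)" "integrable M (%x. (k x)^2)" "integrable M (%x. f x * k x)" "0 < \<eta>"
 shows "abs (\<integral>x. f x * k x \<partial>M) <= (\<integral>x. (f x)^2 \<partial>M) / \<eta> + \<eta> * (\<integral>x. (k x)^2 \<partial>M)"
proof -
 have pt: "abs (a * b) <= a^2 / \<eta> + \<eta> * b^2" for a b :: real proof -
  have "0 <= (abs a / sqrt \<eta> - sqrt \<eta> * abs b)^2" by simp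
  also have "... = a^2 / \<eta> - 2 * (abs a * abs b) + \<eta> * b^2"
   using assms(4) by (simp add: power2_diff power_divide power_mult_distrib)
  finally have "2 * (abs a * abs b) <= a^2 / \<eta> + \<eta> * b^2" by simp
  moreover have "0 <= abs a * abs b" by simp
  ultimately show ?thesis unfolding abs_mult by linarith
 qed
 have "abs (\<integral>x. f x * k x \<partial>M) <= (\<integral>x. abs (f x * k x) \<partial>M)" by (rule integral_abs_bound)
 also have "... <= (\<integral>x. (f x)^2 / \<eta> + \<eta> * (k x)^2 \<partial>M)"
  by (intro integral_mono pt Bochner_Integration.integrable_add integrable_divide_zero
    integrable_mult_right integrable_abs assms)
 also have "... = (\<integral>x. (f x)^2 \<partial>M) / \<eta> + \<eta> * (\<integral>x. (k x)^2 \<partial>M)" using assms by simp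
 finally show ?thesis .
qed

text \<open>Take g = F N far out: Q (F n - g) is small by the Cauchy property, and B (F n) g is
  small as an L^2 pairing of F n with a fixed function; quadratic identities then bound Q (F n).
  This is why the norm of an element of the completion depends only on its limit function.\<close>

lemma closability: assumes F: "!!n. F n : test_functions"
  and cauchy: "!!e. 0 < e ==> EX N. ALL m>=N. ALL n>=N. test_norm (%x. F m x - F n x) < e"
  and L2: "(%n. (LBINT x. (F n x)^2)) ----> 0" shows "(%n. Q (F n)) ----> 0" proof (rule order_tendstoI)
 fix a :: real assume "a < 0"
 thus "\<forall>\<^sub>F n in sequentially. a < Q (F n)"
  using Q_nonneg[OF F] by (intro always_eventually) (auto intro: less_le_trans)
next
 fix a :: real assume a: "0 < a"
 obtain N where N: "!!m n. m >= N ==> n >= N ==> test_norm (%x. F m x - F n x) < sqrt (a / 4)"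
  using cauchy[of "sqrt (a / 4)"] a by (auto simp del: real_sqrt_divide)
 define g where "g = F N"
 have g: "g : test_functions" using F by (simp add: g_def)
 obtain k where k: "continuous_on UNIV k" "integrable lborel (%x. (k x)^2)"
  "!!f. f : test_functions ==> integrable lborel (%x. f x * k x)" "!!f. f : test_functions ==> B f g = (LBINT x. f x * k x)"
  using B_eq_integral[OF g] by blast
 define I where "I = (LBINT x. (k x)^2) + 1"
 have I: "0 < I" unfolding I_def by (rule add_nonneg_pos[OF Bochner_Integration.integral_nonneg]) auto
 define \<eta> where "\<eta> = a / (8 * I)"
 have \<eta>: "0 < \<eta>" using a I by (simp add: \<eta>_def)
 have "\<forall>\<^sub>F n in sequentially. (LBINT x. (F n x)^2) < \<eta> * (a / 8)"
  by (rule order_tendstoD(2)[OF L2]) (use a \<eta> in simp)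
 thus "\<forall>\<^sub>F n in sequentially. Q (F n) < a" using eventually_ge_at_top[of N] proof eventually_elim
  case (elim n)
  have 1: "Q (%x. F n x - g x) < a / 4" proof -
   have "sqrt (Q (%x. F n x - g x)) < sqrt (a / 4)"
    using N[of n N] elim test_norm_eq[OF test_diff[OF F g]] by (simp add: g_def del: real_sqrt_divide)
   thus ?thesis by (simp only: real_sqrt_less_iff)
  qed
  have 2: "B (F n) g < a / 4" proof -
   have "abs (B (F n) g) <= (LBINT x. (F n x)^2) / \<eta> + \<eta> * (LBINT x. (k x)^2)"
    unfolding k(4)[OF F] by (rule integral_mult_le[OF C1c_integrable(3)[OF test_C1c[OF F]] k(2) k(3)[OF F] \<eta>])
   also have "(LBINT x. (F n x)^2) / \<eta> < a / 8" using elim(1) \<eta> by (simp add: divide_less_eq mult.commute)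
   also have "\<eta> * (LBINT x. (k x)^2) <= \<eta> * I" using \<eta> by (intro mult_left_mono) (auto simp: I_def)
   also have "\<eta> * I = a / 8" using I by (simp add: \<eta>_def)
   finally show ?thesis by simp
  qed
  \<comment> \<open>Positivity of this combination bounds the mixed term B (F n) (F n - g) by Q (F
    n) / 4 + Q (F n - g).\<close>
  have "0 <= Q (%x. 1 * F n x + (-2) * (F n x - g x))" by (intro Q_nonneg test_lincomb F test_diff g)
  also have "... = Q (F n) - 4 * B (F n) (%x. F n x - g x) + 4 * Q (%x. F n x - g x)"
   unfolding Q_lincomb[OF F test_diff[OF F g]] by simp
  finally have 3: "4 * B (F n) (%x. F n x - g x) <= Q (F n) + 4 * Q (%x. F n x - g x)" by simp
  have "Q g = Q (%x. 1 * F n x + (-1) * (F n x - g x))" by simp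
  also have "... = Q (F n) - 2 * B (F n) (%x. F n x - g x) + Q (%x. F n x - g x)"
   unfolding Q_lincomb[OF F test_diff[OF F g]] by simp
  finally have 4: "Q g = Q (F n) - 2 * B (F n) (%x. F n x - g x) + Q (%x. F n x - g x)" .
  have 5: "Q (%x. F n x - g x) = Q (F n) - 2 * B (F n) g + Q g" using Q_lincomb[OF F[of n] g, of 1 "-1"] by simp
  show ?case using 1 2 3 4 5 a by linarith
 qed
qed

section \<open>Elements of the completion and their norms\<close>

lemma Lp_space_2: assumes "u : Lp_space 2"
 shows "integrable disc_measure (%x. (u x)^2)" "(Lp_norm 2 u)^2 = (\<integral>x. (u x)^2 \<partial>disc_measure)" proof -
 have e: "abs t powr 2 = t^2" for t :: real by (simp add: powr_numeral)
 show i: "integrable disc_measure (%x. (u x)^2)" using assms by (simp add: Lp_space_def e)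
 have "0 <= (\<integral>x. (u x)^2 \<partial>disc_measure)" by (rule Bochner_Integration.integral_nonneg) auto
 thus "(Lp_norm 2 u)^2 = (\<integral>x. (u x)^2 \<partial>disc_measure)" unfolding Lp_norm_def e by (simp add: powr_half_sqrt)
qed

lemma Lp_norm_2_sq:
 fixes u :: "plane => real" shows "(Lp_norm 2 u)^2 = (\<integral>x. (u x)^2 \<partial>disc_measure)" proof -
 have e: "abs t powr 2 = t^2" for t :: real by (simp add: powr_numeral)
 have "0 <= (\<integral>x. (u x)^2 \<partial>disc_measure)" by (rule Bochner_Integration.integral_nonneg) auto
 thus ?thesis unfolding Lp_norm_def e by (simp add: powr_half_sqrt)
qed

lemma test_borel: "f : test_functions ==> f : borel_measurable borel"
 by (rule borel_measurable_continuous_onI[OF smooth_continuous[OF test_smooth]])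

lemma test_sq_integral: assumes f: "f : test_functions"
 shows "(\<integral>x. (f x)^2 \<partial>disc_measure) = (LBINT x. (f x)^2)" "integrable disc_measure (%x. (f x)^2)" proof -
 obtain R where R: "R < 1" "!!x. R <= norm x ==> f x = 0" using test_support[OF f] by metis
 have m: "(%x. (f x)^2) : borel_measurable borel" using test_borel[OF f] by measurable
 show "(\<integral>x. (f x)^2 \<partial>disc_measure) = (LBINT x. (f x)^2)" by (rule disc_integral_support[OF m]) (use R in auto)
 have "(%x. indicator disc x * (f x)^2) = (%x. (f x)^2)" proof
  fix x :: plane
  show "indicator disc x * (f x)^2 = (f x)^2" using R(1) R(2)[of x] by (cases "norm x < 1") auto
 qed
 thus "integrable disc_measure (%x. (f x)^2)" using disc_integrable[OF m] C1c_integrable(3)[OF test_C1c[OF f]] by simp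
qed

lemma represents_test: "represents F u ==> F n : test_functions" by (simp add: represents_def test_Cauchy_def)

lemma represents_Cauchy: "represents F u ==> 0 < e ==> EX N. ALL m>=N. ALL n>=N. test_norm (%x. F m x - F n x) < e"
 by (simp add: represents_def test_Cauchy_def)

lemma represents_L2: assumes "represents F u"
 shows "u : Lp_space 2" "(%n. \<integral>x. (F n x - u x)^2 \<partial>disc_measure) ----> 0" proof -
 show "u : Lp_space 2" using assms by (simp add: represents_def)
 have "(%n. Lp_norm 2 (%x. F n x - u x)) ----> 0" using assms by (simp add: represents_def)
 hence "(%n. (Lp_norm 2 (%x. F n x - u x))^2) ----> 0^2" by (rule tendsto_power)
 thus "(%n. \<integral>x. (F n x - u x)^2 \<partial>disc_measure) ----> 0" by (simp add: Lp_norm_2_sq)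
qed

lemma square_sum_le: "((a::real) - b)^2 <= 2 * a^2 + 2 * b^2"
 using zero_le_power2[of "a + b"] by (simp add: power2_sum power2_diff)

lemma diff_square_integrable: assumes "u : Lp_space 2" "w : Lp_space 2" shows "integrable disc_measure (%x. (w x - u x)^2)"
proof -
 have m: "u : borel_measurable disc_measure" "w : borel_measurable disc_measure" using assms by (auto simp: Lp_space_def)
 show ?thesis proof (rule Bochner_Integration.integrable_bound)
  show "integrable disc_measure (%x. 2 * (w x)^2 + 2 * (u x)^2)"
   using Lp_space_2(1)[OF assms(1)] Lp_space_2(1)[OF assms(2)] by auto
  show "(%x. (w x - u x)^2) : borel_measurable disc_measure" using m by measurable
  show "AE x in disc_measure. norm ((w x - u x)^2) <= norm (2 * (w x)^2 + 2 * (u x)^2)" using square_sum_le by (intro AE_I2) auto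
 qed
qed

lemma test_Lp_space: assumes f: "f : test_functions" and p: "0 < p" shows "f : Lp_space p" proof -
 obtain R where R: "R < 1" "!!x. R <= norm x ==> f x = 0" using test_support[OF f] by metis
 note fm = test_borel[OF f]
 have m: "(%x. abs (f x) powr p) : borel_measurable borel" using fm by measurable
 have c: "continuous_on UNIV (%x. abs (f x) powr p)"
  by (rule continuous_on_powr') (use p in "auto intro!: continuous_on_rabs smooth_continuous[OF test_smooth[OF f]]")
 have i: "integrable lborel (%x. abs (f x) powr p)" by (rule compact_support_integrable[OF c, of R]) (use R in auto)
 have "(%x. indicator disc x * abs (f x) powr p) = (%x. abs (f x) powr p)" proof
  fix x :: plane
  show "indicator disc x * abs (f x) powr p = abs (f x) powr p" using R(1) R(2)[of x] by (cases "norm x < 1") auto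
 qed
 thus ?thesis using disc_integrable[OF m] i borel_to_disc[OF fm] by (simp add: Lp_space_def)
qed

lemma test_norm_convergent: assumes R: "represents F u" shows "convergent (%n. test_norm (F n))" proof -
 have "Cauchy (%n. test_norm (F n))" proof (rule metric_CauchyI)
  fix e :: real assume "0 < e"
  then obtain N where N: "ALL m>=N. ALL n>=N. test_norm (%x. F m x - F n x) < e" using represents_Cauchy[OF R] by blast
  show "EX N. ALL m>=N. ALL n>=N. dist (test_norm (F m)) (test_norm (F n)) < e" proof (intro exI allI impI)
   fix m n assume "N <= m" "N <= n"
   hence "test_norm (%x. F m x - F n x) < e" using N by blast
   thus "dist (test_norm (F m)) (test_norm (F n)) < e" unfolding dist_real_def
    using test_norm_triangle[OF represents_test[OF R] represents_test[OF R]] by (rule le_less_trans[rotated])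
  qed
 qed
 thus ?thesis by (simp add: Cauchy_convergent_iff)
qed

lemma B_abs_le: assumes "f : test_functions" "g : test_functions" shows "abs (B f g) <= sqrt (Q f) * sqrt (Q g)"
 using real_sqrt_le_mono[OF B_sq_le[OF assms]] by (simp add: real_sqrt_mult)

text \<open>The difference of the two sequences is energy-Cauchy and tends to 0 in L^2, so
  closability applies. The definite description in \<open>H_norm\<close> thereby becomes
  meaningful.\<close>

lemma represents_same_limit: assumes F: "represents F u" and G: "represents G u" and l: "(%n. test_norm (F n)) ----> l"
 shows "(%n. test_norm (G n)) ----> l" proof -
 define D where "D n x = F n x - G n x" for n x
 have Ft: "F n : test_functions" and Gt: "G n : test_functions" for n using F G by (auto dest: represents_test)
 have Dt: "D n : test_functions" for n unfolding D_def by (rule test_diff[OF Ft Gt])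
 have "(%n. Q (D n)) ----> 0" proof (rule closability[OF Dt])
  fix e :: real assume e: "0 < e"
  obtain N where N: "ALL m>=N. ALL n>=N. test_norm (%x. F m x - F n x) < e / 2"
   using represents_Cauchy[OF F, of "e / 2"] e by auto
  obtain M where M: "ALL m>=M. ALL n>=M. test_norm (%x. G m x - G n x) < e / 2"
   using represents_Cauchy[OF G, of "e / 2"] e by auto
  show "EX N. ALL m>=N. ALL n>=N. test_norm (%x. D m x - D n x) < e" proof (intro exI allI impI)
   fix m n assume mn: "max N M <= m" "max N M <= n"
   let ?f = "%x. F m x - F n x" and ?g = "%x. G m x - G n x"
   have fg: "?f : test_functions" "?g : test_functions" by (intro test_diff Ft Gt)+
   have e: "(%x. D m x - D n x) = (%x. 1 * ?f x + (-1) * ?g x)" by (auto simp: D_def)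
   have "Q (%x. D m x - D n x) = Q ?f - 2 * B ?f ?g + Q ?g" unfolding e Q_lincomb[OF fg] by simp
   moreover have "- B ?f ?g <= sqrt (Q ?f) * sqrt (Q ?g)" using B_abs_le[OF fg] by linarith
   ultimately have "Q (%x. D m x - D n x) <= (sqrt (Q ?f) + sqrt (Q ?g))^2"
    using Q_nonneg[OF fg(1)] Q_nonneg[OF fg(2)] by (simp add: power2_sum)
   hence "sqrt (Q (%x. D m x - D n x)) <= sqrt (Q ?f) + sqrt (Q ?g)"
    using Q_nonneg[OF fg(1)] Q_nonneg[OF fg(2)] by (intro real_le_lsqrt) auto
   moreover have "test_norm ?f < e / 2" "test_norm ?g < e / 2" using N M mn by simp_all
   hence "sqrt (Q ?f) < e / 2" "sqrt (Q ?g) < e / 2" by (simp_all only: test_norm_eq[OF fg(1)] test_norm_eq[OF fg(2)])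
   ultimately show "test_norm (%x. D m x - D n x) < e" unfolding test_norm_eq[OF test_diff[OF Dt Dt]] by simp
  qed
 next
  note u = represents_L2(1)[OF F]
  have b: "(LBINT x. (D n x)^2) <= 2 * (\<integral>x. (F n x - u x)^2 \<partial>disc_measure) + 2 * (\<integral>x. (G n x - u x)^2 \<partial>disc_measure)" for n
  proof -
   note iF = diff_square_integrable[OF u test_Lp_space[OF Ft[of n]]] and iG = diff_square_integrable[OF u test_Lp_space[OF Gt[of n]]]
   have "(LBINT x. (D n x)^2) = (\<integral>x. (D n x)^2 \<partial>disc_measure)" by (simp add: test_sq_integral[OF Dt])
   also have "... <= (\<integral>x. 2 * (F n x - u x)^2 + 2 * (G n x - u x)^2 \<partial>disc_measure)" proof (rule integral_mono)
    show "integrable disc_measure (%x. 2 * (F n x - u x)^2 + 2 * (G n x - u x)^2)" using iF iG by auto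
    show "(D n x)^2 <= 2 * (F n x - u x)^2 + 2 * (G n x - u x)^2" for x
     using square_sum_le[of "F n x - u x" "G n x - u x"] by (simp add: D_def)
   qed (rule test_sq_integral[OF Dt])
   also have "... = 2 * (\<integral>x. (F n x - u x)^2 \<partial>disc_measure) + 2 * (\<integral>x. (G n x - u x)^2 \<partial>disc_measure)"
    using iF iG by simp
   finally show ?thesis .
  qed
  have z: "(%n. 2 * (\<integral>x. (F n x - u x)^2 \<partial>disc_measure) + 2 * (\<integral>x. (G n x - u x)^2 \<partial>disc_measure)) ----> 2 * 0 + 2 * 0"
   by (intro tendsto_intros represents_L2(2)[OF F] represents_L2(2)[OF G])
  show "(%n. (LBINT x. (D n x)^2)) ----> 0" by (rule tendsto_sandwich[OF _ _ tendsto_const z[simplified]])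
    (use b in "auto intro!: always_eventually Bochner_Integration.integral_nonneg")
 qed
 hence "(%n. sqrt (Q (D n))) ----> sqrt 0" by (rule tendsto_real_sqrt)
 hence d0: "(%n. test_norm (D n)) ----> 0" by (simp add: test_norm_eq[OF Dt])
 have "(%n. test_norm (G n) - test_norm (F n)) ----> 0" proof (rule Lim_null_comparison[OF always_eventually d0], rule allI)
  show "norm (test_norm (G n) - test_norm (F n)) <= test_norm (D n)" for n
   using test_norm_triangle[OF Ft Gt, of n n] by (simp add: D_def[abs_def] abs_minus_commute)
 qed
 hence "(%n. (test_norm (G n) - test_norm (F n)) + test_norm (F n)) ----> 0 + l" by (intro tendsto_add l)
 thus ?thesis by simp
qed

lemma H_norm_limit: assumes F: "represents F u" shows "(%n. test_norm (F n)) ----> H_norm u" proof -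
 obtain l where l: "(%n. test_norm (F n)) ----> l" using test_norm_convergent[OF F] by (auto simp: convergent_def)
 have "H_norm u = l" unfolding H_norm_def proof (rule the_equality)
  show "ALL \<phi>. represents \<phi> u --> (%n. test_norm (\<phi> n)) ----> l" using represents_same_limit[OF F _ l] by blast
  show "L = l" if "ALL \<phi>. represents \<phi> u --> (%n. test_norm (\<phi> n)) ----> L" for L
   using that F l LIMSEQ_unique by blast
 qed
 with l show ?thesis by simp
qed

lemma test_represents: assumes f: "f : test_functions" shows "represents (%_. f) f" proof -
 have "test_norm (%x. f x - f x) = 0" using Q_scale[OF f, of 0] test_norm_eq[OF test_diff[OF f f]] by simp
 moreover have "Lp_norm p (%x. f x - f x) = 0" for p by (simp add: Lp_norm_def)
 ultimately show ?thesis using f test_Lp_space[OF f] by (auto simp: represents_def test_Cauchy_def)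
qed

lemma test_H_space: "f : test_functions ==> f : H_space" using test_represents by (auto simp: H_space_def)

lemma test_H_norm: assumes "f : test_functions" shows "(H_norm f)^2 = Q f"
 using LIMSEQ_unique[OF H_norm_limit[OF test_represents[OF assms]] tendsto_const] test_norm_sq[OF assms] by simp

definition Qa :: "real => (plane => real) => real" where "Qa \<alpha> f = Q f - \<alpha> * (LBINT x. (f x)^2)"

lemma lambda1_le: assumes f: "f : test_functions" shows "lambda1 * (LBINT x. (f x)^2) <= Q f"
proof (cases "(LBINT x. (f x)^2) = 0")
 case True
 thus ?thesis using Q_nonneg[OF f] by simp
next
 case False
 let ?I = "(LBINT x. (f x)^2)"
 have "0 <= ?I" by (rule Bochner_Integration.integral_nonneg) simp
 hence I: "0 < ?I" using False by (metis order_le_less)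
 have L: "(Lp_norm 2 f)^2 = ?I" by (simp add: Lp_norm_2_sq test_sq_integral[OF f])
 have nz: "\<not> (AE x in disc_measure. f x = 0)" proof
  assume "AE x in disc_measure. f x = 0"
  hence "(\<integral>x. (f x)^2 \<partial>disc_measure) = 0" by (intro integral_eq_zero_AE) auto
  thus False using False test_sq_integral[OF f] by simp
 qed
 have "lambda1 <= (H_norm f)^2 / (Lp_norm 2 f)^2" unfolding lambda1_def proof (rule cInf_lower)
  show "(H_norm f)^2 / (Lp_norm 2 f)^2 : {(H_norm u)^2 / (Lp_norm 2 u)^2 |u. u : H_space & \<not> (AE x in disc_measure. u x = 0)}"
   using test_H_space[OF f] nz by blast
  show "bdd_below {(H_norm u)^2 / (Lp_norm 2 u)^2 |u. u : H_space & \<not> (AE x in disc_measure. u x = 0)}"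
   by (rule bdd_belowI[of _ 0]) auto
 qed
 thus ?thesis using I by (simp add: test_H_norm[OF f] L pos_le_divide_eq)
qed

lemma Qa_ge: assumes f: "f : test_functions" shows "(lambda1 - \<alpha>) * (LBINT x. (f x)^2) <= Qa \<alpha> f"
 using lambda1_le[OF f] by (simp add: Qa_def algebra_simps)

lemma Qa_scale: "f : test_functions ==> Qa \<alpha> (%x. a * f x) = a^2 * Qa \<alpha> f"
 by (simp add: Qa_def Q_scale power_mult_distrib right_diff_distrib)

lemma L2_norm_limit: assumes F: "represents F u"
 shows "(%n. (LBINT x. (F n x)^2)) ----> (\<integral>x. (u x)^2 \<partial>disc_measure)" proof -
 have Ft: "F n : test_functions" for n using F by (rule represents_test)
 note u = represents_L2(1)[OF F]
 note ui = Lp_space_2(1)[OF u]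
 have um: "u : borel_measurable disc_measure" using u by (simp add: Lp_space_def)
 define I where "I = (\<integral>x. (u x)^2 \<partial>disc_measure)"
 define d where "d n = (\<integral>x. (F n x - u x)^2 \<partial>disc_measure)" for n
 have I0: "0 <= I" unfolding I_def by (rule Bochner_Integration.integral_nonneg) auto
 have di: "integrable disc_measure (%x. (F n x - u x)^2)" for n by (rule diff_square_integrable[OF u test_Lp_space[OF Ft]]) simp
 have b: "abs ((LBINT x. (F n x)^2) - I) <= d n + 2 * (d n / \<eta> + \<eta> * I)" if \<eta>: "0 < \<eta>" for n \<eta> proof -
  have im: "integrable disc_measure (%x. (F n x - u x) * u x)" proof (rule Bochner_Integration.integrable_bound)
   show "integrable disc_measure (%x. (F n x - u x)^2 + (u x)^2)" using di ui by auto
   show "(%x. (F n x - u x) * u x) : borel_measurable disc_measure"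
    using um borel_to_disc[OF test_borel[OF Ft[of n]]] by measurable
   show "AE x in disc_measure. norm ((F n x - u x) * u x) <= norm ((F n x - u x)^2 + (u x)^2)" proof (rule AE_I2)
    fix x
    have "2 * abs (F n x - u x) * abs (u x) <= abs (F n x - u x)^2 + abs (u x)^2" by (rule sum_squares_bound)
    moreover have "0 <= abs (F n x - u x) * abs (u x)" by simp
    ultimately show "norm ((F n x - u x) * u x) <= norm ((F n x - u x)^2 + (u x)^2)"
     unfolding real_norm_def abs_mult power2_abs mult.assoc by linarith
   qed
  qed
  have "(LBINT x. (F n x)^2) = (\<integral>x. (F n x)^2 \<partial>disc_measure)" by (simp add: test_sq_integral[OF Ft])
  also have "... = (\<integral>x. (F n x - u x)^2 + 2 * ((F n x - u x) * u x) + (u x)^2 \<partial>disc_measure)"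
   by (rule Bochner_Integration.integral_cong) (auto simp: power2_eq_square algebra_simps)
  also have "... = d n + 2 * (\<integral>x. (F n x - u x) * u x \<partial>disc_measure) + I"
   using di im ui by (simp add: d_def I_def)
  finally have e: "(LBINT x. (F n x)^2) - I = d n + 2 * (\<integral>x. (F n x - u x) * u x \<partial>disc_measure)" by simp
  have "abs (\<integral>x. (F n x - u x) * u x \<partial>disc_measure) <= d n / \<eta> + \<eta> * I"
   unfolding d_def I_def by (rule integral_mult_le[OF di ui im \<eta>])
  moreover have "0 <= d n" unfolding d_def by (rule Bochner_Integration.integral_nonneg) auto
  ultimately have "abs X <= d n + 2 * (d n / \<eta> + \<eta> * I)" if "X = d n + 2 * (\<integral>x. (F n x - u x) * u x \<partial>disc_measure)" for X
   unfolding that abs_le_iff by auto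
  thus ?thesis using e by blast
 qed
 have d0: "d ----> 0" using represents_L2(2)[OF F] by (simp add: d_def[abs_def])
 have "(%n. (LBINT x. (F n x)^2) - I) ----> 0" proof (rule LIMSEQ_I)
  fix e :: real assume e: "0 < e"
  define \<eta> where "\<eta> = e / (4 * (I + 1))"
  have \<eta>: "0 < \<eta>" using e I0 by (simp add: \<eta>_def)
  have "\<eta> * I <= \<eta> * (I + 1)" using \<eta> by (intro mult_left_mono) auto
  also have "... = e / 4" using I0 by (simp add: \<eta>_def field_simps)
  finally have \<eta>I: "\<eta> * I <= e / 4" .
  have "(%n. d n + 2 * (d n / \<eta>)) ----> 0 + 2 * (0 / \<eta>)" by (intro tendsto_intros d0) (use \<eta> in simp)
  hence "\<forall>\<^sub>F n in sequentially. d n + 2 * (d n / \<eta>) < e / 2" by (rule order_tendstoD) (use e in simp)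
  then obtain N where N: "!!n. n >= N ==> d n + 2 * (d n / \<eta>) < e / 2" unfolding eventually_sequentially by blast
  have "norm ((LBINT x. (F n x)^2) - I - 0) < e" if "N <= n" for n using b[OF \<eta>, of n] N[OF that] \<eta>I by simp
  thus "EX no. ALL n>=no. norm ((LBINT x. (F n x)^2) - I - 0) < e" by blast
 qed
 thus ?thesis unfolding I_def by (rule LIM_zero_cancel)
qed

lemma Qa_limit: assumes F: "represents F u" shows "(%n. Qa \<alpha> (F n)) ----> (H_norm u)^2 - \<alpha> * (Lp_norm 2 u)^2"
proof -
 have "(%n. (test_norm (F n))^2 - \<alpha> * (LBINT x. (F n x)^2)) ----> (H_norm u)^2 - \<alpha> * (Lp_norm 2 u)^2"
  unfolding Lp_norm_2_sq by (intro tendsto_intros H_norm_limit[OF F] L2_norm_limit[OF F])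
 moreover have "(test_norm (F n))^2 = Q (F n)" for n by (rule test_norm_sq[OF represents_test[OF F]])
 ultimately show ?thesis by (simp add: Qa_def)
qed

lemma norm_1_sq_limit: assumes F: "represents F u" and \<alpha>: "\<alpha> < lambda1"
 shows "(%n. Qa \<alpha> (F n)) ----> (norm_1 \<alpha> u)^2" proof -
 \<comment> \<open>\<open>norm_1\<close> is a square root; squaring recovers its argument because
   the spectral bound makes that argument nonnegative.\<close>
 have "0 <= Qa \<alpha> (F n)" for n proof -
  have "0 <= (lambda1 - \<alpha>) * (LBINT x. (F n x)^2)"
   using \<alpha> by (intro mult_nonneg_nonneg Bochner_Integration.integral_nonneg) auto
  thus ?thesis using Qa_ge[OF represents_test[OF F], of \<alpha> n] by linarith
 qed
 hence "0 <= (H_norm u)^2 - \<alpha> * (Lp_norm 2 u)^2" by (intro LIMSEQ_le_const[OF Qa_limit[OF F]]) auto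
 thus ?thesis using Qa_limit[OF F, of \<alpha>] by (simp add: norm_1_def)
qed

text \<open>By Fatou's lemma along an almost everywhere convergent subsequence it suffices to bound the
  exponential integral for test functions.\<close>

lemma exp_integral_le_test_bound: assumes u: "u : H_space" and \<alpha>: "\<alpha> < lambda1" and n1: "norm_1 \<alpha> u <= 1"
  and bound: "!!f. f : test_functions ==> Qa \<alpha> f <= 1 ==> exp_integral \<beta> f <= M" shows "exp_integral \<beta> u <= M"
proof -
 obtain F where F: "represents F u" using u by (auto simp: H_space_def)
 have Ft: "F n : test_functions" for n using F by (rule represents_test)
 note uL = represents_L2(1)[OF F]
 have um: "u : borel_measurable disc_measure" using uL by (simp add: Lp_space_def)
 have Fm: "F n : borel_measurable disc_measure" for n by (rule borel_to_disc[OF test_borel[OF Ft]])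
 have di: "integrable disc_measure (%x. (F n x - u x)^2)" for n by (rule diff_square_integrable[OF uL test_Lp_space[OF Ft]]) simp
 have L1: "(%n. \<integral>x. norm ((F n x - u x)^2) \<partial>disc_measure) ----> 0" using represents_L2(2)[OF F] by simp
 obtain r where r: "strict_mono (r::nat => nat)" "AE x in disc_measure. (%n. (F (r n) x - u x)^2) ----> 0"
  using tendsto_L1_AE_subseq[OF di L1] by blast
 \<comment> \<open>The approximants may leave the unit ball slightly; they are scaled back exactly
   when they do, and the factors tend to 1.\<close>
 define c where "c n = 1 / sqrt (max 1 (Qa \<alpha> (F n)))" for n
 have c1: "(%n. c n) ----> 1" proof -
  have "(%n. 1 / sqrt (max 1 (Qa \<alpha> (F n)))) ----> 1 / sqrt (max 1 ((norm_1 \<alpha> u)^2))"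
  proof (intro tendsto_intros norm_1_sq_limit[OF F \<alpha>])
   show "sqrt (max 1 ((norm_1 \<alpha> u)^2)) ~= 0" by (auto simp: max_def)
  qed
  moreover have "(norm_1 \<alpha> u)^2 <= 1" proof -
   have "0 <= norm_1 \<alpha> u" proof -
    have "(%n. Qa \<alpha> (F n)) ----> (norm_1 \<alpha> u)^2" by (rule norm_1_sq_limit[OF F \<alpha>])
    hence e: "(norm_1 \<alpha> u)^2 = (H_norm u)^2 - \<alpha> * (Lp_norm 2 u)^2" using Qa_limit[OF F] LIMSEQ_unique by blast
    have "0 <= (H_norm u)^2 - \<alpha> * (Lp_norm 2 u)^2" unfolding e[symmetric] by simp
    thus ?thesis by (simp add: norm_1_def)
   qed
   thus ?thesis using n1 by (simp add: power_le_one)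
  qed
  ultimately show ?thesis by (simp add: c_def max_def split: if_splits)
 qed
 have cb: "exp_integral \<beta> (%x. c n * F n x) <= M" for n proof (rule bound)
  show "(%x. c n * F n x) : test_functions" by (rule test_scale[OF Ft])
  have "Qa \<alpha> (%x. c n * F n x) = Qa \<alpha> (F n) / max 1 (Qa \<alpha> (F n))"
   unfolding Qa_scale[OF Ft] by (simp add: c_def power_divide)
  also have "... <= 1" by (simp add: divide_le_eq)
  finally show "Qa \<alpha> (%x. c n * F n x) <= 1" .
 qed
 define g where "g n x = ennreal (exp (\<beta> * (c (r n) * F (r n) x)^2))" for n x
 have gm: "g n : borel_measurable disc_measure" for n unfolding g_def using Fm[of "r n"] by measurable
 have lim: "AE x in disc_measure. liminf (%n. g n x) = ennreal (exp (\<beta> * (u x)^2))" using r(2) proof eventually_elim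
  case (elim x)
  have "(%n. sqrt ((F (r n) x - u x)^2)) ----> sqrt 0" by (intro tendsto_real_sqrt elim)
  hence "(%n. F (r n) x - u x) ----> 0" by (simp add: tendsto_rabs_zero_iff)
  hence "(%n. F (r n) x) ----> u x" by (rule LIM_zero_cancel)
  moreover have "(%n. c (r n)) ----> 1" using LIMSEQ_subseq_LIMSEQ[OF c1 r(1)] by (simp add: comp_def)
  ultimately have "(%n. ennreal (exp (\<beta> * (c (r n) * F (r n) x)^2))) ----> ennreal (exp (\<beta> * (1 * u x)^2))"
   by (intro tendsto_ennrealI tendsto_intros)
  thus ?case unfolding g_def by (intro lim_imp_Liminf) auto
 qed
 have "exp_integral \<beta> u = (\<integral>\<^sup>+x. liminf (%n. g n x) \<partial>disc_measure)"
  unfolding exp_integral_def by (rule nn_integral_cong_AE) (use lim in "auto elim: AE_mp")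
 also have "... <= liminf (%n. \<integral>\<^sup>+x. g n x \<partial>disc_measure)" by (rule nn_integral_liminf[OF gm])
 also have "... <= M" by (rule order_trans[OF Liminf_le_Limsup Limsup_bounded]) (use cb in "auto simp: g_def exp_integral_def")
 finally show ?thesis .
qed

subsection \<open>Radial functions on the disc\<close>

lemma emeasure_plane_ball: "0 <= r ==> emeasure lborel (ball (0::plane) r) = ennreal (pi * r^2)"
 by (simp add: emeasure_ball unit_ball_vol_2)

lemma emeasure_plane_cball: "0 <= r ==> emeasure lborel (cball (0::plane) r) = ennreal (pi * r^2)"
 by (simp add: emeasure_cball unit_ball_vol_2)

text \<open>Both measures give the ray above t the area of an annulus: |x|^2 is uniformly
  distributed on (0, 1) with total mass pi.\<close>

lemma distr_norm_square: "distr disc_measure borel (%x. (norm x)^2) = density lborel (%q. ennreal pi * indicator {0<..<1} q)"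
  (is "?M = ?N") proof -
 have m: "(%x::plane. (norm x)^2) : borel_measurable disc_measure" by (rule borel_to_disc) measurable
 have M: "emeasure ?M {t<..} = ennreal (pi * (1 - min 1 (max 0 t)))" for t proof -
  define E where "E = {x : disc. t < (norm x)^2}"
  have Eb: "E : sets borel" unfolding E_def by measurable
  have "emeasure ?M {t<..} = emeasure disc_measure ((%x. (norm x)^2) -` {t<..} \<inter> space disc_measure)"
   by (rule emeasure_distr[OF m]) simp
  also have "(%x. (norm x)^2) -` {t<..} \<inter> space disc_measure = E" by (auto simp: E_def space_restrict_space)
  also have "emeasure disc_measure E = emeasure lebesgue E" by (rule emeasure_restrict_space) (auto simp: E_def)
  also have "... = emeasure lborel E" using Eb by simp
  also have "... = ennreal (pi * (1 - min 1 (max 0 t)))" proof -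
   consider "t < 0" | "0 <= t" "t < 1" | "1 <= t" by linarith
   thus ?thesis proof cases
    case 1
    hence "E = disc" by (auto simp: E_def intro: less_le_trans)
    thus ?thesis using emeasure_plane_ball[of 1] 1 by simp
   next
    case 2
    have s: "t < (norm x)^2 \<longleftrightarrow> sqrt t < norm x" for x :: plane
     using real_sqrt_less_iff[of t "(norm x)^2"] by simp
    have "E = disc - cball 0 (sqrt t)" by (auto simp: E_def s not_le)
    moreover have "emeasure lborel (disc - cball 0 (sqrt t)) = emeasure lborel disc - emeasure lborel (cball (0::plane) (sqrt t))"
    proof (rule emeasure_Diff)
     have t1: "sqrt t < 1" using 2 by simp
     show "cball 0 (sqrt t) \<subseteq> disc" proof
      fix x :: plane assume "x : cball 0 (sqrt t)"
      hence "norm x <= sqrt t" by simp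
      hence "norm x < 1" using t1 by (rule le_less_trans)
      thus "x : disc" by simp
     qed
    qed (use 2 in "auto simp: emeasure_plane_cball")
    ultimately show ?thesis using 2 by (simp add: emeasure_plane_cball emeasure_plane_ball ennreal_minus right_diff_distrib)
   next
    case 3
    hence "E = {}" by (auto simp: E_def dest!: norm_lt_1_sq)
    thus ?thesis using 3 by simp
   qed
  qed
  finally show ?thesis .
 qed
 have N: "emeasure ?N {t<..} = ennreal (pi * (1 - min 1 (max 0 t)))" for t proof -
  have "emeasure ?N {t<..} = (\<integral>\<^sup>+q. ennreal pi * indicator {0<..<1} q * indicator {t<..} q \<partial>lborel)"
   by (rule emeasure_density) auto
  also have "... = (\<integral>\<^sup>+q. ennreal pi * indicator {max 0 t<..<1} q \<partial>lborel)"
   by (rule nn_integral_cong) (auto simp: indicator_def)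
  also have "... = ennreal pi * emeasure lborel {max 0 t<..<1}" by (simp add: nn_integral_cmult_indicator)
  also have "emeasure lborel {max 0 t<..<1} = ennreal (1 - min 1 (max 0 t))" by (cases "max 0 t <= 1") auto
  finally show ?thesis by (simp add: ennreal_mult'')
 qed
 show ?thesis by (rule measure_eqI_lessThan) (auto simp: M N)
qed

lemma disc_radial_nn_integral:
 fixes g :: "real => ennreal" assumes [measurable]: "g : borel_measurable borel"
 shows "(\<integral>\<^sup>+x. g ((norm x)^2) \<partial>disc_measure) = ennreal pi * (\<integral>\<^sup>+q. g q * indicator {0<..<1} q \<partial>lborel)"
proof -
 have m: "(%x::plane. (norm x)^2) : borel_measurable disc_measure" by (rule borel_to_disc) measurable
 have "(\<integral>\<^sup>+x. g ((norm x)^2) \<partial>disc_measure) = (\<integral>\<^sup>+q. g q \<partial>distr disc_measure borel (%x. (norm x)^2))"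
  by (rule nn_integral_distr[symmetric, OF m]) simp
 also have "... = (\<integral>\<^sup>+q. ennreal pi * indicator {0<..<1} q * g q \<partial>lborel)"
  unfolding distr_norm_square by (rule nn_integral_density) auto
 also have "... = (\<integral>\<^sup>+q. ennreal pi * (g q * indicator {0<..<1} q) \<partial>lborel)" by (simp add: ac_simps)
 finally show ?thesis by (simp add: nn_integral_cmult)
qed

lemma disc_radial_integral:
 fixes g :: "real => real" assumes c: "continuous_on {0..1} g"
 shows "(\<integral>x. g ((norm x)^2) \<partial>disc_measure) = pi * integral {0..1} g" proof -
 define G where "G q = indicator {0..1} q *R g q" for q
 have Gm[measurable]: "G : borel_measurable borel" unfolding G_def by (rule borel_measurable_continuous_on_indicator[OF _ c]) simp
 have m: "(%x::plane. (norm x)^2) : borel_measurable disc_measure" by (rule borel_to_disc) measurable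
 have "(\<integral>x. g ((norm x)^2) \<partial>disc_measure) = (\<integral>x. G ((norm x)^2) \<partial>disc_measure)"
  by (rule Bochner_Integration.integral_cong) (auto simp: G_def indicator_def space_restrict_space dest!: norm_lt_1_sq)
 also have "... = (\<integral>q. G q \<partial>distr disc_measure borel (%x. (norm x)^2))"
  by (rule integral_distr[symmetric, OF m Gm])
 also have "... = (LBINT q. (pi * indicator {0<..<1} q) *R G q)" proof -
  have "density lborel (%q. ennreal pi * indicator {0<..<1} q) = density lborel (%q. ennreal (pi * indicator {0<..<1::real} q))"
   by (rule density_cong) (auto simp: indicator_def)
  thus ?thesis unfolding distr_norm_square by (simp add: integral_density)
 qed
 also have "... = (LBINT q. pi * (indicator {0..1} q *R g q))" proof (rule integral_cong_AE)
  have "AE q in lborel. q ~= (0::real)" by (rule AE_lborel_singleton)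
  moreover have "AE q in lborel. q ~= (1::real)" by (rule AE_lborel_singleton)
  ultimately show "AE q in lborel. (pi * indicator {0<..<1} q) *R G q = pi * (indicator {0..1} q *R g q)"
   by eventually_elim (auto simp: G_def indicator_def)
  show "(%q. (pi * indicator {0<..<1} q) *R G q) : borel_measurable lborel" by measurable
  have "(%q. pi * G q) : borel_measurable lborel" by measurable
  thus "(%q. pi * (indicator {0..1} q *R g q)) : borel_measurable lborel" by (simp add: G_def)
 qed
 also have "... = pi * (LBINT q. indicator {0..1} q *R g q)" by simp
 also have "(LBINT q. indicator {0..1} q *R g q) = integral {0..1} g"
  using set_borel_integral_eq_integral(2)[OF borel_integrable_atLeastAtMost'[OF c]] by (simp add: set_lebesgue_integral_def)
 finally show ?thesis .
qed

definition rad :: "(real => real) => plane => real" where "rad U x = (if norm x < 1 then U ((norm x)^2) else 0)"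

definition rad_grad :: "(real => real) => plane => plane" where
 "rad_grad U' x = (if norm x < 1 then (2 * U' ((norm x)^2)) *R x else 0)"

lemma norm_ge_sqrt: "0 <= \<rho> ==> sqrt \<rho> <= norm (x::plane) ==> \<rho> <= (norm x)^2"
 using power_mono[of "sqrt \<rho>" "norm x" 2] by simp

lemma rad_C1c: assumes R: "rad_C1 \<rho> U U'" shows "C1c (rad U) (rad_grad U')" proof -
 have \<rho>: "0 < \<rho>" "\<rho> < 1" using R by (auto simp: rad_C1_def)
 have dU: "(U has_real_derivative U' q) (at q within {0..1})" if "0 <= q" "q <= 1" for q using R that by (auto simp: rad_C1_def)
 have cU': "continuous_on {0..1} U'" using R by (simp add: rad_C1_def)
 have z: "U q = 0" "U' q = 0" if "\<rho> <= q" "q <= 1" for q using R that by (auto simp: rad_C1_def)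
 define T where "T = sqrt \<rho>"
 have T: "0 < T" "T < 1" using \<rho> by (auto simp: T_def)
 have zero: "rad U x = 0" "rad_grad U' x = 0" if "T <= norm x" for x
  using z[of "(norm x)^2"] norm_ge_sqrt[of \<rho> x] that \<rho> norm_lt_1_sq[of x] by (auto simp: rad_def rad_grad_def T_def)
 have inn: "(norm y)^2 : {0..1}" if "y : disc" for y :: plane using that norm_lt_1_sq[of y] by auto
 show ?thesis unfolding C1c_def proof (intro conjI allI)
  fix x
  show "(rad U has_derivative (%h. rad_grad U' x \<bullet> h)) (at x)" proof (cases "norm x < 1")
   case True
   have d1: "((%x. (norm x)^2) has_derivative (%h. 2 * (x \<bullet> h))) (at x within disc)"
    unfolding power2_norm_eq_inner by (auto intro!: derivative_eq_intros simp: inner_commute)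
   have d2: "(U has_derivative (%h. U' ((norm x)^2) * h)) (at ((norm x)^2) within (%x. (norm x)^2) ` disc)"
    using dU[of "(norm x)^2"] inn True unfolding has_field_derivative_def by (auto intro: has_derivative_subset)
   have "((%x. U ((norm x)^2)) has_derivative (%h. U' ((norm x)^2) * (2 * (x \<bullet> h)))) (at x within disc)"
    by (rule has_derivative_in_compose[OF d1 d2])
   hence "((%x. U ((norm x)^2)) has_derivative (%h. rad_grad U' x \<bullet> h)) (at x)"
    using True by (simp add: at_within_open[of x disc] rad_grad_def ac_simps)
   thus ?thesis by (rule has_derivative_transform_within_open[of _ _ _ _ disc]) (use True in "auto simp: rad_def")
  next
   case False
   have "(rad U has_derivative (%_. 0)) (at x)" by (rule derivative_zero_off_support[OF zero(1)]) (use False T in auto)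
   thus ?thesis using zero(2)[of x] False T by simp
  qed
 next
  have "continuous_on (disc \<union> - cball 0 T) (rad_grad U')" proof (rule continuous_on_open_Un)
   have "continuous_on disc (%x. (2 * U' ((norm x)^2)) *R x)"
    by (intro continuous_intros continuous_on_compose2[OF cU']) (use inn in auto)
   thus "continuous_on disc (rad_grad U')" by (rule continuous_on_eq) (auto simp: rad_grad_def)
   have "continuous_on (- cball 0 T) (%_::plane. 0::plane)" by simp
   thus "continuous_on (- cball 0 T) (rad_grad U')" by (rule continuous_on_eq) (use zero in auto)
  qed auto
  moreover have "disc \<union> - cball 0 T = UNIV" using T by auto
  ultimately show "continuous_on UNIV (rad_grad U')" by simp
 next
  show "EX R<1. ALL x. R <= norm x --> rad U x = 0 & rad_grad U' x = 0" using zero T by blast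
 qed
qed

lemma rad_C1_continuous: assumes "rad_C1 \<rho> U U'" shows "continuous_on {0..1} U" "continuous_on {0..1} U'"
 using assms unfolding rad_C1_def by (auto intro: DERIV_continuous_on)

lemma rad_weight_continuous: assumes R: "rad_C1 \<rho> U U'" shows "continuous_on {0..1} (%q. (U q)^2 * (1 / (1 - q)^2))" proof -
 have \<rho>: "0 < \<rho>" "\<rho> < 1" using R by (auto simp: rad_C1_def)
 note c = rad_C1_continuous(1)[OF R]
 have "continuous_on ({0..\<rho>} \<union> {\<rho>..1}) (%q. (U q)^2 * (1 / (1 - q)^2))" proof (rule continuous_on_closed_Un)
  show "continuous_on {0..\<rho>} (%q. (U q)^2 * (1 / (1 - q)^2))"
   by (intro continuous_intros continuous_on_subset[OF c]) (use \<rho> in auto)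
  have "continuous_on {\<rho>..1} (%_::real. 0::real)" by simp
  thus "continuous_on {\<rho>..1} (%q. (U q)^2 * (1 / (1 - q)^2))" by (rule continuous_on_eq) (use R in "auto simp: rad_C1_def")
 qed auto
 moreover have "{0..\<rho>} \<union> {\<rho>..1} = {0..1}" using \<rho> by auto
 ultimately show ?thesis by simp
qed

lemma rad_form: assumes R: "rad_C1 \<rho> U U'" and \<alpha>: "0 <= \<alpha>"
 shows "Q0 (rad U) (rad_grad U') - \<alpha> * (LBINT x. (rad U x)^2) = pi * ground_state.form \<alpha> U U'"
  and "(LBINT x. (rad U x)^2) = pi * integral {0..1} (%q. (U q)^2)" proof -
 interpret ground_state \<alpha> by unfold_locales (rule \<alpha>)
 note C = rad_C1c[OF R]
 obtain T where T: "T < 1" "!!x. T <= norm x ==> rad U x = 0" "!!x. T <= norm x ==> rad_grad U' x = 0"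
  using C1c_support[OF C] by metis
 have fm: "rad U : borel_measurable borel" and gm: "rad_grad U' : borel_measurable borel"
  by (rule borel_measurable_continuous_onI, rule C1c_continuous[OF C])+
 have hm: "hardy (rad U) : borel_measurable borel" by (rule borel_measurable_continuous_onI[OF hardy_continuous[OF C]])
 have sp: "norm x < 1" if "x : space disc_measure" for x :: plane using that by (simp add: space_restrict_space)
 have "(LBINT x. (norm (rad_grad U' x))^2 - hardy (rad U) x) = (\<integral>x. (norm (rad_grad U' x))^2 - hardy (rad U) x \<partial>disc_measure)"
  by (rule disc_integral_support[symmetric]) (use fm gm hm T in "auto simp: hardy_def")
 also have "... = (\<integral>x. 4 * (norm x)^2 * (U' ((norm x)^2))^2 - (U ((norm x)^2))^2 * (1 / (1 - (norm x)^2)^2) \<partial>disc_measure)"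
  by (rule Bochner_Integration.integral_cong[OF refl]) (simp add: sp rad_grad_def hardy_def rad_def power_mult_distrib)
 also have "... = pi * integral {0..1} (%q. 4 * q * (U' q)^2 - (U q)^2 * (1 / (1 - q)^2))"
  by (rule disc_radial_integral) (intro continuous_intros rad_C1_continuous[OF R] rad_weight_continuous[OF R])
 finally have 1: "Q0 (rad U) (rad_grad U') = pi * integral {0..1} (%q. 4 * q * (U' q)^2 - (U q)^2 * (1 / (1 - q)^2))"
  by (simp add: Q0_def)
 have "(LBINT x. (rad U x)^2) = (\<integral>x. (rad U x)^2 \<partial>disc_measure)"
  by (rule disc_integral_support[symmetric]) (use fm T in auto)
 also have "... = (\<integral>x. (U ((norm x)^2))^2 \<partial>disc_measure)"
  by (rule Bochner_Integration.integral_cong[OF refl]) (simp add: sp rad_def)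
 also have "... = pi * integral {0..1} (%q. (U q)^2)"
  by (rule disc_radial_integral) (intro continuous_intros rad_C1_continuous[OF R])
 finally show 2: "(LBINT x. (rad U x)^2) = pi * integral {0..1} (%q. (U q)^2)" .
 have "form U U' = integral {0..1} (%q. (4 * q * (U' q)^2 - (U q)^2 * (1 / (1 - q)^2)) - \<alpha> * (U q)^2)"
  unfolding form_def pot_def by (rule integral_cong) (simp add: algebra_simps)
 also have "... = integral {0..1} (%q. 4 * q * (U' q)^2 - (U q)^2 * (1 / (1 - q)^2)) - integral {0..1} (%q. \<alpha> * (U q)^2)"
  by (rule integral_diff; rule integrable_continuous_real; intro continuous_intros rad_C1_continuous[OF R] rad_weight_continuous[OF R])
 finally have "form U U' = integral {0..1} (%q. 4 * q * (U' q)^2 - (U q)^2 * (1 / (1 - q)^2)) - \<alpha> * integral {0..1} (%q. (U q)^2)"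
  by simp
 thus "Q0 (rad U) (rad_grad U') - \<alpha> * (LBINT x. (rad U x)^2) = pi * form U U'"
  unfolding 1 2 by (simp add: right_diff_distrib)
qed

context coercive_ground_state
begin

text \<open>The push-forward of dq under S and the measure omega ds agree on rays: S decreases, so
  {S > t} is the interval below \<open>Qi t\<close>, and omega has mass \<open>Qi t\<close> beyond
  t. The value chosen at the origin affects only a null set.\<close>

lemma disc_S_nn_integral:
 fixes g :: "real => ennreal" assumes [measurable]: "g : borel_measurable borel"
 shows "(\<integral>\<^sup>+x. g (if x = 0 then 0 else S ((norm x)^2)) \<partial>disc_measure)
  = ennreal pi * (\<integral>\<^sup>+s. ennreal (omega s) * indicator {0..} s * g s \<partial>lborel)" proof -
 define S' where "S' q = indicator {0<..<1} q *R S q" for q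
 have S'm[measurable]: "S' : borel_measurable borel" unfolding S'_def by (rule borel_measurable_continuous_on_indicator)
   (auto intro!: continuous_at_imp_continuous_on DERIV_isCont[OF S_deriv])
 define L where "L = restrict_space lborel {0<..<1::real}"
 have mL: "S' : borel_measurable L" unfolding L_def by (rule measurable_restrict_space1) simp
 have D: "distr L borel S' = density lborel (%s. ennreal (omega s) * indicator {0..} s)" (is "?M = ?N") proof -
  have M: "emeasure ?M {t<..} = emeasure lborel {q : {0<..<1}. t < S q}" for t proof -
   have "emeasure ?M {t<..} = emeasure L (S' -` {t<..} \<inter> space L)" by (rule emeasure_distr[OF mL]) simp
   also have "S' -` {t<..} \<inter> space L = {q : {0<..<1}. t < S q}" by (auto simp: L_def space_restrict_space S'_def)
   also have "emeasure L {q : {0<..<1}. t < S q} = emeasure lborel {q : {0<..<1}. t < S q}"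
    unfolding L_def by (rule emeasure_restrict_space) auto
   finally show ?thesis .
  qed
  have M1: "emeasure ?M {t<..} = ennreal (if t <= 0 then 1 else Qi t)" for t proof (cases "t <= 0")
   case True
   hence "{q : {0<..<1}. t < S q} = {0<..<1}" using S_pos by (auto intro: le_less_trans)
   thus ?thesis using True by (simp add: M)
  next
   case False
   hence "{q : {0<..<1}. t < S q} = {0<..<Qi t}" proof (intro set_eqI iffI)
    fix q assume "q : {0<..<Qi t}"
    hence "0 < q" "q < 1" "q < Qi t" using False Qi(2)[of t] by auto
    thus "q : {q : {0<..<1}. t < S q}" using Qi_less_iff[of t q] False by auto
   qed (use Qi_less_iff[of t] False in auto)
   thus ?thesis using False Qi[of t] by (simp add: M)
  qed
  have N1: "emeasure ?N {t<..} = ennreal (if t <= 0 then 1 else Qi t)" for t proof -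
   have "emeasure ?N {t<..} = (\<integral>\<^sup>+s. ennreal (omega s) * indicator {0..} s * indicator {t<..} s \<partial>lborel)"
    by (rule emeasure_density) auto
   also have "... = ennreal (if t <= 0 then 1 else Qi t)" proof (cases "t <= 0")
    case True
    hence "(\<integral>\<^sup>+s. ennreal (omega s) * indicator {0..} s * indicator {t<..} s \<partial>lborel)
      = (\<integral>\<^sup>+s. ennreal (omega s) * indicator {0..} s \<partial>lborel)"
     by (intro nn_integral_cong) (auto simp: indicator_def omega_def)
    thus ?thesis using True omega_total by simp
   next
    case False
    have "(\<integral>\<^sup>+s. ennreal (omega s) * indicator {0..} s * indicator {t<..} s \<partial>lborel)
      = (\<integral>\<^sup>+s. ennreal (omega s) * indicator {t..} s \<partial>lborel)" proof (rule nn_integral_cong_AE)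
     have "AE s in lborel. s ~= t" by (rule AE_lborel_singleton)
     thus "AE s in lborel. ennreal (omega s) * indicator {0..} s * indicator {t<..} s = ennreal (omega s) * indicator {t..} s"
      by eventually_elim (use False in "auto simp: indicator_def")
    qed
    thus ?thesis using False omega_tail[of t] by simp
   qed
   finally show ?thesis .
  qed
  show ?thesis by (rule measure_eqI_lessThan) (auto simp: M1 N1)
 qed
 have gS: "(%q. g (S' q)) : borel_measurable borel" by measurable
 have "(\<integral>\<^sup>+x. g (if x = 0 then 0 else S ((norm x)^2)) \<partial>disc_measure) = (\<integral>\<^sup>+x. g (S' ((norm x)^2)) \<partial>disc_measure)"
  by (rule nn_integral_cong) (auto simp: S'_def indicator_def space_restrict_space dest!: norm_lt_1_sq)
 also have "... = ennreal pi * (\<integral>\<^sup>+q. g (S' q) * indicator {0<..<1} q \<partial>lborel)"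
  by (rule disc_radial_nn_integral[OF gS])
 also have "(\<integral>\<^sup>+q. g (S' q) * indicator {0<..<1} q \<partial>lborel) = (\<integral>\<^sup>+q. g (S' q) \<partial>L)"
  unfolding L_def by (rule nn_integral_restrict_space[symmetric]) simp
 also have "... = (\<integral>\<^sup>+s. g s \<partial>distr L borel S')" by (rule nn_integral_distr[symmetric, OF mL]) simp
 also have "... = (\<integral>\<^sup>+s. ennreal (omega s) * indicator {0..} s * g s \<partial>lborel)"
  unfolding D by (rule nn_integral_density) auto
 finally show ?thesis .
qed

end

section \<open>Approximation of radial profiles by radial test functions\<close>

definition bump :: "nat => real => real" where "bump m t = (if t <= 0 then 0 else exp (- 1 / t) / t ^ m)"

lemma exp_inverse_over_power: "((%t::real. exp (- 1 / t) / t ^ k) \<longlongrightarrow> 0) (at_right 0)" proof -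
 have "((%x::real. x ^ k / exp x) \<longlongrightarrow> 0) at_top" by (rule tendsto_power_div_exp_0)
 hence "((%t::real. inverse t ^ k / exp (inverse t)) \<longlongrightarrow> 0) (at_right 0)"
  by (rule filterlim_compose[OF _ filterlim_inverse_at_top_right])
 moreover have "(%t::real. inverse t ^ k / exp (inverse t)) = (%t. exp (- 1 / t) / t ^ k)" by (auto simp: exp_minus field_simps)
 ultimately show ?thesis by simp
qed

text \<open>The functions exp (- 1 / t) / t^m are closed under differentiation up to linear
  combinations; at 0 the right difference quotient is again of this type and tends to 0.\<close>

lemma bump_deriv: "DERIV (bump m) t :> bump (m + 2) t - real m * bump (Suc m) t" proof -
 consider "t < 0" | "t = 0" | "0 < t" by linarith
 thus ?thesis proof cases
  case 1
  have "DERIV (%_. 0::real) t :> 0" by simp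
  hence "DERIV (bump m) t :> 0"
   by (rule has_field_derivative_transform_within_open[of _ _ _ "{..<0}"]) (use 1 in "auto simp: bump_def")
  thus ?thesis using 1 by (simp add: bump_def)
 next
  case 2
  have "((%h. (bump m (0 + h) - bump m 0) / h) \<longlongrightarrow> 0) (at 0)" proof (rule filterlim_split_at_real)
   have "\<forall>\<^sub>F h in at_left (0::real). (bump m (0 + h) - bump m 0) / h = 0"
    by (auto simp: eventually_at_filter bump_def)
   thus "((%h. (bump m (0 + h) - bump m 0) / h) \<longlongrightarrow> 0) (at_left 0)" by (rule tendsto_eventually)
   have "\<forall>\<^sub>F h in at_right (0::real). exp (- 1 / h) / h ^ Suc m = (bump m (0 + h) - bump m 0) / h"
    by (auto simp: eventually_at_filter bump_def)
   from Lim_transform_eventually[OF exp_inverse_over_power this]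
   show "((%h. (bump m (0 + h) - bump m 0) / h) \<longlongrightarrow> 0) (at_right 0)" .
  qed
  thus ?thesis using 2 by (simp add: DERIV_def bump_def)
 next
  case 3
  have d1: "DERIV (%t. exp (- 1 / t)) t :> exp (- 1 / t) * (1 / t^2)"
   using 3 by (auto intro!: derivative_eq_intros simp: power2_eq_square)
  have d2: "DERIV (%t. t ^ m) t :> real m * t ^ (m - 1)" by (auto intro!: derivative_eq_intros)
  have "((%t. exp (- 1 / t) / t ^ m) has_real_derivative
    (exp (- 1 / t) * (1 / t^2) * t ^ m - exp (- 1 / t) * (real m * t ^ (m - 1))) / (t ^ m * t ^ m)) (at t)"
   by (rule DERIV_divide[OF d1 d2]) (use 3 in simp)
  also have "(exp (- 1 / t) * (1 / t^2) * t ^ m - exp (- 1 / t) * (real m * t ^ (m - 1))) / (t ^ m * t ^ m)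
   = bump (m + 2) t - real m * bump (Suc m) t" proof (cases m)
   case 0
   thus ?thesis using 3 by (simp add: bump_def power2_eq_square)
  next
   case (Suc n)
   have "exp (- 1 / t) * (1 / t^2) * t ^ m / (t ^ m * t ^ m) = bump (m + 2) t"
    using 3 by (simp add: bump_def power_add power2_eq_square)
   moreover have "exp (- 1 / t) * (real m * t ^ (m - 1)) / (t ^ m * t ^ m) = real m * bump (Suc m) t"
    using 3 by (simp add: bump_def Suc)
   ultimately show ?thesis by (simp add: diff_divide_distrib)
  qed
  finally have "DERIV (%t. exp (- 1 / t) / t ^ m) t :> bump (m + 2) t - real m * bump (Suc m) t" .
  thus ?thesis by (rule has_field_derivative_transform_within_open[of _ _ _ "{0<..}"]) (use 3 in "auto simp: bump_def")
 qed
qed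

text \<open>A class that contains radial cut-offs and is closed under partial derivatives, because
  differentiating a bump yields bumps of higher index times coordinates. Smoothness then follows
  from \<open>smooth_coinduct\<close>.\<close>

inductive smooth_expr :: "real => (plane => real) => bool" for \<rho> where
 const: "smooth_expr \<rho> (%_. c)"
| coord: "b : Basis ==> smooth_expr \<rho> (%x. x \<bullet> b)"
| bump: "smooth_expr \<rho> (%x. bump m (\<rho> - (norm x)^2))"
| add: "smooth_expr \<rho> f ==> smooth_expr \<rho> g ==> smooth_expr \<rho> (%x. f x + g x)"
| mult: "smooth_expr \<rho> f ==> smooth_expr \<rho> g ==> smooth_expr \<rho> (%x. f x * g x)"

lemma smooth_expr_derivative: assumes "smooth_expr \<rho> f"
 shows "EX D. (ALL x. (f has_derivative D x) (at x)) & (ALL b:Basis. smooth_expr \<rho> (%x. D x b))" using assms proof induction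
 case (const c)
 show ?case by (rule exI[of _ "%_ _. 0"]) (auto intro: smooth_expr.const)
next
 case (coord b)
 show ?case by (rule exI[of _ "%_ h. h \<bullet> b"]) (auto intro!: derivative_eq_intros smooth_expr.const)
next
 case (bump m)
 define e where "e x = bump (m + 2) (\<rho> - (norm x)^2) - real m * bump (Suc m) (\<rho> - (norm x)^2)" for x :: plane
 have "((%x. bump m (\<rho> - (norm x)^2)) has_derivative (%h. e x * (- (2 * (x \<bullet> h))))) (at x)" for x :: plane proof -
  have "((%x. \<rho> - (norm x)^2) has_derivative (%h. - (2 * (x \<bullet> h)))) (at x)"
   unfolding power2_norm_eq_inner by (auto intro!: derivative_eq_intros simp: inner_commute)
  moreover have "(bump m has_derivative (%h. e x * h)) (at (\<rho> - (norm x)^2))"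
   using bump_deriv[of m "\<rho> - (norm x)^2"] unfolding has_field_derivative_def e_def .
  ultimately show ?thesis by (rule has_derivative_compose)
 qed
 moreover have "smooth_expr \<rho> (%x. e x * (- (2 * (x \<bullet> b))))" if "b : Basis" for b proof -
  have "smooth_expr \<rho> (%x. (bump (m + 2) (\<rho> - (norm x)^2) + (- real m) * bump (Suc m) (\<rho> - (norm x)^2)) * ((-2) * (x \<bullet> b)))"
   by (intro smooth_expr.intros that)
  thus ?thesis by (simp add: e_def)
 qed
 ultimately show ?case by (intro exI[of _ "%x h. e x * (- (2 * (x \<bullet> h)))"]) auto
next
 case (add f g)
 then obtain D E where D: "!!x. (f has_derivative D x) (at x)" "!!b. b : Basis ==> smooth_expr \<rho> (%x. D x b)"
  and E: "!!x. (g has_derivative E x) (at x)" "!!b. b : Basis ==> smooth_expr \<rho> (%x. E x b)" by metis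
 show ?case by (rule exI[of _ "%x h. D x h + E x h"]) (auto intro: has_derivative_add D E smooth_expr.add)
next
 case (mult f g)
 then obtain D E where D: "!!x. (f has_derivative D x) (at x)" "!!b. b : Basis ==> smooth_expr \<rho> (%x. D x b)"
  and E: "!!x. (g has_derivative E x) (at x)" "!!b. b : Basis ==> smooth_expr \<rho> (%x. E x b)" by metis
 show ?case proof (intro exI[of _ "%x h. f x * E x h + D x h * g x"] conjI allI ballI)
  show "smooth_expr \<rho> (%x. f x * E x b + D x b * g x)" if "b : Basis" for b
   by (rule smooth_expr.add[OF smooth_expr.mult[OF mult.hyps(1) E(2)[OF that]] smooth_expr.mult[OF D(2)[OF that] mult.hyps(2)]])
 qed (rule has_derivative_mult[OF D(1) E(1)])
qed

lemma smooth_expr_smooth: assumes "smooth_expr \<rho> f" shows "smooth f"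
proof (rule smooth_coinduct[of f "{f. smooth_expr \<rho> f}"])
 fix g :: "plane => real" and x b :: plane assume "g : {f. smooth_expr \<rho> f}"
 then obtain D where D: "!!x. (g has_derivative D x) (at x)" "!!b. b : Basis ==> smooth_expr \<rho> (%x. D x b)"
  using smooth_expr_derivative by blast
 show "g differentiable (at x)" using D(1) by (auto simp: differentiable_def)
 have "frechet_derivative g (at y) = D y" for y by (rule frechet_derivative_at[OF D(1), symmetric])
 thus "partial g b : {f. smooth_expr \<rho> f}" if "b : Basis" using D(2)[OF that] by simp
qed (use assms in simp)

lemma smooth_expr_sum:
 assumes "finite I" "!!i. i : I ==> smooth_expr \<rho> (f i)" shows "smooth_expr \<rho> (%x. \<Sum>i\<in>I. f i x)"
 using assms by (induction I rule: finite_induct) (auto intro: smooth_expr.intros)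

lemma smooth_expr_power: "smooth_expr \<rho> f ==> smooth_expr \<rho> (%x. f x ^ n)"
 by (induction n) (auto intro: smooth_expr.intros)

lemma smooth_expr_norm_square: "smooth_expr \<rho> (%x. (norm x)^2)" proof -
 have "smooth_expr \<rho> (%x. \<Sum>b\<in>Basis. (x \<bullet> b) * (x \<bullet> b))"
  by (intro smooth_expr_sum smooth_expr.intros) auto
 moreover have "(%x::plane. \<Sum>b\<in>Basis. (x \<bullet> b) * (x \<bullet> b)) = (%x. (norm x)^2)"
  by (rule ext) (simp only: power2_norm_eq_inner euclidean_inner[symmetric])
 ultimately show ?thesis by simp
qed

text \<open>The derivative is approximated by a polynomial, which is then integrated with the value
  g 0 at 0; the functions differ by at most e1 * r.\<close>

lemma polynomial_C1_approx:
 fixes g g' :: "real => real" assumes g: "!!q. q : {0..r} ==> (g has_real_derivative g' q) (at q within {0..r})"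
  and c: "continuous_on {0..r} g'" and r: "0 < r" and e: "0 < e"
 shows "EX a n. ALL q:{0..r}. abs ((\<Sum>i\<le>n. a i * q ^ i) - g q) <= e &
  abs ((\<Sum>i\<le>n. real i * a i * q ^ (i - 1)) - g' q) <= e" proof -
 define e1 where "e1 = min e (e / r)"
 have e1: "0 < e1" "e1 <= e" "e1 * r <= e" using e r by (auto simp: e1_def min_def field_simps)
 obtain p where p: "real_polynomial_function p" "!!q. q : {0..r} ==> abs (g' q - p q) < e1"
  using Stone_Weierstrass_real_polynomial_function[of "{0..r}" g' e1] c e1 by auto
 obtain d n where d: "p = (%x. \<Sum>i\<le>n. d i * x ^ i)" using p(1) unfolding real_polynomial_function_iff_sum by blast
 define a where "a i = (if i = 0 then g 0 else d (i - 1) / real i)" for i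
 define P where "P q = (\<Sum>i\<le>Suc n. a i * q ^ i)" for q
 have P': "(\<Sum>i\<le>Suc n. real i * a i * q ^ (i - 1)) = p q" for q
  unfolding d sum.atMost_Suc_shift[of _ n] by (simp add: a_def)
 have dP: "(P has_real_derivative p q) (at q within X)" for q X proof -
  have "(P has_real_derivative (\<Sum>i\<le>Suc n. a i * (real i * q ^ (i - 1)))) (at q within X)"
   unfolding P_def by (intro DERIV_sum DERIV_cmult) (auto intro!: derivative_eq_intros)
  moreover have "(\<Sum>i\<le>Suc n. a i * (real i * q ^ (i - 1))) = p q" unfolding P'[symmetric] by (rule sum.cong) auto
  ultimately show ?thesis by simp
 qed
 have P0: "P 0 = g 0" unfolding P_def sum.atMost_Suc_shift[of _ n] by (simp add: a_def)
 have cl: "abs (P q - g q) <= e" if q: "q : {0..r}" for q proof -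
  have "norm ((P q - g q) - (P 0 - g 0)) <= e1 * norm (q - 0)"
  proof (rule differentiable_bound[of "{0..r}" "%q. P q - g q" "%q h. (p q - g' q) * h" e1])
   show "((%q. P q - g q) has_derivative (%h. (p x - g' x) * h)) (at x within {0..r})" if "x : {0..r}" for x
    using DERIV_diff[OF dP g[OF that]] by (simp add: has_field_derivative_def)
   show "onorm (%h. (p x - g' x) * h) <= e1" if "x : {0..r}" for x
    using p(2)[OF that] by (intro onorm_le) (auto simp: abs_mult abs_minus_commute intro!: mult_right_mono)
  qed (use q r in auto)
  also have "... <= e1 * r" using q e1 by (intro mult_left_mono) auto
  finally show ?thesis using P0 e1 by simp
 qed
 show ?thesis by (rule exI[of _ a], rule exI[of _ "Suc n"])
   (use cl p(2) e1 in "force simp: P'[symmetric] P_def abs_minus_commute")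
qed

text \<open>U is divided by a smooth cut-off that is positive for q < r, with r beyond the support
  of U. The C^1 quotient is approximated by a polynomial in q and multiplied back, which gives a
  smooth function of x supported inside the disc.\<close>

lemma rad_C1_test_approx: assumes R: "rad_C1 \<rho> U U'" and e: "0 < e"
 shows "EX F F'. rad F : test_functions & rad_C1 ((\<rho> + 1) / 2) F F' &
  (ALL q:{0..1}. abs (F q - U q) <= e & abs (F' q - U' q) <= e)" proof -
 have \<rho>: "0 < \<rho>" "\<rho> < 1" using R by (auto simp: rad_C1_def)
 define r where "r = (\<rho> + 1) / 2"
 have r: "\<rho> < r" "r < 1" "0 < r" using \<rho> by (auto simp: r_def)
 define ch where "ch q = bump 0 (r - q)" for q
 define ch' where "ch' q = - bump 2 (r - q)" for q
 have dch: "(ch has_real_derivative ch' q) (at q within X)" for q X proof -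
  have "((%q. bump 0 (r - q)) has_real_derivative (bump (0 + 2) (r - q) - real 0 * bump (Suc 0) (r - q)) * (- 1)) (at q within X)"
   by (rule DERIV_chain2[OF bump_deriv]) (auto intro!: derivative_eq_intros)
  thus ?thesis by (simp add: ch_def[abs_def] ch'_def numeral_2_eq_2)
 qed
 have chpos: "0 < ch q" if "q < r" for q using that by (simp add: ch_def bump_def)
 have ch0: "ch q = 0" "ch' q = 0" if "r <= q" for q using that by (auto simp: ch_def ch'_def bump_def)
 have bumpc: "continuous_on X (bump m)" for X m by (rule continuous_at_imp_continuous_on) (auto intro: DERIV_isCont bump_deriv)
 have chc: "continuous_on X ch" "continuous_on X ch'" for X
  unfolding ch_def ch'_def by (intro continuous_intros continuous_on_compose2[OF bumpc[of UNIV]]; auto)+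
 have "bounded (ch ` {0..1})" "bounded (ch' ` {0..1})" by (intro compact_imp_bounded compact_continuous_image chc; simp)+
 then obtain M1 M2 where "ALL z:ch ` {0..1}. norm z <= M1" "ALL z:ch' ` {0..1}. norm z <= M2" unfolding bounded_iff by blast
 hence M12: "!!q. q : {0..1} ==> abs (ch q) <= M1" "!!q. q : {0..1} ==> abs (ch' q) <= M2" by auto
 define M where "M = max 1 (max M1 M2)"
 have M: "1 <= M" "!!q. q : {0..1} ==> abs (ch q) <= M" "!!q. q : {0..1} ==> abs (ch' q) <= M"
  using M12 by (auto simp: M_def le_max_iff_disj)
 define g where "g q = U q / ch q" for q
 \<comment> \<open>U vanishes from \<rho> < r on, so the quotient and its derivative continue by 0
   up to r although the cut-off vanishes there.\<close>
 define g' where "g' q = (if q < r then (U' q * ch q - U q * ch' q) / (ch q * ch q) else 0)" for q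
 have z: "U q = 0" "U' q = 0" if "\<rho> <= q" "q <= 1" for q using R that by (auto simp: rad_C1_def)
 have dg: "(g has_real_derivative g' q) (at q within {0..r})" if q: "q : {0..r}" for q proof (cases "q < r")
  case True
  have "(U has_real_derivative U' q) (at q within {0..r})"
   by (rule DERIV_subset[of _ _ _ "{0..1}"]) (use R q r in "auto simp: rad_C1_def")
  from DERIV_divide[OF this dch] chpos[OF True] show ?thesis unfolding g_def g'_def using True by auto
 next
  case False
  hence "q = r" using q by simp
  have "((%_. 0) has_real_derivative 0) (at r within {0..r})" by simp
  hence "(g has_real_derivative 0) (at r within {0..r})"
  proof (rule has_field_derivative_transform_within[of _ _ _ _ "r - \<rho>"])
   fix x assume "x : {0..r}" "dist x r < r - \<rho>"
   hence "\<rho> <= x" "x <= 1" using r by (auto simp: dist_real_def)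
   thus "0 = g x" using z by (simp add: g_def)
  qed (use r in auto)
  thus ?thesis using \<open>q = r\<close> by (simp add: g'_def)
 qed
 have cg': "continuous_on {0..r} g'" proof -
  define m where "m = (\<rho> + r) / 2"
  have m: "\<rho> < m" "m < r" using r by (auto simp: m_def)
  have "continuous_on ({0..m} \<union> {m..r}) g'" proof (rule continuous_on_closed_Un)
   have "continuous_on {0..m} (%q. (U' q * ch q - U q * ch' q) / (ch q * ch q))" proof (intro continuous_intros chc)
    show "continuous_on {0..m} U'" "continuous_on {0..m} U"
     using rad_C1_continuous[OF R] m r by (auto intro: continuous_on_subset)
    show "ALL q:{0..m}. ch q * ch q ~= 0" proof
     fix q assume "q : {0..m}"
     hence "0 < ch q" using m by (intro chpos) auto
     thus "ch q * ch q ~= 0" by simp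
    qed
   qed
   thus "continuous_on {0..m} g'" by (rule continuous_on_eq) (use m in "auto simp: g'_def")
   have "continuous_on {m..r} (%_::real. 0::real)" by simp
   thus "continuous_on {m..r} g'" by (rule continuous_on_eq) (use m r z in "auto simp: g'_def")
  qed auto
  moreover have "{0..m} \<union> {m..r} = {0..r}" using m \<rho> by auto
  ultimately show ?thesis by simp
 qed
 obtain a n where an: "!!q. q : {0..r} ==> abs ((\<Sum>i\<le>n. a i * q ^ i) - g q) <= e / (2 * M) &
  abs ((\<Sum>i\<le>n. real i * a i * q ^ (i - 1)) - g' q) <= e / (2 * M)" proof -
  have "0 < e / (2 * M)" using e M(1) by simp
  from polynomial_C1_approx[OF dg cg' r(3) this] show ?thesis using that by blast
 qed
 define P where "P q = (\<Sum>i\<le>n. a i * q ^ i)" for q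
 define P' where "P' q = (\<Sum>i\<le>n. real i * a i * q ^ (i - 1))" for q
 have dP: "(P has_real_derivative P' q) (at q within X)" for q X proof -
  have "(P has_real_derivative (\<Sum>i\<le>n. a i * (real i * q ^ (i - 1)))) (at q within X)"
   unfolding P_def by (intro DERIV_sum DERIV_cmult) (auto intro!: derivative_eq_intros)
  thus ?thesis by (simp add: P'_def ac_simps)
 qed
 define F where "F q = ch q * P q" for q
 define F' where "F' q = ch' q * P q + P' q * ch q" for q
 have F0: "F q = 0" "F' q = 0" if "r <= q" for q using ch0[OF that] by (auto simp: F_def F'_def)
 have dF: "(F has_real_derivative F' q) (at q within X)" for q X unfolding F_def F'_def by (rule DERIV_mult[OF dch dP])
 have radF: "rad F = (%x. bump 0 (r - (norm x)^2) * (\<Sum>i\<le>n. a i * ((norm x)^2) ^ i))" proof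
  fix x :: plane
  show "rad F x = bump 0 (r - (norm x)^2) * (\<Sum>i\<le>n. a i * ((norm x)^2) ^ i)" proof (cases "norm x < 1")
   case False
   hence "1 <= (norm x)^2" by (simp add: one_le_power)
   hence "r <= (norm x)^2" using r by linarith
   thus ?thesis using False by (simp add: rad_def bump_def)
  qed (simp add: rad_def F_def ch_def P_def)
 qed
 have "rad F : test_functions" proof (rule test_supportI[of _ "sqrt r"])
  have "smooth_expr r (rad F)"
   unfolding radF by (intro smooth_expr.intros smooth_expr_sum smooth_expr_power smooth_expr_norm_square) auto
  thus "smooth (rad F)" by (rule smooth_expr_smooth)
  show "rad F x = 0" if "sqrt r <= norm x" for x using norm_ge_sqrt[of r x] that r F0 by (simp add: rad_def)
 qed (use r in simp)
 moreover have "rad_C1 r F F'" unfolding rad_C1_def using r dF F0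
  by (auto simp: F'_def P_def P'_def intro!: continuous_intros chc)
 moreover have "abs (F q - U q) <= e & abs (F' q - U' q) <= e" if q: "q : {0..1}" for q proof (cases "q < r")
  case False
  thus ?thesis using F0[of q] z[of q] q r e by auto
 next
  case True
  have qr: "q : {0..r}" using q True by auto
  have Uq: "U q = ch q * g q" using chpos[OF True] by (simp add: g_def)
  have U'q: "U' q = ch' q * g q + g' q * ch q" using chpos[OF True] True by (simp add: g_def g'_def field_simps)
  have eM: "M * (e / (2 * M)) = e / 2" using M(1) by simp
  have b1: "abs (ch q * (P q - g q)) <= e / 2" "abs (ch' q * (P q - g q)) <= e / 2" "abs (ch q * (P' q - g' q)) <= e / 2"
   unfolding abs_mult eM[symmetric] using M(1)
   by (intro mult_mono M(2)[OF q] M(3)[OF q] conjunct1[OF an[OF qr], folded P_def] conjunct2[OF an[OF qr], folded P'_def]; simp)+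
  have "F q - U q = ch q * (P q - g q)" unfolding Uq F_def by (simp add: right_diff_distrib)
  moreover have "F' q - U' q = ch' q * (P q - g q) + ch q * (P' q - g' q)" unfolding U'q F'_def by (simp add: algebra_simps)
  ultimately show ?thesis using b1 e by linarith
 qed
 ultimately show ?thesis unfolding r_def by blast
qed

text \<open>Both profiles vanish beyond the midpoint of \<rho> and 1, so the singular potential is
  bounded where it acts, and the form is Lipschitz in the C^1 distance near U.\<close>

lemma (in ground_state) form_close: assumes R: "rad_C1 \<rho> U U'"
 shows "EX C>0. ALL F F' e. 0 < e --> e <= 1 --> rad_C1 ((\<rho> + 1) / 2) F F' -->
  (ALL q:{0..1}. abs (F q - U q) <= e & abs (F' q - U' q) <= e) -->
  abs (form F F' - form U U') <= C * e & abs (integral {0..1} (%q. (F q)^2) - integral {0..1} (%q. (U q)^2)) <= C * e" proof -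
 have \<rho>: "0 < \<rho>" "\<rho> < 1" using R by (auto simp: rad_C1_def)
 define r where "r = (\<rho> + 1) / 2"
 have r: "\<rho> < r" "r < 1" using \<rho> by (auto simp: r_def)
 have "bounded (U ` {0..1})" "bounded (U' ` {0..1})"
  by (intro compact_imp_bounded compact_continuous_image rad_C1_continuous[OF R]; simp)+
 then obtain M1 M2 where "ALL z:U ` {0..1}. norm z <= M1" "ALL z:U' ` {0..1}. norm z <= M2" unfolding bounded_iff by blast
 hence M12: "!!q. q : {0..1} ==> abs (U q) <= M1" "!!q. q : {0..1} ==> abs (U' q) <= M2" by auto
 define M where "M = max 1 (max M1 M2)"
 have M: "1 <= M" "!!q. q : {0..1} ==> abs (U q) <= M" "!!q. q : {0..1} ==> abs (U' q) <= M"
  using M12 by (auto simp: M_def le_max_iff_disj)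
 define K where "K = 4 + (1 / (1 - r)^2 + \<alpha>)"
 have K: "4 <= K" using \<alpha> by (simp add: K_def)
 define C where "C = K * (2 * M + 1)"
 have C: "0 < C" using K M by (simp add: C_def)
 have sq: "abs (s^2 - t^2) <= (2 * M + 1) * e" if "abs (s - t) <= e" "abs t <= M" "e <= 1" "0 < e" for s t e :: real proof -
  have "abs (s^2 - t^2) = abs (s + t) * abs (s - t)" by (simp add: power2_eq_square square_diff_square_factored flip: abs_mult)
  also have "... <= (2 * M + 1) * e" using that by (intro mult_mono) auto
  finally show ?thesis .
 qed
 have main: "abs (form F F' - form U U') <= C * e & abs (integral {0..1} (%q. (F q)^2) - integral {0..1} (%q. (U q)^2)) <= C * e"
  if e: "0 < e" "e <= 1" and F: "rad_C1 r F F'" and cl: "ALL q:{0..1}. abs (F q - U q) <= e & abs (F' q - U' q) <= e" for F F' e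
 proof -
  have pc: "continuous_on {0..1} (%q. 4 * q * (G' q)^2 - pot q * (G q)^2)" if G: "rad_C1 sg G G'" for sg G G' proof -
   have "continuous_on {0..1} (%q. 4 * q * (G' q)^2 - ((G q)^2 * (1 / (1 - q)^2) + \<alpha> * (G q)^2))"
    by (intro continuous_intros rad_C1_continuous[OF G] rad_weight_continuous[OF G])
   thus ?thesis by (simp add: pot_def algebra_simps)
  qed
  have U0: "U q = 0" "F q = 0" if "r <= q" "q <= 1" for q using R F that r by (auto simp: rad_C1_def)
  have pt: "norm ((4 * q * (F' q)^2 - pot q * (F q)^2) - (4 * q * (U' q)^2 - pot q * (U q)^2)) <= C * e" if q: "q : {0..1}" for q
  proof -
   have 1: "abs (4 * q * ((F' q)^2 - (U' q)^2)) <= 4 * ((2 * M + 1) * e)"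
    unfolding abs_mult using q sq[of "F' q" "U' q" e] cl M e by (intro mult_mono) auto
   have 2: "abs (pot q * ((F q)^2 - (U q)^2)) <= (1 / (1 - r)^2 + \<alpha>) * ((2 * M + 1) * e)" proof (cases "q < r")
    case True
    have "1 / (1 - q)^2 <= 1 / (1 - r)^2" using True r q by (intro divide_left_mono power_mono mult_pos_pos) auto
    hence "abs (pot q) <= 1 / (1 - r)^2 + \<alpha>" using pot_nonneg[of q] by (simp add: pot_def)
    thus ?thesis unfolding abs_mult using sq[of "F q" "U q" e] cl M e q \<alpha> by (intro mult_mono) auto
   next
    case False
    thus ?thesis using U0[of q] q M e \<alpha> by simp
   qed
   have "abs ((4 * q * (F' q)^2 - pot q * (F q)^2) - (4 * q * (U' q)^2 - pot q * (U q)^2))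
    = abs (4 * q * ((F' q)^2 - (U' q)^2) - pot q * ((F q)^2 - (U q)^2))" by (simp add: algebra_simps)
   also have "... <= 4 * ((2 * M + 1) * e) + (1 / (1 - r)^2 + \<alpha>) * ((2 * M + 1) * e)"
    using abs_triangle_ineq4[of "4 * q * ((F' q)^2 - (U' q)^2)" "pot q * ((F q)^2 - (U q)^2)"] 1 2 by linarith
   also have "... = C * e" by (simp only: C_def K_def distrib_right mult.assoc)
   finally show ?thesis by simp
  qed
  have "norm (integral {0..1} (%q. (4 * q * (F' q)^2 - pot q * (F q)^2) - (4 * q * (U' q)^2 - pot q * (U q)^2)))
    <= integral {0..1} (%_::real. C * e)" by (rule integral_norm_bound_integral)
    (use pt in "auto intro!: integrable_continuous_real continuous_on_diff pc[OF F] pc[OF R]")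
  moreover have "integral {0..1} (%q. (4 * q * (F' q)^2 - pot q * (F q)^2) - (4 * q * (U' q)^2 - pot q * (U q)^2)) = form F F' - form U U'"
   unfolding form_def by (rule integral_diff; rule integrable_continuous_real; rule pc[OF F] pc[OF R])
  ultimately have A: "abs (form F F' - form U U') <= C * e" by simp
  have "norm (integral {0..1} (%q. (F q)^2 - (U q)^2)) <= integral {0..1} (%_::real. C * e)"
  proof (rule integral_norm_bound_integral)
   show "(%q. (F q)^2 - (U q)^2) integrable_on {0..1}"
    by (intro integrable_continuous_real continuous_intros rad_C1_continuous[OF F] rad_C1_continuous[OF R])
   show "norm ((F q)^2 - (U q)^2) <= C * e" if "q : {0..1}" for q proof -
    have "norm ((F q)^2 - (U q)^2) <= 1 * ((2 * M + 1) * e)" using sq[of "F q" "U q" e] cl M e that by simp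
    also have "... <= K * ((2 * M + 1) * e)" using K M e by (intro mult_right_mono) auto
    finally show ?thesis by (simp add: C_def mult.assoc)
   qed
  qed auto
  moreover have "integral {0..1} (%q. (F q)^2 - (U q)^2) = integral {0..1} (%q. (F q)^2) - integral {0..1} (%q. (U q)^2)"
   by (rule integral_diff; rule integrable_continuous_real; intro continuous_intros rad_C1_continuous[OF F] rad_C1_continuous[OF R])
  ultimately show ?thesis using A by simp
 qed
 show ?thesis by (rule exI[of _ C]) (use C main in "simp add: r_def")
qed

lemma rad_test_gradient: assumes "rad_C1 \<rho> F F'" shows "gradient (rad F) = rad_grad F'"
 by (rule C1c_gradient[OF rad_C1c[OF assms]])

lemma Qa_rad: assumes "rad_C1 \<rho> F F'" "0 <= \<alpha>" shows "Qa \<alpha> (rad F) = pi * ground_state.form \<alpha> F F'"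
 using rad_form(1)[OF assms] by (simp add: Qa_def Q_def rad_test_gradient[OF assms(1)])

text \<open>The infimum \<open>lambda1\<close> yields the gap for radial test functions; their C^1
  density and the continuity of the form extend it to radial C^1 profiles.\<close>

lemma coercive_ground_state:
 assumes a: "0 <= \<alpha>" "\<alpha> < lambda1" shows "coercive_ground_state \<alpha> (lambda1 - \<alpha>)" proof -
 interpret ground_state \<alpha> by unfold_locales (rule a(1))
 show ?thesis proof (rule coercive_ground_state.intro[OF ground_state_axioms coercive_ground_state_axioms.intro])
  show "0 < lambda1 - \<alpha>" using a by simp
  fix \<rho> U U' assume R: "rad_C1 \<rho> U U'"
  let ?I = "%U. integral {0..1} (%q. (U q)^2)"
  obtain C where C: "0 < C" "!!F F' e. 0 < e ==> e <= 1 ==> rad_C1 ((\<rho> + 1) / 2) F F' ==>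
    (ALL q:{0..1}. abs (F q - U q) <= e & abs (F' q - U' q) <= e) ==>
    abs (form F F' - form U U') <= C * e & abs (?I F - ?I U) <= C * e" using form_close[OF R] by blast
  define k where "k = lambda1 - \<alpha>"
  have k: "0 < k" using a by (simp add: k_def)
  have ae: "k * ?I U <= form U U' + (k + 1) * (C * e)" if e: "0 < e" "e <= 1" for e proof -
   obtain F F' where F: "rad F : test_functions" "rad_C1 ((\<rho> + 1) / 2) F F'"
    "ALL q:{0..1}. abs (F q - U q) <= e & abs (F' q - U' q) <= e" using rad_C1_test_approx[OF R e(1)] by blast
   note cl = C(2)[OF e F(2,3)]
   have "k * (pi * ?I F) <= pi * form F F'"
    using Qa_ge[OF F(1), of \<alpha>] unfolding Qa_rad[OF F(2) a(1)] rad_form(2)[OF F(2) a(1)] k_def .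
   hence "pi * (k * ?I F) <= pi * form F F'" by (simp add: ac_simps)
   hence le: "k * ?I F <= form F F'" by (simp add: mult_le_cancel_left)
   have "?I U <= ?I F + C * e" using cl by linarith
   hence "k * ?I U <= k * (?I F + C * e)" using k by (intro mult_left_mono) auto
   thus ?thesis using le conjunct1[OF cl] unfolding distrib_left distrib_right by linarith
  qed
  have lim: "k * ?I U <= form U U' + (k + 1) * (C * (1 / real (Suc n)))" for n by (rule ae) auto
  have "(%n. form U U' + (k + 1) * (C * (1 / real (Suc n)))) ----> form U U' + (k + 1) * (C * 0)"
   using LIMSEQ_inverse_real_of_nat by (intro tendsto_intros) (simp add: inverse_eq_divide)
  hence "k * ?I U <= form U U' + (k + 1) * (C * 0)" by (rule LIMSEQ_le_const) (use lim in auto)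
  thus "(lambda1 - \<alpha>) * ?I U <= form U U'" by (simp add: k_def)
 qed
qed

text \<open>The bounds on {a..} with a > 0 reach 0 by shifting y and letting the shift tend to 0;
  vanishing near 0 supplies the continuity there.\<close>

lemma energy_le_zero_extend: assumes E: "!!a. 0 < a ==> energy_le a y C" and y: "!!s. s <= sg ==> y s = 0" and sg: "0 < sg"
 shows "energy_le 0 y C" proof (rule energy_le_limit[of 0 "%k s. y (1 / real (Suc k) + s) - 0" "%_. C"])
 show "energy_le 0 (%s. y (1 / real (Suc k) + s) - 0) C" for k by (rule energy_le_shift[OF E]) simp
 fix s :: real assume s: "0 <= s"
 have z: "(%k. 1 / real (Suc k) + s) ----> 0 + s"
  using LIMSEQ_inverse_real_of_nat by (intro tendsto_intros) (simp add: inverse_eq_divide)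
 have "isCont y s" proof (cases "s < sg")
  case True
  have "isCont (%_. 0::real) s" by simp
  moreover have "\<forall>\<^sub>F x in nhds s. (%_. 0) x = y x"
   by (rule eventually_nhds_in_open[of "{..<sg}", THEN eventually_mono]) (use True y in auto)
  ultimately show ?thesis by (rule isCont_cong[THEN iffD1, rotated])
 next
  case False
  have "continuous_on {sg/2<..} y" by (rule continuous_on_subset[OF energy_le_continuous[OF E[of "sg/2"]]]) (use sg in auto)
  thus ?thesis by (rule continuous_on_interior) (use False sg in "simp add: interior_open")
 qed
 from isCont_tendsto_compose[OF this] z show "(%k. y (1 / real (Suc k) + s) - 0) ----> y s" by simp
qed simp

section \<open>Passage between the disc and the half-line\<close>

context coercive_ground_state
begin

text \<open>The inverse of the substitution u = \<phi> y(S) / sqrt (2 pi), from a profile in q back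
  to y.\<close>

definition pull :: "(real => real) => real => real" where
 "pull F s = (if s <= 0 then 0 else sqrt (2 * pi) * F (Qi s) / \<phi> (Qi s))"

text \<open>Jacobi's factorization read in the other direction: K accumulates half of the form minus
  a boundary term, K' = 2 q \<phi>^2 w'^2 for w = U / \<phi>, and the energy of y between a and t is
  2 pi (K (Qi a) - K (Qi t)).\<close>

lemma radial_energy: assumes R: "rad_C1 \<rho> U U'" shows "energy_le 0 (pull U) (pi * form U U')" proof -
 have \<rho>: "0 < \<rho>" "\<rho> < 1" using R by (auto simp: rad_C1_def)
 have nz: "\<phi> q ~= 0" if "0 <= q" "q < 1" for q using \<phi>_pos[OF that] by simp
 define i where "i q = 4 * q * (U' q)^2 - pot q * (U q)^2" for q
 have ic: "continuous_on {0..1} i" proof -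
  have "continuous_on {0..1} (%q. 4 * q * (U' q)^2 - ((U q)^2 * (1 / (1 - q)^2) + \<alpha> * (U q)^2))"
   by (intro continuous_intros rad_C1_continuous[OF R] rad_weight_continuous[OF R])
  thus ?thesis by (simp add: i_def[abs_def] pot_def algebra_simps)
 qed
 define w' where "w' q = (U' q * \<phi> q - U q * \<phi>' q) / (\<phi> q)^2" for q
 define K where "K q = integral {0..q} i / 2 - 2 * (q * \<phi>' q) * ((U q)^2 / \<phi> q)" for q
 have dU: "DERIV U q :> U' q" if "0 < q" "q < 1" for q proof -
  have "(U has_real_derivative U' q) (at q within {0..1})" using R that by (simp add: rad_C1_def)
  thus ?thesis using at_within_Icc_at[OF that] by simp
 qed
 have dK: "DERIV K q :> 2 * q * (\<phi> q)^2 * (w' q)^2" if q: "0 < q" "q < 1" for q proof -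
  have p: "0 < \<phi> q" using \<phi>_pos q by simp
  have d1: "DERIV (%q. integral {0..q} i) q :> i q"
   using integral_has_real_derivative[OF ic, of q] q at_within_Icc_at[of 0 q 1] by auto
  have d2: "DERIV (%q. q * \<phi>' q) q :> - (pot q * \<phi> q) / 4" using \<phi>_ode q by simp
  have d3: "DERIV (%q. (U q)^2 / \<phi> q) q :> (2 * U q * U' q * \<phi> q - (U q)^2 * \<phi>' q) / (\<phi> q * \<phi> q)"
   using p q by (auto intro!: derivative_eq_intros dU \<phi>_deriv)
  have "DERIV K q :> i q / 2 - (2 * (- (pot q * \<phi> q) / 4) * ((U q)^2 / \<phi> q)
    + (2 * U q * U' q * \<phi> q - (U q)^2 * \<phi>' q) / (\<phi> q * \<phi> q) * (2 * (q * \<phi>' q)))"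
   unfolding K_def by (rule DERIV_diff[OF DERIV_cdivide[OF d1] DERIV_mult[OF DERIV_cmult[OF d2] d3]])
  also have "i q / 2 - (2 * (- (pot q * \<phi> q) / 4) * ((U q)^2 / \<phi> q)
    + (2 * U q * U' q * \<phi> q - (U q)^2 * \<phi>' q) / (\<phi> q * \<phi> q) * (2 * (q * \<phi>' q))) = 2 * q * (\<phi> q)^2 * (w' q)^2"
   using p unfolding i_def w'_def by (simp add: divide_simps power2_eq_square) (simp add: algebra_simps)
  finally show ?thesis .
 qed
 have Kmono: "K p <= K q" if pq: "0 <= p" "p <= q" "q < 1" for p q proof (rule DERIV_nonneg_imp_increasing_open[OF pq(2)])
  show "EX D. DERIV K x :> D & 0 <= D" if "p < x" "x < q" for x by (intro exI conjI, rule dK) (use that pq in auto)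
  show "continuous_on {p..q} K" unfolding K_def using pq
   by (intro ballI nz continuous_intros continuous_on_subset[OF indefinite_integral_continuous_1[OF integrable_continuous_real[OF ic]]]
    continuous_on_subset[OF rad_C1_continuous(1)[OF R]] \<phi>_continuous \<phi>'_continuous) force+
 qed
 have K0: "0 <= K q" if "0 <= q" "q < 1" for q using Kmono[of 0 q] that by (simp add: K_def)
 have z: "U q = 0" "U' q = 0" if "\<rho> <= q" "q <= 1" for q using R that by (auto simp: rad_C1_def)
 have K1: "K q <= form U U' / 2" if q: "0 <= q" "q < 1" for q proof -
  \<comment> \<open>From \<rho> on the integrand and the boundary term vanish, so K has reached its
    final value.\<close>
  have "K (max q \<rho>) = form U U' / 2" proof -
   have "integral {0..1} i = integral {0..max q \<rho>} i + integral {max q \<rho>..1} i"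
    by (rule Henstock_Kurzweil_Integration.integral_combine[symmetric])
     (use q \<rho> in "auto intro: integrable_continuous_real[OF ic]")
   moreover have "integral {max q \<rho>..1} i = 0" using integral_cong[of "{max q \<rho>..1}" i "%_. 0"] by (auto simp: i_def z)
   ultimately show ?thesis using z[of "max q \<rho>"] q \<rho> by (simp add: K_def form_def i_def[abs_def])
  qed
  thus ?thesis using Kmono[of q "max q \<rho>"] q \<rho> by simp
 qed
 define y' where "y' s = sqrt (2 * pi) * w' (Qi s) * (- (2 * Qi s * (\<phi> (Qi s))^2))" for s
 have dy: "DERIV (pull U) s :> y' s" if s: "0 < s" for s proof -
  note Q = Qi(1,2)[OF s]
  have "DERIV (%q. sqrt (2 * pi) * U q / \<phi> q) (Qi s) :> sqrt (2 * pi) * w' (Qi s)"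
   using \<phi>_pos[of "Qi s"] Q unfolding w'_def
   by (auto intro!: derivative_eq_intros dU \<phi>_deriv simp: power2_eq_square algebra_simps)
  from DERIV_chain2[OF this Qi_deriv[OF s]]
  have "DERIV (%s. sqrt (2 * pi) * U (Qi s) / \<phi> (Qi s)) s :> y' s" by (simp add: y'_def)
  thus ?thesis by (rule has_field_derivative_transform_within_open[of _ _ _ "{0<..}"]) (use s in "auto simp: pull_def")
 qed
 have Qc: "continuous_on {a..} Qi" if "0 < a" for a by (rule continuous_at_imp_continuous_on) (use that Qi_isCont in auto)
 have en: "energy_le a (pull U) (pi * form U U')" if a: "0 < a" for a proof (rule energy_le_C1)
  show "(pull U has_real_derivative y' s) (at s within {a..})" if "a <= s" for s
   using dy a that by (auto intro: has_field_derivative_at_within)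
  have im: "Qi ` {a..} \<subseteq> {0..1}" "Qi ` {a..} \<subseteq> {0<..<1}" using Qi a by (auto simp: less_imp_le)
  have "continuous_on {0<..<1} w'" unfolding w'_def
   by (intro ballI power_not_zero nz continuous_intros continuous_on_subset[OF rad_C1_continuous(1)[OF R]]
    continuous_on_subset[OF rad_C1_continuous(2)[OF R]] \<phi>_continuous \<phi>'_continuous) force+
  moreover have "continuous_on {0<..<1} \<phi>" by (rule \<phi>_continuous) auto
  ultimately show "continuous_on {a..} y'"
   unfolding y'_def using im(2) by (intro continuous_intros Qc[OF a] continuous_on_compose2[OF _ Qc[OF a]]) auto
  fix t assume t: "a <= t"
  have "((%s. (y' s)^2) has_integral (- 2 * pi * K (Qi t)) - (- 2 * pi * K (Qi a))) {a..t}"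
  proof (rule fundamental_theorem_of_calculus[OF t])
   fix s assume "s : {a..t}"
   hence s: "0 < s" using a by auto
   note Q = Qi(1,2)[OF s]
   have "((%s. - 2 * pi * K (Qi s)) has_real_derivative
     - 2 * pi * (2 * Qi s * (\<phi> (Qi s))^2 * (w' (Qi s))^2 * (- (2 * Qi s * (\<phi> (Qi s))^2)))) (at s)"
    by (intro DERIV_cmult DERIV_chain2[OF dK Qi_deriv] Q s)
   also have "- 2 * pi * (2 * Qi s * (\<phi> (Qi s))^2 * (w' (Qi s))^2 * (- (2 * Qi s * (\<phi> (Qi s))^2))) = (y' s)^2"
    by (simp add: y'_def power_mult_distrib) (simp add: power2_eq_square power4_eq_xxxx)
   finally show "((%s. - 2 * pi * K (Qi s)) has_vector_derivative (y' s)^2) (at s within {a..t})"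
    by (simp add: has_real_derivative_iff_has_vector_derivative has_vector_derivative_at_within)
  qed
  hence "integral {a..t} (%s. (y' s)^2) = 2 * pi * (K (Qi a) - K (Qi t))" by (simp add: integral_unique algebra_simps)
  also have "... <= 2 * pi * (form U U' / 2)" proof -
   have "K (Qi a) - K (Qi t) <= form U U' / 2 - 0"
    using K1[of "Qi a"] K0[of "Qi t"] Qi[OF a] Qi[of t] a t by (intro diff_mono) auto
   thus ?thesis by simp
  qed
  finally show "integral {a..t} (%s. (y' s)^2) <= pi * form U U'" by simp
 qed
 show ?thesis proof (rule energy_le_zero_extend[OF en, of "S \<rho>"])
  fix s assume "s <= S \<rho>"
  thus "pull U s = 0" using Qi_less_iff[of s \<rho>] Qi[of s] z[of "Qi s"] \<rho> Qi_S[of \<rho>]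
   by (cases "s = S \<rho>") (auto simp: pull_def not_less)
 qed (use S_pos \<rho> in auto)
qed

text \<open>A Steklov average vanishes near 0 and is constant near infinity, exactly the flatness at
  both ends that the factorization of the form requires.\<close>

lemma rad_C1_profile: assumes "0 < h" "0 <= T" "y 0 = 0" "energy_le 0 y C"
 shows "EX \<rho> U U'. rad_C1 \<rho> U U' & pi * form U U' <= C &
  (ALL q. 0 < q --> q < 1 --> U q = \<phi> q * (steklov h T y (S q) / sqrt (2 * pi)))" proof -
 interpret steklov_average h T C y by unfold_locales (use assms in auto)
 obtain qT where qT: "0 < qT" "qT < 1" "!!q. 0 < q ==> q < qT ==> T + 2 * h <= S q" using S_at_zero[of "T + 2 * h"] by blast
 obtain \<rho> where \<rho>: "0 < \<rho>" "\<rho> < 1" "!!q. \<rho> < q ==> q < 1 ==> S q <= h"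
  using S_small[OF h] by (metis less_imp_le)
 define c where "c = sqrt (2 * pi)"
 define z where "z s = steklov h T y s / c" for s
 define z' where "z' s = steklov_deriv h T y s / c" for s
 have z: "DERIV z s :> z' s" "continuous_on UNIV z'"
  "T + 2 * h <= s ==> z' s = 0" "s <= h ==> z s = 0" "s <= h ==> z' s = 0" for s
  using deriv deriv_zero_right deriv_zero_left zero_left deriv_continuous
  by (auto simp: z_def[abs_def] z'_def[abs_def] c_def intro: DERIV_cdivide intro!: continuous_intros)
 have T2: "0 <= T + 2 * h" using T h by simp
 let ?W = "%q. if q <= 0 then z (T + 2 * h) else if q < 1 then z (S q) else 0"
 let ?W' = "%q. if 0 < q & q < 1 then z' (S q) * (- 1 / (2 * q * (\<phi> q)^2)) else 0"
 have a: "rad_C1 ((\<rho> + 1) / 2) (%q. \<phi> q * ?W q) (%q. \<phi>' q * ?W q + \<phi> q * ?W' q)"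
  by (rule form_factorization(1)[of 1 S qT "T + 2 * h" \<rho> h z z']) (use \<phi>_pos S_deriv qT \<rho> h z T2 in auto)
 have "form (%q. \<phi> q * ?W q) (%q. \<phi>' q * ?W q + \<phi> q * ?W' q) = 2 * integral {0..T + 2 * h} (%s. (z' s)^2)"
  by (rule form_factorization(2)[of 1 S qT "T + 2 * h" \<rho> h z z']) (use \<phi>_pos S_deriv qT \<rho> h z T2 in auto)
 also have "(%s. (z' s)^2) = (%s. (steklov_deriv h T y s)^2 / (2 * pi))" by (simp add: z'_def power_divide c_def)
 finally have "pi * form (%q. \<phi> q * ?W q) (%q. \<phi>' q * ?W q + \<phi> q * ?W' q) <= C" using energy_bound[OF T2] by simp
 thus ?thesis using a
  by (intro exI[of _ "(\<rho> + 1) / 2"] exI[of _ "%q. \<phi> q * ?W q"] exI[of _ "%q. \<phi>' q * ?W q + \<phi> q * ?W' q"] conjI)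
   (auto simp: z_def c_def)
qed

lemma steklov_test_approx: assumes y: "0 < h" "0 <= T" "y 0 = 0" "energy_le 0 y C" and e: "0 < e"
 shows "EX \<rho> F F'. rad F : test_functions & rad_C1 \<rho> F F' & Qa \<alpha> (rad F) <= C + e &
  (ALL q. 0 < q --> q < 1 --> abs (F q - \<phi> q * (steklov h T y (S q) / sqrt (2 * pi))) <= e)" proof -
 obtain \<rho> U U' where U: "rad_C1 \<rho> U U'" "pi * form U U' <= C"
  "!!q. 0 < q ==> q < 1 ==> U q = \<phi> q * (steklov h T y (S q) / sqrt (2 * pi))" using rad_C1_profile[OF y] by blast
 obtain K where K: "0 < K" "!!F F' e. 0 < e ==> e <= 1 ==> rad_C1 ((\<rho> + 1) / 2) F F' ==>
    (ALL q:{0..1}. abs (F q - U q) <= e & abs (F' q - U' q) <= e) ==> abs (form F F' - form U U') <= K * e"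
  using form_close[OF U(1)] by blast
 define d where "d = min 1 (min e (e / (pi * K)))"
 have d: "0 < d" "d <= 1" "d <= e" "pi * (K * d) <= e" using e K(1) by (auto simp: d_def min_def field_simps)
 obtain F F' where F: "rad F : test_functions" "rad_C1 ((\<rho> + 1) / 2) F F'"
  "ALL q:{0..1}. abs (F q - U q) <= d & abs (F' q - U' q) <= d" using rad_C1_test_approx[OF U(1) d(1)] by blast
 have "form F F' <= form U U' + K * d" using K(2)[OF d(1,2) F(2,3)] by linarith
 hence "pi * form F F' <= pi * (form U U' + K * d)" by (intro mult_left_mono) auto
 hence "Qa \<alpha> (rad F) <= C + e" using U(2) d(4) unfolding Qa_rad[OF F(2) \<alpha>] by (simp add: distrib_left)
 moreover have "abs (F q - \<phi> q * (steklov h T y (S q) / sqrt (2 * pi))) <= e" if "0 < q" "q < 1" for q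
  using F(3)[rule_format, of q] U(3)[OF that] d(3) that by auto
 ultimately show ?thesis using F by blast
qed

end

lemma Qa_parallelogram: assumes f: "f : test_functions" and g: "g : test_functions"
 shows "Qa \<alpha> (%x. 1/2 * f x + 1/2 * g x) = (Qa \<alpha> f + Qa \<alpha> g) / 2 - Qa \<alpha> (%x. f x - g x) / 4" proof -
 have i: "integrable lborel (%x. (h x)^2)" if "h : test_functions" for h by (rule C1c_integrable(3)[OF test_C1c[OF that]])
 note d = test_diff[OF f g]
 have *: "qa - \<alpha> * ia = ((qf - \<alpha> * i) + (qg - \<alpha> * j)) / 2 - (qd - \<alpha> * k) / 4"
  if "ia = 1/2 * i + 1/2 * j - 1/4 * k" "qa = qf / 4 + b / 2 + qg / 4" "qd = qf - 2 * b + qg"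
  for qa qf qg qd i j k ia b :: real unfolding that by (simp add: field_simps)
 have "(LBINT x. (1/2 * f x + 1/2 * g x)^2) = (LBINT x. 1/2 * (f x)^2 + 1/2 * (g x)^2 - 1/4 * (f x - g x)^2)"
  by (rule Bochner_Integration.integral_cong) (auto simp: power2_eq_square field_simps)
 also have "... = 1/2 * (LBINT x. (f x)^2) + 1/2 * (LBINT x. (g x)^2) - 1/4 * (LBINT x. (f x - g x)^2)"
  using i[OF f] i[OF g] i[OF d] by simp
 finally show ?thesis unfolding Qa_def
  by (rule *) (use Q_lincomb[OF f g, of "1/2" "1/2"] Q_lincomb[OF f g, of 1 "- 1"] in "simp_all add: power2_eq_square")
qed

lemma rad_C1_avg: assumes "rad_C1 \<rho> U U'" "rad_C1 sg W W'"
 shows "rad_C1 (max \<rho> sg) (%q. 1/2 * U q + 1/2 * W q) (%q. 1/2 * U' q + 1/2 * W' q)" using assms unfolding rad_C1_def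
 by (intro conjI ballI DERIV_add DERIV_cmult continuous_intros) auto

lemma AE_disc_nonzero: "AE x in disc_measure. x ~= 0" by (rule AE_I'[of "{0}"]) (auto simp: null_sets_restrict_space)

context coercive_ground_state
begin

definition height :: "plane => real" where "height x = (if x = 0 then 0 else S ((norm x)^2))"

definition lift :: "(real => real) => plane => real" where "lift y x = \<phi> ((norm x)^2) * (y (height x) / sqrt (2 * pi))"

lemma height_pos: "x : disc ==> x ~= 0 ==> 0 < height x" using S_pos[of "(norm x)^2"] norm_lt_1_sq[of x] by (simp add: height_def)

lemma height_measurable: "height : borel_measurable disc_measure" proof -
 have "(%q. indicator {0<..<1} q *R S q) : borel_measurable borel" by (rule borel_measurable_continuous_on_indicator)
   (auto intro!: continuous_at_imp_continuous_on DERIV_isCont[OF S_deriv])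
 hence "(%x::plane. indicator {0<..<1} ((norm x)^2) *R S ((norm x)^2)) : borel_measurable borel"
  by (rule measurable_compose[rotated]) measurable
 from borel_to_disc[OF this] show ?thesis proof (rule measurable_cong[THEN iffD1, rotated])
  fix x assume "x : space disc_measure"
  hence "(norm x)^2 < 1" using norm_lt_1_sq[of x] by (simp add: space_restrict_space)
  thus "indicator {0<..<1} ((norm x)^2) *R S ((norm x)^2) = height x" by (auto simp: height_def indicator_def)
 qed
qed

text \<open>The weight decays like exp (- 2 s), so the exponential of the height is integrable; up
  to a constant it exceeds every power of the height and thus serves as majorant for all p at
  once.\<close>

lemma exp_height_integrable: "integrable disc_measure (%x. K * exp (C + height x))" proof -
 note [measurable] = height_measurable
 have "(\<integral>\<^sup>+x. ennreal (exp (height x)) \<partial>disc_measure)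
   = ennreal pi * (\<integral>\<^sup>+s. ennreal (omega s) * indicator {0..} s * ennreal (exp s) \<partial>lborel)"
  unfolding height_def by (rule disc_S_nn_integral) measurable
 also have "(\<integral>\<^sup>+s. ennreal (omega s) * indicator {0..} s * ennreal (exp s) \<partial>lborel)
   <= (\<integral>\<^sup>+s. ennreal (2 * exp (2 * A)) * (ennreal (exp (- 1 * s)) * indicator {0..} s) \<partial>lborel)"
 proof (intro nn_integral_mono)
  fix s :: real
  have "omega s * exp s <= 2 * exp (2 * A - 2 * s) * exp s" by (intro mult_right_mono omega_le) simp
  also have "... = 2 * exp (2 * A) * exp (- 1 * s)" by (simp add: exp_diff exp_minus field_simps flip: exp_add)
  finally show "ennreal (omega s) * indicator {0..} s * ennreal (exp s)
    <= ennreal (2 * exp (2 * A)) * (ennreal (exp (- 1 * s)) * indicator {0..} s)"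
   by (auto simp: indicator_def intro!: ennreal_leI simp flip: ennreal_mult'')
 qed
 also have "... = ennreal (2 * exp (2 * A)) * (\<integral>\<^sup>+s. ennreal (exp (- 1 * s)) * indicator {0..} s \<partial>lborel)"
  by (rule nn_integral_cmult) measurable
 finally have "(\<integral>\<^sup>+x. ennreal (exp (height x)) \<partial>disc_measure) < \<infinity>"
  using exp_Ici_finite[of 1] by (auto intro: le_less_trans ennreal_mult_less_top simp: mult_left_mono ennreal_mult_less_top)
 hence "integrable disc_measure (%x. exp (height x))" by (intro integrableI_nonneg) auto
 hence "integrable disc_measure (%x. (K * exp C) * exp (height x))" by simp
 thus ?thesis by (simp add: exp_add mult.assoc)
qed

lemma powr_le_exp: fixes t p :: real assumes "0 <= t" "0 < p" shows "t powr p <= p powr p * exp t" proof -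
 have "t / p <= exp (t / p)" using exp_ge_add_one_self[of "t / p"] by linarith
 hence "t <= p * exp (t / p)" using assms(2) by (simp add: field_simps)
 hence "t powr p <= (p * exp (t / p)) powr p" using assms by (intro powr_mono2) auto
 also have "... = p powr p * exp t" using assms by (simp add: powr_mult exp_powr_real)
 finally show ?thesis .
qed

text \<open>The approximants are Cauchy because the energy of \<open>y\<close> is the least one: by the parallelogram law,
  midpoints of distant approximants would have smaller energy in the limit.\<close>

lemma lift_H_space: assumes al: "\<alpha> < lambda1" and y0: "y 0 = 0" and E: "energy_le 0 y C"
  and min: "!!C'. energy_le 0 y C' ==> C <= C'" shows "lift y : H_space" and "(norm_1 \<alpha> (lift y))^2 = C" proof -
 define e where "e k = 1 / real (Suc k)" for k
 define c where "c = sqrt (2 * pi)"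
 have c: "1 <= c" using pi_ge_two by (simp add: c_def)
 have e: "0 < e k" "e k <= 1" for k by (auto simp: e_def)
 have e0: "e ----> 0" using LIMSEQ_inverse_real_of_nat by (simp add: e_def[abs_def] inverse_eq_divide)
 have edec: "e m <= e n" if "n <= m" for m n using that by (simp add: e_def frac_le)
 define Y where "Y k = steklov (e k) (real (Suc k)) y" for k
 have "EX \<rho> F F'. rad F : test_functions & rad_C1 \<rho> F F' & Qa \<alpha> (rad F) <= C + e k &
  (ALL q. 0 < q --> q < 1 --> abs (F q - \<phi> q * (Y k (S q) / c)) <= e k)" for k
  unfolding Y_def c_def by (rule steklov_test_approx[OF e(1) _ y0 E e(1)]) simp
 then obtain \<rho> F F' where F: "!!k. rad (F k) : test_functions" "!!k. rad_C1 (\<rho> k) (F k) (F' k)"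
  "!!k. Qa \<alpha> (rad (F k)) <= C + e k" "!!k q. 0 < q ==> q < 1 ==> abs (F k q - \<phi> q * (Y k (S q) / c)) <= e k" by metis
 define f where "f k = rad (F k)" for k
 have Ylim: "(%k. Y k s) ----> y s" if "0 <= s" for s unfolding Y_def e_def by (rule steklov_tendsto[OF y0 E that])
 have Flim: "(%k. F k q) ----> \<phi> q * (y (S q) / c)" if q: "0 < q" "q < 1" for q proof -
  have "(%k. F k q - \<phi> q * (Y k (S q) / c)) ----> 0"
   by (rule Lim_null_comparison[OF always_eventually e0]) (use F(4)[OF q] in simp)
  moreover have "(%k. \<phi> q * (Y k (S q) / c)) ----> \<phi> q * (y (S q) / c)"
   by (intro tendsto_intros Ylim) (use S_pos[OF q] c in auto)
  ultimately have "(%k. (F k q - \<phi> q * (Y k (S q) / c)) + \<phi> q * (Y k (S q) / c)) ----> 0 + \<phi> q * (y (S q) / c)"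
   by (rule tendsto_add)
  thus ?thesis by simp
 qed
 have plim: "(%k. pull (F k) s) ----> y s" if s: "0 <= s" for s proof (cases "s = 0")
  case False
  hence s: "0 < s" using s by simp
  note Q = Qi[OF s]
  have "(%k. sqrt (2 * pi) * F k (Qi s) / \<phi> (Qi s)) ----> sqrt (2 * pi) * (\<phi> (Qi s) * (y (S (Qi s)) / c)) / \<phi> (Qi s)"
   using \<phi>_pos[of "Qi s"] Q by (intro tendsto_intros Flim) auto
  moreover have "sqrt (2 * pi) * (\<phi> (Qi s) * (y (S (Qi s)) / c)) / \<phi> (Qi s) = y s"
   using \<phi>_pos[of "Qi s"] Q c by (simp add: c_def)
  ultimately show ?thesis using s by (simp add: pull_def)
 qed (simp add: pull_def y0)
 have cauchy: "EX N. ALL m>=N. ALL n>=N. Qa \<alpha> (%x. f m x - f n x) < d" if d: "0 < d" for d proof (rule ccontr)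
  assume "\<nexists>N. ALL m>=N. ALL n>=N. Qa \<alpha> (%x. f m x - f n x) < d"
  hence "ALL N. EX m n. N <= m & N <= n & d <= Qa \<alpha> (%x. f m x - f n x)" by (meson not_less)
  then obtain a b where ab: "!!N. N <= a N" "!!N. N <= b N" "!!N. d <= Qa \<alpha> (%x. f (a N) x - f (b N) x)" by metis
  define G where "G N q = 1/2 * F (a N) q + 1/2 * F (b N) q" for N q
  have Gr: "rad_C1 (max (\<rho> (a N)) (\<rho> (b N))) (G N) (%q. 1/2 * F' (a N) q + 1/2 * F' (b N) q)" for N
   unfolding G_def by (rule rad_C1_avg[OF F(2) F(2)])
  have "energy_le 0 (pull (G N)) (C + e N - d / 4)" for N proof (rule energy_le_mono[OF radial_energy[OF Gr]])
   have "rad (G N) = (%x. 1/2 * f (a N) x + 1/2 * f (b N) x)" by (auto simp: rad_def f_def G_def)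
   hence eq: "Qa \<alpha> (rad (G N)) = (Qa \<alpha> (f (a N)) + Qa \<alpha> (f (b N))) / 2 - Qa \<alpha> (%x. f (a N) x - f (b N) x) / 4"
    using Qa_parallelogram F(1) by (simp add: f_def)
   have avg: "(p + q) / 2 - t / 4 <= C + e N - d / 4" if "p <= C + e (a N)" "q <= C + e (b N)" "d <= t" for p q t :: real
    using that edec[OF ab(1)[of N]] edec[OF ab(2)[of N]] by argo
   have "Qa \<alpha> (rad (G N)) <= C + e N - d / 4" unfolding eq by (rule avg[OF _ _ ab(3)]) (use F(3) in "simp_all add: f_def")
   thus "pi * form (G N) (%q. 1/2 * F' (a N) q + 1/2 * F' (b N) q) <= C + e N - d / 4" unfolding Qa_rad[OF Gr \<alpha>] .
  qed
  moreover have "(%N. pull (G N) s) ----> y s" if "0 <= s" for s proof -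
   have "filterlim a at_top sequentially" "filterlim b at_top sequentially"
    using ab(1,2) by (auto intro: filterlim_at_top_mono[OF filterlim_ident])
   hence "(%N. 1/2 * pull (F (a N)) s + 1/2 * pull (F (b N)) s) ----> 1/2 * y s + 1/2 * y s"
    by (intro tendsto_intros filterlim_compose[OF plim[OF that]])
   moreover have "pull (G N) s = 1/2 * pull (F (a N)) s + 1/2 * pull (F (b N)) s" for N
    by (simp add: pull_def G_def add_divide_distrib distrib_left)
   ultimately show ?thesis by simp
  qed
  moreover have "(%N. C + e N - d / 4) ----> C + 0 - d / 4" by (intro tendsto_intros e0)
  ultimately have "energy_le 0 y (C + 0 - d / 4)" by (rule energy_le_limit)
  from min[OF this] d show False by simp
 qed
 have fn: "f k : test_functions" for k using F(1) by (simp add: f_def)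
 have tc: "test_Cauchy f" unfolding test_Cauchy_def proof (intro conjI allI impI fn)
  fix d :: real assume d: "0 < d"
  \<comment> \<open>Converts smallness of \<open>Qa\<close> into smallness of \<open>Q\<close>: by
    the spectral gap, \<alpha> times the squared L^2-norm is at most \<alpha> / (lambda1 - \<alpha>)
    times \<open>Qa\<close>.\<close>
  define k where "k = 1 + \<alpha> / (lambda1 - \<alpha>)"
  have k: "0 < k" using al \<alpha> by (auto simp: k_def intro: add_pos_nonneg)
  obtain N where N: "!!m n. N <= m ==> N <= n ==> Qa \<alpha> (%x. f m x - f n x) < d^2 / k"
   using cauchy[of "d^2 / k"] k d by auto
  have "test_norm (%x. f m x - f n x) < d" if "N <= m" "N <= n" for m n proof -
   let ?g = "%x. f m x - f n x" and ?I = "(LBINT x. (f m x - f n x)^2)"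
   have g: "?g : test_functions" by (rule test_diff[OF fn fn])
   have "?I <= Qa \<alpha> ?g / (lambda1 - \<alpha>)" using Qa_ge[OF g, of \<alpha>] al by (simp add: field_simps)
   hence "\<alpha> * ?I <= \<alpha> * (Qa \<alpha> ?g / (lambda1 - \<alpha>))" by (rule mult_left_mono[OF _ \<alpha>])
   hence "Q ?g <= k * Qa \<alpha> ?g" by (simp add: Qa_def k_def distrib_right)
   also have "... < d^2" using N[OF that] k by (simp add: field_simps)
   finally have "(test_norm ?g)^2 < d^2" using test_norm_sq[OF g] by simp
   thus ?thesis by (rule power_less_imp_less_base[OF _ less_imp_le[OF d]])
  qed
  thus "EX N. ALL m>=N. ALL n>=N. test_norm (%x. f m x - f n x) < d" by blast
 qed
 have C: "0 <= C" by (rule energy_le_nonneg[OF E])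
 have bd: "abs (z s) <= (C + s) / 2" if "energy_le 0 z C" "z 0 = 0" "0 <= s" for z s proof -
  have "(z s)^2 <= C * s" using energy_le_two[OF that(1), of 0 s] that by simp
  hence "abs (z s) <= sqrt (C * s)" by (metis real_sqrt_abs real_sqrt_le_iff)
  also have "... <= (C + s) / 2" by (rule arith_geo_mean_sqrt[OF C that(3)])
  finally show ?thesis .
 qed
 have shrink: "abs (\<phi> ((norm x)^2) * (t / c)) <= abs t" if x: "x : disc" for t and x :: plane proof -
  have "(norm x)^2 < 1" using x norm_lt_1_sq by simp
  hence p: "0 <= \<phi> ((norm x)^2)" "\<phi> ((norm x)^2) <= 1"
   using \<phi>_pos \<phi>_le_1[of "(norm x)^2"] by (auto simp: less_imp_le)
  have "abs (\<phi> ((norm x)^2) * (t / c)) = \<phi> ((norm x)^2) * (abs t / c)" using p c by (simp add: abs_mult)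
  also have "... <= 1 * (abs t / 1)" using p c by (intro mult_mono divide_left_mono) auto
  finally show ?thesis by simp
 qed
 have u_le: "abs (lift y x) <= (C + height x) / 2" if "x : disc" for x proof -
  have "0 <= height x" using height_pos[OF that] by (cases "x = 0") (auto simp: height_def)
  from order_trans[OF shrink[OF that] bd[OF E y0 this]] show ?thesis by (simp add: lift_def c_def)
 qed
 have fx: "f k x = F k ((norm x)^2)" if "x : disc" for k x using that by (simp add: f_def rad_def)
 have f_le: "abs (f k x) <= 1 + (C + height x) / 2" if x: "x : disc" "x ~= 0" for k x proof -
  interpret steklov_average "e k" "real (Suc k)" C y by unfold_locales (use e y0 E in auto)
  have "abs (Y k (height x)) <= (C + height x) / 2"
   unfolding Y_def by (rule bd[OF steklov_energy zero_left]) (use e(1)[of k] height_pos[OF x] in "auto simp: less_imp_le")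
  hence "abs (\<phi> ((norm x)^2) * (Y k (height x) / c)) <= (C + height x) / 2" by (rule order_trans[OF shrink[OF x(1)]])
  moreover have "abs (F k ((norm x)^2) - \<phi> ((norm x)^2) * (Y k (height x) / c)) <= 1"
   using order_trans[OF F(4)[of "(norm x)^2" k] e(2)[of k]] x norm_lt_1_sq[of x] by (simp add: height_def)
  ultimately show ?thesis unfolding fx[OF x(1)] by linarith
 qed
 have ulim: "(%k. f k x) ----> lift y x" if x: "x : disc" "x ~= 0" for x
  using Flim[of "(norm x)^2"] norm_lt_1_sq[of x] x by (simp add: fx lift_def height_def c_def)
 have fm: "f k : borel_measurable disc_measure" for k by (rule borel_to_disc[OF test_borel[OF fn]])
 have um: "lift y : borel_measurable disc_measure" proof (rule borel_measurable_LIMSEQ_metric)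
  have "(%x. (if x = 0 then 0 else 1) * f k x) : borel_measurable disc_measure" for k
   by (rule borel_measurable_times[OF borel_to_disc fm]) measurable
  thus "(%x. (if x = 0 then 0 else 1) * f k x) : borel_measurable disc_measure" for k .
  fix x assume "x : space disc_measure"
  hence "x : disc" by (simp add: space_restrict_space)
  thus "(%k. (if x = 0 then 0 else 1) * f k x) ----> lift y x"
   using ulim[of x] by (cases "x = 0") (auto simp: lift_def height_def y0)
 qed
 have sp: "AE x in disc_measure. x : disc" by (rule AE_I2) (simp add: space_restrict_space)
 have dom: "t powr p <= p powr p * exp (1 + C + height x)" if "0 <= t" "t <= 1 + C + height x" "0 < p" for t p x
  using powr_le_exp[of t p] that by (smt (verit) exp_le_cancel_iff mult_left_mono powr_ge_zero)
 have Lp: "lift y : Lp_space p" if p: "0 < p" for p proof -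
  have "integrable disc_measure (%x. abs (lift y x) powr p)"
  proof (rule Bochner_Integration.integrable_bound[OF exp_height_integrable[of "p powr p" "1 + C"]])
   show "(%x. abs (lift y x) powr p) : borel_measurable disc_measure" using um by measurable
   show "AE x in disc_measure. norm (abs (lift y x) powr p) <= norm (p powr p * exp (1 + C + height x))" using sp
   proof eventually_elim
    case (elim x)
    have "0 <= height x" using height_pos[OF elim] by (cases "x = 0") (auto simp: height_def)
    hence "abs (lift y x) <= 1 + C + height x" using u_le[OF elim] C by argo
    thus ?case using dom[OF _ _ p, of "abs (lift y x)" x] by simp
   qed
  qed
  thus ?thesis using um by (simp add: Lp_space_def)
 qed
 have conv: "(%n. Lp_norm p (%x. f n x - lift y x)) ----> 0" if p: "0 < p" for p proof -
  have "(%n. \<integral>x. abs (f n x - lift y x) powr p \<partial>disc_measure) ----> (\<integral>x. 0 \<partial>disc_measure)"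
  proof (rule integral_dominated_convergence[OF _ _ exp_height_integrable[of "p powr p" "1 + C"]])
   show "(%x. abs (f n x - lift y x) powr p) : borel_measurable disc_measure" for n using um fm by measurable
   show "AE x in disc_measure. (%n. abs (f n x - lift y x) powr p) ----> 0" using sp AE_disc_nonzero proof eventually_elim
    case (elim x)
    have "(%n. abs (f n x - lift y x)) ----> abs (lift y x - lift y x)" by (intro tendsto_intros ulim elim)
    thus ?case using p by (intro tendsto_zero_powrI[OF _ tendsto_const]) auto
   qed
   show "AE x in disc_measure. norm (abs (f n x - lift y x) powr p) <= p powr p * exp (1 + C + height x)" for n
    using sp AE_disc_nonzero proof eventually_elim
    case (elim x)
    have "abs (f n x - lift y x) <= abs (f n x) + abs (lift y x)" by (rule abs_triangle_ineq4)
    also have "... <= (1 + (C + height x) / 2) + (C + height x) / 2" by (intro add_mono f_le u_le elim)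
    also have "... = 1 + C + height x" by (simp add: field_simps)
    finally have "abs (f n x - lift y x) <= 1 + C + height x" .
    thus ?case using dom[OF _ _ p, of "abs (f n x - lift y x)" x] by simp
   qed
  qed simp
  hence "(%n. \<integral>x. abs (f n x - lift y x) powr p \<partial>disc_measure) ----> 0" by simp
  thus ?thesis unfolding Lp_norm_def by (rule tendsto_zero_powrI[OF _ tendsto_const]) (use p in auto)
 qed
 have rep: "represents f (lift y)" unfolding represents_def using tc Lp conv by auto
 thus "lift y : H_space" by (auto simp: H_space_def)
 note lim = norm_1_sq_limit[OF rep al]
 \<comment> \<open>The approximants give the upper bound. Conversely, their pulled-back energies
   bound the energy of the pointwise limit y, and C is the least bound for it.\<close>
 have "(norm_1 \<alpha> (lift y))^2 <= C + 0"
  by (rule LIMSEQ_le[OF lim tendsto_add[OF tendsto_const e0]]) (use F(3) in "auto simp: f_def")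
 moreover have "energy_le 0 y ((norm_1 \<alpha> (lift y))^2)"
  by (rule energy_le_limit[OF _ plim lim]) (use radial_energy[OF F(2)] in "simp add: f_def Qa_rad[OF F(2) \<alpha>]")
 ultimately show "(norm_1 \<alpha> (lift y))^2 = C" using min by force
qed

lemma exp_integral_lift: assumes y0: "y 0 = 0" and E: "energy_le 0 y C" and \<gamma>: "0 <= \<gamma>" "\<gamma> <= 2"
 shows "exp_integral (2 * pi * \<gamma>) (lift y) = ennreal pi * weighted_moser.J omega hh \<gamma> y" proof -
 interpret weighted_moser omega hh A \<gamma> by (rule weighted_moser[OF \<gamma>])
 define z where "z s = y (max 0 s)" for s
 have "continuous_on UNIV z"
  unfolding z_def by (rule continuous_on_compose2[OF energy_le_continuous[OF E]]) (auto intro!: continuous_intros)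
 hence [measurable]: "z : borel_measurable borel" by (rule borel_measurable_continuous_onI)
 have "exp_integral (2 * pi * \<gamma>) (lift y) = (\<integral>\<^sup>+x. ennreal (exp (\<gamma> * hh (height x) * (z (height x))^2)) \<partial>disc_measure)"
  unfolding exp_integral_def proof (rule nn_integral_cong)
  fix x assume "x : space disc_measure"
  hence x: "x : disc" by (simp add: space_restrict_space)
  show "ennreal (exp (2 * pi * \<gamma> * (lift y x)^2)) = ennreal (exp (\<gamma> * hh (height x) * (z (height x))^2))"
  proof (cases "x = 0")
   case False
   hence "hh (height x) = (\<phi> ((norm x)^2))^2"
    using height_pos[OF x] Qi_S[of "(norm x)^2"] norm_lt_1_sq[of x] x by (simp add: hh_def height_def)
   thus ?thesis using height_pos[OF x False] by (simp add: lift_def z_def power_mult_distrib power_divide)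
  qed (simp add: lift_def height_def hh_def y0)
 qed
 also have "... = ennreal pi * (\<integral>\<^sup>+s. ennreal (omega s) * indicator {0..} s * ennreal (exp (\<gamma> * hh s * (z s)^2)) \<partial>lborel)"
  unfolding height_def by (rule disc_S_nn_integral) measurable
 also have "(\<integral>\<^sup>+s. ennreal (omega s) * indicator {0..} s * ennreal (exp (\<gamma> * hh s * (z s)^2)) \<partial>lborel) = J y"
  unfolding J_def by (rule nn_integral_cong) (auto simp: integrand_def z_def indicator_def \<omega>_nonneg ennreal_mult)
 finally show ?thesis .
qed

end

subsection \<open>Inversions and polarization\<close>

lemma glue_zero_continuous:
 fixes h :: "plane => 'b::real_normed_vector" assumes "continuous_on disc h" "R < 1" "!!x. R <= norm x ==> norm x < 1 ==> h x = 0"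
 shows "continuous_on UNIV (%x. if norm x < 1 then h x else 0)" proof -
 have o: "open (- cball (0::plane) R)" by auto
 have "continuous_on (disc \<union> - cball 0 R) (%x. if norm x < 1 then h x else 0)"
 proof (rule continuous_on_open_Un[OF open_ball o])
  show "continuous_on disc (%x. if norm x < 1 then h x else 0)" by (rule continuous_on_eq[OF assms(1)]) simp
  have "continuous_on (- cball 0 R) (%_::plane. 0::'b)" by simp
  thus "continuous_on (- cball 0 R) (%x. if norm x < 1 then h x else 0)" by (rule continuous_on_eq) (use assms(3) in auto)
 qed
 moreover have "disc \<union> - cball 0 R = UNIV" using assms(2) by auto
 ultimately show ?thesis by simp
qed

text \<open>Inversion in the circle about c of squared radius |c|^2 - 1. This circle meets the unit
  circle orthogonally, so the inversion is a hyperbolic reflection of the disc; \<open>nn\<close> is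
  the squared distance to c.\<close>

locale inversion =
 fixes c :: plane assumes c: "1 < norm c"
begin

definition kap :: real where "kap = (norm c)^2 - 1"
definition nn :: "plane => real" where "nn x = (x - c) \<bullet> (x - c)"
definition sg :: "plane => plane" where "sg x = c + (kap / nn x) *R (x - c)"
definition sg' :: "plane => plane => plane" where "sg' x h = (kap / nn x) *R (h - (2 * ((x - c) \<bullet> h) / nn x) *R (x - c))"

lemma kap: "0 < kap" using c by (simp add: kap_def one_less_power)

lemma nn_pos: assumes "norm x < 1" shows "0 < nn x" using assms c by (auto simp: nn_def inner_gt_zero_iff)

lemma sg_minus: "sg x - c = (kap / nn x) *R (x - c)" by (simp add: sg_def)

lemma nn_sg: assumes "norm x < 1" shows "nn (sg x) = kap^2 / nn x" proof -
 have "nn (sg x) = (kap / nn x)^2 * nn x" unfolding nn_def[of "sg x"] sg_minus by (simp add: nn_def power2_eq_square)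
 thus ?thesis using nn_pos[OF assms] by (simp add: power2_eq_square)
qed

text \<open>The conformal factor kap / nn x is the ratio of the boundary weights, which is the
  invariance of the hyperbolic metric. The invariance of the disc, of the Hardy term and of the
  weighted gradient bound all rest on it.\<close>

lemma one_minus_sg: assumes "norm x < 1" shows "1 - (norm (sg x))^2 = kap / nn x * (1 - (norm x)^2)" proof -
 have "(norm (sg x))^2 = (norm c)^2 + 2 * (kap / nn x) * (c \<bullet> (x - c)) + (kap / nn x)^2 * nn x" proof -
  have "(norm (c + t *R d))^2 = (norm c)^2 + 2 * t * (c \<bullet> d) + t^2 * (d \<bullet> d)" for t d
   unfolding power2_norm_eq_inner
   by (simp add: inner_add_left inner_add_right inner_commute[of d c] power2_eq_square distrib_left)
  thus ?thesis unfolding sg_def nn_def .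
 qed
 moreover have "2 * (c \<bullet> (x - c)) = (norm x)^2 - (norm c)^2 - nn x"
  by (simp add: nn_def power2_norm_eq_inner inner_diff_left inner_diff_right inner_commute)
 ultimately have "(norm (sg x))^2 = (norm c)^2 + (kap / nn x) * ((norm x)^2 - (norm c)^2 - nn x) + (kap / nn x)^2 * nn x" by simp
 also have "... = (norm c)^2 - kap + (kap / nn x) * ((norm x)^2 - (norm c)^2 + kap)"
  using nn_pos[OF assms] by (simp add: field_simps power2_eq_square)
 also have "... = 1 - kap / nn x * (1 - (norm x)^2)" by (simp add: kap_def right_diff_distrib)
 finally show ?thesis by simp
qed

lemma sg_disc: assumes "norm x < 1" shows "norm (sg x) < 1" proof -
 have "0 < 1 - (norm (sg x))^2" unfolding one_minus_sg[OF assms] using kap nn_pos[OF assms] norm_lt_1_sq[OF assms] by simp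
 thus ?thesis using power_less_imp_less_base[of "norm (sg x)" 2 1] by simp
qed

lemma sg_sg: assumes "norm x < 1" shows "sg (sg x) = x" proof -
 have "sg (sg x) = c + (kap / nn (sg x) * (kap / nn x)) *R (x - c)" unfolding sg_def[of "sg x"] sg_minus by simp
 also have "kap / nn (sg x) * (kap / nn x) = 1" using nn_pos[OF assms] kap by (simp add: nn_sg[OF assms] power2_eq_square)
 finally show ?thesis by simp
qed

lemma sg_image: "sg ` disc = disc" using sg_disc sg_sg by (force simp: image_iff)

lemma sg_deriv: assumes "norm x < 1" shows "(sg has_derivative sg' x) (at x within X)" proof -
 have n: "(x - c) \<bullet> (x - c) ~= 0" using nn_pos[OF assms] by (simp add: nn_def)
 have 1: "((%x. kap * inverse ((x - c) \<bullet> (x - c))) has_derivative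
   (%h. kap * - (inverse ((x - c) \<bullet> (x - c)) * (2 * ((x - c) \<bullet> h)) * inverse ((x - c) \<bullet> (x - c))))) (at x within X)"
  using n by (auto intro!: derivative_eq_intros simp: inner_commute)
 have 2: "((%x. x - c) has_derivative (%h. h)) (at x within X)" by (auto intro!: derivative_eq_intros)
 have "(sg has_derivative (%h. 0 + ((kap * inverse ((x - c) \<bullet> (x - c))) *R h
   + (kap * - (inverse ((x - c) \<bullet> (x - c)) * (2 * ((x - c) \<bullet> h)) * inverse ((x - c) \<bullet> (x - c)))) *R (x - c)))) (at x within X)"
  unfolding sg_def nn_def divide_inverse by (intro has_derivative_add has_derivative_const has_derivative_scaleR 1 2)
 also have "(%h. 0 + ((kap * inverse ((x - c) \<bullet> (x - c))) *R h
   + (kap * - (inverse ((x - c) \<bullet> (x - c)) * (2 * ((x - c) \<bullet> h)) * inverse ((x - c) \<bullet> (x - c)))) *R (x - c))) = sg' x"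
  by (rule ext) (simp add: sg'_def nn_def divide_inverse scaleR_diff_right ac_simps)
 finally show ?thesis .
qed

text \<open>The differential is a Euclidean reflection times kap / nn x.\<close>

lemma sg'_norm: assumes "norm x < 1" shows "norm (sg' x h) = kap / nn x * norm h" proof -
 define t where "t = (x - c) \<bullet> h"
 have n: "0 < nn x" by (rule nn_pos[OF assms])
 have "(norm (h - (2 * t / nn x) *R (x - c)))^2 = (norm h)^2 - 2 * (2 * t / nn x) * t + (2 * t / nn x)^2 * nn x" proof -
  have "(norm (h - a *R d))^2 = (norm h)^2 - 2 * a * (d \<bullet> h) + a^2 * (d \<bullet> d)" for a d
   unfolding power2_norm_eq_inner
   by (simp add: inner_diff_left inner_diff_right inner_commute[of h d] power2_eq_square right_diff_distrib)
  thus ?thesis unfolding nn_def t_def .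
 qed
 also have "... = (norm h)^2" using n by (simp add: field_simps power2_eq_square)
 finally have "norm (h - (2 * t / nn x) *R (x - c)) = norm h" by simp
 thus ?thesis using kap n by (simp add: sg'_def t_def)
qed

lemma sg'_adjoint: "sg' x h \<bullet> k = h \<bullet> sg' x k" proof -
 have "(a *R (h - (2 * (d \<bullet> h) / n) *R d)) \<bullet> k = h \<bullet> (a *R (k - (2 * (d \<bullet> k) / n) *R d))" for a n d
  by (simp add: inner_diff_left inner_diff_right inner_commute[of h d])
 thus ?thesis unfolding sg'_def .
qed

lemma sg'_linear: "linear (sg' x)" proof -
 have "linear (%h. a *R (h - (2 * (d \<bullet> h) / n) *R d))" for a n and d :: plane
  by (rule linearI) (simp_all add: inner_add_right distrib_left add_divide_distrib scaleR_add_left scaleR_diff_right scaleR_add_right mult.left_commute)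
 thus ?thesis unfolding sg'_def[abs_def] .
qed

lemma sg'_sg': assumes "norm x < 1" shows "sg' x (sg' (sg x) h) = h" proof -
 define d where "d = x - c"
 define t where "t = d \<bullet> h"
 have n: "0 < nn x" "d \<bullet> d = nn x" using nn_pos[OF assms] by (auto simp: d_def nn_def)
 have r: "kap / nn (sg x) = nn x / kap" using kap n by (simp add: nn_sg[OF assms] power2_eq_square)
 have "2 * ((sg x - c) \<bullet> h) / nn (sg x) * (kap / nn x) = 2 * t / nn x"
  using kap n unfolding sg_minus by (simp add: nn_sg[OF assms] power2_eq_square t_def d_def)
 hence e: "sg' (sg x) h = (nn x / kap) *R (h - (2 * t / nn x) *R d)" unfolding sg'_def[of "sg x"] r by (simp add: sg_minus d_def)
 have "d \<bullet> (h - (2 * t / nn x) *R d) = - t" using n by (simp add: inner_diff_right t_def)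
 hence i: "d \<bullet> sg' (sg x) h = nn x / kap * - t" unfolding e by simp
 have "sg' x (sg' (sg x) h) = (kap / nn x) *R (sg' (sg x) h - (2 * (nn x / kap * - t) / nn x) *R d)"
  unfolding sg'_def[of x] d_def[symmetric] i ..
 also have "... = h" unfolding e using kap n by (simp add: scaleR_diff_right)
 finally show ?thesis .
qed

definition jac :: "plane => real" where "jac x = (kap / nn x)^2"

lemma det_sg': assumes "norm x < 1" shows "abs (det (matrix (sg' x))) = jac x" proof -
 define d where "d = x - c"
 have n: "0 < nn x" "(d $ 1)^2 + (d $ 2)^2 = nn x"
  using nn_pos[OF assms] by (auto simp: d_def nn_def inner_vec_def sum_2 power2_eq_square)
 have ent: "matrix (sg' x) $ i $ j = kap / nn x * ((if i = j then 1 else 0) - 2 * d $ j / nn x * d $ i)" for i j :: 2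
  unfolding matrix_def sg'_def by (simp add: inner_axis d_def) (simp add: axis_def)
 have "det (matrix (sg' x)) = (kap / nn x)^2 * ((1 - 2 * (d $ 1)^2 / nn x) * (1 - 2 * (d $ 2)^2 / nn x) - 4 * (d $ 1)^2 * (d $ 2)^2 / (nn x)^2)"
  unfolding det_2 ent using n(1) by (simp add: power2_eq_square field_simps)
 also have "... = (kap / nn x)^2 * (1 - 2 * ((d $ 1)^2 + (d $ 2)^2) / nn x)"
  using n(1) by (simp add: field_simps power2_eq_square)
 also have "... = - jac x" unfolding n(2) using n(1) by (simp add: jac_def)
 finally show ?thesis by (simp add: jac_def)
qed

text \<open>The conformal factor is bounded below, so a point whose image stays away from the
  boundary stays away from it as well; reflection thus preserves compact support in the
  disc.\<close>

lemma sg_support: assumes "0 < R" "R < 1"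
 obtains R' where "0 < R'" "R' < 1" "!!x. R' <= norm x ==> norm x < 1 ==> R <= norm (sg x)" proof -
 define \<delta> where "\<delta> = kap * (1 - R^2) / (norm c + 1)^2"
 have R2: "R^2 < 1" using assms by (simp add: power_less_one_iff)
 have \<delta>: "0 < \<delta>" using kap R2 c by (auto simp: \<delta>_def intro!: mult_pos_pos divide_pos_pos)
 have key: "R <= norm (sg x)" if x: "norm x < 1" "1 - (norm x)^2 <= \<delta>" for x proof (rule ccontr)
  assume n: "\<not> R <= norm (sg x)"
  have "1 - (norm (sg x))^2 > 1 - R^2" using n assms by (simp add: power_strict_mono)
  moreover have s: "norm (sg x) < 1" by (rule sg_disc[OF x(1)])
  have "nn (sg x) <= (norm c + 1)^2" proof -
   have "norm (sg x - c) <= norm c + 1" using norm_triangle_ineq4[of "sg x" c] s by simp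
   thus ?thesis by (simp add: nn_def flip: power2_norm_eq_inner)
  qed
  hence "kap / (norm c + 1)^2 <= kap / nn (sg x)" using nn_pos[OF s] kap c by (intro divide_left_mono) auto
  ultimately have "kap / (norm c + 1)^2 * (1 - R^2) < kap / nn (sg x) * (1 - (norm (sg x))^2)"
   using kap R2 nn_pos[OF s] by (intro mult_le_less_imp_less) (auto intro!: divide_pos_pos zero_less_power simp: add_nonneg_pos)
  also have "... = 1 - (norm x)^2" using one_minus_sg[OF s] sg_sg[OF x(1)] by simp
  finally show False using x(2) by (simp add: \<delta>_def)
 qed
 define r where "r = sqrt (1 - min \<delta> (1/2))"
 have r: "0 < r" "r < 1" using \<delta> by (auto simp: r_def)
 show ?thesis proof (rule that[OF r])
  fix x :: plane assume x: "r <= norm x" "norm x < 1"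
  have "1 - min \<delta> (1/2) <= (norm x)^2" by (rule norm_ge_sqrt) (use x in "auto simp: r_def")
  thus "R <= norm (sg x)" using x by (intro key) auto
 qed
qed

lemma sg_continuous: "continuous_on disc sg" by (rule has_derivative_continuous_on[OF sg_deriv]) simp

lemma inverse_nn_continuous: "continuous_on disc (%x. kap / nn x)"
 unfolding nn_def using nn_pos by (intro continuous_intros) (force simp: nn_def)

definition pullb :: "(plane => real) => plane => real" where "pullb F x = (if norm x < 1 then jac x * F (sg x) else 0)"

lemma pullb: assumes F: "continuous_on UNIV F" "!!x. R <= norm x ==> F x = 0" and R: "0 < R" "R < 1"
 shows "integrable lborel (pullb F)" "(LBINT x. pullb F x) = (LBINT x. F x)" "continuous_on UNIV (pullb F)" proof -
 obtain R' where R': "0 < R'" "R' < 1" "!!x. R' <= norm x ==> norm x < 1 ==> R <= norm (sg x)" by (rule sg_support[OF R]) blast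
 have "continuous_on disc (%x. jac x * F (sg x))" unfolding jac_def
  by (intro continuous_intros inverse_nn_continuous continuous_on_compose2[OF F(1) sg_continuous]) auto
 hence "continuous_on UNIV (%x. if norm x < 1 then jac x * F (sg x) else 0)"
  by (rule glue_zero_continuous[OF _ R'(2)]) (use R'(3) F(2) in auto)
 thus pc: "continuous_on UNIV (pullb F)" by (simp add: pullb_def[abs_def])
 show i: "integrable lborel (pullb F)"
  by (rule compact_support_integrable[OF pc, of R']) (use R'(3) F(2) in "auto simp: pullb_def")
 have iF: "integrable lborel F" by (rule compact_support_integrable[OF F])
 \<comment> \<open>The change of variables below is applied to vector-valued integrands, so real
   values are packed into \<open>real^1\<close>.\<close>
 define v :: "real => real^1" where "v t = t *R axis 1 1" for t
 have v: "bounded_linear v" unfolding v_def by (rule bounded_linear_scaleR_left)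
 have p: "bounded_linear (%w::real^1. w $ 1)" by (rule bounded_linear_vec_nth)
 have "integrable lebesgue F" using iF by (simp add: integrable_completion)
 hence "F absolutely_integrable_on UNIV" by (simp add: set_integrable_def)
 hence aF: "F absolutely_integrable_on disc" by (rule set_integrable_subset) auto
 have a: "(%x. v (F x)) absolutely_integrable_on sg ` disc"
  using absolutely_integrable_linear[OF aF v] by (simp add: sg_image o_def)
 have inj: "inj_on sg disc" by (rule inj_on_inverseI[of _ sg]) (simp add: sg_sg)
 note cv = has_absolute_integral_change_of_variables[OF disc_sets(1) sg_deriv inj, of "%x. v (F x)" "integral (sg ` disc) (%x. v (F x))"]
 have "integral disc (%x. abs (det (matrix (sg' x))) *R v (F (sg x))) = integral disc (%x. v (F x))"
  "(%x. abs (det (matrix (sg' x))) *R v (F (sg x))) absolutely_integrable_on disc" using cv a by (auto simp: sg_image)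
 moreover from this(2) have "(%x. abs (det (matrix (sg' x))) *R v (F (sg x))) integrable_on disc"
  "(%x. v (F x)) integrable_on disc" using a by (auto simp: sg_image intro: set_lebesgue_integral_eq_integral)
 note this[THEN integral_linear, OF p]
 ultimately have "integral disc (%x. abs (det (matrix (sg' x))) * F (sg x)) = integral disc F" by (simp add: o_def v_def)
 moreover have "integral disc (%x. abs (det (matrix (sg' x))) * F (sg x)) = integral disc (pullb F)"
  by (rule integral_cong) (simp add: pullb_def det_sg')
 moreover have "integral disc (pullb F) = integral UNIV (pullb F)" "integral disc F = integral UNIV F"
  using F(2) R by (auto simp: integral_restrict_UNIV[symmetric, of disc] pullb_def intro!: integral_cong)
 ultimately show "(LBINT x. pullb F x) = (LBINT x. F x)" using integral_lborel[OF i] integral_lborel[OF iF] by simp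
qed

definition refl :: "(plane => real) => plane => real" where "refl f x = (if norm x < 1 then f (sg x) else 0)"
definition reflv :: "(plane => plane) => plane => plane" where "reflv G x = (if norm x < 1 then sg' x (G (sg x)) else 0)"

lemma C1c_refl: assumes C: "C1c f G" shows "C1c (refl f) (reflv G)" proof -
 obtain R where R: "0 < R" "R < 1" "!!x. R <= norm x ==> f x = 0" "!!x. R <= norm x ==> G x = 0" by (rule C1c_support[OF C]) blast
 obtain R' where R': "0 < R'" "R' < 1" "!!x. R' <= norm x ==> norm x < 1 ==> R <= norm (sg x)"
  by (rule sg_support[OF R(1,2)]) blast
 have lin0: "sg' x 0 = 0" for x by (simp add: sg'_def)
 have z: "refl f x = 0" "reflv G x = 0" if "R' <= norm x" for x using R'(3) R(3,4) that by (auto simp: refl_def reflv_def lin0)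
 have "(refl f has_derivative (%h. reflv G x \<bullet> h)) (at x)" for x proof (cases "norm x < 1")
  case True
  have "(f has_derivative (%h. G (sg x) \<bullet> h)) (at (sg x))" using C by (simp add: C1c_def)
  from has_derivative_compose[OF sg_deriv[OF True] this]
  have "((%x. f (sg x)) has_derivative (%h. reflv G x \<bullet> h)) (at x)" using True by (simp add: reflv_def sg'_adjoint)
  thus ?thesis by (rule has_derivative_transform_within_open[of _ _ _ _ disc]) (use True in "auto simp: refl_def")
 next
  case False
  hence "(refl f has_derivative (%_. 0)) (at x)" by (intro derivative_zero_off_support[of R']) (use z R' in auto)
  thus ?thesis using False by (simp add: reflv_def)
 qed
 moreover have "continuous_on UNIV (reflv G)" proof -
  have G: "continuous_on disc (%x. G (sg x))"
   by (rule continuous_on_compose2[OF C1c_continuous(2)[OF C, of UNIV] sg_continuous]) auto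
  have "continuous_on disc (%x. (kap / nn x) *R (G (sg x) - (2 * ((x - c) \<bullet> G (sg x)) / nn x) *R (x - c)))"
   using nn_pos by (intro continuous_intros inverse_nn_continuous G) (force simp: nn_def intro!: continuous_intros)+
  hence "continuous_on UNIV (%x. if norm x < 1 then sg' x (G (sg x)) else 0)" unfolding sg'_def[symmetric]
   by (rule glue_zero_continuous[OF _ R'(2)]) (use R'(3) R(4) lin0 in auto)
  thus ?thesis by (simp add: reflv_def[abs_def])
 qed
 ultimately show ?thesis unfolding C1c_def using z R'(2) by blast
qed

lemma reflv_norm: assumes "norm x < 1" shows "(norm (reflv G x))^2 = jac x * (norm (G (sg x)))^2"
 using assms by (simp add: reflv_def sg'_norm jac_def power_mult_distrib power_divide)

lemma reflv_energy: assumes C: "continuous_on UNIV G" "!!x. R <= norm x ==> G x = 0" "0 < R" "R < 1"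
 shows "(LBINT x. (norm (reflv G x))^2) = (LBINT x. (norm (G x))^2)" "integrable lborel (%x. (norm (reflv G x))^2)" proof -
 have e: "(%x. (norm (reflv G x))^2) = pullb (%x. (norm (G x))^2)"
  by (rule ext) (use reflv_norm in "auto simp: pullb_def reflv_def")
 show "(LBINT x. (norm (reflv G x))^2) = (LBINT x. (norm (G x))^2)" "integrable lborel (%x. (norm (reflv G x))^2)"
  unfolding e by (rule pullb[of _ R]; use C in "auto intro!: continuous_intros")+
qed

end

section \<open>Smoothed maxima and minima, and the class on which polarization acts\<close>

definition sroot :: "real => real => real" where "sroot eps d = sqrt (d^2 + eps^2) - eps"
definition sroot' :: "real => real => real" where "sroot' eps d = d / sqrt (d^2 + eps^2)"
text \<open>\<open>sroot eps\<close> is an even C^1 version of the absolute value that vanishes at 0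
  together with its derivative; \<open>soft eps\<close> annihilates all values up to eps. Slopes of
  at most 1 keep gradient bounds and energies from growing.\<close>

definition soft :: "real => real => real" where "soft eps t = sroot eps (max 0 (t - eps))"
definition soft' :: "real => real => real" where "soft' eps t = sroot' eps (max 0 (t - eps))"

lemma sroot_facts: assumes e: "0 < eps"
 shows "DERIV (sroot eps) d :> sroot' eps d" "continuous_on X (sroot' eps)" "abs (sroot' eps d) <= 1"
  "sroot eps 0 = 0" "sroot' eps 0 = 0" "0 <= sroot eps d" "sroot eps d <= abs d" "abs d - eps <= sroot eps d"
  "sroot eps (- d) = sroot eps d" "sroot' eps (- d) = - sroot' eps d" proof -
 have p: "0 < d^2 + eps^2" for d using e by (simp add: add_nonneg_pos)
 have "DERIV (%d. sqrt (d^2 + eps^2)) d :> inverse (sqrt (d^2 + eps^2)) / 2 * (2 * d)"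
  by (rule DERIV_chain2[where g="%d. d^2 + eps^2", OF DERIV_real_sqrt[OF p]]) (auto intro!: derivative_eq_intros)
 hence "DERIV (%d. sqrt (d^2 + eps^2)) d :> sroot' eps d" by (simp add: sroot'_def inverse_eq_divide)
 from DERIV_diff[OF this DERIV_const[of eps]] show "DERIV (sroot eps) d :> sroot' eps d" by (simp add: sroot_def[abs_def])
 show "continuous_on X (sroot' eps)"
  unfolding sroot'_def[abs_def] using p by (intro continuous_intros) (auto simp: less_imp_neq[symmetric])
 have le: "abs d <= sqrt (d^2 + eps^2)" by (rule real_le_rsqrt) simp
 moreover have "0 < sqrt (d^2 + eps^2)" using p by simp
 ultimately show "abs (sroot' eps d) <= 1" by (simp add: sroot'_def abs_divide)
 have "eps <= sqrt (d^2 + eps^2)" by (rule real_le_rsqrt) simp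
 thus "0 <= sroot eps d" by (simp add: sroot_def)
 have "sqrt (d^2 + eps^2) <= abs d + eps" by (rule real_le_lsqrt) (use e in "auto simp: power2_sum")
 thus "sroot eps d <= abs d" by (simp add: sroot_def)
 show "abs d - eps <= sroot eps d" using le by (simp add: sroot_def)
qed (use e in "auto simp: sroot_def sroot'_def")

lemma soft_facts: assumes e: "0 < eps"
 shows "DERIV (soft eps) t :> soft' eps t" "continuous_on X (soft' eps)" "abs (soft' eps t) <= 1"
  "t <= eps ==> soft eps t = 0" "t <= eps ==> soft' eps t = 0" "0 <= soft eps t" "0 <= t ==> soft eps t <= t" "t - 2 * eps <= soft eps t"
proof -
 let ?m = "%t. max 0 (t - eps)"
 have p: "0 < (?m t)^2 + eps^2" for t using e by (simp add: add_nonneg_pos)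
 have "DERIV (%t. (?m t)^2 + eps^2) t :> 2 * ?m t * 1 + 0"
  by (intro DERIV_add DERIV_const DERIV_chain2[OF DERIV_max_square]) (auto intro!: derivative_eq_intros)
 from DERIV_chain2[where g="%t. (?m t)^2 + eps^2", OF DERIV_real_sqrt[OF p] this]
 have "DERIV (%t. sqrt ((?m t)^2 + eps^2)) t :> soft' eps t" by (simp add: soft'_def sroot'_def inverse_eq_divide)
 from DERIV_diff[OF this DERIV_const[of eps]] show "DERIV (soft eps) t :> soft' eps t" by (simp add: soft_def[abs_def] sroot_def)
 show "continuous_on X (soft' eps)" unfolding soft'_def[abs_def]
  by (rule continuous_on_compose2[OF sroot_facts(2)[OF e, of UNIV]]) (auto intro!: continuous_intros)
 show "t - 2 * eps <= soft eps t" using sroot_facts(8)[OF e, of "?m t"] by (simp add: soft_def max_def split: if_splits)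
 show "0 <= t ==> soft eps t <= t" using sroot_facts(7)[OF e, of "?m t"] e by (simp add: soft_def max_def split: if_splits)
qed (use sroot_facts[OF e] in "auto simp: soft_def soft'_def")

lemma C1c_compose: assumes C: "C1c f G" and t: "!!s. DERIV \<tau> s :> \<tau>' s" "continuous_on UNIV \<tau>'" "\<tau> 0 = 0"
 shows "C1c (%x. \<tau> (f x)) (%x. \<tau>' (f x) *R G x)" unfolding C1c_def proof (intro conjI allI)
 fix x
 have "(\<tau> has_derivative (%h. \<tau>' (f x) * h)) (at (f x))" using t(1) by (simp add: has_field_derivative_def)
 moreover have "(f has_derivative (%h. G x \<bullet> h)) (at x)" using C by (simp add: C1c_def)
 ultimately have "((%x. \<tau> (f x)) has_derivative (%h. \<tau>' (f x) * (G x \<bullet> h))) (at x)" using has_derivative_compose by blast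
 then
 show "((%x. \<tau> (f x)) has_derivative (%h. (\<tau>' (f x) *R G x) \<bullet> h)) (at x)" by simp
 show "continuous_on UNIV (%x. \<tau>' (f x) *R G x)"
  by (intro continuous_intros C1c_continuous[OF C] continuous_on_compose2[OF t(2)]) auto
 show "EX R<1. ALL x. R <= norm x --> \<tau> (f x) = 0 & \<tau>' (f x) *R G x = 0"
  by (rule C1c_support[OF C]) (use t(3) in "auto intro!: exI")
qed

lemma C1c_lincomb: assumes "C1c f F" "C1c g G" shows "C1c (%x. a * f x + b * g x) (%x. a *R F x + b *R G x)" proof -
 obtain R S where R: "R < 1" "!!x. R <= norm x ==> f x = 0 & F x = 0" and S: "S < 1" "!!x. S <= norm x ==> g x = 0 & G x = 0"
  using assms by (auto simp: C1c_def)
 have "((%x. a * f x + b * g x) has_derivative (%h. (a *R F x + b *R G x) \<bullet> h)) (at x)" for x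
  using assms unfolding C1c_def by (auto intro!: derivative_eq_intros simp: inner_add_left)
 moreover have "continuous_on UNIV (%x. a *R F x + b *R G x)"
  by (intro continuous_intros C1c_continuous(2)[OF assms(1)] C1c_continuous(2)[OF assms(2)])
 ultimately show ?thesis unfolding C1c_def using R S by (intro conjI exI[of _ "max R S"]) auto
qed

text \<open>Compactness needs a Lipschitz bound that polarization preserves: (1 - |x|^2) |G| is, up
  to a constant, the hyperbolic length of the gradient, hence invariant under the reflections,
  unlike the Euclidean length.\<close>

definition dclass :: "real => real => real => (plane => real) => (plane => plane) => bool" where
 "dclass R L E g G \<longleftrightarrow> 0 < R & R < 1 & C1c g G & (ALL x. 0 <= g x) & (ALL x. R <= norm x --> g x = 0 & G x = 0) &
  (ALL x. norm x < 1 --> (1 - (norm x)^2) * norm (G x) <= L) & (LBINT x. (norm (G x))^2) <= E"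

text \<open>Maxima and minima are in general not C^1. The uniform closure admits them and inherits
  support and Lipschitz bounds, while the Dirichlet bound E is remembered only through the
  approximants.\<close>

definition dclosure :: "real => real => real => (plane => real) => bool" where
 "dclosure R L E u \<longleftrightarrow> (ALL e>0. EX g G. dclass R L E g G & (ALL x. abs (g x - u x) <= e))"

context inversion
begin

text \<open>The factor s jumps across the circle nn x = kap, but f and its gradient vanish there, so
  the product is differentiable with derivative 0 on the circle and its gradient remains
  continuous.\<close>

lemma C1c_sign: assumes C: "C1c f F" and Z: "!!x. nn x = kap ==> f x = 0" "!!x. nn x = kap ==> F x = 0"
 defines "s \<equiv> %x. if kap <= nn x then 1 else (- 1 :: real)" shows "C1c (%x. s x * f x) (%x. s x *R F x)" proof -
 have nc: "continuous_on UNIV nn" unfolding nn_def by (intro continuous_intros)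
 have o: "open {x. kap < nn x}" "open {x. nn x < kap}" using nc by (auto intro!: open_Collect_less continuous_intros)
 note d = C1c_def[THEN iffD1, OF C, THEN conjunct1, rule_format]
 note Fc = C1c_continuous(2)[OF C, of UNIV]
 have cF: "isCont F x" for x using Fc by (simp add: continuous_on_eq_continuous_at)
 have s1: "abs (s x) = 1" for x by (simp add: s_def)
 have "((%x. s x * f x) has_derivative (%h. (s x *R F x) \<bullet> h)) (at x) & isCont (%x. s x *R F x) x" for x proof -
  consider "kap < nn x" | "nn x < kap" | "nn x = kap" by linarith
  thus ?thesis proof cases
   case 1
   have "\<forall>\<^sub>F y in nhds x. F y = s y *R F y"
    using eventually_nhds_in_open[OF o(1), of x] 1 by (auto elim!: eventually_mono simp: s_def)
   hence "isCont (%x. s x *R F x) x" using isCont_cong[of F "%y. s y *R F y" x] cF by simp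
   moreover have "((%x. s x * f x) has_derivative (%h. F x \<bullet> h)) (at x)"
    by (rule has_derivative_transform_within_open[OF d o(1)]) (use 1 in "auto simp: s_def")
   ultimately show ?thesis using 1 by (simp add: s_def)
  next
   case 2
   have "\<forall>\<^sub>F y in nhds x. - F y = s y *R F y"
    using eventually_nhds_in_open[OF o(2), of x] 2 by (auto elim!: eventually_mono simp: s_def)
   hence "isCont (%x. s x *R F x) x" using isCont_cong[of "%y. - F y" "%y. s y *R F y" x] cF[of x] by simp
   moreover have "((%x. s x * f x) has_derivative (%h. - (F x \<bullet> h))) (at x)"
    by (rule has_derivative_transform_within_open[OF has_derivative_minus[OF d] o(2)]) (use 2 in "auto simp: s_def")
   ultimately show ?thesis using 2 by (simp add: s_def)
  next
   case 3
   have "((%y. norm (f y - f x - F x \<bullet> (y - x)) / norm (y - x)) \<longlongrightarrow> 0) (at x)"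
    using d[of x] by (simp add: has_derivative_iff_norm)
   hence "((%y. norm (f y) / norm (y - x)) \<longlongrightarrow> 0) (at x)" using Z[OF 3] by simp
   hence "((%y. norm (s y * f y - s x * f x - 0) / norm (y - x)) \<longlongrightarrow> 0) (at x)"
    using Z[OF 3] s1 by (simp add: abs_mult)
   hence "((%x. s x * f x) has_derivative (%_. 0)) (at x)" by (simp add: has_derivative_iff_norm)
   moreover have "((%y. s y *R F y) \<longlongrightarrow> 0) (at x)" proof (rule tendsto_0_le[of F])
    show "(F \<longlongrightarrow> 0) (at x)" using cF[of x] Z(2)[OF 3] by (simp add: isCont_def)
    show "\<forall>\<^sub>F y in at x. norm (s y *R F y) <= norm (F y) * 1" using s1 by simp
   qed
   ultimately show ?thesis using Z[OF 3] by (simp add: isCont_def)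
  qed
 qed
 note both = this
 obtain R where "R < 1" "!!x. R <= norm x ==> f x = 0 & F x = 0" using C by (auto simp: C1c_def)
 hence "EX R<1. ALL x. R <= norm x --> s x * f x = 0 & s x *R F x = 0" by (intro exI[of _ R]) auto
 thus ?thesis unfolding C1c_def continuous_on_eq_continuous_at[OF open_UNIV]
  by (intro conjI allI ballI both[THEN conjunct1] both[THEN conjunct2])
qed

text \<open>Polarization moves the larger of the values at x and its reflection to the side of the
  origin; that side is \<open>kap <= nn x\<close>, because nn 0 = |c|^2 > kap.\<close>

definition pol :: "(plane => real) => plane => real" where
 "pol u x = (if norm x < 1 then if kap <= nn x then max (u x) (u (sg x)) else min (u x) (u (sg x)) else 0)"

lemma sg_fixed: "norm x < 1 ==> nn x = kap ==> sg x = x" using nn_pos[of x] by (simp add: sg_def)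

lemma nn_sg_iff: assumes "norm x < 1" shows "kap <= nn (sg x) \<longleftrightarrow> nn x <= kap" "nn (sg x) <= kap \<longleftrightarrow> kap <= nn x"
 using nn_pos[OF assms] kap by (auto simp: nn_sg[OF assms] power2_eq_square field_simps)

lemma norm_sg_ge: assumes "norm x < 1" "kap <= nn x" shows "norm x <= norm (sg x)" proof -
 have "kap / nn x * (1 - (norm x)^2) <= 1 * (1 - (norm x)^2)"
  using assms nn_pos[of x] norm_lt_1_sq[OF assms(1)] by (intro mult_right_mono) auto
 hence "1 - (norm (sg x))^2 <= 1 - (norm x)^2" unfolding one_minus_sg[OF assms(1)] by simp
 hence "(norm x)^2 <= (norm (sg x))^2" by simp
 thus ?thesis by (simp add: power2_le_iff_abs_le)
qed

text \<open>\<open>max\<close> and \<open>min\<close> are smoothed by \<open>sroot\<close>, and the two halves still fit together to first order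
  because \<open>sroot\<close> vanishes to second order at 0; \<open>soft\<close> restores the support.\<close>

lemma pol_dclass: assumes K: "dclass R L E g G" and e: "0 < eps"
 shows "EX h H. dclass R L E h H & (ALL x. abs (h x - pol g x) <= 3 * eps)" proof -
 have R: "0 < R" "R < 1" and C: "C1c g G" and g0: "!!x. 0 <= g x" and z: "!!x. R <= norm x ==> g x = 0" "!!x. R <= norm x ==> G x = 0"
  and GL: "!!x. norm x < 1 ==> (1 - (norm x)^2) * norm (G x) <= L" and GE: "(LBINT x. (norm (G x))^2) <= E"
  using K by (auto simp: dclass_def)
 define b where "b = refl g"
 define Gb where "Gb = reflv G"
 have Cb: "C1c b Gb" unfolding b_def Gb_def by (rule C1c_refl[OF C])
 have off: "g x = 0" "b x = 0" "G x = 0" "Gb x = 0" if "\<not> norm x < 1" for x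
  using that R z[of x] by (auto simp: b_def Gb_def refl_def reflv_def)
 have b0: "0 <= b x" for x using g0 by (simp add: b_def refl_def)
 define s :: "plane => real" where "s x = (if kap <= nn x then 1 else - 1)" for x
 define D where "D x = 1 * g x + - 1 * b x" for x
 define GD where "GD x = 1 *R G x + - 1 *R Gb x" for x
 have CD: "C1c D GD" unfolding D_def GD_def by (rule C1c_lincomb[OF C Cb])
 have DZ: "D x = 0" if "nn x = kap" for x
  using off[of x] sg_fixed[OF _ that] by (cases "norm x < 1") (auto simp: D_def b_def refl_def)
 note sr = sroot_facts[OF e] and sf = soft_facts[OF e]
 have CR: "C1c (%x. sroot eps (D x)) (%x. sroot' eps (D x) *R GD x)" by (rule C1c_compose[OF CD sr(1,2,4)])
 have CS: "C1c (%x. s x * sroot eps (D x)) (%x. s x *R sroot' eps (D x) *R GD x)"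
  unfolding s_def by (rule C1c_sign[OF CR]) (use DZ sr in auto)
 \<comment> \<open>Maximum and minimum are (g + b) / 2 plus or minus |g - b| / 2, here with the
   absolute value smoothed.\<close>
 define P where "P x = 1/2 * (1 * g x + 1 * b x) + 1/2 * (s x * sroot eps (D x))" for x
 define t where "t x = s x * sroot' eps (D x)" for x
 define PG where "PG x = (1/2) *R (1 *R G x + 1 *R Gb x) + (1/2) *R (s x *R sroot' eps (D x) *R GD x)" for x
 have CP: "C1c P PG" unfolding P_def PG_def by (rule C1c_lincomb[OF C1c_lincomb[OF C Cb] CS])
 have PGt: "PG x = ((1 + t x) / 2) *R G x + ((1 - t x) / 2) *R Gb x" for x
  by (simp add: vec_eq_iff PG_def GD_def t_def field_simps)
 have t1: "abs (t x) <= 1" for x using sr(3)[of "D x"] by (simp add: t_def s_def)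
 define h where "h x = soft eps (P x)" for x
 define H where "H x = soft' eps (P x) *R PG x" for x
 have Ch: "C1c h H" unfolding h_def H_def by (rule C1c_compose[OF CP sf(1,2)]) (use sf(4) e in simp)
 have P0: "0 <= P x" for x using sr(6)[of "D x"] sr(7)[of "D x"] g0[of x] b0[of x] by (auto simp: P_def s_def D_def)
 \<comment> \<open>Beyond R on the side of the origin the reflected point is at least as far out, so
   b vanishes as well; on the other side P is a smoothed minimum with g x = 0. Either way
   \<open>soft\<close> removes the remainder of at most eps.\<close>
 have Pz: "P x <= eps" if x: "R <= norm x" for x proof (cases "norm x < 1")
  case True
  show ?thesis proof (cases "kap <= nn x")
   case T: True
   have "b x = 0" using norm_sg_ge[OF True T] x z True by (simp add: b_def refl_def)
   thus ?thesis using z(1)[OF x] sr(4) e by (simp add: P_def D_def)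
  next
   case False
   thus ?thesis using z(1)[OF x] sr(8)[of "D x"] b0[of x] e by (simp add: P_def D_def s_def)
  qed
 qed (use off[of x] sr(4) e in "simp add: P_def D_def")
 have hz: "h x = 0" "H x = 0" if "R <= norm x" for x using sf(4,5)[OF Pz[OF that]] by (auto simp: h_def H_def)
 have HP: "norm (H x) <= norm (PG x)" for x using mult_right_mono[OF sf(3)[of "P x"], of "norm (PG x)"] by (simp add: H_def)
 have HL: "(1 - (norm x)^2) * norm (H x) <= L" if x: "norm x < 1" for x proof -
  define w where "w = 1 - (norm x)^2"
  have w: "0 <= w" using norm_lt_1_sq[OF x] by (simp add: w_def)
  have "w * norm (Gb x) = w * (kap / nn x) * norm (G (sg x))" using x by (simp add: Gb_def reflv_def sg'_norm)
  also have "... = (1 - (norm (sg x))^2) * norm (G (sg x))" by (simp add: one_minus_sg[OF x] w_def)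
  also have "... <= L" by (rule GL[OF sg_disc[OF x]])
  finally have 1: "w * norm (Gb x) <= L" .
  have "w * norm (H x) <= w * norm (PG x)" by (rule mult_left_mono[OF HP w])
  also have "... <= w * ((1 + t x) / 2 * norm (G x) + (1 - t x) / 2 * norm (Gb x))"
   unfolding PGt using t1[of x] by (intro mult_left_mono w order_trans[OF norm_triangle_ineq]) (auto simp: abs_le_iff)
  also have "... = (1 + t x) / 2 * (w * norm (G x)) + (1 - t x) / 2 * (w * norm (Gb x))" by (simp add: algebra_simps)
  also have "... <= (1 + t x) / 2 * L + (1 - t x) / 2 * L"
   using t1[of x] 1 GL[OF x] by (intro add_mono mult_left_mono) (auto simp: w_def)
  also have "... = L" by (simp add: field_simps)
  finally show ?thesis by (simp add: w_def)
 qed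
 have HE: "(LBINT x. (norm (H x))^2) <= E" proof -
  obtain r where r: "0 < r" "r < 1" "!!x. r <= norm x ==> P x = 0" "!!x. r <= norm x ==> PG x = 0"
   by (rule C1c_support[OF CP]) blast
  note e1 = reflv_energy[OF C1c_continuous(2)[OF CP] r(4,1,2)]
  note e2 = reflv_energy[OF C1c_continuous(2)[OF C] z(2) R]
  note i = C1c_integrable(1)[OF Ch] C1c_integrable(1)[OF CP] C1c_integrable(1)[OF C]
  \<comment> \<open>Since t agrees at x and its reflection, the gradient of P and its reflected
    counterpart are convex combinations of those of g with exchanged weights, so the sum of their
    squares cannot grow. Integration turns this into twice the energy inequality.\<close>
  have pt: "(norm (PG x))^2 + (norm (reflv PG x))^2 <= (norm (G x))^2 + (norm (reflv G x))^2" for x proof (cases "norm x < 1")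
   case True
   have ts: "t (sg x) = t x" proof (cases "nn x = kap")
    case True
    thus ?thesis using \<open>norm x < 1\<close> sg_fixed[of x] by simp
   next
    case F: False
    have "D (sg x) = - D x" using True by (simp add: D_def b_def refl_def sg_disc sg_sg)
    moreover have "s (sg x) = - s x" using F nn_sg_iff[OF True] by (auto simp: s_def)
    ultimately show ?thesis using sr(10) by (simp add: t_def)
   qed
   interpret lin: linear "sg' x" by (rule sg'_linear)
   have "sg' x (Gb (sg x)) = G x" using True by (simp add: Gb_def reflv_def sg_disc sg_sg sg'_sg')
   hence "reflv PG x = ((1 + t x) / 2) *R Gb x + ((1 - t x) / 2) *R G x"
    using True unfolding reflv_def PGt ts by (simp add: lin.add lin.scale Gb_def reflv_def)
   moreover have "(norm (((1 + a) / 2) *R p + ((1 - a) / 2) *R q))^2 + (norm (((1 + a) / 2) *R q + ((1 - a) / 2) *R p))^2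
     <= (norm p)^2 + (norm q)^2" if "abs a <= 1" for a and p q :: plane proof -
    have "(norm (((1 + a) / 2) *R p + ((1 - a) / 2) *R q))^2 + (norm (((1 + a) / 2) *R q + ((1 - a) / 2) *R p))^2
     = (norm p)^2 + (norm q)^2 - (1 - a^2) / 2 * (norm (p - q))^2" unfolding power2_norm_eq_inner
     by (simp add: inner_add_left inner_add_right inner_diff_left inner_diff_right inner_commute[of q p] power2_eq_square field_simps)
    moreover have "a^2 <= 1" using that by (simp add: abs_square_le_1)
    hence "0 <= (1 - a^2) / 2 * (norm (p - q))^2" by simp
    ultimately show ?thesis by linarith
   qed
   ultimately show ?thesis unfolding PGt[of x] using t1[of x] by (simp add: Gb_def)
  qed (use off[of x] in "simp add: PGt reflv_def")
  have "2 * (LBINT x. (norm (H x))^2) <= 2 * (LBINT x. (norm (PG x))^2)"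
   using HP by (intro mult_left_mono integral_mono i power_mono) auto
  also have "... = (LBINT x. (norm (PG x))^2 + (norm (reflv PG x))^2)" using e1 i(2) by simp
  also have "... <= (LBINT x. (norm (G x))^2 + (norm (reflv G x))^2)"
   using pt by (intro integral_mono Bochner_Integration.integrable_add i e1(2) e2(2)) auto
  also have "... = 2 * (LBINT x. (norm (G x))^2)" using e2 i(3) by simp
  finally show ?thesis using GE by simp
 qed
 have "abs (h x - pol g x) <= 3 * eps" for x proof -
  have 1: "abs (h x - P x) <= 2 * eps" using sf(7)[OF P0[of x]] sf(8)[of "P x"] unfolding h_def by linarith
  have "abs (P x - pol g x) <= eps / 2" proof (cases "norm x < 1")
   case True
   hence bx: "g (sg x) = b x" by (simp add: b_def refl_def)
   show ?thesis using sr(7)[of "D x"] sr(8)[of "D x"] True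
    unfolding P_def pol_def s_def bx D_def by (auto simp: max_def min_def abs_le_iff field_simps)
  qed (use off[of x] sr(4) e in "simp add: P_def D_def pol_def")
  thus ?thesis using 1 e by linarith
 qed
 thus ?thesis using R Ch hz HL HE sf(6) unfolding dclass_def h_def by blast
qed

lemma pol_dclosure: assumes "dclosure R L E u" shows "dclosure R L E (pol u)" unfolding dclosure_def proof (intro allI impI)
 fix e :: real assume e: "0 < e"
 hence e4: "0 < e / 4" by simp
 obtain g G where g: "dclass R L E g G" "!!x. abs (g x - u x) <= e / 4"
  using assms[unfolded dclosure_def, rule_format, OF e4] by blast
 obtain h H where h: "dclass R L E h H" "!!x. abs (h x - pol g x) <= 3 * (e / 4)" using pol_dclass[OF g(1) e4] by blast
 have "abs (h x - u' x) <= e" if "u' = pol u" for x u' proof -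
  have "abs (pol g x - pol u x) <= e / 4" proof -
   have "abs (max a b - max a' b') <= d & abs (min a b - min a' b') <= d"
    if "abs (a - a') <= d" "abs (b - b') <= d" for a b a' b' d :: real
    using that by (auto simp: max_def min_def abs_if split: if_splits)
   from this[OF g(2)[of x] g(2)[of "sg x"]] show ?thesis using e by (simp add: pol_def)
  qed
  thus ?thesis using h(2)[of x] unfolding that by linarith
 qed
 thus "EX g G. dclass R L E g G & (ALL x. abs (g x - pol u x) <= e)" using h(1) by blast
qed

lemma pol_cases: assumes "norm x < 1"
 obtains "kap <= nn x" "jac x <= 1" "pol u x = max (u x) (u (sg x))" "pol u (sg x) = min (u x) (u (sg x))"
 | "nn x < kap" "1 <= jac x" "pol u x = min (u x) (u (sg x))" "pol u (sg x) = max (u x) (u (sg x))" proof (cases "kap <= nn x")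
 case True
 have "pol u (sg x) = min (u x) (u (sg x))" using assms True nn_sg_iff[OF assms] sg_fixed[OF assms]
  by (cases "nn x = kap") (auto simp: pol_def sg_disc sg_sg min.commute)
 moreover have "jac x <= 1" using True kap nn_pos[OF assms] by (simp add: jac_def power_le_one)
 ultimately show ?thesis using that(1) True assms by (simp add: pol_def)
next
 case False
 have "pol u (sg x) = max (u x) (u (sg x))"
  using assms False nn_sg_iff[OF assms] by (auto simp: pol_def sg_disc sg_sg max.commute)
 moreover have "1 <= jac x" using False nn_pos[OF assms] by (simp add: jac_def one_le_power)
 ultimately show ?thesis using that(2) False assms by (simp add: pol_def)
qed

text \<open>Adding the pulled-back integrand lets integrals be compared pointwise on pairs of
  reflected points.\<close>

lemma integral_doubling: assumes F: "continuous_on UNIV F" "!!x. R <= norm x ==> F x = 0" and R: "0 < R" "R < 1"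
 shows "2 * (LBINT x. F x) = (LBINT x. F x + pullb F x)" "integrable lborel (%x. F x + pullb F x)"
 using pullb[OF F R] compact_support_integrable[OF F] by auto

text \<open>The Jacobian cancels the conformal factor of the Hardy weight, so a pair of reflected
  points contributes the sum of both squared values over one common weight; exchanging the values
  changes nothing.\<close>

lemma pol_hardy: assumes u: "continuous_on UNIV (hardy u)" "!!x. R <= norm x ==> u x = 0"
  and v: "continuous_on UNIV (hardy (pol u))" "!!x. R <= norm x ==> pol u x = 0" and R: "0 < R" "R < 1"
 shows "(LBINT x. hardy (pol u) x) = (LBINT x. hardy u x)" proof -
 have h: "jac x * hardy f (sg x) = (f (sg x))^2 / (1 - (norm x)^2)^2" if "norm x < 1" for f x
  using nn_pos[OF that] kap by (simp add: hardy_def one_minus_sg[OF that] jac_def power_mult_distrib power_divide)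
 have "hardy (pol u) x + pullb (hardy (pol u)) x = hardy u x + pullb (hardy u) x" for x proof (cases "norm x < 1")
  case True
  show ?thesis unfolding pullb_def using True h[OF True]
   by (rule_tac pol_cases[OF True, of u]) (auto simp: hardy_def max_def min_def add_ac)
 next
  case False
  hence "u x = 0" "pol u x = 0" using u(2) v(2) R by auto
  thus ?thesis using False by (simp add: pullb_def hardy_def)
 qed
 hence "2 * (LBINT x. hardy (pol u) x) = 2 * (LBINT x. hardy u x)"
  by (subst (1 2) integral_doubling[OF _ _ R]) (use u v in "auto simp: hardy_def")
 thus ?thesis by simp
qed

text \<open>On the side of the origin jac <= 1, so the reflected point counts for less area and
  moving the larger value here cannot lower the contribution of the pair. A strict gain at one point
  spreads to a ball by continuity.\<close>

lemma pol_integral_mono: assumes u: "continuous_on UNIV u" "!!x. R <= norm x ==> u x = 0" "!!x. 0 <= u x"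
  and v: "continuous_on UNIV (pol u)" "!!x. R <= norm x ==> pol u x = 0" and R: "0 < R" "R < 1"
  and f: "continuous_on UNIV f" "f 0 = 0" "!!s t. 0 <= s ==> s <= t ==> f s <= (f t :: real)"
 shows "(LBINT x. f (u x)) <= (LBINT x. f (pol u x))"
  and "norm y < 1 ==> kap < nn y ==> u y < u (sg y) ==> f (u y) < f (u (sg y)) ==> (LBINT x. f (u x)) < (LBINT x. f (pol u x))"
proof -
 define A where "A x = f (u x)" for x
 define B where "B x = f (pol u x)" for x
 have A: "continuous_on UNIV A" "!!x. R <= norm x ==> A x = 0"
  unfolding A_def by (intro continuous_on_compose2[OF f(1) u(1)]) (use u(2) f(2) in auto)
 have B: "continuous_on UNIV B" "!!x. R <= norm x ==> B x = 0"
  unfolding B_def by (intro continuous_on_compose2[OF f(1) v(1)]) (use v(2) f(2) in auto)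
 define w where "w x = (B x + pullb B x) - (A x + pullb A x)" for x
 have iw: "2 * (LBINT x. B x) - 2 * (LBINT x. A x) = (LBINT x. w x)" "integrable lborel w"
  using integral_doubling[OF A R] integral_doubling[OF B R] by (auto simp: w_def[abs_def])
 have j0: "0 <= jac x" for x by (simp add: jac_def)
 have wx: "w x = f (pol u x) - f (u x) + jac x * (f (pol u (sg x)) - f (u (sg x)))" if "norm x < 1" for x
  using that by (simp add: w_def A_def B_def pullb_def right_diff_distrib)
 have w0: "0 <= w x" for x proof (cases "norm x < 1")
  case True
  note fm = f(3)[OF u(3)]
  show ?thesis proof (rule pol_cases[OF True, of u])
   assume a: "jac x <= 1" "pol u x = max (u x) (u (sg x))" "pol u (sg x) = min (u x) (u (sg x))"
   show "0 <= w x" proof (cases "u x <= u (sg x)")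
    case le: True
    have "jac x * (f (u (sg x)) - f (u x)) <= 1 * (f (u (sg x)) - f (u x))"
     by (rule mult_right_mono[OF a(1)]) (use fm[OF le] in simp)
    thus ?thesis using le by (simp add: wx[OF True] a algebra_simps)
   qed (simp add: wx[OF True] a)
  next
   assume a: "1 <= jac x" "pol u x = min (u x) (u (sg x))" "pol u (sg x) = max (u x) (u (sg x))"
   show "0 <= w x" proof (cases "u x <= u (sg x)")
    case le: False
    hence l: "u (sg x) <= u x" by simp
    have "1 * (f (u x) - f (u (sg x))) <= jac x * (f (u x) - f (u (sg x)))"
     by (rule mult_right_mono[OF a(1)]) (use fm[OF l] in simp)
    thus ?thesis using l le by (simp add: wx[OF True] a algebra_simps)
   qed (simp add: wx[OF True] a)
  qed
 next
  case False
  thus ?thesis using A(2) B(2) R by (simp add: w_def pullb_def)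
 qed
 have "0 <= (LBINT x. w x)" by (rule integral_nonneg_AE) (simp add: w0)
 thus "(LBINT x. f (u x)) <= (LBINT x. f (pol u x))" using iw(1) by (simp add: A_def B_def)
 assume y: "norm y < 1" "kap < nn y" "u y < u (sg y)" "f (u y) < f (u (sg y))"
 have "kap / nn y < 1" "0 <= kap / nn y" using y(2) kap nn_pos[OF y(1)] by auto
 hence j: "jac y < 1" by (simp add: jac_def power_less_one_iff)
 have "w y = (1 - jac y) * (f (u (sg y)) - f (u y))"
  by (rule pol_cases[OF y(1), of u]) (use y in "auto simp: wx[OF y(1)] algebra_simps")
 hence wy: "0 < w y" using j y(4) by simp
 have "continuous_on UNIV w" unfolding w_def by (intro continuous_intros A B pullb(3)[OF A R] pullb(3)[OF B R])
 hence "(w \<longlongrightarrow> w y) (nhds y)"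
  by (simp add: continuous_on_eq_continuous_at isCont_def tendsto_at_iff_tendsto_nhds)
 from order_tendstoD(1)[OF this, of "w y / 2"] have "\<forall>\<^sub>F x in nhds y. w y / 2 < w x" using wy by simp
 then obtain r where r: "0 < r" "!!x. dist x y < r ==> w y / 2 < w x" by (auto simp: eventually_nhds_metric)
 have "0 < w y / 2 * measure lborel (ball y r)" using wy content_ball_pos[OF r(1), of y] by simp
 also have "... = (LBINT x. w y / 2 * indicator (ball y r) x)" by simp
 also have "... <= (LBINT x. w x)" proof (rule integral_mono[OF _ iw(2)])
  show "integrable lborel (%x. w y / 2 * indicator (ball y r) x)"
   using emeasure_bounded_finite[OF bounded_ball, of y r] by (intro integrable_mult_right integrable_real_indicator) auto
  show "w y / 2 * indicator (ball y r) x <= w x" for x using r(2)[of x] w0[of x] by (auto simp: indicator_def dist_commute)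
 qed
 finally show "(LBINT x. f (u x)) < (LBINT x. f (pol u x))" using iw(1) by (simp add: A_def B_def)
qed

end

subsection \<open>Symmetrization\<close>

lemma dclass_lipschitz: assumes K: "dclass R L E g G" shows "abs (g x - g y) <= L / (1 - R^2) * norm (x - y)" proof -
 have R: "0 < R" "R < 1" and C: "C1c g G" and z: "!!x. R <= norm x ==> G x = 0"
  and GL: "!!x. norm x < 1 ==> (1 - (norm x)^2) * norm (G x) <= L" using K by (auto simp: dclass_def)
 have R2: "0 < 1 - R^2" using R by (simp add: power_less_one_iff)
 have L: "0 <= L" using order_trans[OF norm_ge_zero GL[of 0, simplified]] .
 show ?thesis proof (rule C1c_lipschitz[OF C])
  fix x
  show "norm (G x) <= L / (1 - R^2)" proof (cases "R <= norm x")
   case True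
   thus ?thesis using z R2 L by simp
  next
   case False
   hence "1 - R^2 <= 1 - (norm x)^2" using power_mono[of "norm x" R 2] by simp
   hence "(1 - R^2) * norm (G x) <= (1 - (norm x)^2) * norm (G x)" by (rule mult_right_mono) simp
   also have "... <= L" using GL[of x] False R by simp
   finally show ?thesis using R2 by (simp add: field_simps)
  qed
 qed
qed

lemma dclosure_approx: assumes "dclosure R L E u" "0 < e"
 obtains g G where "dclass R L E g G" "!!x. abs (g x - u x) <= e" using assms unfolding dclosure_def by blast

lemma le_of_le_add: assumes "!!e. 0 < e ==> a <= b + e * C" "0 <= C" shows "(a::real) <= b" proof (rule field_le_epsilon)
 fix e :: real assume e: "0 < e"
 have "a <= b + e / (C + 1) * C" by (rule assms(1)) (use assms(2) e in simp)
 also have "e / (C + 1) * C <= e" using assms(2) e by (simp add: field_simps)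
 finally show "a <= b + e" by simp
qed

text \<open>Each property holds for the approximants up to an error e that tends to 0. The final
  bound compares x with the unit vector \<open>axis 1 1\<close>, where u vanishes and whose distance
  from points of the disc is at most 2.\<close>

lemma dclosure_facts: assumes u: "dclosure R L E u" shows "0 < R" "R < 1" "0 <= u x" "R <= norm x ==> u x = 0"
  "abs (u x - u y) <= L / (1 - R^2) * norm (x - y)" "continuous_on X u" "u x <= 2 * (L / (1 - R^2))" proof -
 obtain g G where g: "dclass R L E g G" by (rule dclosure_approx[OF u zero_less_one])
 show R: "0 < R" "R < 1" using g by (auto simp: dclass_def)
 have lip: "abs (u x - u y) <= L / (1 - R^2) * norm (x - y)" for x y proof (rule le_of_le_add[of _ _ 2])
  fix e :: real assume "0 < e"
  then obtain g G where g: "dclass R L E g G" "!!x. abs (g x - u x) <= e" by (rule dclosure_approx[OF u]) blast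
  show "abs (u x - u y) <= L / (1 - R^2) * norm (x - y) + e * 2"
   using dclass_lipschitz[OF g(1), of x y] g(2)[of x] g(2)[of y] by linarith
 qed simp
 show "abs (u x - u y) <= L / (1 - R^2) * norm (x - y)" by (rule lip)
 have "0 <= u x" for x proof (rule le_of_le_add[of _ _ 1])
  fix e :: real assume "0 < e"
  then obtain g G where g: "dclass R L E g G" "!!x. abs (g x - u x) <= e" by (rule dclosure_approx[OF u]) blast
  moreover have "0 <= g x" using g(1) by (simp add: dclass_def)
  ultimately show "0 <= u x + e * 1" using g(2)[of x] by linarith
 qed simp
 thus "0 <= u x" .
 have z: "u x = 0" if "R <= norm x" for x proof -
  have "abs (u x) <= 0" proof (rule le_of_le_add[of _ _ 1])
   fix e :: real assume "0 < e"
   then obtain g G where g: "dclass R L E g G" "!!x. abs (g x - u x) <= e" by (rule dclosure_approx[OF u]) blast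
   moreover have "g x = 0" using g(1) that by (simp add: dclass_def)
   ultimately show "abs (u x) <= 0 + e * 1" using g(2)[of x] by simp
  qed simp
  thus ?thesis by simp
 qed
 thus "R <= norm x ==> u x = 0" .
 define k where "k = L / (1 - R^2)"
 have k: "0 <= k" using order_trans[OF abs_ge_zero lip[of "axis 1 1" 0]] by (simp add: k_def norm_axis_1)
 have "k-lipschitz_on X u" by (rule lipschitz_onI) (use lip k in "auto simp: dist_norm k_def")
 thus "continuous_on X u" by (rule lipschitz_on_continuous_on)
 show "u x <= 2 * (L / (1 - R^2))" proof (cases "norm x < 1")
  case True
  have "norm (x - axis 1 1) <= 2" using norm_triangle_ineq4[of x "axis 1 1"] True by (simp add: norm_axis_1)
  hence "k * norm (x - axis 1 1) <= k * 2" using k by (rule mult_left_mono)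
  moreover have "abs (u x) <= k * norm (x - axis 1 1)"
   using lip[of x "axis 1 1"] z[of "axis 1 1"] R by (simp add: k_def norm_axis_1)
  ultimately have "u x <= 2 * k" by linarith
  thus ?thesis by (simp add: k_def)
 next
  case False
  thus ?thesis using z[of x] R k by (simp add: k_def)
 qed
qed

lemma dclosure_closed: assumes "!!e. 0 < e ==> EX v. dclosure R L E v & (ALL x. abs (v x - u x) <= e)" shows "dclosure R L E u"
 unfolding dclosure_def proof (intro allI impI)
 fix e :: real assume e: "0 < e"
 hence e2: "0 < e / 2" by simp
 obtain v where v: "dclosure R L E v" "!!x. abs (v x - u x) <= e / 2" using assms[OF e2] by blast
 obtain g G where g: "dclass R L E g G" "!!x. abs (g x - v x) <= e / 2" by (rule dclosure_approx[OF v(1) e2]) blast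
 have "abs (g x - u x) <= e" for x using v(2)[of x] g(2)[of x] by linarith
 thus "EX g G. dclass R L E g G & (ALL x. abs (g x - u x) <= e)" using g(1) by blast
qed

lemma dclosure_hardy_continuous: assumes u: "dclosure R L E u" shows "continuous_on UNIV (hardy u)" proof -
 have "continuous_on UNIV (%x. (u x)^2 * (1 / (1 - (norm x)^2) ^ 2))" by (rule continuous_times_weight[of _ R])
   (use dclosure_facts[OF u] in "auto intro!: continuous_intros inverse_weight_continuous")
 thus ?thesis by (simp add: hardy_def[abs_def])
qed

lemma bounded_support_convergence:
 fixes F :: "nat => plane => real"
 assumes F: "!!n. continuous_on UNIV (F n)" "!!n x. R <= norm x ==> F n x = 0" "!!n x. norm x < R ==> abs (F n x) <= M"
  and G: "continuous_on UNIV G" "!!x. (%n. F n x) ----> G x" shows "(%n. (LBINT x. F n x)) ----> (LBINT x. G x)"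
proof (rule integral_dominated_convergence[where w = "%x. abs M * indicator (cball 0 R) x"])
 show "integrable lborel (%x::plane. abs M * indicator (cball 0 R) x)"
  using emeasure_bounded_finite[OF bounded_cball, of "0::plane" R] by (intro integrable_mult_right integrable_real_indicator) auto
 show "AE x in lborel. norm (F n x) <= abs M * indicator (cball 0 R) x" for n proof (rule AE_I2)
  fix x show "norm (F n x) <= abs M * indicator (cball 0 R) x"
   using F(2)[of x n] F(3)[of x n] by (cases "norm x < R") (auto simp: indicator_def)
 qed
qed (use F(1) G in "auto intro: borel_measurable_continuous_onI")

lemma dclosure_compose_limit:
 assumes U: "!!n. dclosure R L E (U n)" and u: "dclosure R L E u" and lim: "!!x. (%n. U n x) ----> u x"
  and f: "continuous_on UNIV (f :: real => real)" "f 0 = 0" shows "(%n. (LBINT x. f (U n x))) ----> (LBINT x. f (u x))"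
  and "(%n. (LBINT x. hardy (U n) x)) ----> (LBINT x. hardy u x)" proof -
 note d = dclosure_facts[OF U] and du = dclosure_facts[OF u]
 define B where "B = 2 * (L / (1 - R^2))"
 have "compact (f ` {0..B})" by (rule compact_continuous_image[OF continuous_on_subset[OF f(1)]]) auto
 then obtain M where "ALL y:f ` {0..B}. norm y <= M" using compact_imp_bounded bounded_iff by blast
 hence M: "abs (f t) <= M" if "0 <= t" "t <= B" for t using that by simp
 show "(%n. (LBINT x. f (U n x))) ----> (LBINT x. f (u x))" proof (rule bounded_support_convergence[where R = R and M = M])
  show "(%n. f (U n x)) ----> f (u x)" for x
   using f(1) lim[of x] by (intro isCont_tendsto_compose[of _ f]) (auto simp: continuous_on_eq_continuous_at)
 qed (use d du f(2) M in "auto intro!: continuous_on_compose2[OF f(1)] simp: B_def")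
 show "(%n. (LBINT x. hardy (U n) x)) ----> (LBINT x. hardy u x)"
 proof (rule bounded_support_convergence[where R = R and M = "B^2 / (1 - R^2)^2"])
  show "(%n. hardy (U n) x) ----> hardy u x" for x unfolding hardy_def divide_inverse by (intro tendsto_intros lim)
  fix n and x :: plane assume x: "norm x < R"
  have "0 < 1 - R^2" "1 - R^2 <= 1 - (norm x)^2" using x d(1,2) power_mono[of "norm x" R 2] by (auto simp: power_less_one_iff)
  thus "abs (hardy (U n) x) <= B^2 / (1 - R^2)^2"
   unfolding hardy_def using d(3,7)[of n x] by (auto simp: B_def intro!: frac_le power_mono)
 next
  show "hardy (U n) x = 0" if "R <= norm x" for n x using d(4) that by (simp add: hardy_def)
 qed (rule dclosure_hardy_continuous, (rule U u))+
qed

text \<open>Common support and Lipschitz constant allow Arzela-Ascoli, and uniform convergence keeps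
  the limit in the closure.\<close>

lemma dclosure_compact: assumes U: "!!n::nat. dclosure R L E (U n)"
 shows "EX u r. dclosure R L E u & strict_mono (r::nat => nat) & (ALL x. (%n. U (r n) x) ----> u x)" proof -
 note d = dclosure_facts[OF U]
 define k where "k = L / (1 - R^2)"
 obtain g r where g: "strict_mono (r :: nat => nat)"
  "!!e. 0 < e ==> EX N. ALL n x. n >= N & x : cball 0 1 --> norm (U (r n) x - g x) < e"
 proof (rule Great_Picard.Arzela_Ascoli[where S="cball (0::plane) 1" and \<F>=U and M="2 * k"])
  show "norm (U n x) <= 2 * k" for n x using d(3,7)[of n x] by (simp add: k_def)
  fix x :: plane and e :: real assume e: "0 < e"
  show "EX d>0. ALL n y. y : cball 0 1 & norm (x - y) < d --> norm (U n x - U n y) < e"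
  proof (intro exI[of _ "e / (abs k + 1)"] conjI allI impI)
   fix n y assume y: "y : cball 0 1 & norm (x - y) < e / (abs k + 1)"
   have "abs (U n x - U n y) <= k * norm (x - y)" using d(5) by (simp add: k_def)
   also have "... <= (abs k + 1) * norm (x - y)" by (intro mult_right_mono) auto
   also have "... < e" using y by (simp add: field_simps)
   finally show "norm (U n x - U n y) < e" by simp
  qed (use e in simp)
 qed (auto intro: that)
 define u where "u x = (if norm x < 1 then g x else 0)" for x
 have unif: "EX N. ALL n>=N. ALL x. abs (U (r n) x - u x) < e" if e: "0 < e" for e proof -
  obtain N where N: "!!n x. n >= N ==> x : cball 0 1 ==> norm (U (r n) x - g x) < e" using g(2)[OF e] by blast
  have "abs (U (r n) x - u x) < e" if "N <= n" for n x
   using N[OF that, of x] d(4)[of x "r n"] d(2) e by (cases "norm x < 1") (auto simp: u_def)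
  thus ?thesis by blast
 qed
 have "dclosure R L E u" proof (rule dclosure_closed)
  fix e :: real assume "0 < e"
  then obtain N where "ALL n>=N. ALL x. abs (U (r n) x - u x) < e" using unif by blast
  thus "EX v. dclosure R L E v & (ALL x. abs (v x - u x) <= e)" using U by (meson less_imp_le order_refl)
 qed
 moreover have "(%n. U (r n) x) ----> u x" for x by (rule LIMSEQ_I) (use unif in "auto; blast")
 ultimately show ?thesis using g(1) by blast
qed

text \<open>The centre is sought beyond y on the line through x and y, as c = x + t (y - x). The
  condition |c|^2 - 1 = |x - c| |y - c|, which makes x and y inverse points, is linear in t with
  solution (1 - |x|^2) / (|y|^2 - |x|^2) > 1.\<close>

lemma reflecting_inversion:
 fixes x y :: plane assumes xy: "norm x < norm y" "norm y < 1"
 obtains c where "inversion c" "inversion.kap c < inversion.nn c x" "inversion.sg c x = y" proof -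
 define D where "D = (norm y)^2 - (norm x)^2"
 define t where "t = (1 - (norm x)^2) / D"
 define m where "m = (y - x) \<bullet> (y - x)"
 define c where "c = x + t *R (y - x)"
 have D: "0 < D" using xy by (simp add: D_def power_strict_mono)
 have "D < 1 - (norm x)^2" using norm_lt_1_sq[OF xy(2)] by (simp add: D_def)
 hence t: "1 < t" using D by (simp add: t_def)
 have tD: "t * D = 1 - (norm x)^2" using D by (simp add: t_def)
 have m: "0 < m" using xy by (auto simp: m_def inner_gt_zero_iff)
 have Dm: "D = 2 * (x \<bullet> (y - x)) + m"
  by (simp add: D_def m_def power2_norm_eq_inner inner_diff_left inner_diff_right inner_commute)
 have "(norm c)^2 = (norm x)^2 + 2 * t * (x \<bullet> (y - x)) + t^2 * m" proof -
  have "(norm (x + t *R d))^2 = (norm x)^2 + 2 * t * (x \<bullet> d) + t^2 * (d \<bullet> d)" for d unfolding power2_norm_eq_inner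
   by (simp add: inner_add_left inner_add_right inner_commute[of d x] power2_eq_square distrib_left)
  thus ?thesis unfolding c_def m_def .
 qed
 also have "... = (norm x)^2 + t * (D - m) + t^2 * m" by (simp add: Dm)
 also have "... = 1 + t * (t - 1) * m" using tD by (simp add: power2_eq_square algebra_simps)
 finally have c2: "(norm c)^2 - 1 = t * (t - 1) * m" by simp
 moreover have "0 < t * (t - 1) * m" using t m by simp
 ultimately have "1^2 < (norm c)^2" by simp
 hence "1 < norm c" by (rule power2_less_imp_less) simp
 hence inv: "inversion c" by (simp add: inversion_def)
 have xc: "x - c = - t *R (y - x)" by (simp add: c_def)
 have cy: "c + - (t - 1) *R (y - x) = y" by (simp add: c_def algebra_simps)
 interpret inversion c by (rule inv)
 have n: "nn x = t^2 * m" unfolding nn_def xc by (simp add: m_def power2_eq_square)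
 have k: "kap = t * (t - 1) * m" using c2 by (simp add: kap_def)
 have "t * (t - 1) * m < t * t * m" using t m by (intro mult_strict_right_mono mult_strict_left_mono) auto
 hence kn: "kap < nn x" by (simp add: k n power2_eq_square)
 have e: "kap / nn x * - t = - (t - 1)" using t m by (simp add: k n power2_eq_square)
 have "sg x = y" unfolding sg_def xc scaleR_scaleR e by (rule cy)
 thus ?thesis by (rule that[OF inv kn])
qed

text \<open>|f| need not be C^1, but \<open>sroot e\<close> of f is within e of it and has a
  gradient no longer than that of f.\<close>

lemma test_abs_dclosure: assumes f: "f : test_functions"
 shows "EX R L. dclosure R L (LBINT x. (norm (gradient f x))^2) (%x. abs (f x))" proof -
 note C = test_C1c[OF f]
 obtain R where R: "0 < R" "R < 1" "!!x. R <= norm x ==> f x = 0" "!!x. R <= norm x ==> gradient f x = 0"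
  by (rule C1c_support[OF C]) blast
 obtain L where L: "0 < L" "!!x. norm (gradient f x) <= L" by (rule C1c_bounded_gradient[OF C]) blast
 let ?E = "(LBINT x. (norm (gradient f x))^2)"
 have "dclosure R L ?E (%x. abs (f x))" unfolding dclosure_def proof (intro allI impI)
  fix e :: real assume e: "0 < e"
  note s = sroot_facts[OF e]
  define g where "g x = sroot e (f x)" for x
  define G where "G x = sroot' e (f x) *R gradient f x" for x
  have Cg: "C1c g G" unfolding g_def G_def by (rule C1c_compose[OF C s(1,2,4)])
  have Gn: "norm (G x) <= norm (gradient f x)" for x
   using mult_right_mono[OF s(3)[of "f x"], of "norm (gradient f x)"] by (simp add: G_def)
  have "(LBINT x. (norm (G x))^2) <= ?E"
   by (intro integral_mono C1c_integrable(1)[OF Cg] C1c_integrable(1)[OF C] power_mono Gn) auto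
  moreover have "(1 - (norm x)^2) * norm (G x) <= L" if "norm x < 1" for x proof -
   have "(1 - (norm x)^2) * norm (G x) <= 1 * L" using Gn[of x] L(2)[of x] norm_lt_1_sq[OF that] by (intro mult_mono) auto
   thus ?thesis by simp
  qed
  ultimately have "dclass R L ?E g G" unfolding dclass_def using R Cg s(4,5,6) by (auto simp: g_def G_def)
  moreover have "abs (g x - abs (f x)) <= e" for x using s(7,8)[of "f x"] by (simp add: g_def abs_le_iff)
  ultimately show "EX g G. dclass R L ?E g G & (ALL x. abs (g x - abs (f x)) <= e)" by blast
 qed
 thus ?thesis by blast
qed

text \<open>Among all functions of the closure with the prescribed Hardy term and at least the exponential
  integral of \<open>f\<close>, one of largest \<open>L\<^sup>2\<close>-norm is invariant under polarization, hence radial and nonincreasing.\<close>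

lemma symmetrization: assumes f: "f : test_functions" and \<beta>: "0 <= \<beta>"
 shows "EX R L v. dclosure R L (LBINT x. (norm (gradient f x))^2) v & (LBINT x. hardy v x) = (LBINT x. hardy f x) &
  (LBINT x. (f x)^2) <= (LBINT x. (v x)^2) & (LBINT x. exp (\<beta> * (f x)^2) - 1) <= (LBINT x. exp (\<beta> * (v x)^2) - 1) &
  (ALL x y. norm x <= norm y --> v y <= v x)" proof -
 define E where "E = (LBINT x. (norm (gradient f x))^2)"
 obtain R L where f0: "dclosure R L E (%x. abs (f x))" using test_abs_dclosure[OF f] by (auto simp: E_def)
 define ex where "ex s = exp (\<beta> * s^2) - 1" for s :: real
 have exc: "continuous_on UNIV ex" "ex 0 = 0" unfolding ex_def by (auto intro!: continuous_intros)
 have exm: "ex s <= ex t" if "0 <= s" "s <= t" for s t using that \<beta> by (auto simp: ex_def intro!: mult_left_mono power_mono)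
 have sqc: "continuous_on UNIV (%s::real. s^2)" by (intro continuous_intros)
 \<comment> \<open>All three conditions survive uniform limits and polarization; the Dirichlet bound
   is contained in \<open>dclosure\<close>.\<close>
 define \<A> where "\<A> = {u. dclosure R L E u & (LBINT x. hardy u x) = (LBINT x. hardy f x) &
  (LBINT x. ex (f x)) <= (LBINT x. ex (u x))}"
 define I where "I u = (LBINT x. (u x)^2)" for u :: "plane => real"
 have fA: "(%x. abs (f x)) : \<A>" using f0 by (simp add: \<A>_def hardy_def ex_def)
 have "bdd_above (I ` \<A>)" proof (rule bdd_aboveI2)
  fix u assume "u : \<A>"
  hence u: "dclosure R L E u" by (simp add: \<A>_def)
  note d = dclosure_facts[OF u]
  show "I u <= (LBINT x. (2 * (L / (1 - R^2)))^2 * indicator (cball (0::plane) R) x)" unfolding I_def proof (rule integral_mono)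
   show "integrable lborel (%x. (u x)^2)" by (rule compact_support_integrable[of _ R]) (use d in "auto intro!: continuous_intros")
   show "integrable lborel (%x. (2 * (L / (1 - R^2)))^2 * indicator (cball (0::plane) R) x)"
    using emeasure_bounded_finite[OF bounded_cball, of "0::plane" R]
    by (intro integrable_mult_right integrable_real_indicator) auto
   show "(u x)^2 <= (2 * (L / (1 - R^2)))^2 * indicator (cball 0 R) x" for x
    using power_mono[OF d(7)[of x] d(3)[of x], of 2] d(4)[of x] by (cases "R <= norm x") (auto simp: indicator_def)
  qed
 qed
 note bdd = this
 define T where "T = Sup (I ` \<A>)"
 have IT: "I u <= T" if "u : \<A>" for u unfolding T_def using bdd that by (intro cSup_upper) auto
 have "EX u:\<A>. T - 1 / real (Suc n) < I u" for n
  using less_cSupD[of "I ` \<A>" "T - 1 / real (Suc n)"] fA by (auto simp: T_def)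
 then obtain U where U: "!!n. U n : \<A>" "!!n. T - 1 / real (Suc n) < I (U n)" by metis
 have UK: "dclosure R L E (U n)" for n using U(1) by (simp add: \<A>_def)
 obtain v r where v: "dclosure R L E v" "strict_mono (r :: nat => nat)" "!!x. (%n. U (r n) x) ----> v x"
  using dclosure_compact[of R L E U, OF UK] by blast
 note lim = dclosure_compose_limit[OF UK v(1,3)]
 have vA: "v : \<A>" proof -
  have "(%n. (LBINT x. hardy (U (r n)) x)) = (%_. (LBINT x. hardy f x))" using U(1) by (auto simp: \<A>_def)
  hence "(LBINT x. hardy v x) = (LBINT x. hardy f x)" using lim(2)[OF sqc] by (simp add: LIMSEQ_const_iff)
  moreover have "(LBINT x. ex (f x)) <= (LBINT x. ex (v x))"
   by (rule LIMSEQ_le_const[OF lim(1)[OF exc]]) (use U(1) in "auto simp: \<A>_def")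
  ultimately show ?thesis using v(1) by (simp add: \<A>_def)
 qed
 have "T - 0 <= I v" proof (rule LIMSEQ_le[OF tendsto_diff[OF tendsto_const]])
  show "(%n. 1 / real (Suc (r n))) ----> 0"
   by (rule filterlim_compose[OF LIMSEQ_inverse_real_of_nat[unfolded inverse_eq_divide] filterlim_subseq[OF v(2)]])
  show "(%n. I (U (r n))) ----> I v" unfolding I_def by (rule lim(1)[OF sqc]) simp
  show "EX N. ALL n>=N. T - 1 / real (Suc (r n)) <= I (U (r n))" using U(2) by (auto intro: less_imp_le)
 qed
 hence Tv: "T <= I v" by simp
 note d = dclosure_facts[OF v(1)]
 have strict: "v y <= v x" if xy: "norm x < norm y" for x y proof (rule ccontr)
  assume "\<not> v y <= v x"
  hence lt: "v x < v y" by simp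
  hence y1: "norm y < 1" using d(4)[of y] d(3)[of x] d(2) by (metis less_le_not_le linorder_not_less order_trans less_imp_le)
  obtain c where inv: "inversion c" "inversion.kap c < inversion.nn c x" "inversion.sg c x = y"
   by (rule reflecting_inversion[OF xy y1])
  interpret inversion c by (rule inv)
  have p: "dclosure R L E (pol v)" by (rule pol_dclosure[OF v(1)])
  note dp = dclosure_facts[OF p]
  note mono = pol_integral_mono[OF d(6) d(4) d(3) dp(6) dp(4) d(1,2)]
  have "(LBINT x. ex (v x)) <= (LBINT x. ex (pol v x))" by (rule mono(1)[OF _ _ exc exm])
  moreover have "(LBINT x. hardy (pol v) x) = (LBINT x. hardy v x)"
   by (rule pol_hardy[OF dclosure_hardy_continuous[OF v(1)] d(4) dclosure_hardy_continuous[OF p] dp(4) d(1,2)])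
  ultimately have "pol v : \<A>" using vA p by (simp add: \<A>_def)
  moreover have "I v < I (pol v)" unfolding I_def proof (rule mono(2)[OF _ _ sqc])
   show "norm x < 1" using xy y1 by simp
   show "(v x)^2 < (v (sg x))^2" using lt d(3)[of x] inv(3) by (simp add: power_strict_mono)
  qed (use inv lt in "auto intro: power_mono")
  ultimately show False using IT[of "pol v"] Tv by simp
 qed
 \<comment> \<open>Points of equal norm are compared by pushing y outwards and letting the dilation
   factor tend to 1; exchanging the two points then gives radial symmetry.\<close>
 have "v y <= v x" if xy: "norm x <= norm y" for x y proof (cases "norm x < norm y \<or> y = 0")
  case True
  thus ?thesis using strict[of x y] xy by auto
 next
  case False
  have "(%n. (1 + 1 / real (Suc n)) *R y) ----> (1 + 0) *R y"
   using LIMSEQ_inverse_real_of_nat by (intro tendsto_intros) (simp add: inverse_eq_divide)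
  moreover have "isCont v y" using d(6)[of UNIV] by (simp add: continuous_on_eq_continuous_at)
  ultimately have "(%n. v ((1 + 1 / real (Suc n)) *R y)) ----> v y" using isCont_tendsto_compose by fastforce
  moreover have "v ((1 + 1 / real (Suc n)) *R y) <= v x" for n proof (rule strict)
   have "1 * norm y < (1 + 1 / real (Suc n)) * norm y" using False by (intro mult_strict_right_mono) auto
   thus "norm x < norm ((1 + 1 / real (Suc n)) *R y)" using False xy by simp
  qed
  ultimately show ?thesis by (intro LIMSEQ_le_const2) auto
 qed
 moreover have "(LBINT x. (f x)^2) <= (LBINT x. (v x)^2)" using IT[OF fA] Tv by (simp add: I_def)
 ultimately show ?thesis using vA unfolding \<A>_def E_def ex_def by blast
qed

lemma integral_square_le:
 fixes h :: "real => real" assumes h: "continuous_on {0..t} h" and t: "0 < t"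
 shows "(integral {0..t} h)^2 <= t * integral {0..t} (%s. (h s)^2)" proof -
 define m where "m = integral {0..t} h / t"
 have i: "h integrable_on {0..t}" "(%s. (h s)^2) integrable_on {0..t}" by (intro integrable_continuous_real continuous_intros h)+
 have "0 <= integral {0..t} (%s. (h s - m)^2)" by (intro integral_nonneg integrable_continuous_real continuous_intros h) auto
 also have "integral {0..t} (%s. (h s - m)^2) = integral {0..t} (%s. (h s)^2 - 2 * m * h s + m^2)"
  by (rule integral_cong) (simp add: power2_diff)
 also have "... = integral {0..t} (%s. (h s)^2) - 2 * m * integral {0..t} h + t * m^2" proof (rule integral_unique)
  have "((%s. m^2) has_integral t * m^2) {0..t}" using has_integral_const_real[of "m^2" 0 t] t by simp
  thus "((%s. (h s)^2 - 2 * m * h s + m^2) has_integral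
    integral {0..t} (%s. (h s)^2) - 2 * m * integral {0..t} h + t * m^2) {0..t}"
   by (intro has_integral_add has_integral_diff has_integral_mult_right integrable_integral i)
 qed
 also have "2 * m * integral {0..t} h = 2 * (integral {0..t} h)^2 / t" by (simp add: m_def power2_eq_square)
 also have "t * m^2 = (integral {0..t} h)^2 / t" using t by (simp add: m_def power2_eq_square)
 finally have "(integral {0..t} h)^2 / t <= integral {0..t} (%s. (h s)^2)" by simp
 thus ?thesis using t by (simp add: field_simps)
qed

section \<open>Energy of the symmetrized function through dilations\<close>

lemma nn_integral_dilation:
 fixes F :: "plane => ennreal" assumes [measurable]: "F : borel_measurable borel" and c: "0 < c"
 shows "(\<integral>\<^sup>+x. ennreal (c^2) * F (c *R x) \<partial>lborel) = (\<integral>\<^sup>+x. F x \<partial>lborel)"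
proof -
 have "(\<integral>\<^sup>+x. F x \<partial>lborel) = (\<integral>\<^sup>+x. F x \<partial>density (distr lborel borel (%x. 0 + c *R x)) (%_. abs c ^ DIM(plane)))"
  using lborel_affine[of c "0::plane"] c by simp
 also have "... = (\<integral>\<^sup>+x. ennreal (c^2) * F (c *R x) \<partial>lborel)"
  using c by (simp add: nn_integral_density nn_integral_distr)
 finally show ?thesis by simp
qed

text \<open>In the plane dilations preserve the Dirichlet integral, so the radial difference quotients are
  bounded by it; unlike the gradient they pass to uniform limits.\<close>

lemma dilation_bound: assumes C: "C1c g G" and t: "0 < t"
 shows "(\<integral>\<^sup>+x. ennreal ((g (exp t *R x) - g x)^2 / (norm x)^2) \<partial>lborel) <= ennreal (t^2 * (LBINT x. (norm (G x))^2))"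
proof -
 note Gc = C1c_continuous(2)[OF C]
 have [measurable]: "G : borel_measurable borel" by (rule borel_measurable_continuous_onI[OF Gc])
 \<comment> \<open>Along the points exp s x with s in [0, t] the increment of g is an integral of
   radial derivatives; Cauchy-Schwarz and division by |x|^2 leave dilated copies of |G|^2, each with
   the same integral.\<close>
 have pt: "ennreal ((g (exp t *R x) - g x)^2 / (norm x)^2)
   <= (\<integral>\<^sup>+s. ennreal (t * (exp s)^2 * (norm (G (exp s *R x)))^2) * indicator {0..t} s \<partial>lborel)" for x
 proof -
  define h where "h s = G (exp s *R x) \<bullet> (exp s *R x)" for s
  define k where "k s = t * (exp s)^2 * (norm (G (exp s *R x)))^2" for s
  have Gx: "continuous_on {0..t} (%s. G (exp s *R x))"
   by (rule continuous_on_compose2[OF Gc[of UNIV]]) (auto intro!: continuous_intros)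
  have hc: "continuous_on {0..t} h" unfolding h_def by (intro continuous_intros Gx)
  have kc: "continuous_on {0..t} k" unfolding k_def by (intro continuous_intros Gx)
  have "(h has_integral g (exp t *R x) - g (exp 0 *R x)) {0..t}" proof (rule fundamental_theorem_of_calculus)
   fix s
   have "((%s. exp s *R x) has_derivative (%d. (d * exp s) *R x)) (at s within {0..t})"
    by (auto intro!: derivative_eq_intros simp: mult.commute)
   moreover have "(g has_derivative (%d. G (exp s *R x) \<bullet> d)) (at (exp s *R x))" using C by (simp add: C1c_def)
   ultimately have "((%s. g (exp s *R x)) has_derivative (%d. G (exp s *R x) \<bullet> ((d * exp s) *R x))) (at s within {0..t})"
    by (rule has_derivative_compose)
   thus "((%s. g (exp s *R x)) has_vector_derivative h s) (at s within {0..t})"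
    by (simp add: has_vector_derivative_def h_def mult.assoc)
  qed (use t in simp)
  hence "g (exp t *R x) - g x = integral {0..t} h" by (simp add: integral_unique)
  hence "(g (exp t *R x) - g x)^2 <= t * integral {0..t} (%s. (h s)^2)" using integral_square_le[OF hc t] by simp
  also have "t * integral {0..t} (%s. (h s)^2) = integral {0..t} (%s. t * (h s)^2)" by simp
  also have "... <= integral {0..t} (%s. (norm x)^2 * k s)" proof (rule integral_le)
   fix s
   have "abs (h s) <= norm (G (exp s *R x)) * (exp s * norm x)"
    using Cauchy_Schwarz_ineq2[of "G (exp s *R x)" "exp s *R x"] by (simp add: h_def)
   hence "abs (h s)^2 <= (norm (G (exp s *R x)) * (exp s * norm x))^2" by (rule power_mono) simp
   thus "t * (h s)^2 <= (norm x)^2 * k s" using t by (simp add: k_def power_mult_distrib ac_simps)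
  qed (intro integrable_continuous_real continuous_intros hc kc)+
  also have "... = (norm x)^2 * integral {0..t} k" by simp
  finally have "(g (exp t *R x) - g x)^2 / (norm x)^2 <= integral {0..t} k"
   using integral_nonneg[OF integrable_continuous_real[OF kc]] t by (cases "x = 0") (auto simp: k_def field_simps)
  hence "ennreal ((g (exp t *R x) - g x)^2 / (norm x)^2) <= ennreal (integral {0..t} k)" by (rule ennreal_leI)
  also have "... = (\<integral>\<^sup>+s. ennreal (k s * indicator {0..t} s) \<partial>lborel)" proof -
   have "(k has_integral integral {0..t} k) {0..t}" by (intro integrable_integral integrable_continuous_real kc)
   moreover have "((%s. k s * indicator {0..t} s) has_integral integral {0..t} k) UNIV"
    if "(k has_integral integral {0..t} k) {0..t}" proof -
    have eq: "(%s. k s * indicator {0..t} s) = (%s. if s : {0..t} then k s else 0)" by (auto simp: indicator_def)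
    show ?thesis using that unfolding eq has_integral_restrict_UNIV .
   qed
   moreover have "(%s. k s * indicator {0..t} s) : borel_measurable borel" unfolding k_def by measurable
   ultimately show ?thesis by (intro nn_integral_has_integral_lborel[symmetric]) (use t in "auto simp: k_def")
  qed
  also have "... = (\<integral>\<^sup>+s. ennreal (k s) * indicator {0..t} s \<partial>lborel)"
   by (rule nn_integral_cong) (auto simp: indicator_def)
  finally show ?thesis by (simp add: k_def)
 qed
 have D: "(\<integral>\<^sup>+x. ennreal ((norm (G x))^2) \<partial>lborel) = ennreal (LBINT x. (norm (G x))^2)"
  by (rule nn_integral_eq_integral[OF C1c_integrable(1)[OF C]]) simp
 have "(\<integral>\<^sup>+x. ennreal ((g (exp t *R x) - g x)^2 / (norm x)^2) \<partial>lborel)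
   <= (\<integral>\<^sup>+x. \<integral>\<^sup>+s. ennreal (t * (exp s)^2 * (norm (G (exp s *R x)))^2) * indicator {0..t} s \<partial>lborel \<partial>lborel)"
  by (rule nn_integral_mono) (rule pt)
 also have "... = (\<integral>\<^sup>+s. \<integral>\<^sup>+x. ennreal (t * (exp s)^2 * (norm (G (exp s *R x)))^2) * indicator {0..t} s \<partial>lborel \<partial>lborel)"
  by (rule lborel_pair.Fubini') measurable
 also have "... = (\<integral>\<^sup>+s. ennreal t * (\<integral>\<^sup>+x. ennreal ((norm (G x))^2) \<partial>lborel) * indicator {0..t} s \<partial>lborel)"
 proof (rule nn_integral_cong)
  fix s :: real
  have "(\<integral>\<^sup>+x. ennreal (t * (exp s)^2 * (norm (G (exp s *R x)))^2) * indicator {0..t} s \<partial>lborel)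
    = (\<integral>\<^sup>+x. ennreal t * indicator {0..t} s * (ennreal ((exp s)^2) * ennreal ((norm (G (exp s *R x)))^2)) \<partial>lborel)"
   using t by (intro nn_integral_cong) (auto simp: ennreal_mult indicator_def mult.assoc)
  also have "... = ennreal t * indicator {0..t} s * (\<integral>\<^sup>+x. ennreal ((exp s)^2) * ennreal ((norm (G (exp s *R x)))^2) \<partial>lborel)"
   by (rule nn_integral_cmult) measurable
  also have "(\<integral>\<^sup>+x. ennreal ((exp s)^2) * ennreal ((norm (G (exp s *R x)))^2) \<partial>lborel) = (\<integral>\<^sup>+x. ennreal ((norm (G x))^2) \<partial>lborel)"
   by (rule nn_integral_dilation) auto
  finally show "(\<integral>\<^sup>+x. ennreal (t * (exp s)^2 * (norm (G (exp s *R x)))^2) * indicator {0..t} s \<partial>lborel)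
    = ennreal t * (\<integral>\<^sup>+x. ennreal ((norm (G x))^2) \<partial>lborel) * indicator {0..t} s" by (simp add: ac_simps)
 qed
 also have "... = ennreal t * (\<integral>\<^sup>+x. ennreal ((norm (G x))^2) \<partial>lborel) * ennreal t"
  using t by (subst nn_integral_cmult) auto
 also have "... = ennreal (t^2 * (LBINT x. (norm (G x))^2))" proof -
  have "ennreal t * ennreal I * ennreal t = ennreal (t^2 * I)" if "0 <= I" for I
   using t that by (simp add: power2_eq_square ac_simps flip: ennreal_mult)
  from this[of "(LBINT x. (norm (G x))^2)"] show ?thesis unfolding D by simp
 qed
 finally show ?thesis .
qed

lemma dclosure_dilation_bound: assumes v: "dclosure R L E v" and t: "0 < t"
 shows "(\<integral>\<^sup>+x. ennreal ((v (exp t *R x) - v x)^2 / (norm x)^2) \<partial>lborel) <= ennreal (t^2 * E)" proof -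
 have "EX g G. dclass R L E g G & (ALL x. abs (g x - v x) <= 1 / real (Suc n))" for n using v unfolding dclosure_def by simp
 then obtain g G where g: "!!n. dclass R L E (g n) (G n)" "!!n x. abs (g n x - v x) <= 1 / real (Suc n)" by metis
 have lim: "(%n. g n x) ----> v x" for x
  by (rule LIM_zero_cancel, rule Lim_null_comparison[OF always_eventually LIMSEQ_inverse_real_of_nat[unfolded inverse_eq_divide]])
   (use g(2) in simp)
 have C: "C1c (g n) (G n)" for n using g(1) by (simp add: dclass_def)
 define F where "F n x = ennreal ((g n (exp t *R x) - g n x)^2 / (norm x)^2)" for n x
 have gm[measurable]: "g n : borel_measurable borel" for n by (rule borel_measurable_continuous_onI[OF C1c_continuous(1)[OF C]])
 have Fm: "F n : borel_measurable lborel" for n unfolding F_def by measurable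
 have Fl: "(%n. F n x) ----> ennreal ((v (exp t *R x) - v x)^2 / (norm x)^2)" for x
  unfolding F_def divide_inverse by (intro tendsto_intros lim)
 have "(\<integral>\<^sup>+x. ennreal ((v (exp t *R x) - v x)^2 / (norm x)^2) \<partial>lborel) = (\<integral>\<^sup>+x. liminf (%n. F n x) \<partial>lborel)"
  by (rule nn_integral_cong) (simp add: lim_imp_Liminf[OF _ Fl])
 also have "... <= liminf (%n. \<integral>\<^sup>+x. F n x \<partial>lborel)" by (rule nn_integral_liminf[OF Fm])
 also have "... <= liminf (%n::nat. ennreal (t^2 * E))" proof (intro Liminf_mono always_eventually allI)
  fix n
  have "(LBINT x. (norm (G n x))^2) <= E" using g(1) by (simp add: dclass_def)
  hence "ennreal (t^2 * (LBINT x. (norm (G n x))^2)) <= ennreal (t^2 * E)" by (intro ennreal_leI mult_left_mono) auto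
  thus "(\<integral>\<^sup>+x. F n x \<partial>lborel) <= ennreal (t^2 * E)"
   unfolding F_def using dilation_bound[OF C t] by (rule order_trans[rotated])
 qed
 finally show ?thesis by (simp add: Liminf_const)
qed

text \<open>The symmetrized function is radial but known only through Lipschitz and dilation bounds;
  its profile must be regularized before the radial form can be evaluated.\<close>

locale radial_limit =
 fixes R L E :: real and v :: "plane => real" assumes v: "dclosure R L E v" and mono: "!!x y. norm x <= norm y ==> v y <= v x"
begin

lemmas facts = dclosure_facts[OF v]

definition prof :: "real => real" where "prof q = v (sqrt q *R axis 1 1)"

lemma prof_norm: "prof ((norm x)^2) = v x" by (rule antisym; unfold prof_def; rule mono) (simp_all add: norm_axis_1)

lemma prof_continuous: "continuous_on X prof"
 unfolding prof_def by (rule continuous_on_compose2[OF facts(6)[of UNIV]]) (auto intro!: continuous_intros)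

lemma prof_mono: "0 <= p ==> p <= q ==> prof q <= prof p" unfolding prof_def by (rule mono) (simp add: norm_axis_1)

lemma prof_zero: "R^2 <= q ==> prof q = 0"
 unfolding prof_def using facts(1) by (intro facts(4)) (auto simp: norm_axis_1 intro: order_trans[OF real_le_rsqrt abs_ge_self])

lemma prof_nonneg: "0 <= prof q" unfolding prof_def by (rule facts(3))

text \<open>Cutting the profile at its value at \<delta> makes it constant on [0, \<delta>], so that
  averaging over dilations produces no singularity at the origin.\<close>

definition trunc :: "real => real => real" where "trunc \<delta> q = min (prof q) (prof \<delta>)"

text \<open>An average over dilations x to exp s x, which act on q = |x|^2 by exp (2 s): its
  derivative is a difference of the truncated profile and a dilate, as controlled by the dilation
  bound.\<close>

definition smoothed :: "real => real => real" where "smoothed t q = integral {0..t} (%s. trunc t (exp (2 * s) * q)) / t"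

text \<open>The maximum only prevents a division by zero: where it differs from q the numerator
  vanishes.\<close>

definition smoothed' :: "real => real => real" where
 "smoothed' t q = (trunc t (exp (2 * t) * q) - trunc t q) / (2 * t * max q (exp (- 2 * t) * t / 2))"

lemma trunc_continuous: "continuous_on X (trunc \<delta>)" unfolding trunc_def by (intro continuous_intros prof_continuous)

lemma trunc_mono: "0 <= p ==> p <= q ==> trunc \<delta> q <= trunc \<delta> p"
 using prof_mono[of p q] by (simp add: trunc_def min_def)

lemma trunc_const: "0 <= q ==> q <= \<delta> ==> trunc \<delta> q = prof \<delta>"
 using prof_mono[of q \<delta>] by (simp add: trunc_def)

lemma smoothed_const: assumes "0 < t" "0 <= q" "q <= exp (- 2 * t) * t" shows "smoothed t q = prof t" proof -
 have "integral {0..t} (%s. trunc t (exp (2 * s) * q)) = integral {0..t} (%_. prof t)" proof (rule integral_cong)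
  fix s assume s: "s : {0..t}"
  have "exp (2 * s) * q <= exp (2 * t) * (exp (- 2 * t) * t)" using assms s by (intro mult_mono) auto
  also have "... = t" by (simp add: exp_minus field_simps)
  finally show "trunc t (exp (2 * s) * q) = prof t" using assms by (intro trunc_const) auto
 qed
 thus ?thesis using assms by (simp add: smoothed_def)
qed

lemma smoothed_bounds: assumes t: "0 < t" and q: "0 <= q"
 shows "trunc t (exp (2 * t) * q) <= smoothed t q" "smoothed t q <= trunc t q" proof -
 have i: "(%s. trunc t (exp (2 * s) * q)) integrable_on {0..t}"
  by (intro integrable_continuous_real continuous_on_compose2[OF trunc_continuous[of UNIV]]) (auto intro!: continuous_intros)
 have "integral {0..t} (%_. trunc t (exp (2 * t) * q)) <= integral {0..t} (%s. trunc t (exp (2 * s) * q))"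
  by (rule integral_le[OF _ i]) (use q in "auto intro!: trunc_mono mult_right_mono")
 thus "trunc t (exp (2 * t) * q) <= smoothed t q" using t by (simp add: smoothed_def field_simps)
 have "integral {0..t} (%s. trunc t (exp (2 * s) * q)) <= integral {0..t} (%_. trunc t q)" proof (rule integral_le[OF i])
  fix s assume "s : {0..t}"
  hence "1 * q <= exp (2 * s) * q" using q by (intro mult_right_mono) auto
  thus "trunc t (exp (2 * s) * q) <= trunc t q" using q by (intro trunc_mono) auto
 qed (rule integrable_const_ivl)
 thus "smoothed t q <= trunc t q" using t by (simp add: smoothed_def field_simps)
qed

text \<open>In the variable ln q / 2 the average is the increment of one antiderivative over a
  window of length t, divided by t; near q = 0 it is constant.\<close>

lemma smoothed_deriv: assumes t: "0 < t" and q: "0 <= q"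
 shows "(smoothed t has_real_derivative smoothed' t q) (at q within {0..})" proof (cases "q < exp (- 2 * t) * t")
 case True
 have "exp (2 * t) * q <= exp (2 * t) * (exp (- 2 * t) * t)" using True by (intro mult_left_mono) auto
 also have "... = t" by (simp add: exp_minus field_simps)
 finally have "trunc t (exp (2 * t) * q) = prof t" using q by (intro trunc_const) auto
 moreover have "exp (- 2 * t) * t <= 1 * t" using t by (intro mult_right_mono) auto
 hence "trunc t q = prof t" using True q by (intro trunc_const) auto
 ultimately have z: "smoothed' t q = 0" by (simp add: smoothed'_def)
 have "((%_. prof t) has_real_derivative 0) (at q within {0..})" by simp
 hence "(smoothed t has_real_derivative 0) (at q within {0..})"
  by (rule has_field_derivative_transform_within[of _ _ _ _ "exp (- 2 * t) * t - q"])
   (use True q t in "auto simp: smoothed_const dist_real_def")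
 thus ?thesis using z by simp
next
 case False
 define a where "a = exp (- 2 * t) * t / 2"
 have "0 < exp (- 2 * t) * t" using t by simp
 hence a: "0 < a" "a < q" using False unfolding a_def by linarith+
 define W where "W s = trunc t (exp (2 * s))" for s
 have Wc: "continuous_on X W" for X
  unfolding W_def by (rule continuous_on_compose2[OF trunc_continuous[of UNIV]]) (auto intro!: continuous_intros)
 define b where "b = ln a / 2"
 define F where "F s = integral {b..s} W" for s
 have dF: "DERIV F s :> W s" if "b < s" for s proof -
  have "(F has_real_derivative W s) (at s within {b..s + 1})"
   unfolding F_def by (rule integral_has_real_derivative[OF Wc]) (use that in auto)
  thus ?thesis using that at_within_Icc_at[of b s "s + 1"] by simp
 qed
 have sm: "smoothed t p = (F (ln p / 2 + t) - F (ln p / 2)) / t" if p: "a < p" for p proof -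
  have p0: "0 < p" and bp: "b < ln p / 2" using p a by (auto simp: b_def)
  have "integral {0..t} (%s. trunc t (exp (2 * s) * p)) = integral {0..t} (%s. W (s + ln p / 2))"
   using p0 by (intro integral_cong) (simp add: W_def distrib_left exp_add)
  also have "... = integral {0 + ln p / 2..t + ln p / 2} W" using integral_shift[of 0 "ln p / 2" t W, OF Wc] by (simp add: o_def)
  also have "... = F (ln p / 2 + t) - F (ln p / 2)"
   using Henstock_Kurzweil_Integration.integral_combine[of b "ln p / 2" "ln p / 2 + t" W] bp t
   by (simp add: F_def add.commute integrable_continuous_real Wc)
  finally show ?thesis by (simp add: smoothed_def)
 qed
 have q0: "0 < q" and bq: "b < ln q / 2" using a by (auto simp: b_def)
 have lnd: "DERIV (%p. ln p / 2) q :> 1 / (2 * q)" using q0 by (auto intro!: derivative_eq_intros)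
 have lnd2: "DERIV (%p. ln p / 2 + t) q :> 1 / (2 * q)" using q0 by (auto intro!: derivative_eq_intros)
 have d1: "DERIV (%p. F (ln p / 2)) q :> W (ln q / 2) * (1 / (2 * q))"
  by (rule DERIV_chain2[of F _ "%p. ln p / 2", OF dF[OF bq] lnd])
 have d2: "DERIV (%p. F (ln p / 2 + t)) q :> W (ln q / 2 + t) * (1 / (2 * q))"
  by (rule DERIV_chain2[of F _ "%p. ln p / 2 + t", OF dF lnd2]) (use bq t in simp)
 have "((%p. (F (ln p / 2 + t) - F (ln p / 2)) / t) has_real_derivative
   (W (ln q / 2 + t) * (1 / (2 * q)) - W (ln q / 2) * (1 / (2 * q))) / t) (at q)" by (rule DERIV_cdivide[OF DERIV_diff[OF d2 d1]])
 hence "(smoothed t has_real_derivative (W (ln q / 2 + t) * (1 / (2 * q)) - W (ln q / 2) * (1 / (2 * q))) / t) (at q)"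
  by (rule has_field_derivative_transform_within_open[of _ _ _ "{a<..}"]) (use a sm in auto)
 also have "W (ln q / 2) = trunc t q" using q0 by (simp add: W_def)
 also have "W (ln q / 2 + t) = trunc t (exp (2 * t) * q)" using q0 by (simp add: W_def distrib_left exp_add mult.commute)
 also have "(trunc t (exp (2 * t) * q) * (1 / (2 * q)) - trunc t q * (1 / (2 * q))) / t = smoothed' t q" proof -
  have mx: "max q (exp (- 2 * t) * t / 2) = q" using a(2) by (simp add: a_def)
  show ?thesis unfolding smoothed'_def mx by (simp add: diff_divide_distrib ac_simps)
 qed
 finally show ?thesis by (rule has_field_derivative_at_within)
qed

lemma trunc_zero: "R^2 <= q ==> trunc \<delta> q = 0" using prof_zero[of q] prof_nonneg[of \<delta>] by (simp add: trunc_def)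

lemma smoothed_rad_C1: assumes t: "0 < t" shows "rad_C1 (R^2) (smoothed t) (smoothed' t)" unfolding rad_C1_def
proof (intro conjI ballI)
 show "0 < R^2" "R^2 < 1" using facts(1,2) by (auto simp: power_less_one_iff)
 show "(smoothed t has_real_derivative smoothed' t q) (at q within {0..1})" if "q : {0..1}" for q
  by (rule DERIV_subset[OF smoothed_deriv[OF t]]) (use that in auto)
 have m: "0 < max q (exp (- 2 * t) * t / 2)" for q using t by (simp add: less_max_iff_disj)
 show "continuous_on {0..1} (smoothed' t)" unfolding smoothed'_def using t m
  by (intro continuous_intros continuous_on_compose2[OF trunc_continuous[of UNIV]]) (auto simp: less_imp_neq[symmetric])
 fix q assume q: "q : {R^2..1}"
 have q0: "0 <= q" using q by (auto intro: order_trans[OF zero_le_power2])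
 have "1 * q <= exp (2 * t) * q" using t q0 by (intro mult_right_mono) auto
 hence z: "trunc t q = 0" "trunc t (exp (2 * t) * q) = 0" using q by (auto intro!: trunc_zero)
 thus "smoothed t q = 0" using smoothed_bounds[OF t q0] by simp
 show "smoothed' t q = 0" using z by (simp add: smoothed'_def)
qed

text \<open>Truncation can only shrink differences, and the maximum in the denominator only shrinks
  the quotient, so the squared gradient is pointwise at most the squared dilation quotient of v
  divided by t^2.\<close>

lemma smoothed_energy: assumes t: "0 < t" shows "(LBINT x. (norm (rad_grad (smoothed' t) x))^2) <= E" proof -
 note C = rad_C1c[OF smoothed_rad_C1[OF t]]
 have E: "0 <= E" proof -
  obtain g G where "dclass R L E g G" by (rule dclosure_approx[OF v zero_less_one])
  hence "(LBINT x. (norm (G x))^2) <= E" by (simp add: dclass_def)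
  moreover have "0 <= (LBINT x. (norm (G x))^2)" by (rule Bochner_Integration.integral_nonneg) simp
  ultimately show ?thesis by linarith
 qed
 have pt: "(norm (rad_grad (smoothed' t) x))^2 <= (v (exp t *R x) - v x)^2 / (norm x)^2 / t^2" for x
 proof (cases "norm x < 1 & x ~= 0")
  case True
  define q where "q = (norm x)^2"
  define m where "m = max q (exp (- 2 * t) * t / 2)"
  define d where "d = trunc t (exp (2 * t) * q) - trunc t q"
  have q: "0 < q" "q <= m" using True by (auto simp: q_def m_def)
  have "(norm (rad_grad (smoothed' t) x))^2 = 4 * q * (smoothed' t q)^2"
   using True by (simp add: rad_grad_def q_def power_mult_distrib)
  also have "... = q * d^2 / (t^2 * m^2)" by (simp add: smoothed'_def d_def m_def power_divide power_mult_distrib)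
  also have "... <= q * d^2 / (t^2 * q^2)"
   using q t by (intro divide_left_mono mult_left_mono power_mono mult_nonneg_nonneg mult_pos_pos) auto
  also have "... = d^2 / q / t^2" using q by (simp add: power2_eq_square)
  also have "... <= (v (exp t *R x) - v x)^2 / q / t^2" proof (intro divide_right_mono)
   have e: "prof (exp (2 * t) * q) = v (exp t *R x)"
    using prof_norm[of "exp t *R x"] by (simp add: q_def power_mult_distrib exp_double)
   have qv: "prof q = v x" by (simp add: q_def prof_norm)
   have "abs d <= abs (prof (exp (2 * t) * q) - prof q)" by (simp add: d_def trunc_def min_def)
   hence "abs d^2 <= abs (v (exp t *R x) - v x)^2" unfolding e qv by (rule power_mono) simp
   thus "d^2 <= (v (exp t *R x) - v x)^2" by simp
  qed (use q in auto)
  finally show ?thesis by (simp add: q_def)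
 qed (auto simp: rad_grad_def)
 have [measurable]: "v : borel_measurable borel" by (rule borel_measurable_continuous_onI[OF facts(6)])
 have "ennreal (LBINT x. (norm (rad_grad (smoothed' t) x))^2) = (\<integral>\<^sup>+x. ennreal ((norm (rad_grad (smoothed' t) x))^2) \<partial>lborel)"
  by (rule nn_integral_eq_integral[OF C1c_integrable(1)[OF C], symmetric]) simp
 also have "... <= (\<integral>\<^sup>+x. ennreal (1 / t^2) * ennreal ((v (exp t *R x) - v x)^2 / (norm x)^2) \<partial>lborel)"
  by (intro nn_integral_mono) (use pt in "auto simp: divide_inverse ac_simps intro!: ennreal_leI simp flip: ennreal_mult")
 also have "... = ennreal (1 / t^2) * (\<integral>\<^sup>+x. ennreal ((v (exp t *R x) - v x)^2 / (norm x)^2) \<partial>lborel)"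
  by (rule nn_integral_cmult) measurable
 also have "... <= ennreal (1 / t^2) * ennreal (t^2 * E)" by (rule mult_left_mono[OF dclosure_dilation_bound[OF v t]]) simp
 also have "... = ennreal E" using t E by (simp flip: ennreal_mult)
 finally show ?thesis using E by simp
qed

lemma smoothed_limit: assumes q: "0 <= q" shows "(%n. smoothed (1 / real (Suc n)) q) ----> prof q" proof -
 have e: "(%n. 1 / real (Suc n)) ----> 0" using LIMSEQ_inverse_real_of_nat by (simp add: inverse_eq_divide)
 have pc: "isCont prof p" for p using prof_continuous[of UNIV] by (simp add: continuous_on_eq_continuous_at)
 have p0: "(%n. prof (1 / real (Suc n))) ----> prof 0" by (rule isCont_tendsto_compose[OF pc e])
 have "(%n. exp (2 * (1 / real (Suc n))) * q) ----> exp (2 * 0) * q" by (intro tendsto_intros e)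
 hence "(%n. prof (exp (2 * (1 / real (Suc n))) * q)) ----> prof q" using isCont_tendsto_compose[OF pc] by fastforce
 from tendsto_min[OF this p0] have lo: "(%n. trunc (1 / real (Suc n)) (exp (2 * (1 / real (Suc n))) * q)) ----> prof q"
  using prof_mono[of 0 q] q by (simp add: trunc_def)
 from tendsto_min[OF tendsto_const[of "prof q"] p0] have hi: "(%n. trunc (1 / real (Suc n)) q) ----> prof q"
  using prof_mono[of 0 q] q by (simp add: trunc_def)
 show ?thesis by (rule tendsto_sandwich[OF always_eventually always_eventually lo hi]) (intro allI smoothed_bounds q; simp)+
qed

end

text \<open>The regularized profiles have Dirichlet integral at most E, and their Hardy and L^2
  terms converge to those of w; lower semicontinuity of the energy does the rest.\<close>

lemma (in coercive_ground_state) radial_limit_energy: assumes "radial_limit R L E w"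
 shows "energy_le 0 (pull (radial_limit.prof w)) (E - (LBINT x. hardy w x) - \<alpha> * (LBINT x. (w x)^2))" proof -
 interpret radial_limit R L E w by (rule assms)
 define t where "t n = 1 / real (Suc n)" for n
 have t: "0 < t n" for n by (simp add: t_def)
 define f where "f n = rad (smoothed (t n))" for n
 note RC = smoothed_rad_C1[OF t]
 note C = rad_C1c[OF RC]
 have R2: "0 < R^2" "R^2 < 1" using facts(1,2) by (auto simp: power_less_one_iff)
 have lim: "(%n. f n x) ----> w x" for x proof (cases "norm x < 1")
  case True
  thus ?thesis using smoothed_limit[of "(norm x)^2"] by (simp add: f_def rad_def t_def prof_norm)
 qed (use facts(2,4) in "simp add: f_def rad_def")
 have f0: "f n x = 0" if "R <= norm x" for n x
  using RC[of n] that facts(1) power_mono[of R "norm x" 2] norm_lt_1_sq[of x] by (auto simp: rad_C1_def f_def rad_def)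
 have fb: "abs (f n x) <= prof 0" for n x proof -
  have "0 <= trunc (t n) q & trunc (t n) q <= prof 0" if "0 <= q" for q
   using prof_nonneg prof_mono[of 0 q] that by (auto simp: trunc_def min_le_iff_disj)
  note b = this
  have q: "0 <= (norm x)^2" "0 <= exp (2 * t n) * (norm x)^2" by auto
  have "0 <= smoothed (t n) ((norm x)^2) & smoothed (t n) ((norm x)^2) <= prof 0"
   using smoothed_bounds[OF t[of n] q(1)] b[OF q(1)] b[OF q(2)] by linarith
  thus ?thesis using prof_nonneg[of 0] by (simp add: f_def rad_def)
 qed
 have en: "energy_le 0 (pull (smoothed (t n))) (E - (LBINT x. hardy (f n) x) - \<alpha> * (LBINT x. (f n x)^2))" for n
 proof (rule energy_le_mono[OF radial_energy[OF RC]])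
  have "pi * form (smoothed (t n)) (smoothed' (t n)) = Q0 (f n) (rad_grad (smoothed' (t n))) - \<alpha> * (LBINT x. (f n x)^2)"
   unfolding f_def by (rule rad_form(1)[OF RC \<alpha>, symmetric])
  also have "Q0 (f n) (rad_grad (smoothed' (t n))) = (LBINT x. (norm (rad_grad (smoothed' (t n)) x))^2) - (LBINT x. hardy (f n) x)"
   unfolding Q0_def f_def by (rule Bochner_Integration.integral_diff; rule C1c_integrable[OF C])
  finally show "pi * form (smoothed (t n)) (smoothed' (t n)) <= E - (LBINT x. hardy (f n) x) - \<alpha> * (LBINT x. (f n x)^2)"
   using smoothed_energy[OF t, of n] by simp
 qed
 have pl: "(%n. pull (smoothed (t n)) s) ----> pull prof s" for s proof (cases "s <= 0")
  case False
  hence "0 < Qi s" "0 < \<phi> (Qi s)" using Qi[of s] \<phi>_pos[of "Qi s"] by auto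
  hence "(%n. sqrt (2 * pi) * smoothed (t n) (Qi s) / \<phi> (Qi s)) ----> sqrt (2 * pi) * prof (Qi s) / \<phi> (Qi s)"
   unfolding t_def by (intro tendsto_intros smoothed_limit) auto
  thus ?thesis using False by (simp add: pull_def)
 qed (simp add: pull_def)
 have l2: "(%n. (LBINT x. (f n x)^2)) ----> (LBINT x. (w x)^2)"
 proof (rule bounded_support_convergence[where R = R and M = "(prof 0)^2"])
  show "continuous_on UNIV (%x. (f n x)^2)" for n unfolding f_def by (intro continuous_intros C1c_continuous(1)[OF C])
  show "continuous_on UNIV (%x. (w x)^2)" by (intro continuous_intros facts)
  show "abs ((f n x)^2) <= (prof 0)^2" for n x using power_mono[OF fb[of n x], of 2] by simp
 qed (use f0 lim in "auto intro: tendsto_intros")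
 have lh: "(%n. (LBINT x. hardy (f n) x)) ----> (LBINT x. hardy w x)"
 proof (rule bounded_support_convergence[where R = R and M = "(prof 0)^2 / (1 - R^2)^2"])
  show "continuous_on UNIV (hardy (f n))" for n unfolding f_def by (rule hardy_continuous[OF C])
  show "continuous_on UNIV (hardy w)" by (rule dclosure_hardy_continuous[OF v])
  show "(%n. hardy (f n) x) ----> hardy w x" for x unfolding hardy_def divide_inverse by (intro tendsto_intros lim)
  show "hardy (f n) x = 0" if "R <= norm x" for n x using f0[OF that] by (simp add: hardy_def)
  fix n and x :: plane assume x: "norm x < R"
  have "0 < 1 - R^2" "1 - R^2 <= 1 - (norm x)^2" using x R2 power_mono[of "norm x" R 2] by auto
  moreover have "(f n x)^2 <= (prof 0)^2" using power_mono[OF fb[of n x], of 2] by simp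
  ultimately show "abs (hardy (f n) x) <= (prof 0)^2 / (1 - R^2)^2" unfolding hardy_def by (auto intro!: frac_le power_mono)
 qed
 show ?thesis
  by (rule energy_le_limit[OF en pl tendsto_diff[OF tendsto_diff[OF tendsto_const lh] tendsto_mult[OF tendsto_const l2]]])
qed

subsection \<open>Attainment of the supremum\<close>

text \<open>Subtracting 1 makes the integrand compactly supported, so exponential integrals can be
  compared through finite real integrals.\<close>

lemma exp_integral_split: assumes u: "continuous_on UNIV u" "!!x. R <= norm x ==> u x = 0" "R < 1" and \<beta>: "0 <= \<beta>"
 shows "exp_integral \<beta> u = ennreal (LBINT x. exp (\<beta> * (u x)^2) - 1) + emeasure disc_measure (space disc_measure)"
proof -
 define F where "F x = exp (\<beta> * (u x)^2) - 1" for x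
 have F0: "0 <= F x" for x using \<beta> by (simp add: F_def)
 have Fc: "continuous_on UNIV F" unfolding F_def by (intro continuous_intros u)
 have Fm: "F : borel_measurable borel" by (rule borel_measurable_continuous_onI[OF Fc])
 have Fi: "integrable lborel F" by (rule compact_support_integrable[OF Fc, of R]) (use u in "simp add: F_def")
 note [measurable] = borel_to_disc[OF Fm]
 have "exp_integral \<beta> u = (\<integral>\<^sup>+x. ennreal (F x) + 1 \<partial>disc_measure)" unfolding exp_integral_def
 proof (rule nn_integral_cong)
  fix x
  have "ennreal (F x) + 1 = ennreal (F x + 1)" using F0[of x] by (simp add: ennreal_plus)
  thus "ennreal (exp (\<beta> * (u x)^2)) = ennreal (F x) + 1" by (simp add: F_def)
 qed
 also have "... = (\<integral>\<^sup>+x. ennreal (F x) \<partial>disc_measure) + emeasure disc_measure (space disc_measure)"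
  by (subst nn_integral_add) auto
 also have "(\<integral>\<^sup>+x. ennreal (F x) \<partial>disc_measure) = (\<integral>\<^sup>+x. ennreal (F x) \<partial>lborel)"
  unfolding disc_nn_integral by (rule nn_integral_cong) (use u(2,3) in "auto simp: F_def indicator_def")
 also have "... = ennreal (LBINT x. F x)" by (rule nn_integral_eq_integral[OF Fi]) (simp add: F0)
 finally show ?thesis by (simp add: F_def)
qed

text \<open>Each partition sum lies below every bound, hence below their infimum. Lifting to the
  disc works with this least bound.\<close>

lemma energy_least: assumes "energy_le a y C" shows "EX C0. energy_le a y C0 & (ALL C'. energy_le a y C' --> C0 <= C')"
proof (intro exI[of _ "Inf {C. energy_le a y C}"] conjI allI impI)
 have "partition_sum y p n <= Inf {C. energy_le a y C}" if "a <= p 0" "ALL i<n. p i < p (Suc i)" for p n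
  by (rule cInf_greatest) (use that assms in "auto intro: energy_leD")
 thus "energy_le a y (Inf {C. energy_le a y C})" by (subst energy_le_def) blast
 show "Inf {C. energy_le a y C} <= C'" if "energy_le a y C'" for C'
  using that by (intro cInf_lower bdd_belowI[of _ 0]) (auto intro: energy_le_nonneg)
qed

text \<open>A stand-in for the zero function in case that is a maximizer, since a norm of exactly 1
  is required.\<close>

lemma ramp_energy: "energy_le 0 (%s. min s 1) 1" proof (rule witness_imp_energy_le)
 show "energy_witness {0..} (%s::real. min s 1) (%s. min s 1)" unfolding energy_witness_def
 proof (intro conjI ballI impI mono_onI)
  fix s t :: real assume "s <= t"
  hence "0 <= min t 1 - min s 1" "min t 1 - min s 1 <= t - s" by auto
  thus "(min t 1 - min s 1)^2 <= (t - s) * (min t 1 - min s 1)" unfolding power2_eq_square by (intro mult_right_mono)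
 qed auto
qed auto

lemma (in weighted_moser) J_mono: assumes "!!s. 0 <= s ==> (y s)^2 <= (z s)^2" shows "J y <= J z" unfolding J_def
proof (rule nn_integral_mono)
 fix s
 have "\<omega> s * exp (\<gamma> * h s * (y s)^2) <= \<omega> s * exp (\<gamma> * h s * (z s)^2)" if "0 <= s"
  using assms[OF that] \<omega>_nonneg[OF that] h_nonneg[OF that] \<gamma>(1) by (intro mult_left_mono) (auto intro!: mult_left_mono)
 thus "integrand y s <= integrand z s" by (auto simp: integrand_def indicator_def intro: ennreal_leI)
qed

context coercive_ground_state
begin

text \<open>With \<alpha> >= 0 a larger L^2-norm only lowers the form, so the pulled-back
  symmetrization is admissible; its lift agrees with the symmetrization off the origin.\<close>

lemma test_exp_bound: assumes f: "f : test_functions" and Q1: "Qa \<alpha> f <= 1" and \<gamma>: "0 <= \<gamma>" "\<gamma> <= 2"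
 shows "exp_integral (2 * pi * \<gamma>) f <= ennreal pi * (SUP y\<in>{y. admissible y}. weighted_moser.J omega hh \<gamma> y)"
proof -
 define \<beta> where "\<beta> = 2 * pi * \<gamma>"
 have \<beta>: "0 <= \<beta>" using \<gamma> by (simp add: \<beta>_def)
 define E where "E = (LBINT x. (norm (gradient f x))^2)"
 obtain R L w where w: "dclosure R L E w" "(LBINT x. hardy w x) = (LBINT x. hardy f x)" "(LBINT x. (f x)^2) <= (LBINT x. (w x)^2)"
  "(LBINT x. exp (\<beta> * (f x)^2) - 1) <= (LBINT x. exp (\<beta> * (w x)^2) - 1)" "!!x y. norm x <= norm y ==> w y <= w x"
  using symmetrization[OF f \<beta>] unfolding E_def by blast
 have rl: "radial_limit R L E w" by (rule radial_limit.intro) (use w in auto)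
 define y where "y = pull (radial_limit.prof w)"
 have "Qa \<alpha> f = E - (LBINT x. hardy f x) - \<alpha> * (LBINT x. (f x)^2)"
  using C1c_integrable[OF test_C1c[OF f]] by (simp add: Qa_def Q_def Q0_def E_def)
 moreover have "\<alpha> * (LBINT x. (f x)^2) <= \<alpha> * (LBINT x. (w x)^2)" by (rule mult_left_mono[OF w(3) \<alpha>])
 ultimately have E1: "energy_le 0 y 1" using energy_le_mono[OF radial_limit_energy[OF rl], of 1] w(2) Q1 by (simp add: y_def)
 have y0: "y 0 = 0" by (simp add: y_def pull_def)
 have ly: "lift y x = w x" if "x : disc" "x ~= 0" for x proof -
  interpret radial_limit R L E w by (rule rl)
  have q: "0 < (norm x)^2" "(norm x)^2 < 1" using that norm_lt_1_sq by auto
  thus ?thesis using \<phi>_pos[of "(norm x)^2"] S_pos[OF q] Qi_S[OF q] that prof_norm[of x]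
   by (simp add: lift_def height_def y_def pull_def)
 qed
 note d = dclosure_facts[OF w(1)]
 obtain r where r: "0 < r" "r < 1" "!!x. r <= norm x ==> f x = 0" using test_support[OF f] by metis
 have "exp_integral \<beta> f <= exp_integral \<beta> w" proof -
  have "exp_integral \<beta> w = ennreal (LBINT x. exp (\<beta> * (w x)^2) - 1) + emeasure disc_measure (space disc_measure)"
   by (rule exp_integral_split[of w R]) (use d \<beta> in auto)
  moreover have "exp_integral \<beta> f = ennreal (LBINT x. exp (\<beta> * (f x)^2) - 1) + emeasure disc_measure (space disc_measure)"
   by (rule exp_integral_split[of f r]) (use r \<beta> smooth_continuous[OF test_smooth[OF f]] in auto)
  ultimately show ?thesis by (simp only:) (intro add_right_mono ennreal_leI w)
 qed
 also have "... = exp_integral \<beta> (lift y)" unfolding exp_integral_def proof (rule nn_integral_cong_AE)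
  have "AE x in disc_measure. x : disc" by (rule AE_I2) (simp add: space_restrict_space)
  thus "AE x in disc_measure. ennreal (exp (\<beta> * (w x)^2)) = ennreal (exp (\<beta> * (lift y x)^2))"
   using AE_disc_nonzero by eventually_elim (simp add: ly)
 qed
 also have "... = ennreal pi * weighted_moser.J omega hh \<gamma> y"
  unfolding \<beta>_def by (rule exp_integral_lift[of y 1, OF y0 E1 \<gamma>])
 also have "... <= ennreal pi * (SUP y\<in>{y. admissible y}. weighted_moser.J omega hh \<gamma> y)"
  by (intro mult_left_mono SUP_upper) (use y0 E1 in "auto simp: admissible_def")
 finally show ?thesis by (simp add: \<beta>_def)
qed

text \<open>J grows with y^2, so a maximizer may be scaled up to least energy exactly 1. One of
  energy 0 vanishes identically, and the ramp is then a maximizer too.\<close>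

lemma maximizer_unit_energy: assumes \<gamma>: "0 <= \<gamma>" "\<gamma> <= 2"
 shows "EX y. y 0 = 0 & energy_le 0 y 1 & (ALL C. energy_le 0 y C --> 1 <= C) &
  weighted_moser.J omega hh \<gamma> y = (SUP y\<in>{y. admissible y}. weighted_moser.J omega hh \<gamma> y) &
  weighted_moser.J omega hh \<gamma> y < \<infinity>" proof -
 interpret weighted_moser omega hh A \<gamma> by (rule weighted_moser[OF \<gamma>])
 obtain z where z: "admissible z" "J z = (SUP y\<in>{y. admissible y}. J y)" "J z < \<infinity>"
  using maximizer[OF \<gamma>] by blast
 have better: "J y = (SUP y\<in>{y. admissible y}. J y) & J y < \<infinity>"
  if "admissible y" "!!s. 0 <= s ==> (z s)^2 <= (y s)^2" for y proof -
  have "J y <= J z" unfolding z(2) by (rule SUP_upper) (use that in simp)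
  hence "J y = J z" using J_mono[of z y] that(2) by (intro antisym) auto
  thus ?thesis using z by simp
 qed
 have z0: "z 0 = 0" "energy_le 0 z 1" using z(1) by (auto simp: admissible_def)
 obtain C where C: "energy_le 0 z C" "!!C'. energy_le 0 z C' ==> C <= C'" using energy_least[OF z0(2)] by blast
 have C01: "0 <= C" "C <= 1" using energy_le_nonneg[OF C(1)] C(2)[OF z0(2)] by auto
 show ?thesis proof (cases "C = 0")
  case True
  have "(z s)^2 <= (min s 1)^2" if "0 <= s" for s using energy_le_two[OF C(1), of 0 s] that True z0(1) by simp
  moreover have "1 <= C'" if "energy_le 0 (%s. min s 1) C'" for C' :: real using energy_le_two[OF that, of 0 1] by simp
  ultimately show ?thesis
   using better[of "%s. min s 1"] ramp_energy by (intro exI[of _ "%s. min s 1"]) (auto simp: admissible_def)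
 next
  case False
  hence Cp: "0 < C" using C01 by simp
  define k where "k = 1 / sqrt C"
  define y where "y s = k * z s" for s
  have k2: "k^2 * C = 1" using Cp by (simp add: k_def power_divide)
  have E: "energy_le 0 y 1" using energy_le_scale[OF C(1), of k] by (simp add: y_def[abs_def] k2)
  have min: "1 <= C'" if "energy_le 0 y C'" for C' proof -
   have "energy_le 0 (%s. sqrt C * y s) ((sqrt C)^2 * C')" by (rule energy_le_scale[OF that])
   moreover have "(%s. sqrt C * y s) = z" using Cp by (simp add: y_def k_def fun_eq_iff)
   ultimately have "C <= C * C'" using C(2)[of "C * C'"] Cp by simp
   thus ?thesis using Cp by simp
  qed
  have "1 <= k^2" using Cp C01 by (simp add: k_def power_divide)
  hence "(z s)^2 <= (y s)^2" for s using mult_right_mono[of 1 "k^2" "(z s)^2"] by (simp add: y_def power_mult_distrib)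
  moreover have "y 0 = 0" by (simp add: y_def z0)
  ultimately show ?thesis using better[of y] E min by (auto simp: admissible_def)
 qed
qed

end

lemma norm_1_nonneg: assumes "u : H_space" "\<alpha> < lambda1" shows "0 <= norm_1 \<alpha> u" proof -
 obtain F where F: "represents F u" using assms by (auto simp: H_space_def)
 have "0 <= Qa \<alpha> (F n)" for n proof -
  have "0 <= (lambda1 - \<alpha>) * (LBINT x. (F n x)^2)"
   using assms(2) by (intro mult_nonneg_nonneg Bochner_Integration.integral_nonneg) auto
  thus ?thesis using Qa_ge[OF represents_test[OF F], of \<alpha> n] by linarith
 qed
 hence "0 <= (H_norm u)^2 - \<alpha> * (Lp_norm 2 u)^2" by (intro LIMSEQ_le_const[OF Qa_limit[OF F]]) auto
 thus ?thesis by (simp add: norm_1_def)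
qed

theorem theorem1:
  fixes \<alpha> \<beta> :: real
  assumes "0 \<le> \<beta>" and "\<beta> \<le> 4 * pi"
    and "0 \<le> \<alpha>" and "\<alpha> < lambda1"
  shows "\<exists>u0\<in>H_space. norm_1 \<alpha> u0 = 1 \<and>
    exp_integral \<beta> u0 = (SUP u\<in>{u \<in> H_space. norm_1 \<alpha> u \<le> 1}. exp_integral \<beta> u) \<and>
    exp_integral \<beta> u0 < \<infinity>"
proof -
 \<comment> \<open>The substitution gives u^2 = \<phi>^2 y^2 / (2 pi), so \<beta> = 4 pi corresponds
   to the critical \<gamma> = 2.\<close>
 define \<gamma> where "\<gamma> = \<beta> / (2 * pi)"
 have \<gamma>: "0 <= \<gamma>" "\<gamma> <= 2" and \<beta>: "2 * pi * \<gamma> = \<beta>"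
  using assms(1,2) pi_gt_zero by (auto simp: \<gamma>_def field_simps)
 interpret gs: coercive_ground_state \<alpha> "lambda1 - \<alpha>" by (rule coercive_ground_state[OF assms(3,4)])
 let ?J = "weighted_moser.J gs.omega gs.hh \<gamma>"
 let ?M = "SUP y\<in>{y. admissible y}. ?J y"
 obtain y where y: "y 0 = 0" "energy_le 0 y 1" "!!C. energy_le 0 y C ==> 1 <= C" "?J y = ?M" "?J y < \<infinity>"
  using gs.maximizer_unit_energy[OF \<gamma>] by blast
 define u where "u = gs.lift y"
 have u: "u : H_space" "(norm_1 \<alpha> u)^2 = 1" unfolding u_def using gs.lift_H_space[OF assms(4) y(1,2,3)] by auto
 hence n1: "norm_1 \<alpha> u = 1" using norm_1_nonneg[OF u(1) assms(4)] by (simp add: power2_eq_1_iff)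
 have eu: "exp_integral \<beta> u = ennreal pi * ?M"
  using gs.exp_integral_lift[of y 1 \<gamma>, OF y(1,2) \<gamma>] y(4) by (simp add: \<beta> u_def)
 \<comment> \<open>The lift realizes pi times the one-dimensional supremum; the same number bounds
   test functions and, by approximation, every competitor in the completion.\<close>
 have "(SUP u\<in>{u : H_space. norm_1 \<alpha> u <= 1}. exp_integral \<beta> u) = exp_integral \<beta> u"
 proof (intro antisym SUP_least SUP_upper)
  fix w assume w: "w : {u : H_space. norm_1 \<alpha> u <= 1}"
  show "exp_integral \<beta> w <= exp_integral \<beta> u" unfolding eu
   by (rule exp_integral_le_test_bound[of w \<alpha>]) (use w assms(4) gs.test_exp_bound[OF _ _ \<gamma>] in "auto simp: \<beta>")
 qed (use u n1 in simp)
 moreover have "exp_integral \<beta> u < \<infinity>" unfolding eu using y(4,5) by (simp add: ennreal_mult_less_top)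
 ultimately show ?thesis using u(1) n1 by (intro bexI[of _ u]) auto
qed

end
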